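(* Equal Subset Sum can be solved with high probability in time $O^*(1.7067^n)$.
   Context: Equal Subset Sum: given $\vec{x} \in \mathbb{Z}^n$, find a nonzero vector $\vec{c} \in \{-1,0,1\}^n$ with $\vec{c}\cdot\vec{x} = 0$ (equivalently, two distinct subsets of the input with equal sum), or report that none exists. Input integers have absolute value at most $2^{n^{O(1)}}$ and arithmetic on them takes unit time. $O^*$ suppresses factors polynomial in $n$. "With high probability" means the algorithm never outputs an invalid solution and, whenever a solution exists, outputs one with probability at least $1 - 2^{-\Omega(n)}$. *)

theory Defs
  imports "HOL-Probability.Probability_Mass_Function" "HOL-Library.Landau_Symbols"
begin

section \<open>Equal Subset Sum\<close>

definition ess_solution :: "int list \<Rightarrow> int list \<Rightarrow> bool" where
  "ess_solution xs cs \<longleftrightarrow>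
     length cs = length xs \<and> set cs \<subseteq> {-1, 0, 1} \<and> (\<exists>c\<in>set cs. c \<noteq> 0) \<and>
     (\<Sum>i<length xs. cs ! i * xs ! i) = 0"

section \<open>Randomized random access machines\<close>

text \<open>
  Programs are finite and independent of the input length. The machine has integer registers
  and an integer-addressed memory of integers. Every step performs one instruction (one
  arithmetic operation, one memory access, one fair coin flip, or one test) and costs one unit
  of time. The instructions themselves do not limit the size of the integers; the predicate
  \<open>words_bounded\<close> below does, because unit-cost arithmetic is only legitimate for
  integers of polynomially many bits.
\<close>

datatype binop = Add | Sub | Mul | Div | Mod | Less

fun binop_val :: "binop \<Rightarrow> int \<Rightarrow> int \<Rightarrow> int" where
  "binop_val Add a b = a + b"
| "binop_val Sub a b = a - b"
| "binop_val Mul a b = a * b"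
| "binop_val Div a b = a div b"
| "binop_val Mod a b = a mod b"
| "binop_val Less a b = (if a < b then 1 else 0)"

datatype com =
    SetConst nat int                     \<comment> \<open>\<open>r\<^sub>i := k\<close>\<close>
  | Op binop nat nat nat                 \<comment> \<open>\<open>r\<^sub>i := r\<^sub>j op r\<^sub>k\<close>\<close>
  | Load nat nat                         \<comment> \<open>\<open>r\<^sub>i := M[r\<^sub>j]\<close>\<close>
  | Store nat nat                        \<comment> \<open>\<open>M[r\<^sub>i] := r\<^sub>j\<close>\<close>
  | Coin nat                             \<comment> \<open>\<open>r\<^sub>i :=\<close> uniformly random bit\<close>
  | IfNZ nat "com list" "com list"       \<comment> \<open>branch on \<open>r\<^sub>i \<noteq> 0\<close>\<close>
  | WhileNZ nat "com list"               \<comment> \<open>loop while \<open>r\<^sub>i \<noteq> 0\<close>\<close>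

record state =
  reg :: "nat \<Rightarrow> int"
  mem :: "int \<Rightarrow> int"

abbreviation set_reg :: "nat \<Rightarrow> int \<Rightarrow> state \<Rightarrow> state" where
  "set_reg i v s \<equiv> s\<lparr>reg := (reg s)(i := v)\<rparr>"

text \<open>A configuration consists of the commands still to be executed and the current state.\<close>

type_synonym config = "com list \<times> state"

fun step :: "config \<Rightarrow> config pmf" where
  "step ([], s) = return_pmf ([], s)"
| "step (SetConst i k # cs, s) = return_pmf (cs, set_reg i k s)"
| "step (Op f i j k # cs, s) = return_pmf (cs, set_reg i (binop_val f (reg s j) (reg s k)) s)"
| "step (Load i j # cs, s) = return_pmf (cs, set_reg i (mem s (reg s j)) s)"
| "step (Store i j # cs, s) = return_pmf (cs, s\<lparr>mem := (mem s)(reg s i := reg s j)\<rparr>)"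
| "step (Coin i # cs, s) =
     map_pmf (\<lambda>b. (cs, set_reg i (of_bool b) s)) (bernoulli_pmf (1/2))"
| "step (IfNZ i as bs # cs, s) = return_pmf ((if reg s i \<noteq> 0 then as else bs) @ cs, s)"
| "step (WhileNZ i as # cs, s) =
     return_pmf (if reg s i \<noteq> 0 then as @ WhileNZ i as # cs else cs, s)"

fun run :: "nat \<Rightarrow> config \<Rightarrow> config pmf" where
  "run 0 c = return_pmf c"
| "run (Suc t) c = bind_pmf (step c) (run t)"

text \<open>
  The input length \<open>n\<close> is passed in register 0 and the input numbers in memory cells
  \<open>0, \<dots>, n - 1\<close>; everything else is initially zero.
\<close>

definition init :: "com list \<Rightarrow> int list \<Rightarrow> config" where
  "init P xs =
     (P, \<lparr>reg = (\<lambda>_. 0)(0 := int (length xs)),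
          mem = (\<lambda>a. if 0 \<le> a \<and> a < int (length xs) then xs ! nat a else 0)\<rparr>)"

definition halted :: "config \<Rightarrow> bool" where
  "halted c \<longleftrightarrow> fst c = []"

text \<open>
  Output convention: register 0 is zero for ``no solution found''; otherwise the answer is the
  vector in memory cells \<open>0, \<dots>, n - 1\<close>.
\<close>

definition result :: "nat \<Rightarrow> config \<Rightarrow> int list option" where
  "result n c =
     (if reg (snd c) 0 = 0 then None else Some (map (\<lambda>i. mem (snd c) (int i)) [0..<n]))"

definition words_bounded :: "nat \<Rightarrow> config \<Rightarrow> bool" where
  "words_bounded w c \<longleftrightarrow> (\<forall>i. \<bar>reg (snd c) i\<bar> \<le> 2 ^ w) \<and> (\<forall>a. \<bar>mem (snd c) a\<bar> \<le> 2 ^ w)"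

section \<open>Asymptotics\<close>

definition poly_bounded :: "(nat \<Rightarrow> nat) \<Rightarrow> bool" where
  "poly_bounded f \<longleftrightarrow> (\<exists>d. (\<lambda>n. real (f n)) \<in> O(\<lambda>n. real n ^ d))"

definition Ostar :: "(nat \<Rightarrow> real) \<Rightarrow> (nat \<Rightarrow> real) set" where
  "Ostar g = {f. \<exists>d. f \<in> O(\<lambda>n. real n ^ d * g n)}"

section \<open>Solving Equal Subset Sum with high probability\<close>

text \<open>
  \<open>b\<close> bounds the bit length of the input numbers, \<open>w\<close> the bit length of all integers
  occurring in any run, \<open>T\<close> the running time of every run (whatever the coin flips),
  and \<open>2\<^sup>-\<^sup>e\<close> the failure probability, all as functions of \<open>n\<close>. The exponent
  \<open>e\<close> is a natural number because Landau's Omega ignores signs.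
\<close>

definition solves_ess ::
  "com list \<Rightarrow> (nat \<Rightarrow> nat) \<Rightarrow> (nat \<Rightarrow> nat) \<Rightarrow> (nat \<Rightarrow> nat) \<Rightarrow> (nat \<Rightarrow> nat) \<Rightarrow> bool" where
  "solves_ess P b w T e \<longleftrightarrow>
     (\<forall>n xs. length xs = n \<and> (\<forall>x\<in>set xs. \<bar>x\<bar> \<le> 2 ^ b n) \<longrightarrow>
        (\<forall>t. \<forall>c\<in>set_pmf (run t (init P xs)). words_bounded (w n) c) \<and>
        (\<forall>c\<in>set_pmf (run (T n) (init P xs)).
           halted c \<and> (\<forall>cs. result n c = Some cs \<longrightarrow> ess_solution xs cs)) \<and>
        ((\<exists>cs. ess_solution xs cs) \<longrightarrow>
           measure_pmf.prob (run (T n) (init P xs))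
             {c. \<exists>cs. result n c = Some cs \<and> ess_solution xs cs} \<ge> 1 - 1 / 2 ^ e n))"

end

theory Submission
  imports Defs "HOL-Real_Asymp.Real_Asymp"
begin

text \<open>
  Let \<open>c\<close> be a solution of minimal support, of size \<open>l\<close>. A random type in \<open>{0, 1, 2, 3}\<close> per
  coordinate splits the coordinates into \<open>V\<^sub>1\<close> (type 0), \<open>V\<^sub>2\<close> (type 1) and \<open>R\<close> (types 2, 3). Write
  \<open>c = c\<^sub>1 - c\<^sub>2\<close>, where \<open>c\<^sub>1\<close> is a sign vector on \<open>V\<^sub>1\<close> with at most \<open>z\<close> zeros plus a subset of \<open>R\<close>, and \<open>c\<^sub>2\<close>
  likewise on \<open>V\<^sub>2\<close>. Any set of zeros of \<open>c\<close> in \<open>R\<close> may be added to both parts, and if this set is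
  smaller than \<open>l\<close>, minimality forces distinct common values \<open>c\<^sub>1 \<cdot> x = c\<^sub>2 \<cdot> x\<close>. So a solution has about \<open>2\<^sup>k\<close>
  representations, one of which survives a random hash constraint with \<open>2\<^sup>k\<close> buckets with
  constant probability. Both lists of surviving parts are found by a join of an enumeration of sign vectors
  with the subsets of \<open>R\<close>, and a collision between the two lists is a solution.

  The parameters depend on \<open>l\<close>: for \<open>l \<le> n/7\<close> the support is placed inside \<open>R\<close> and \<open>k = 0\<close>; for
  \<open>n/7 < l \<le> 2n/3\<close> the types are balanced and \<open>k = n/7\<close>; for larger \<open>l\<close> the types are biased to
  \<open>(11, 11, 16)/38\<close> on the support and to \<open>(3, 3, 32)/38\<close> on the zeros, and \<open>k\<close> is about the number of zeros in \<open>R\<close>.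
  Cost divided by success probability is then below \<open>1.69\<^sup>n\<close> up to polynomial factors. As
  \<open>l\<close> is unknown, all parameters are sampled; attempt \<open>j\<close> is given the running time \<open>B/j\<close> with
  \<open>B = \<lfloor>1.7\<^sup>n\<rfloor>\<close>, so that the harmonic sum bounds the total time and every trade-off between
  cost and success probability is covered.
\<close>

section \<open>Runs of the machine\<close>

text \<open>The hash must be compatible with sums, since the lists are filtered while they are
  joined. \<open>hh\<close> is the leading part of \<open>\<alpha> * w mod Q\<close>, which is
  additive up to one carry, and the join guesses the carry. With \<open>Q = S * 2 ^ n\<close> the
  buckets have equal width for every \<open>k \<le> n\<close>, and the representations of one
  solution differ in value by less than this width, which bounds their collisions under a random
  \<open>\<alpha>\<close>. The thresholds on \<open>l\<close> come from the set of common zeros: it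
  must be smaller than the support and fit into \<open>R\<close>. Supports below \<open>n/7\<close>
  are too small for it, but placing them inside \<open>R\<close> is then likely enough; when zeros
  are few, a bias moves more of them into \<open>R\<close>. The middle range is the most expensive:
  joining under \<open>n/7\<close> hash bits costs \<open>12 ^ (n/4) / 2 ^ (n/7)\<close>, about
  \<open>1.686 ^ n\<close>. In the last range the fractions over 38 are tuned such that the estimate
  of join cost over probability is exactly \<open>(64/38) ^ 38\<close> for each block of 38
  coordinates, on the support as well as on the zeros. The gap between 1.69 and 1.7 absorbs
  polynomial factors and makes the failure probability exponentially small.\<close>

inductive reach :: "(state \<Rightarrow> bool) \<Rightarrow> nat \<Rightarrow> config \<Rightarrow> config \<Rightarrow> bool" for I where
  refl: "I (snd c) \<Longrightarrow> reach I 0 c c"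
| step: "I (snd c) \<Longrightarrow> step c = return_pmf c' \<Longrightarrow> reach I k c' c'' \<Longrightarrow> reach I (Suc k) c c''"

lemma reach_trans: "reach I k a b \<Longrightarrow> reach I l b c \<Longrightarrow> reach I (k + l) a c"
  by (induction rule: reach.induct) (auto intro: reach.step)

lemma reach_I: "reach I k a b \<Longrightarrow> I (snd a) \<and> I (snd b)"
  by (induction rule: reach.induct) auto

lemma reach_1: "I (snd c) \<Longrightarrow> step c = return_pmf c' \<Longrightarrow> I (snd c') \<Longrightarrow> reach I 1 c c'"
  using reach.step[OF _ _ reach.refl] by auto

text \<open>\<open>I\<close> is required at every moment of every run, \<open>A\<close> of every
  final state, \<open>S\<close> only with probability at least \<open>p\<close>. Quantifying over
  all \<open>T \<ge> B\<close> allows branches that halt at different times to be combined.\<close>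

definition guar :: "(state \<Rightarrow> bool) \<Rightarrow> (state \<Rightarrow> bool) \<Rightarrow> (state \<Rightarrow> bool) \<Rightarrow> nat \<Rightarrow> real \<Rightarrow> config \<Rightarrow> bool" where
  "guar I A S B p c \<longleftrightarrow>
     (\<forall>t. \<forall>c'\<in>set_pmf (run t c). I (snd c')) \<and>
     (\<forall>T\<ge>B. (\<forall>c'\<in>set_pmf (run T c). halted c' \<and> A (snd c')) \<and>
        measure_pmf.prob (run T c) {c'. S (snd c')} \<ge> p)"

lemma guar_mono: "guar I A S B p c \<Longrightarrow> B \<le> B' \<Longrightarrow> p' \<le> p \<Longrightarrow> guar I A S B' p' c"
  unfolding guar_def by (meson order_trans)

lemma run_halted: "run t ([], s) = return_pmf ([], s)"
  by (induction t) (auto simp: bind_return_pmf)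

lemma guar_halted:
  assumes "I s" "A s" "p \<le> of_bool (S s)"
  shows "guar I A S 0 p ([], s)"
  using assms unfolding guar_def run_halted by (auto simp: halted_def indicator_def)

lemma guar_step:
  assumes "I (snd c)" "step c = return_pmf c'" "guar I A S B p c'"
  shows "guar I A S (Suc B) p c"
  unfolding guar_def
proof (rule conjI; intro allI impI)
  fix t show "\<forall>d\<in>set_pmf (run t c). I (snd d)"
    using assms by (cases t) (auto simp: bind_return_pmf guar_def)
next
  fix T assume "Suc B \<le> T"
  then obtain T' where T': "T = Suc T'" "B \<le> T'" by (cases T) auto
  then show "(\<forall>d\<in>set_pmf (run T c). halted d \<and> A (snd d)) \<and>
      p \<le> measure_pmf.prob (run T c) {d. S (snd d)}"
    using assms by (auto simp: bind_return_pmf guar_def)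
qed

lemma guar_reach: "reach I k c c' \<Longrightarrow> guar I A S B p c' \<Longrightarrow> guar I A S (B + k) p c"
  by (induction rule: reach.induct) (auto intro: guar_step)

lemma prob_coin:
  "measure_pmf.prob (bind_pmf (bernoulli_pmf (1/2)) f) X =
     (measure_pmf.prob (f True) X + measure_pmf.prob (f False) X) / 2"
proof -
  have "ennreal (measure_pmf.prob (bind_pmf (bernoulli_pmf (1/2)) f) X)
      = ennreal ((measure_pmf.prob (f True) X + measure_pmf.prob (f False) X) / 2)"
    unfolding measure_pmf.emeasure_eq_measure[symmetric]
    by (subst emeasure_bind_pmf, subst nn_integral_bernoulli_pmf)
      (simp_all add: measure_pmf.emeasure_eq_measure ennreal_plus[symmetric] divide_ennreal_def[symmetric]
         ennreal_divide_numeral add_divide_distrib del: ennreal_plus)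
  then show ?thesis by simp
qed

lemma guar_coin:
  assumes "I s" "guar I A S B p0 (cs, set_reg i 0 s)" "guar I A S B p1 (cs, set_reg i 1 s)"
  shows "guar I A S (Suc B) ((p0 + p1) / 2) (Coin i # cs, s)"
proof -
  define f where "f b = (cs, set_reg i (of_bool b) s)" for b
  have r: "run (Suc t) (Coin i # cs, s) = bind_pmf (bernoulli_pmf (1/2)) (\<lambda>b. run t (f b))" for t
    by (simp add: bind_map_pmf f_def)
  have f: "guar I A S B p0 (f False)" "guar I A S B p1 (f True)"
    using assms by (auto simp: f_def)
  show ?thesis
    unfolding guar_def
  proof (intro conjI allI impI)
    fix t show "\<forall>d\<in>set_pmf (run t (Coin i # cs, s)). I (snd d)"
    proof (cases t)
      case 0 then show ?thesis using assms(1) by auto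
    next
      case (Suc t')
      have "\<forall>d\<in>set_pmf (run t' (f b)). I (snd d)" for b
        using f by (cases b) (simp_all add: guar_def)
      then show ?thesis unfolding Suc r set_bind_pmf by blast
    qed
  next
    fix T assume "Suc B \<le> T"
    then obtain T' where T': "T = Suc T'" "B \<le> T'" by (cases T) auto
    have b: "(\<forall>c'\<in>set_pmf (run T' (f b)). halted c' \<and> A (snd c'))" for b
      using f T'(2) by (cases b) (auto simp: guar_def)
    have p: "p0 \<le> measure_pmf.prob (run T' (f False)) {d. S (snd d)}"
        "p1 \<le> measure_pmf.prob (run T' (f True)) {d. S (snd d)}"
      using f T'(2) by (auto simp: guar_def)
    show "\<forall>d\<in>set_pmf (run T (Coin i # cs, s)). halted d \<and> A (snd d)"
      unfolding T' r set_bind_pmf using b by blast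
    show "(p0 + p1) / 2 \<le> measure_pmf.prob (run T (Coin i # cs, s)) {d. S (snd d)}"
      unfolding T' r prob_coin using add_mono[OF p(2) p(1)] by (simp add: add.commute)
  qed
qed

section \<open>A structured language and its compilation\<close>

text \<open>
  \<open>Ld\<close> and \<open>Wr\<close> address the virtual memory of one attempt, which lives in the cells
  \<open>a * str + kk\<close>; distinct \<open>kk < str\<close> give disjoint fresh memories, so nothing ever has to be erased.
  \<open>Inp\<close> reads a machine address directly. The odd registers from 21 on are a stack for subexpressions,
  and registers 1 to 7 hold \<open>0, 1, H, 2 * H, str, kk\<close> and the remaining fuel.
\<close>

datatype ex = N int | V nat | Bin binop ex ex | Ld ex | Inp ex

datatype st = Skip | Asg nat ex | Wr ex ex | Sq st st (infixr ";;" 60) | Ite ex st st | Whl ex st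

abbreviation Rg :: "nat \<Rightarrow> nat" where "Rg v \<equiv> 20 + 2 * v"
abbreviation Tm :: "nat \<Rightarrow> nat" where "Tm d \<equiv> 21 + 2 * d"

text \<open>Operands live on a register stack: the value of an expression at depth \<open>d\<close>
  ends in \<open>Tm d\<close>, and deeper registers are scratch. Adding \<open>H\<close>, reducing
  modulo \<open>2 * H\<close> and subtracting \<open>H\<close> after every operation computes
  \<open>clamp\<close>. Register 1 holds 0, so adding it copies a variable.\<close>

fun ce :: "nat \<Rightarrow> ex \<Rightarrow> com list" where
  "ce d (N k) = [SetConst (Tm d) k]"
| "ce d (V v) = [Op Add (Tm d) (Rg v) 1]"
| "ce d (Bin f a b) = ce d a @ ce (Suc d) b @
     [Op f (Tm d) (Tm d) (Tm (Suc d)), Op Add (Tm d) (Tm d) 3, Op Mod (Tm d) (Tm d) 4, Op Sub (Tm d) (Tm d) 3]"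
| "ce d (Ld a) = ce d a @ [Op Mul (Tm d) (Tm d) 5, Op Add (Tm d) (Tm d) 6, Load (Tm d) (Tm d)]"
| "ce d (Inp a) = ce d a @ [Load (Tm d) (Tm d)]"

text \<open>The loop register holds the guard times the remaining fuel. It vanishes as soon as
  either factor does, so a single test enforces both.\<close>

fun cst :: "st \<Rightarrow> com list" where
  "cst Skip = []"
| "cst (Asg v e) = ce 0 e @ [Op Add (Rg v) (Tm 0) 1]"
| "cst (Wr a e) = ce 0 a @ ce 1 e @ [Op Mul (Tm 0) (Tm 0) 5, Op Add (Tm 0) (Tm 0) 6, Store (Tm 0) (Tm 1)]"
| "cst (a ;; b) = cst a @ cst b"
| "cst (Ite e a b) = ce 0 e @ [IfNZ (Tm 0) (cst a) (cst b)]"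
| "cst (Whl e b) = ce 0 e @ [Op Mul (Tm 0) (Tm 0) 7,
     WhileNZ (Tm 0) (Op Sub 7 7 2 # cst b @ ce 0 e @ [Op Mul (Tm 0) (Tm 0) 7])]"

fun ssz :: "st \<Rightarrow> nat" where
  "ssz Skip = 0"
| "ssz (Asg v e) = length (ce 0 e) + 1"
| "ssz (Wr a e) = length (ce 0 a) + length (ce 1 e) + 3"
| "ssz (a ;; b) = ssz a + ssz b"
| "ssz (Ite e a b) = length (ce 0 e) + 1 + ssz a + ssz b"
| "ssz (Whl e b) = ssz b + length (ce 0 e) + 3"

definition wb :: "int \<Rightarrow> state \<Rightarrow> bool" where
  "wb X s \<longleftrightarrow> (\<forall>i. \<bar>reg s i\<bar> \<le> X) \<and> (\<forall>a. \<bar>mem s a\<bar> \<le> X)"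

text \<open>The remaining program \<open>rest\<close> is part of a configuration; quantifying over
  it makes executions of code fragments composable.\<close>

definition exc :: "(state \<Rightarrow> bool) \<Rightarrow> nat \<Rightarrow> com list \<Rightarrow> state \<Rightarrow> state \<Rightarrow> bool" where
  "exc I k p s s' \<longleftrightarrow> (\<forall>rest. reach I k (p @ rest, s) (rest, s'))"

lemma exc_append: "exc I k p s s1 \<Longrightarrow> exc I l q s1 s2 \<Longrightarrow> exc I (k + l) (p @ q) s s2"
  unfolding exc_def by (metis append_assoc reach_trans)

lemma exc_Nil: "I s \<Longrightarrow> exc I 0 [] s s"
  unfolding exc_def using reach.refl[of I "(_, s)"] by simp

lemma exc_Cons: "exc I (Suc 0) [c] s s1 \<Longrightarrow> exc I l q s1 s2 \<Longrightarrow> exc I (Suc l) (c # q) s s2"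
  using exc_append[of I "Suc 0" "[c]" s s1 l q s2] by simp

lemma exc_1:
  assumes "I s" "I s'" "\<And>rest. step (c # rest, s) = return_pmf (rest, s')"
  shows "exc I (Suc 0) [c] s s'"
  unfolding exc_def using reach_1[of I "(c # _, s)"] assms by simp

lemma exc_SetConst: "I s \<Longrightarrow> I (set_reg i k s) \<Longrightarrow> exc I (Suc 0) [SetConst i k] s (set_reg i k s)"
  by (rule exc_1) auto

lemma exc_Op: "I s \<Longrightarrow> I (set_reg i (binop_val f (reg s j) (reg s k)) s) \<Longrightarrow>
    exc I (Suc 0) [Op f i j k] s (set_reg i (binop_val f (reg s j) (reg s k)) s)"
  by (rule exc_1) auto

lemma exc_Load: "I s \<Longrightarrow> I (set_reg i (mem s (reg s j)) s) \<Longrightarrow>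
    exc I (Suc 0) [Load i j] s (set_reg i (mem s (reg s j)) s)"
  by (rule exc_1) auto

lemma exc_Store: "I s \<Longrightarrow> I (s\<lparr>mem := (mem s)(reg s i := reg s j)\<rparr>) \<Longrightarrow>
    exc I (Suc 0) [Store i j] s (s\<lparr>mem := (mem s)(reg s i := reg s j)\<rparr>)"
  by (rule exc_1) auto

lemma wb_set_reg: "wb X s \<Longrightarrow> \<bar>v\<bar> \<le> X \<Longrightarrow> wb X (set_reg i v s)"
  unfolding wb_def by auto

lemma wb_store: "wb X s \<Longrightarrow> wb X (s\<lparr>mem := (mem s)(reg s i := reg s j)\<rparr>)"
  unfolding wb_def by auto

lemma wb_load: "wb X s \<Longrightarrow> wb X (set_reg i (mem s a) s)"
  unfolding wb_def by auto

lemma exc_I: "exc I k p s s' \<Longrightarrow> I s'"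
  unfolding exc_def using reach_I by fastforce

lemma abs_div_le: "\<bar>a div b\<bar> \<le> \<bar>a\<bar>" for a b :: int
proof -
  have pos: "\<bar>a div b\<bar> \<le> \<bar>a\<bar>" if "b \<ge> 1" for a b :: int
  proof (cases "a \<ge> 0")
    case True
    with that have "a \<le> a * b" by (simp add: mult_le_cancel_left1)
    from zdiv_mono1[OF this, of b] that True show ?thesis
      by (simp add: pos_imp_zdiv_nonneg_iff)
  next
    case False
    with that have "a * b \<le> a" by (simp add: mult_le_cancel_left2)
    from zdiv_mono1[OF this, of b] that False show ?thesis
      using div_neg_pos_less0[of a b] by simp
  qed
  consider "b \<ge> 1" | "b = 0" | "- b \<ge> 1" by linarith
  then show ?thesis
    by cases (use pos[of b a] pos[of "-b" "-a"] in auto)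
qed

lemma Tm_Rg: "Tm d \<noteq> Rg v" by presburger

text \<open>
  Every operation is reduced to \<open>{-H..<H}\<close> and every loop stops when the fuel \<open>F\<close> is used up. The word
  size and the running time are therefore bounded for all coin flips, not only those for which an attempt is meaningful.
\<close>

locale vm =
  fixes H str kk :: int
begin

definition clamp :: "int \<Rightarrow> int" where "clamp v = (v + H) mod (2 * H) - H"

fun ev :: "ex \<Rightarrow> (nat \<Rightarrow> int) \<Rightarrow> (int \<Rightarrow> int) \<Rightarrow> int" where
  "ev (N c) va me = c"
| "ev (V v) va me = va v"
| "ev (Bin f a b) va me = clamp (binop_val f (ev a va me) (ev b va me))"
| "ev (Ld a) va me = me (ev a va me * str + kk)"
| "ev (Inp a) va me = me (ev a va me)"

fun cok :: "ex \<Rightarrow> bool" where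
  "cok (N c) \<longleftrightarrow> \<bar>c\<bar> \<le> H"
| "cok (V v) \<longleftrightarrow> True"
| "cok (Bin f a b) \<longleftrightarrow> cok a \<and> cok b"
| "cok (Ld a) \<longleftrightarrow> cok a"
| "cok (Inp a) \<longleftrightarrow> cok a"

fun sok :: "st \<Rightarrow> bool" where
  "sok Skip \<longleftrightarrow> True"
| "sok (Asg v e) \<longleftrightarrow> cok e"
| "sok (Wr a e) \<longleftrightarrow> cok a \<and> cok e"
| "sok (a ;; b) \<longleftrightarrow> sok a \<and> sok b"
| "sok (Ite e a b) \<longleftrightarrow> cok e \<and> sok a \<and> sok b"
| "sok (Whl e b) \<longleftrightarrow> cok e \<and> sok b"

text \<open>\<open>WhlF\<close> leaves a loop when the fuel is exhausted even if its guard still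
  holds. So every program has an outcome from every state, also for samples on which nothing
  meaningful is computed.\<close>

inductive bs :: "st \<Rightarrow> (nat \<Rightarrow> int) \<Rightarrow> (int \<Rightarrow> int) \<Rightarrow> nat \<Rightarrow> (nat \<Rightarrow> int) \<Rightarrow> (int \<Rightarrow> int) \<Rightarrow> nat \<Rightarrow> bool" where
  Skip: "bs Skip va me F va me F"
| Asg: "bs (Asg v e) va me F (va(v := ev e va me)) me F"
| Wr: "bs (Wr a e) va me F va (me(ev a va me * str + kk := ev e va me)) F"
| Sq: "bs a va me F va1 me1 F1 \<Longrightarrow> bs b va1 me1 F1 va2 me2 F2 \<Longrightarrow> bs (a ;; b) va me F va2 me2 F2"
| IteT: "ev e va me \<noteq> 0 \<Longrightarrow> bs a va me F va1 me1 F1 \<Longrightarrow> bs (Ite e a b) va me F va1 me1 F1"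
| IteF: "ev e va me = 0 \<Longrightarrow> bs b va me F va1 me1 F1 \<Longrightarrow> bs (Ite e a b) va me F va1 me1 F1"
| WhlF: "ev e va me = 0 \<or> F = 0 \<Longrightarrow> bs (Whl e b) va me F va me F"
| WhlT: "ev e va me \<noteq> 0 \<Longrightarrow> bs b va me F va1 me1 F1 \<Longrightarrow> bs (Whl e b) va1 me1 F1 va2 me2 F2
    \<Longrightarrow> bs (Whl e b) va me (Suc F) va2 me2 F2"

lemma bs_le: "bs c va me F va' me' F' \<Longrightarrow> F' \<le> F"
  by (induction rule: bs.induct) auto

text \<open>Induction on the program, and for loops on the fuel: a body cannot increase it and each
  iteration takes one unit.\<close>

lemma bs_total: "\<exists>va' me' F'. bs c va me F va' me' F'"
proof (induction c arbitrary: va me F)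
  case (Whl e b)
  show ?case
  proof (induction F arbitrary: va me rule: less_induct)
    case (less F)
    show ?case
    proof (cases "ev e va me = 0 \<or> F = 0")
      case True then show ?thesis by (blast intro: WhlF)
    next
      case False
      then obtain F0 where F: "F = Suc F0" "ev e va me \<noteq> 0" by (cases F) auto
      obtain va1 me1 F1 where 1: "bs b va me F0 va1 me1 F1" using Whl by blast
      with bs_le F have "F1 < F" by fastforce
      from less[OF this, of va1 me1] 1 F show ?thesis by (blast intro: WhlT)
    qed
  qed
next
  case (Ite e a b)
  then show ?case by (cases "ev e va me = 0") (blast intro: IteT IteF)+
qed (blast intro: bs.intros)+

definition sb :: "(nat \<Rightarrow> int) \<Rightarrow> (int \<Rightarrow> int) \<Rightarrow> bool" where
  "sb va me \<longleftrightarrow> (\<forall>v. \<bar>va v\<bar> \<le> H) \<and> (\<forall>a. \<bar>me a\<bar> \<le> H)"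

definition cor :: "(nat \<Rightarrow> int) \<Rightarrow> (int \<Rightarrow> int) \<Rightarrow> nat \<Rightarrow> state \<Rightarrow> bool" where
  "cor va me F s \<longleftrightarrow> (\<forall>v. reg s (Rg v) = va v) \<and> mem s = me \<and> reg s 1 = 0 \<and> reg s 2 = 1 \<and>
     reg s 3 = H \<and> reg s 4 = 2 * H \<and> reg s 5 = str \<and> reg s 6 = kk \<and> reg s 7 = int F"

lemma clamp_bound: "H \<ge> 1 \<Longrightarrow> \<bar>clamp v\<bar> \<le> H"
  unfolding clamp_def using pos_mod_bound[of "2*H" "v+H"] pos_mod_sign[of "2*H" "v+H"] by linarith

lemma ev_bound: "H \<ge> 1 \<Longrightarrow> sb va me \<Longrightarrow> cok e \<Longrightarrow> \<bar>ev e va me\<bar> \<le> H"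
  by (induction e) (auto simp: sb_def clamp_bound)

lemma bs_sb: "bs c va me F va' me' F' \<Longrightarrow> H \<ge> 1 \<Longrightarrow> sb va me \<Longrightarrow> sok c \<Longrightarrow> sb va' me'"
proof (induction rule: bs.induct)
  case (Asg v e va me F)
  then show ?case using ev_bound[of va me e] by (auto simp: sb_def)
next
  case (Wr a e va me F)
  then show ?case using ev_bound[of va me e] by (auto simp: sb_def)
qed auto

lemma binop_bound:
  assumes "H \<ge> 1" "\<bar>a\<bar> \<le> H" "\<bar>b\<bar> \<le> H"
  shows "\<bar>binop_val f a b\<bar> \<le> 2 * (H * H)"
proof -
  have HH: "H \<le> H * H" using assms by (simp add: mult_le_cancel_left1)
  have m: "\<bar>a * b\<bar> \<le> H * H" unfolding abs_mult by (rule mult_mono) (use assms in auto)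
  have d: "\<bar>a div b\<bar> \<le> H"
  proof (cases "b = 0")
    case False
    then show ?thesis using abs_div_le[of a b] assms by linarith
  qed (use assms in simp)
  have mo: "\<bar>a mod b\<bar> \<le> H"
  proof (cases "b = 0")
    case False
    then show ?thesis using abs_mod_less[of b a] assms by linarith
  qed (use assms in simp)
  note facts = HH m d mo assms
  show ?thesis
  proof (cases f)
    case Less
    then have "\<bar>binop_val f a b\<bar> \<le> 1" by simp
    with facts show ?thesis by linarith
  qed (simp_all only: binop_val.simps, (use facts in linarith)+)
qed

lemma cor_eq:
  assumes "cor va me F s" "mem s' = mem s" "\<forall>r. (\<forall>d. r \<noteq> Tm d) \<longrightarrow> reg s' r = reg s r"
  shows "cor va me F s'"
proof -
  have "reg s' r = reg s r" if "r < 10 \<or> even r" for r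
  proof -
    have "\<forall>d. r \<noteq> Tm d" using that by presburger
    then show ?thesis using assms(3) by blast
  qed
  then show ?thesis using assms unfolding cor_def by simp
qed

text \<open>One operation on reduced values stays below \<open>2 * (H * H)\<close>. The shift by
  \<open>H\<close> before the reduction, or an address \<open>a * str + kk\<close>, still fits below
  \<open>4 * (H * H)\<close>.\<close>

context
  fixes X :: int
  assumes H1: "H \<ge> 1" and X: "4 * (H * H) \<le> X" and str: "0 \<le> str" "str \<le> H" and kk: "0 \<le> kk" "kk \<le> H"
begin

lemma HH: "H \<le> H * H"
  using H1 by (simp add: mult_le_cancel_left1)

lemma addr_bound: "\<bar>a\<bar> \<le> H \<Longrightarrow> \<bar>a * str\<bar> \<le> X \<and> \<bar>a * str + kk\<bar> \<le> X"
proof -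
  assume "\<bar>a\<bar> \<le> H"
  then have "\<bar>a * str\<bar> \<le> H * H" unfolding abs_mult by (rule mult_mono) (use H1 str in auto)
  then show ?thesis using HH X kk H1 by linarith
qed

lemma HX: "v \<le> H \<Longrightarrow> v \<le> X" using HH X H1 by linarith

lemma ce_correct:
  assumes "cor va me F s" "wb X s" "sb va me" "cok e"
  shows "\<exists>s'. exc (wb X) (length (ce d e)) (ce d e) s s' \<and> reg s' (Tm d) = ev e va me \<and> mem s' = mem s \<and>
     (\<forall>r. (\<forall>d'\<ge>d. r \<noteq> Tm d') \<longrightarrow> reg s' r = reg s r)"
  using assms
proof (induction e arbitrary: d s)
  case (N c)
  have "wb X (set_reg (Tm d) c s)" using N HX by (intro wb_set_reg) auto
  with N show ?case
    by (intro exI[of _ "set_reg (Tm d) c s"]) (auto intro!: exc_SetConst)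
next
  case (V v)
  let ?s = "set_reg (Tm d) (binop_val Add (reg s (Rg v)) (reg s 1)) s"
  have "binop_val Add (reg s (Rg v)) (reg s 1) = va v" using V by (simp add: cor_def)
  moreover have "wb X ?s" using V calculation HX unfolding sb_def by (intro wb_set_reg) (auto)
  ultimately have "exc (wb X) (Suc 0) [Op Add (Tm d) (Rg v) 1] s ?s"
    using exc_Op[of "wb X" s "Tm d" Add "Rg v" 1] V by blast
  with \<open>binop_val Add (reg s (Rg v)) (reg s 1) = va v\<close> show ?case
    by (intro exI[of _ ?s]) (auto simp del: binop_val.simps)
next
  case (Bin f a b)
  from Bin.IH(1)[of s d] Bin.prems obtain s1 where
    1: "exc (wb X) (length (ce d a)) (ce d a) s s1" "reg s1 (Tm d) = ev a va me" "mem s1 = mem s"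
     "\<forall>r. (\<forall>d'\<ge>d. r \<noteq> Tm d') \<longrightarrow> reg s1 r = reg s r" by auto
  have c1: "cor va me F s1" using cor_eq[OF Bin.prems(1) 1(3)] 1(4) by blast
  from Bin.IH(2)[of s1 "Suc d"] Bin.prems c1 exc_I[OF 1(1)] obtain s2 where
    2: "exc (wb X) (length (ce (Suc d) b)) (ce (Suc d) b) s1 s2" "reg s2 (Tm (Suc d)) = ev b va me" "mem s2 = mem s1"
     "\<forall>r. (\<forall>d'\<ge>Suc d. r \<noteq> Tm d') \<longrightarrow> reg s2 r = reg s1 r" by auto
  have c2: "cor va me F s2" using cor_eq[OF c1 2(3)] 2(4) by blast
  have a2: "reg s2 (Tm d) = ev a va me" using 1(2) 2(4) by auto
  let ?v = "binop_val f (ev a va me) (ev b va me)"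
  have ba: "\<bar>?v\<bar> \<le> 2 * (H * H)"
    by (rule binop_bound) (use Bin.prems H1 ev_bound in auto)
  let ?s3 = "set_reg (Tm d) ?v s2"
  let ?s4 = "set_reg (Tm d) (?v + H) s2"
  let ?s5 = "set_reg (Tm d) ((?v + H) mod (2 * H)) s2"
  let ?s6 = "set_reg (Tm d) (clamp ?v) s2"
  have cH: "\<bar>clamp ?v\<bar> \<le> H" using clamp_bound[OF H1] .
  have mH: "\<bar>(?v + H) mod (2 * H)\<bar> \<le> 2 * H"
    using pos_mod_bound[of "2*H" "?v+H"] pos_mod_sign[of "2*H" "?v+H"] H1 by linarith
  have w2: "wb X s2" using exc_I[OF 2(1)] .
  have w: "wb X ?s3" "wb X ?s4" "wb X ?s5" "wb X ?s6"
    by (rule wb_set_reg[OF w2]; use ba cH mH X HH H1 in linarith)+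
  have 4: "3 \<noteq> Tm d" "4 \<noteq> Tm d" by presburger+
  have r: "reg s2 3 = H" "reg s2 4 = 2 * H" using c2 by (auto simp: cor_def)
  have e3: "exc (wb X) (Suc 0) [Op f (Tm d) (Tm d) (Tm (Suc d))] s2 ?s3"
    using exc_Op[of "wb X" s2 "Tm d" f "Tm d" "Tm (Suc d)"] w w2 a2 2(2) by simp
  have e4: "exc (wb X) (Suc 0) [Op Add (Tm d) (Tm d) 3] ?s3 ?s4"
    using exc_Op[of "wb X" ?s3 "Tm d" Add "Tm d" 3] w r 4 by simp
  have e5: "exc (wb X) (Suc 0) [Op Mod (Tm d) (Tm d) 4] ?s4 ?s5"
    using exc_Op[of "wb X" ?s4 "Tm d" Mod "Tm d" 4] w r 4 by simp
  have e6: "exc (wb X) (Suc 0) [Op Sub (Tm d) (Tm d) 3] ?s5 ?s6"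
    using exc_Op[of "wb X" ?s5 "Tm d" Sub "Tm d" 3] w r 4 by (simp add: clamp_def)
  have e: "exc (wb X) (Suc (Suc (Suc (Suc 0)))) [Op f (Tm d) (Tm d) (Tm (Suc d)), Op Add (Tm d) (Tm d) 3,
     Op Mod (Tm d) (Tm d) 4, Op Sub (Tm d) (Tm d) 3] s2 ?s6"
    by (rule exc_Cons[OF e3 exc_Cons[OF e4 exc_Cons[OF e5 e6]]])
  have "exc (wb X) (length (ce d (Bin f a b))) (ce d (Bin f a b)) s ?s6"
    using exc_append[OF 1(1) exc_append[OF 2(1) e]] by (simp add: ac_simps)
  then show ?case using 1 2 by (intro exI[of _ ?s6]) auto
next
  case (Ld a)
  from Ld.IH[of s d] Ld.prems obtain s1 where
    1: "exc (wb X) (length (ce d a)) (ce d a) s s1" "reg s1 (Tm d) = ev a va me" "mem s1 = mem s"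
     "\<forall>r. (\<forall>d'\<ge>d. r \<noteq> Tm d') \<longrightarrow> reg s1 r = reg s r" by auto
  have c1: "cor va me F s1" using cor_eq[OF Ld.prems(1) 1(3)] 1(4) by blast
  have w1: "wb X s1" using exc_I[OF 1(1)] .
  let ?a = "ev a va me"
  have b: "\<bar>?a\<bar> \<le> H" using Ld.prems H1 ev_bound by auto
  let ?s2 = "set_reg (Tm d) (?a * str) s1"
  let ?s3 = "set_reg (Tm d) (?a * str + kk) s1"
  let ?s4 = "set_reg (Tm d) (mem s1 (?a * str + kk)) s1"
  have w: "wb X ?s2" "wb X ?s3" "wb X ?s4"
    using addr_bound[OF b] w1 by (auto intro!: wb_set_reg simp: wb_def)
  have 4: "5 \<noteq> Tm d" "6 \<noteq> Tm d" by presburger+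
  have r: "reg s1 5 = str" "reg s1 6 = kk" using c1 by (auto simp: cor_def)
  have e2: "exc (wb X) (Suc 0) [Op Mul (Tm d) (Tm d) 5] s1 ?s2"
    using exc_Op[of "wb X" s1 "Tm d" Mul "Tm d" 5] w w1 1(2) r by simp
  have e3: "exc (wb X) (Suc 0) [Op Add (Tm d) (Tm d) 6] ?s2 ?s3"
    using exc_Op[of "wb X" ?s2 "Tm d" Add "Tm d" 6] w r 4 by simp
  have e4: "exc (wb X) (Suc 0) [Load (Tm d) (Tm d)] ?s3 ?s4"
    using exc_Load[of "wb X" ?s3 "Tm d" "Tm d"] w by simp
  have "exc (wb X) (length (ce d (Ld a))) (ce d (Ld a)) s ?s4"
    using exc_append[OF 1(1) exc_Cons[OF e2 exc_Cons[OF e3 e4]]] by simp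
  then show ?case using 1 c1 by (intro exI[of _ ?s4]) (auto simp: cor_def)
next
  case (Inp a)
  from Inp.IH[of s d] Inp.prems obtain s1 where
    1: "exc (wb X) (length (ce d a)) (ce d a) s s1" "reg s1 (Tm d) = ev a va me" "mem s1 = mem s"
     "\<forall>r. (\<forall>d'\<ge>d. r \<noteq> Tm d') \<longrightarrow> reg s1 r = reg s r" by auto
  have c1: "cor va me F s1" using cor_eq[OF Inp.prems(1) 1(3)] 1(4) by blast
  have w1: "wb X s1" using exc_I[OF 1(1)] .
  let ?s4 = "set_reg (Tm d) (mem s1 (ev a va me)) s1"
  have e4: "exc (wb X) (Suc 0) [Load (Tm d) (Tm d)] s1 ?s4"
    using exc_Load[of "wb X" s1 "Tm d" "Tm d"] w1 1(2) wb_load[OF w1] by simp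
  have "exc (wb X) (length (ce d (Inp a))) (ce d (Inp a)) s ?s4"
    using exc_append[OF 1(1) e4] by simp
  then show ?case using 1 c1 by (intro exI[of _ ?s4]) (auto simp: cor_def)
qed

lemma ce_correct0:
  assumes "cor va me F s" "wb X s" "sb va me" "cok e"
  obtains s' where "exc (wb X) (length (ce d e)) (ce d e) s s'" "reg s' (Tm d) = ev e va me"
     "cor va me F s'" "wb X s'" "\<And>r. (\<forall>d'\<ge>d. r \<noteq> Tm d') \<Longrightarrow> reg s' r = reg s r"
  using ce_correct[OF assms, of d] cor_eq[OF assms(1)] exc_I by metis

lemma cor_Asg: "cor va me F s \<Longrightarrow> cor (va(v := x)) me F (set_reg (Rg v) x s)"
  unfolding cor_def by auto

lemma cor_set7: "cor va me F s \<Longrightarrow> cor va me F' (set_reg 7 (int F') s)"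
  unfolding cor_def by auto

lemma exc_copy:
  assumes "cor va me F s" "wb X s"
  shows "exc (wb X) (Suc 0) [Op Add i j 1] s (set_reg i (reg s j) s)"
  using exc_Op[of "wb X" s i Add j 1] assms by (simp add: wb_def cor_def)

lemma guard_correct:
  assumes "cor va me F s" "wb X s" "sb va me" "cok e" "int F \<le> H"
  obtains s' where "exc (wb X) (length (ce 0 e) + 1) (ce 0 e @ [Op Mul (Tm 0) (Tm 0) 7]) s s'"
    "reg s' (Tm 0) = ev e va me * int F" "cor va me F s'" "wb X s'"
    "\<And>r. (\<forall>d. r \<noteq> Tm d) \<Longrightarrow> reg s' r = reg s r"
proof -
  from ce_correct0[OF assms(1-4), of 0] obtain s1 where
    1: "exc (wb X) (length (ce 0 e)) (ce 0 e) s s1" "reg s1 (Tm 0) = ev e va me"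
     "cor va me F s1" "wb X s1" "\<And>r. (\<forall>d'\<ge>0. r \<noteq> Tm d') \<Longrightarrow> reg s1 r = reg s r" by metis
  let ?s2 = "set_reg (Tm 0) (ev e va me * int F) s1"
  have "\<bar>ev e va me * int F\<bar> \<le> H * H"
    unfolding abs_mult using ev_bound[OF H1 assms(3,4)] assms(5) by (intro mult_mono) auto
  then have w: "wb X ?s2" using 1(4) X HH H1 by (intro wb_set_reg) auto
  have "exc (wb X) (Suc 0) [Op Mul (Tm 0) (Tm 0) 7] s1 ?s2"
    using exc_Op[of "wb X" s1 "Tm 0" Mul "Tm 0" 7] w 1 by (simp add: cor_def)
  from exc_append[OF 1(1) this] have "exc (wb X) (length (ce 0 e) + 1) (ce 0 e @ [Op Mul (Tm 0) (Tm 0) 7]) s ?s2"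
    by simp
  moreover have "cor va me F ?s2"
    by (rule cor_eq[OF 1(3)]) auto
  moreover have "reg ?s2 r = reg s r" if "\<forall>d. r \<noteq> Tm d" for r
    using 1(5)[of r] that by auto
  ultimately show ?thesis using that[of ?s2] w by auto
qed

text \<open>Between two decrements of the fuel no code is repeated, so the number of steps is at
  most the program size times one plus the fuel consumed.\<close>

lemma cst_correct:
  assumes "bs c va me F va' me' F'" "cor va me F s" "wb X s" "sb va me" "sok c" "int F \<le> H"
  shows "\<exists>k s'. exc (wb X) k (cst c) s s' \<and> k \<le> ssz c * (1 + (F - F')) \<and> cor va' me' F' s' \<and>
    (\<forall>r. even r \<longrightarrow> r < 20 \<longrightarrow> reg s' r = reg s r)"
proof -
  define W where "W e b = [WhileNZ (Tm 0) (Op Sub 7 7 2 # cst b @ ce 0 e @ [Op Mul (Tm 0) (Tm 0) 7])]" for e b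
  define R where "R s s' \<longleftrightarrow> (\<forall>r. even r \<longrightarrow> r < 20 \<longrightarrow> reg s' r = reg s r)" for s s' :: state
  have "\<And>r d. even r \<Longrightarrow> r \<noteq> Tm d" by presburger
  then have RI: "R s s'" if "\<And>r. (\<forall>d. r \<noteq> Tm d) \<Longrightarrow> reg s' r = reg s r" for s s'
    using that unfolding R_def by blast
  have Rt: "R a c" if "R a b" "R b c" for a b c using that unfolding R_def by simp
  have R1: "R s (set_reg (Rg v) x s)" "R s (set_reg 7 x s)" "R s s"
    "R s (set_reg (Tm d) x s)" "R s (s\<lparr>mem := m\<rparr>)" for s v x d m
    unfolding R_def by auto
  \<comment> \<open>A machine loop ends each iteration by evaluating its guard again. The induction
    therefore needs a second claim, about \<open>W e b\<close> started with the product of guard and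
    fuel already in \<open>Tm 0\<close>.\<close>
  have "(\<forall>s. cor va me F s \<longrightarrow> wb X s \<longrightarrow> sb va me \<longrightarrow> sok c \<longrightarrow> int F \<le> H \<longrightarrow>
      (\<exists>k s'. exc (wb X) k (cst c) s s' \<and> k \<le> ssz c * (1 + (F - F')) \<and> cor va' me' F' s' \<and> R s s')) \<and>
    (\<forall>e b s. c = Whl e b \<longrightarrow> cor va me F s \<longrightarrow> reg s (Tm 0) = ev e va me * int F \<longrightarrow>
      wb X s \<longrightarrow> sb va me \<longrightarrow> sok c \<longrightarrow> int F \<le> H \<longrightarrow>
      (\<exists>k s'. exc (wb X) k (W e b) s s' \<and> k \<le> ssz c * (F - F') + 1 \<and> cor va' me' F' s' \<and> R s s'))"
    using assms(1)
  proof (induction rule: bs.induct)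
    case (Skip va me F)
    then show ?case by (auto intro!: exI[of _ 0] exc_Nil R1)
  next
    case (Asg v e va me F)
    show ?case
    proof (intro conjI allI impI)
      fix s assume a: "cor va me F s" "wb X s" "sb va me" "sok (Asg v e)"
      then have "cok e" by simp
      from ce_correct0[OF a(1-3) this, of 0] obtain s1 where
        1: "exc (wb X) (length (ce 0 e)) (ce 0 e) s s1" "reg s1 (Tm 0) = ev e va me"
        "cor va me F s1" "wb X s1" "\<And>r. (\<forall>d'\<ge>0. r \<noteq> Tm d') \<Longrightarrow> reg s1 r = reg s r" by metis
      have "exc (wb X) (length (ce 0 e) + Suc 0) (cst (Asg v e)) s (set_reg (Rg v) (ev e va me) s1)"
        using exc_append[OF 1(1) exc_copy[OF 1(3,4), of "Rg v" "Tm 0"]] 1(2) by simp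
      moreover have "R s (set_reg (Rg v) (ev e va me) s1)"
        using Rt[OF RI R1(1)] 1(5) by blast
      ultimately show "\<exists>k s'. exc (wb X) k (cst (Asg v e)) s s' \<and> k \<le> ssz (Asg v e) * (1 + (F - F)) \<and>
          cor (va(v := ev e va me)) me F s' \<and> R s s'"
        using cor_Asg[OF 1(3)] by (intro exI conjI) auto
    qed simp
  next
    case (Wr a e va me F)
    show ?case
    proof (intro conjI allI impI)
      fix s assume a: "cor va me F s" "wb X s" "sb va me" "sok (Wr a e)"
      then have ok: "cok a" "cok e" by simp_all
      from ce_correct0[OF a(1-3) ok(1), of 0] obtain s1 where
        1: "exc (wb X) (length (ce 0 a)) (ce 0 a) s s1" "reg s1 (Tm 0) = ev a va me"
        "cor va me F s1" "wb X s1" "\<And>r. (\<forall>d'\<ge>0. r \<noteq> Tm d') \<Longrightarrow> reg s1 r = reg s r" by metis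
      from ce_correct0[OF 1(3,4) a(3) ok(2), of 1] obtain s2 where
        2: "exc (wb X) (length (ce 1 e)) (ce 1 e) s1 s2" "reg s2 (Tm 1) = ev e va me"
        "cor va me F s2" "wb X s2" "\<And>r. (\<forall>d'\<ge>1. r \<noteq> Tm d') \<Longrightarrow> reg s2 r = reg s1 r" by metis
      let ?a = "ev a va me"
      have b: "\<bar>?a\<bar> \<le> H" using a ok H1 ev_bound by auto
      have r0: "reg s2 (Tm 0) = ?a" using 2(5)[of "Tm 0"] 1(2) by simp
      let ?s3 = "set_reg (Tm 0) (?a * str) s2"
      let ?s4 = "set_reg (Tm 0) (?a * str + kk) s2"
      let ?s5 = "?s4\<lparr>mem := (mem s2)(?a * str + kk := ev e va me)\<rparr>"
      have w: "wb X ?s3" "wb X ?s4"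
        using addr_bound[OF b] 2(4) by (auto intro!: wb_set_reg)
      have w5: "wb X ?s5" using wb_store[OF w(2), of "Tm 0" "Tm 1"] 2(2) by simp
      have r: "reg s2 5 = str" "reg s2 6 = kk" using 2(3) by (auto simp: cor_def)
      have e3: "exc (wb X) (Suc 0) [Op Mul (Tm 0) (Tm 0) 5] s2 ?s3"
        using exc_Op[of "wb X" s2 "Tm 0" Mul "Tm 0" 5] w 2(4) r0 r by simp
      have e4: "exc (wb X) (Suc 0) [Op Add (Tm 0) (Tm 0) 6] ?s3 ?s4"
        using exc_Op[of "wb X" ?s3 "Tm 0" Add "Tm 0" 6] w r by simp
      have e5: "exc (wb X) (Suc 0) [Store (Tm 0) (Tm 1)] ?s4 ?s5"
        using exc_Store[of "wb X" ?s4 "Tm 0" "Tm 1"] w w5 2(2) by simp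
      have "exc (wb X) (ssz (Wr a e)) (cst (Wr a e)) s ?s5"
        using exc_append[OF 1(1) exc_append[OF 2(1) exc_Cons[OF e3 exc_Cons[OF e4 e5]]]]
        by (simp add: ac_simps numeral_3_eq_3)
      moreover have "R s ?s5"
        using Rt[OF RI Rt[OF RI Rt[OF R1(4) R1(5)]]] 1(5) 2(5) by blast
      moreover have "cor va (me(?a * str + kk := ev e va me)) F ?s5"
        using 2(3) by (auto simp: cor_def Tm_Rg)
      ultimately show "\<exists>k s'. exc (wb X) k (cst (Wr a e)) s s' \<and> k \<le> ssz (Wr a e) * (1 + (F - F)) \<and>
          cor va (me(?a * str + kk := ev e va me)) F s' \<and> R s s'"
        by (intro exI conjI) auto
    qed simp
  next
    case (Sq a va me F va1 me1 F1 b va2 me2 F2)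
    show ?case
    proof (intro conjI allI impI)
      fix s assume h: "cor va me F s" "wb X s" "sb va me" "sok (a ;; b)" "int F \<le> H"
      from Sq.IH(1) h obtain k1 s1 where 1: "exc (wb X) k1 (cst a) s s1" "k1 \<le> ssz a * (1 + (F - F1))"
        "cor va1 me1 F1 s1" "R s s1" by auto
      have "sb va1 me1" using bs_sb[OF Sq.hyps(1) H1] h by simp
      with Sq.IH(2) h 1 exc_I[OF 1(1)] bs_le[OF Sq.hyps(1)] obtain k2 s2 where
        2: "exc (wb X) k2 (cst b) s1 s2" "k2 \<le> ssz b * (1 + (F1 - F2))" "cor va2 me2 F2 s2" "R s1 s2"
        by fastforce
      have "k1 + k2 \<le> ssz a * (1 + (F - F2)) + ssz b * (1 + (F - F2))"
        using 1(2) 2(2) bs_le[OF Sq.hyps(1)] bs_le[OF Sq.hyps(2)]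
        by (intro add_mono order_trans[OF 1(2)] order_trans[OF 2(2)] mult_left_mono) auto
      then show "\<exists>k s'. exc (wb X) k (cst (a ;; b)) s s' \<and> k \<le> ssz (a ;; b) * (1 + (F - F2)) \<and>
          cor va2 me2 F2 s' \<and> R s s'"
        using exc_append[OF 1(1) 2(1)] 2(3) Rt[OF 1(4) 2(4)]
        by (intro exI[of _ "k1 + k2"] exI[of _ s2]) (simp add: algebra_simps)
    qed simp
  next
    case (IteT e va me a F va1 me1 F1 b)
    show ?case
    proof (intro conjI allI impI)
      fix s assume h: "cor va me F s" "wb X s" "sb va me" "sok (Ite e a b)" "int F \<le> H"
      then have ok: "cok e" by simp
      from ce_correct0[OF h(1-3) ok, of 0] obtain s1 where
        1: "exc (wb X) (length (ce 0 e)) (ce 0 e) s s1" "reg s1 (Tm 0) = ev e va me"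
        "cor va me F s1" "wb X s1" "\<And>r. (\<forall>d'\<ge>0. r \<noteq> Tm d') \<Longrightarrow> reg s1 r = reg s r" by metis
      from IteT.IH h 1 obtain k2 s2 where
        2: "exc (wb X) k2 (cst a) s1 s2" "k2 \<le> ssz a * (1 + (F - F1))" "cor va1 me1 F1 s2" "R s1 s2"
        by fastforce
      have "exc (wb X) (Suc k2) [IfNZ (Tm 0) (cst a) (cst b)] s1 s2"
        unfolding exc_def
      proof
        fix rest
        have "reach (wb X) k2 (cst a @ rest, s1) (rest, s2)" using 2(1) by (simp add: exc_def)
        then show "reach (wb X) (Suc k2) ([IfNZ (Tm 0) (cst a) (cst b)] @ rest, s1) (rest, s2)"
          using 1 IteT.hyps by (auto intro!: reach.step)
      qed
      from exc_append[OF 1(1) this] show "\<exists>k s'. exc (wb X) k (cst (Ite e a b)) s s' \<and>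
          k \<le> ssz (Ite e a b) * (1 + (F - F1)) \<and> cor va1 me1 F1 s' \<and> R s s'"
        using 2 Rt[OF RI 2(4), of s] 1(5)
        by (intro exI[of _ "length (ce 0 e) + Suc k2"] exI[of _ s2]) (simp add: algebra_simps)
    qed simp
  next
    case (IteF e va me b F va1 me1 F1 a)
    show ?case
    proof (intro conjI allI impI)
      fix s assume h: "cor va me F s" "wb X s" "sb va me" "sok (Ite e a b)" "int F \<le> H"
      then have ok: "cok e" by simp
      from ce_correct0[OF h(1-3) ok, of 0] obtain s1 where
        1: "exc (wb X) (length (ce 0 e)) (ce 0 e) s s1" "reg s1 (Tm 0) = ev e va me"
        "cor va me F s1" "wb X s1" "\<And>r. (\<forall>d'\<ge>0. r \<noteq> Tm d') \<Longrightarrow> reg s1 r = reg s r" by metis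
      from IteF.IH h 1 obtain k2 s2 where
        2: "exc (wb X) k2 (cst b) s1 s2" "k2 \<le> ssz b * (1 + (F - F1))" "cor va1 me1 F1 s2" "R s1 s2"
        by fastforce
      have "exc (wb X) (Suc k2) [IfNZ (Tm 0) (cst a) (cst b)] s1 s2"
        unfolding exc_def
      proof
        fix rest
        have "reach (wb X) k2 (cst b @ rest, s1) (rest, s2)" using 2(1) by (simp add: exc_def)
        then show "reach (wb X) (Suc k2) ([IfNZ (Tm 0) (cst a) (cst b)] @ rest, s1) (rest, s2)"
          using 1 IteF.hyps by (auto intro!: reach.step)
      qed
      from exc_append[OF 1(1) this] show "\<exists>k s'. exc (wb X) k (cst (Ite e a b)) s s' \<and>
          k \<le> ssz (Ite e a b) * (1 + (F - F1)) \<and> cor va1 me1 F1 s' \<and> R s s'"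
        using 2 Rt[OF RI 2(4), of s] 1(5)
        by (intro exI[of _ "length (ce 0 e) + Suc k2"] exI[of _ s2]) (simp add: algebra_simps)
    qed simp
  next
    case (WhlF e va me F b)
    have main: "exc (wb X) (Suc 0) (W e b) s s"
      if "reg s (Tm 0) = ev e va me * int F" "wb X s" for s
      unfolding W_def by (rule exc_1) (use that WhlF in auto)
    show ?case
    proof (intro conjI allI impI)
      fix s assume h: "cor va me F s" "wb X s" "sb va me" "sok (Whl e b)" "int F \<le> H"
      then have ok: "cok e" by simp
      from guard_correct[OF h(1-3) ok h(5)] obtain s1 where
        1: "exc (wb X) (length (ce 0 e) + 1) (ce 0 e @ [Op Mul (Tm 0) (Tm 0) 7]) s s1"
           "reg s1 (Tm 0) = ev e va me * int F" "cor va me F s1" "wb X s1"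
           "\<And>r. (\<forall>d. r \<noteq> Tm d) \<Longrightarrow> reg s1 r = reg s r" by metis
      from exc_append[OF 1(1) main[OF 1(2,4)]] show "\<exists>k s'. exc (wb X) k (cst (Whl e b)) s s' \<and>
          k \<le> ssz (Whl e b) * (1 + (F - F)) \<and> cor va me F s' \<and> R s s'"
        using 1(3) RI[of s1 s] 1(5)
        by (intro exI[of _ "length (ce 0 e) + 1 + Suc 0"] exI[of _ s1]) (auto simp: W_def)
    next
      fix e' b' s assume "Whl e b = Whl e' b'" "cor va me F s" "wb X s" "reg s (Tm 0) = ev e' va me * int F"
      then show "\<exists>k s'. exc (wb X) k (W e' b') s s' \<and>
          k \<le> ssz (Whl e b) * (F - F) + 1 \<and> cor va me F s' \<and> R s s'"
        using main[of s] R1(3) by (intro exI[of _ "Suc 0"] exI[of _ s]) auto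
    qed
  next
    case (WhlT e va me b F va1 me1 F1 va2 me2 F2)
    have l: "F1 \<le> F" "F2 \<le> F1" using bs_le WhlT.hyps by blast+
    have main: "\<exists>k s'. exc (wb X) k (W e b) s s' \<and>
          k \<le> ssz (Whl e b) * (Suc F - F2) + 1 \<and> cor va2 me2 F2 s' \<and> R s s'"
      if h: "cor va me (Suc F) s" "reg s (Tm 0) = ev e va me * int (Suc F)" "wb X s" "sb va me"
        "sok (Whl e b)" "int (Suc F) \<le> H" for s
    proof -
      let ?s0 = "set_reg 7 (int F) s"
      have w0: "wb X ?s0" using h HX by (intro wb_set_reg) auto
      have c0: "cor va me F ?s0" using cor_set7[OF h(1)] .
      have e0: "exc (wb X) (Suc 0) [Op Sub 7 7 2] s ?s0"
        using exc_Op[of "wb X" s 7 Sub 7 2] w0 h by (simp add: cor_def)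
      from WhlT.IH(1) c0 w0 h obtain k1 s1 where
        1: "exc (wb X) k1 (cst b) ?s0 s1" "k1 \<le> ssz b * (1 + (F - F1))" "cor va1 me1 F1 s1" "R ?s0 s1"
        by fastforce
      have sb1: "sb va1 me1" using bs_sb[OF WhlT.hyps(2) H1] h by simp
      have F1: "int F1 \<le> H" using l h by simp
      have "cok e" using h by simp
      from guard_correct[OF 1(3) exc_I[OF 1(1)] sb1 this F1] obtain s2 where
        2: "exc (wb X) (length (ce 0 e) + 1) (ce 0 e @ [Op Mul (Tm 0) (Tm 0) 7]) s1 s2"
           "reg s2 (Tm 0) = ev e va1 me1 * int F1" "cor va1 me1 F1 s2" "wb X s2"
           "\<And>r. (\<forall>d. r \<noteq> Tm d) \<Longrightarrow> reg s2 r = reg s1 r" by metis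
      from WhlT.IH(2) 2 sb1 h F1 obtain k3 s3 where
        3: "exc (wb X) k3 (W e b) s2 s3" "k3 \<le> ssz (Whl e b) * (F1 - F2) + 1" "cor va2 me2 F2 s3" "R s2 s3"
        by fastforce
      let ?body = "Op Sub 7 7 2 # cst b @ ce 0 e @ [Op Mul (Tm 0) (Tm 0) 7]"
      have "exc (wb X) (Suc 0 + (k1 + (length (ce 0 e) + 1 + k3))) (?body @ W e b) s s3"
        using exc_append[OF e0 exc_append[OF 1(1) exc_append[OF 2(1) 3(1)]]] by simp
      then have "reach (wb X) (Suc 0 + (k1 + (length (ce 0 e) + 1 + k3))) (?body @ W e b @ rest, s) (rest, s3)" for rest
        by (simp add: exc_def)
      then have "exc (wb X) (Suc (Suc 0 + (k1 + (length (ce 0 e) + 1 + k3)))) (W e b) s s3"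
        unfolding exc_def by (intro allI reach.step) (use h WhlT.hyps(1) in \<open>auto simp: W_def\<close>)
      moreover have "Suc (Suc 0 + (k1 + (length (ce 0 e) + 1 + k3))) \<le> ssz (Whl e b) * (Suc F - F2) + 1"
      proof -
        define x y where "x = F - F1" and "y = F1 - F2"
        have "Suc F - F2 = 1 + x + y" using l by (simp add: x_def y_def)
        moreover have "k1 \<le> ssz b * (1 + x)" "k3 \<le> ssz (Whl e b) * y + 1"
          using 1(2) 3(2) by (simp_all add: x_def y_def)
        ultimately show ?thesis by (simp add: algebra_simps)
      qed
      moreover have "R s s3"
        using Rt[OF R1(2) Rt[OF 1(4) Rt[OF RI 3(4)]]] 2(5) by blast
      ultimately show ?thesis using 3(3) by blast
    qed
    show ?case
    proof (intro conjI allI impI)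
      fix s assume h: "cor va me (Suc F) s" "wb X s" "sb va me" "sok (Whl e b)" "int (Suc F) \<le> H"
      then have ok: "cok e" by simp
      from guard_correct[OF h(1-3) ok h(5)] obtain s1 where
        1: "exc (wb X) (length (ce 0 e) + 1) (ce 0 e @ [Op Mul (Tm 0) (Tm 0) 7]) s s1"
           "reg s1 (Tm 0) = ev e va me * int (Suc F)" "cor va me (Suc F) s1" "wb X s1"
           "\<And>r. (\<forall>d. r \<noteq> Tm d) \<Longrightarrow> reg s1 r = reg s r" by metis
      from main[OF 1(3,2,4) h(3,4,5)] obtain k s2 where
        2: "exc (wb X) k (W e b) s1 s2" "k \<le> ssz (Whl e b) * (Suc F - F2) + 1" "cor va2 me2 F2 s2" "R s1 s2"
        by blast
      from exc_append[OF 1(1) 2(1)] show "\<exists>k s'. exc (wb X) k (cst (Whl e b)) s s' \<and>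
          k \<le> ssz (Whl e b) * (1 + (Suc F - F2)) \<and> cor va2 me2 F2 s' \<and> R s s'"
        using 2 Rt[OF RI 2(4), of s] 1(5)
        by (intro exI[of _ "length (ce 0 e) + 1 + k"] exI[of _ s2]) (auto simp: W_def)
    next
      fix e' b' s assume "Whl e b = Whl e' b'" "cor va me (Suc F) s" "reg s (Tm 0) = ev e' va me * int (Suc F)"
        "wb X s" "sb va me" "sok (Whl e b)" "int (Suc F) \<le> H"
      then show "\<exists>k s'. exc (wb X) k (W e' b') s s' \<and>
          k \<le> ssz (Whl e b) * (Suc F - F2) + 1 \<and> cor va2 me2 F2 s' \<and> R s s'"
        using main[of s] by simp
    qed
  qed
  then show ?thesis using assms(2-) unfolding R_def by blast
qed

end

end

section \<open>Frame conditions: which variables and cells a program can change\<close>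

fun asg :: "st \<Rightarrow> nat set" where
  "asg Skip = {}"
| "asg (Asg v e) = {v}"
| "asg (Wr a e) = {}"
| "asg (a ;; b) = asg a \<union> asg b"
| "asg (Ite e a b) = asg a \<union> asg b"
| "asg (Whl e b) = asg b"

context vm begin

lemma bs_asg: "bs c va me F va' me' F' \<Longrightarrow> v \<notin> asg c \<Longrightarrow> va' v = va v"
  by (induction rule: bs.induct) auto

text \<open>Writes only reach addresses congruent to \<open>kk\<close> modulo \<open>str\<close>,
  which keeps the memories of different rounds of the main loop apart.\<close>

lemma bs_mem:
  "bs c va me F va' me' F' \<Longrightarrow> 0 \<le> kk \<Longrightarrow> kk < str \<Longrightarrow> a mod str \<noteq> kk \<Longrightarrow> me' a = me a"
  by (induction rule: bs.induct) auto

end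

text \<open>An exponent such that \<open>Y ^ deg e\<close> bounds the value. A sum costs one factor
  \<open>Y\<close> because \<open>2 \<le> Y\<close>; quotients, remainders and comparisons cost
  none, and a loaded value is at most \<open>Y\<close>.\<close>

fun deg :: "ex \<Rightarrow> nat" where
  "deg (N c) = 1"
| "deg (V v) = 1"
| "deg (Bin f a b) = (case f of Add \<Rightarrow> Suc (max (deg a) (deg b)) | Sub \<Rightarrow> Suc (max (deg a) (deg b))
     | Mul \<Rightarrow> deg a + deg b | _ \<Rightarrow> max (deg a) (deg b))"
| "deg (Ld a) = deg a"
| "deg (Inp a) = deg a"

lemma deg_pos: "1 \<le> deg e"
  by (induction e) (auto split: binop.split)

section \<open>A program logic for unreduced values\<close>

text \<open>
  If variables and the relevant cells \<open>\<Gamma>\<close> are bounded by \<open>Y\<close>, an expression of degree at most 15 is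
  bounded by \<open>Y ^ 15\<close>, so the reduction modulo \<open>2 * H\<close> has no effect.
\<close>

locale jlog = vm +
  fixes Y :: int and \<Gamma> :: "int set"
  assumes Y64: "64 \<le> Y" and YH: "Y ^ 16 \<le> H"
begin

fun evv :: "ex \<Rightarrow> (nat \<Rightarrow> int) \<Rightarrow> (int \<Rightarrow> int) \<Rightarrow> int" where
  "evv (N c) va me = c"
| "evv (V v) va me = va v"
| "evv (Bin f a b) va me = binop_val f (evv a va me) (evv b va me)"
| "evv (Ld a) va me = me (evv a va me * str + kk)"
| "evv (Inp a) va me = me (evv a va me)"

fun okI :: "ex \<Rightarrow> (nat \<Rightarrow> int) \<Rightarrow> (int \<Rightarrow> int) \<Rightarrow> bool" where
  "okI (N c) va me \<longleftrightarrow> \<bar>c\<bar> \<le> 64"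
| "okI (V v) va me \<longleftrightarrow> True"
| "okI (Bin f a b) va me \<longleftrightarrow> okI a va me \<and> okI b va me"
| "okI (Ld a) va me \<longleftrightarrow> okI a va me \<and> evv a va me * str + kk \<in> \<Gamma>"
| "okI (Inp a) va me \<longleftrightarrow> okI a va me \<and> evv a va me \<in> \<Gamma>"

definition bnd :: "(nat \<Rightarrow> int) \<Rightarrow> (int \<Rightarrow> int) \<Rightarrow> bool" where
  "bnd va me \<longleftrightarrow> (\<forall>v. \<bar>va v\<bar> \<le> Y) \<and> (\<forall>a\<in>\<Gamma>. \<bar>me a\<bar> \<le> Y)"

lemma Y_le: "v \<le> Y ^ i \<Longrightarrow> i \<le> j \<Longrightarrow> v \<le> Y ^ j"
  by (rule order_trans, assumption, rule power_increasing) (use Y64 in auto)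

lemma evv_bound: "bnd va me \<Longrightarrow> okI e va me \<Longrightarrow> \<bar>evv e va me\<bar> \<le> Y ^ deg e"
proof (induction e)
  case (N c)
  then show ?case using Y64 by simp
next
  case (V v)
  then show ?case by (simp add: bnd_def)
next
  case (Bin f a b)
  let ?a = "evv a va me" and ?b = "evv b va me"
  define m where "m = max (deg a) (deg b)"
  have a: "\<bar>?a\<bar> \<le> Y ^ deg a" and b: "\<bar>?b\<bar> \<le> Y ^ deg b" using Bin by auto
  have am: "\<bar>?a\<bar> \<le> Y ^ m" and bm: "\<bar>?b\<bar> \<le> Y ^ m"
    using Y_le[OF a] Y_le[OF b] by (auto simp: m_def)
  have m1: "Y ^ m \<ge> 1" using Y64 by simp
  have Ym: "2 * Y ^ m \<le> Y ^ Suc m" using Y64 m1 by simp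
  show ?case
  proof (cases f)
    case Add then show ?thesis using am bm Ym by (simp add: m_def[symmetric])
  next
    case Sub then show ?thesis using am bm Ym by (simp add: m_def[symmetric])
  next
    case Mul
    have "\<bar>?a * ?b\<bar> \<le> Y ^ deg a * Y ^ deg b"
      unfolding abs_mult using a b Y64 by (intro mult_mono) auto
    then show ?thesis using Mul by (simp add: power_add)
  next
    case Div then show ?thesis using am abs_div_le[of ?a ?b] by (simp add: m_def[symmetric])
  next
    case Mod
    have "\<bar>?a mod ?b\<bar> \<le> max \<bar>?a\<bar> \<bar>?b\<bar>"
      by (cases "?b = 0") (use abs_mod_less[of ?b ?a] in auto)
    then show ?thesis using am bm Mod by (auto simp: m_def[symmetric])
  next
    case Less then show ?thesis using m1 by (simp add: m_def[symmetric])
  qed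
next
  case (Ld a)
  then have "\<bar>evv (Ld a) va me\<bar> \<le> Y ^ 1" by (simp add: bnd_def)
  then show ?case using Y_le deg_pos[of a] by fastforce
next
  case (Inp a)
  then have "\<bar>evv (Inp a) va me\<bar> \<le> Y ^ 1" by (simp add: bnd_def)
  then show ?case using Y_le deg_pos[of a] by fastforce
qed

lemma clamp_id: "\<bar>v\<bar> \<le> Y ^ 15 \<Longrightarrow> clamp v = v"
proof -
  assume v: "\<bar>v\<bar> \<le> Y ^ 15"
  have "1 \<le> Y ^ 15" using Y64 by simp
  then have "Y ^ 15 < Y * Y ^ 15" using Y64 by simp
  also have "\<dots> \<le> H" using YH by (simp add: power_Suc[symmetric])
  finally have "\<bar>v\<bar> < H" using v by simp
  then show ?thesis unfolding clamp_def by (simp add: mod_pos_pos_trivial)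
qed

lemma ev_evv: "bnd va me \<Longrightarrow> okI e va me \<Longrightarrow> deg e \<le> 15 \<Longrightarrow> ev e va me = evv e va me"
proof (induction e)
  case (Bin f a b)
  have "deg a \<le> 15" "deg b \<le> 15" using Bin.prems(3) by (auto split: binop.splits)
  moreover have "\<bar>evv (Bin f a b) va me\<bar> \<le> Y ^ 15"
    by (rule Y_le[OF evv_bound]) (use Bin.prems in auto)
  ultimately show ?case using Bin clamp_id by simp
qed auto

text \<open>A total correctness statement with fuel budget \<open>m\<close>. The fuel
  \<open>m'\<close> actually used does not depend on the fuel \<open>F\<close> left over, which is
  why the budgets of consecutive programs add up.\<close>

definition J :: "st \<Rightarrow> (nat \<Rightarrow> int) \<Rightarrow> (int \<Rightarrow> int) \<Rightarrow> nat \<Rightarrow> ((nat \<Rightarrow> int) \<Rightarrow> (int \<Rightarrow> int) \<Rightarrow> bool) \<Rightarrow> bool" where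
  "J c va me m P \<longleftrightarrow> (bnd va me \<longrightarrow> (\<exists>va' me' m'. m' \<le> m \<and> bnd va' me' \<and> P va' me' \<and>
     (\<forall>F. bs c va me (m' + F) va' me' F)))"

lemma J_I: "(bnd va me \<Longrightarrow> J c va me m P) \<Longrightarrow> J c va me m P"
  unfolding J_def by blast

lemma J_conseq: "J c va me m P \<Longrightarrow> m \<le> m' \<Longrightarrow> (\<And>va' me'. bnd va' me' \<Longrightarrow> P va' me' \<Longrightarrow> Q va' me') \<Longrightarrow> J c va me m' Q"
  unfolding J_def by (meson order_trans)

lemma J_Sq: "J a va me m1 (\<lambda>va1 me1. J b va1 me1 m2 P) \<Longrightarrow> J (a ;; b) va me (m1 + m2) P"
proof -
  assume a: "J a va me m1 (\<lambda>va1 me1. J b va1 me1 m2 P)"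
  show ?thesis
    unfolding J_def
  proof
    assume "bnd va me"
    with a obtain va1 me1 k1 where 1: "k1 \<le> m1" "bnd va1 me1" "J b va1 me1 m2 P"
      "\<And>F. bs a va me (k1 + F) va1 me1 F" unfolding J_def by blast
    from 1(2,3) obtain va2 me2 k2 where 2: "k2 \<le> m2" "bnd va2 me2" "P va2 me2"
      "\<And>F. bs b va1 me1 (k2 + F) va2 me2 F" unfolding J_def by blast
    have "bs (a ;; b) va me (k1 + k2 + F) va2 me2 F" for F
      using bs.Sq[OF 1(4)[of "k2 + F"] 2(4)] by (simp add: add.assoc)
    then show "\<exists>va' me' m'. m' \<le> m1 + m2 \<and> bnd va' me' \<and> P va' me' \<and> (\<forall>F. bs (a ;; b) va me (m' + F) va' me' F)"
      using 1(1) 2(1-3) add_mono by blast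
  qed
qed

lemma J_Sq': "J a va me m1 (\<lambda>va1 me1. J b va1 me1 m2 P) \<Longrightarrow> m1 + m2 \<le> m \<Longrightarrow> J (a ;; b) va me m P"
  by (rule J_conseq[OF J_Sq])

lemma J_Skip: "P va me \<Longrightarrow> J Skip va me 0 P"
  unfolding J_def using bs.Skip[of va me] by fastforce

lemma J_Asg:
  assumes "okI e va me" "deg e \<le> 15" "\<bar>evv e va me\<bar> \<le> Y" "P (va(v := evv e va me)) me"
  shows "J (Asg v e) va me 0 P"
  unfolding J_def
proof
  assume b: "bnd va me"
  have "bs (Asg v e) va me (0 + F) (va(v := evv e va me)) me F" for F
    using bs.Asg[of v e va me F] ev_evv[OF b] assms by simp
  moreover have "bnd (va(v := evv e va me)) me" using b assms by (auto simp: bnd_def)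
  ultimately show "\<exists>va' me' m'. m' \<le> 0 \<and> bnd va' me' \<and> P va' me' \<and> (\<forall>F. bs (Asg v e) va me (m' + F) va' me' F)"
    using assms(4) by blast
qed

lemma J_Wr:
  assumes "okI a va me" "deg a \<le> 15" "okI e va me" "deg e \<le> 15" "\<bar>evv e va me\<bar> \<le> Y"
    "P va (me(evv a va me * str + kk := evv e va me))"
  shows "J (Wr a e) va me 0 P"
  unfolding J_def
proof
  assume b: "bnd va me"
  have "bs (Wr a e) va me (0 + F) va (me(evv a va me * str + kk := evv e va me)) F" for F
    using bs.Wr[of a e va me F] ev_evv[OF b] assms by simp
  moreover have "bnd va (me(evv a va me * str + kk := evv e va me))" using b assms by (auto simp: bnd_def)
  ultimately show "\<exists>va' me' m'. m' \<le> 0 \<and> bnd va' me' \<and> P va' me' \<and> (\<forall>F. bs (Wr a e) va me (m' + F) va' me' F)"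
    using assms(6) by blast
qed

lemma J_Ite:
  assumes "okI e va me" "deg e \<le> 15" "evv e va me \<noteq> 0 \<Longrightarrow> J a va me m P" "evv e va me = 0 \<Longrightarrow> J b va me m P"
  shows "J (Ite e a b) va me m P"
proof (rule J_I)
  assume bn: "bnd va me"
  have e: "ev e va me = evv e va me" using ev_evv[OF bn] assms by simp
  show ?thesis
  proof (cases "evv e va me = 0")
    case True
    then show ?thesis using assms(4) bs.IteF[of e va me] e unfolding J_def by metis
  next
    case False
    then show ?thesis using assms(3) bs.IteT[of e va me] e unfolding J_def by metis
  qed
qed

text \<open>The number \<open>K\<close> of iterations is fixed beforehand and \<open>Inv i\<close>
  describes the state after \<open>i\<close> of them; each consumes one unit of fuel besides that of
  the body.\<close>

lemma J_Whl:
  assumes step: "\<And>i va me. i < K \<Longrightarrow> bnd va me \<Longrightarrow> Inv i va me \<Longrightarrow>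
      evv e va me \<noteq> 0 \<and> okI e va me \<and> J b va me (f i) (Inv (Suc i))"
    and last: "\<And>va me. bnd va me \<Longrightarrow> Inv K va me \<Longrightarrow> evv e va me = 0 \<and> okI e va me"
    and deg: "deg e \<le> 15" and init: "Inv 0 va me"
  shows "J (Whl e b) va me (\<Sum>i<K. Suc (f i)) (Inv K)"
proof -
  have "J (Whl e b) va me (\<Sum>i=k..<K. Suc (f i)) (Inv K)" if "k \<le> K" "Inv k va me" for k va me
    using that
  proof (induction arbitrary: va me rule: inc_induct)
    case base
    show ?case unfolding J_def
    proof
      assume b: "bnd va me"
      from last[OF b base] ev_evv[OF b _ deg] have "ev e va me = 0" by simp
      then have "bs (Whl e b) va me (0 + F) va me F" for F by (auto intro: bs.WhlF)
      then show "\<exists>va' me' m'. m' \<le> sum (\<lambda>i. Suc (f i)) {K..<K} \<and> bnd va' me' \<and> Inv K va' me' \<and> (\<forall>F. bs (Whl e b) va me (m' + F) va' me' F)"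
        using b base by blast
    qed
  next
    case (step k)
    show ?case unfolding J_def
    proof
      assume b: "bnd va me"
      from assms(1)[OF step(2) b step(4)] have s: "evv e va me \<noteq> 0" "okI e va me" "J b va me (f k) (Inv (Suc k))"
        by auto
      have e: "ev e va me \<noteq> 0" using ev_evv[OF b s(2) deg] s(1) by simp
      from s(3) b obtain va1 me1 k1 where 1: "k1 \<le> f k" "bnd va1 me1" "Inv (Suc k) va1 me1"
        "\<And>F. bs b va me (k1 + F) va1 me1 F" unfolding J_def by blast
      from step.IH[OF 1(3)] 1(2) obtain va2 me2 k2 where
        2: "k2 \<le> (\<Sum>i=Suc k..<K. Suc (f i))" "bnd va2 me2" "Inv K va2 me2"
        "\<And>F. bs (Whl e b) va1 me1 (k2 + F) va2 me2 F" unfolding J_def by blast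
      have "bs (Whl e b) va me (Suc (k1 + k2) + F) va2 me2 F" for F
        using bs.WhlT[OF e 1(4)[of "k2 + F"] 2(4)] by (simp add: add.assoc)
      moreover have "Suc (k1 + k2) \<le> (\<Sum>i=k..<K. Suc (f i))"
        using 1(1) 2(1) step(2) by (simp add: sum.atLeast_Suc_lessThan)
      ultimately show "\<exists>va' me' m'. m' \<le> (\<Sum>i=k..<K. Suc (f i)) \<and> bnd va' me' \<and> Inv K va' me' \<and> (\<forall>F. bs (Whl e b) va me (m' + F) va' me' F)"
        using 2(2,3) by blast
    qed
  qed
  from this[of 0 va me] init show ?thesis by (simp add: atLeast0LessThan)
qed

text \<open>Weakest preconditions of loop-free code, to be unfolded by the simplifier. Loops get
  \<open>False\<close> here and go through \<open>J_Whl\<close>.\<close>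

fun wp :: "st \<Rightarrow> ((nat \<Rightarrow> int) \<Rightarrow> (int \<Rightarrow> int) \<Rightarrow> bool) \<Rightarrow> (nat \<Rightarrow> int) \<Rightarrow> (int \<Rightarrow> int) \<Rightarrow> bool" where
  "wp Skip P va me = P va me"
| "wp (Asg v e) P va me = (okI e va me \<and> deg e \<le> 15 \<and> \<bar>evv e va me\<bar> \<le> Y \<and> P (va(v := evv e va me)) me)"
| "wp (Wr a e) P va me = (okI a va me \<and> deg a \<le> 15 \<and> okI e va me \<and> deg e \<le> 15 \<and> \<bar>evv e va me\<bar> \<le> Y \<and>
     P va (me(evv a va me * str + kk := evv e va me)))"
| "wp (a ;; b) P va me = wp a (wp b P) va me"
| "wp (Ite e a b) P va me = (okI e va me \<and> deg e \<le> 15 \<and> (evv e va me \<noteq> 0 \<longrightarrow> wp a P va me) \<and>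
     (evv e va me = 0 \<longrightarrow> wp b P va me))"
| "wp (Whl e b) P va me = False"

lemma wp_J: "wp c P va me \<Longrightarrow> J c va me 0 P"
proof (induction c arbitrary: P va me)
  case (Sq a b)
  have "J a va me 0 (wp b P)" using Sq by simp
  then have "J a va me 0 (\<lambda>va1 me1. J b va1 me1 0 P)"
    by (rule J_conseq) (use Sq.IH(2) in auto)
  from J_Sq[OF this] show ?case by simp
next
  case (Ite e a b)
  then show ?case by (auto intro!: J_Ite)
qed (auto intro: J_Skip J_Asg J_Wr)

end

section \<open>Enumeration of the partial vectors\<close>

text \<open>Variables below 20 keep their meaning throughout the main loop, with 16 for the sample
  and 17 for the candidate of a round. Those from 20 to 44 are scratch and are reset by
  \<open>zero_core\<close>.\<close>

abbreviation (input) "vN \<equiv> 0 :: nat"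
abbreviation (input) "vp2 \<equiv> 2 :: nat"
abbreviation (input) "vp3 \<equiv> 3 :: nat"
abbreviation (input) "vB \<equiv> 4 :: nat"
abbreviation (input) "vp4 \<equiv> 5 :: nat"
abbreviation (input) "vN1 \<equiv> 6 :: nat"
abbreviation (input) "vQ \<equiv> 7 :: nat"
abbreviation (input) "vG \<equiv> 8 :: nat"
abbreviation (input) "vL \<equiv> 10 :: nat"
abbreviation (input) "vka \<equiv> 11 :: nat"
abbreviation (input) "vgo \<equiv> 12 :: nat"
abbreviation (input) "vstr \<equiv> 13 :: nat"
abbreviation (input) "vkk \<equiv> 14 :: nat"
abbreviation (input) "vfuel \<equiv> 15 :: nat"
abbreviation (input) "vom \<equiv> 16 :: nat"
abbreviation (input) "vcand \<equiv> 17 :: nat"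
abbreviation (input) "vfound \<equiv> 18 :: nat"

abbreviation (input) "vi \<equiv> 20 :: nat"
abbreviation (input) "vk \<equiv> 21 :: nat"
abbreviation (input) "vz \<equiv> 22 :: nat"
abbreviation (input) "vt \<equiv> 23 :: nat"
abbreviation (input) "vty \<equiv> 24 :: nat"
abbreviation (input) "val \<equiv> 25 :: nat"
abbreviation (input) "vM \<equiv> 26 :: nat"
abbreviation (input) "vW \<equiv> 27 :: nat"
abbreviation (input) "vlen \<equiv> 28 :: nat"
abbreviation (input) "vpw \<equiv> 29 :: nat"
abbreviation (input) "vtt \<equiv> 30 :: nat"
abbreviation (input) "vg \<equiv> 31 :: nat"
abbreviation (input) "vc \<equiv> 32 :: nat"
abbreviation (input) "vnl \<equiv> 33 :: nat"
abbreviation (input) "vj \<equiv> 34 :: nat"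
abbreviation (input) "ve \<equiv> 35 :: nat"
abbreviation (input) "vlA \<equiv> 36 :: nat"
abbreviation (input) "vlB \<equiv> 37 :: nat"
abbreviation (input) "vlC \<equiv> 38 :: nat"
abbreviation (input) "vw \<equiv> 39 :: nat"
abbreviation (input) "vr \<equiv> 40 :: nat"
abbreviation (input) "vp \<equiv> 41 :: nat"
abbreviation (input) "vE1 \<equiv> 42 :: nat"
abbreviation (input) "vE \<equiv> 43 :: nat"
abbreviation (input) "vd \<equiv> 44 :: nat"

abbreviation plus_ex (infixl "[+]" 65) where "a [+] b \<equiv> Bin Add a b"
abbreviation minus_ex (infixl "[-]" 65) where "a [-] b \<equiv> Bin Sub a b"
abbreviation times_ex (infixl "[*]" 70) where "a [*] b \<equiv> Bin Mul a b"
abbreviation div_ex (infixl "[div]" 70) where "a [div] b \<equiv> Bin Div a b"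
abbreviation mod_ex (infixl "[mod]" 70) where "a [mod] b \<equiv> Bin Mod a b"
abbreviation less_ex (infixl "[<]" 50) where "a [<] b \<equiv> Bin Less a b"

text \<open>The residue modulo 8 selects one of several arrays. Within an array, entry
  \<open>j\<close> of level \<open>i\<close> has its own cell, so building level
  \<open>i + 1\<close> does not overwrite level \<open>i\<close>.\<close>

definition adE :: "int \<Rightarrow> ex \<Rightarrow> ex \<Rightarrow> ex" where
  "adE \<tau> i j = (j [*] V vN1 [+] i) [*] N 8 [+] N \<tau>"

definition app :: "int \<Rightarrow> ex \<Rightarrow> st" where
  "app \<tau> e = (Wr (adE \<tau> (V vi [+] N 1) (V vnl)) e ;; Asg vnl (V vnl [+] N 1))"

definition chV_code :: "int \<Rightarrow> int \<Rightarrow> st" where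
  "chV_code \<tau> cls = Ite (V vc [-] N cls) (app \<tau> (V ve))
     (Ite (V vk) (app \<tau> (V ve [+] V vg) ;; app \<tau> (V ve [-] V vg)) Skip ;;
      Ite (V ve [mod] V vN1 [<] V vz) (app \<tau> (V ve [+] N 1)) Skip)"

definition chR_code :: "int \<Rightarrow> st" where
  "chR_code \<tau> = Ite (V vc [<] N 2) (app \<tau> (V ve)) (app \<tau> (V ve) ;; app \<tau> (V ve [+] V vg))"

definition build_inner :: "int \<Rightarrow> st \<Rightarrow> st" where
  "build_inner \<tau> CH = (Asg ve (Ld (adE \<tau> (V vi) (V vj))) ;; CH ;; Asg vj (V vj [+] N 1))"

definition build_body :: "int \<Rightarrow> st \<Rightarrow> st" where
  "build_body \<tau> CH = ((Asg vg ((Inp (V vi) [*] V vG [+] V vpw) [*] V vN1) ;; Asg vc (V vtt [mod] N 4) ;;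
      Asg vnl (N 0) ;; Asg vj (N 0)) ;; Whl (V vlen [-] V vj) (build_inner \<tau> CH) ;;
      (Asg vlen (V vnl) ;; Asg vi (V vi [+] N 1) ;; Asg vpw (V vpw [*] N 3) ;; Asg vtt (V vtt [div] N 4)))"

definition build :: "int \<Rightarrow> st \<Rightarrow> st" where
  "build \<tau> CH = ((Asg vlen (N 1) ;; Asg vi (N 0) ;; Asg vpw (N 1) ;; Asg vtt (V vty)) ;;
     Whl (V vN [-] V vi) (build_body \<tau> CH))"

text \<open>
  A partial vector \<open>d\<close> is stored as \<open>(d \<cdot> x) * (2 * 3 ^ n) + (\<Sum>l. d\<^sub>l * 3 ^ l)\<close>, times \<open>n + 1\<close>, plus its
  number of zero digits; all three components can be recovered.
\<close>

definition gg :: "(nat \<Rightarrow> int) \<Rightarrow> nat \<Rightarrow> nat \<Rightarrow> int" where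
  "gg x n l = (x l * (2 * 3 ^ n) + 3 ^ l) * (int n + 1)"

definition tp :: "int \<Rightarrow> nat \<Rightarrow> int" where
  "tp ty l = (ty div 4 ^ l) mod 4"

text \<open>Coordinates of class \<open>cls\<close> receive a digit 1, -1 or 0. The residue of an
  entry modulo \<open>n + 1\<close> counts its zeros, and a further zero is allowed only while this
  count is below \<open>z\<close>. For \<open>k = 0\<close> the signs are disabled, which leaves at
  most the zero vector.\<close>

definition chV :: "(nat \<Rightarrow> int) \<Rightarrow> nat \<Rightarrow> int \<Rightarrow> int \<Rightarrow> int \<Rightarrow> int \<Rightarrow> nat \<Rightarrow> int \<Rightarrow> int list" where
  "chV x n ty k z cls l e = (if tp ty l = cls then
      (if k \<noteq> 0 then [e + gg x n l, e - gg x n l] else []) @ (if e mod (int n + 1) < z then [e + 1] else [])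
    else [e])"

definition chR :: "(nat \<Rightarrow> int) \<Rightarrow> nat \<Rightarrow> int \<Rightarrow> nat \<Rightarrow> int \<Rightarrow> int list" where
  "chR x n ty l e = (if tp ty l < 2 then [e] else [e, e + gg x n l])"

fun lev :: "(nat \<Rightarrow> int \<Rightarrow> int list) \<Rightarrow> nat \<Rightarrow> int list" where
  "lev ch 0 = [0]"
| "lev ch (Suc i) = concat (map (ch i) (lev ch i))"

text \<open>The product \<open>(n + 1)\<^sup>2 * 2 ^ n * 4 ^ n * (S * 2 ^ n)\<close> in
  \<open>YA\<close> is the number of tuples \<open>(z, k, t, ty, \<alpha>)\<close> that a sample may
  encode. Bounding it by \<open>Y\<close> also covers list entries, weights and hash values.\<close>

locale core = jlog H str kk Y \<Gamma> for H str kk Y :: int and \<Gamma> +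
  fixes n :: nat and x :: "nat \<Rightarrow> int" and S :: int
  assumes S: "1 + (\<Sum>l<n. \<bar>x l\<bar>) \<le> S"
    and YA: "64 * ((int n + 1)^2 * 2 ^ n * 4 ^ n * (S * 2 ^ n)) \<le> Y"
    and kk: "int n \<le> kk" "kk < str"
    and \<Gamma>: "\<Gamma> = {0..<int n} \<union> {a. a mod str = kk}"
begin

definition ctx :: "(nat \<Rightarrow> int) \<Rightarrow> (int \<Rightarrow> int) \<Rightarrow> bool" where
  "ctx va me \<longleftrightarrow> va vN = int n \<and> va vp2 = 2 ^ n \<and> va vp3 = 3 ^ n \<and> va vp4 = 4 ^ n \<and> va vN1 = int n + 1 \<and>
     va vQ = S * 2 ^ n \<and> va vG = 2 * 3 ^ n \<and> (\<forall>l<n. me (int l) = x l)"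

lemma S1: "1 \<le> S" and Sx: "l < n \<Longrightarrow> \<bar>x l\<bar> < S"
proof -
  have "0 \<le> (\<Sum>l<n. \<bar>x l\<bar>)" by (simp add: sum_nonneg)
  then show "1 \<le> S" using S by linarith
  assume "l < n"
  then have "\<bar>x l\<bar> \<le> (\<Sum>l<n. \<bar>x l\<bar>)" by (intro member_le_sum) auto
  then show "\<bar>x l\<bar> < S" using S by linarith
qed

text \<open>The scale of the stored numbers: list entries are at most \<open>3 * A\<close> and sums
  of two of them at most \<open>6 * A\<close> in absolute value.\<close>

definition A where "A = (int n + 1) * 4 ^ n * S"

lemma A_le: "A * ((int n + 1) * 2 ^ n * 2 ^ n) * 64 \<le> Y"
  using YA by (simp add: A_def power2_eq_square mult_ac)

lemma A1: "1 \<le> A" "int n + 1 \<le> A" "4 ^ n \<le> A" "S \<le> A"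
proof -
  have p: "1 \<le> (4::int) ^ n" by simp
  have "1 * 1 \<le> (int n + 1) * 4 ^ n" by (rule mult_mono) auto
  then have "1 * S \<le> (int n + 1) * 4 ^ n * S" by (intro mult_right_mono) (use S1 in auto)
  then show "S \<le> A" by (simp add: A_def)
  then show "1 \<le> A" using S1 by simp
  have "(int n + 1) * 1 \<le> (int n + 1) * (4 ^ n * S)"
    using mult_mono[of 1 "4^n" 1 S] p S1 by (intro mult_left_mono) auto
  then show "int n + 1 \<le> A" by (simp add: A_def mult_ac)
  have "4 ^ n * 1 \<le> (4::int) ^ n * ((int n + 1) * S)"
    using mult_mono[of 1 "int n + 1" 1 S] S1 by (intro mult_left_mono) auto
  then show "4 ^ n \<le> A" by (simp add: A_def mult_ac)
qed

lemma A64: "64 * A \<le> Y"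
proof -
  have "1 * 1 * 1 \<le> (int n + 1) * 2 ^ n * 2 ^ n" by (intro mult_mono) auto
  then have "A * 1 * 64 \<le> A * ((int n + 1) * 2 ^ n * 2 ^ n) * 64"
    using A1 by (intro mult_right_mono mult_left_mono) auto
  with A_le show ?thesis by simp
qed

lemma p34: "(3::int) ^ n \<le> 4 ^ n" "i \<le> n \<Longrightarrow> (3::int) ^ i \<le> 3 ^ n" "(2::int) ^ n \<le> 4 ^ n"
  by (auto intro: power_mono power_increasing)

lemma wv_bound: "l < n \<Longrightarrow> \<bar>gg x n l\<bar> \<le> 2 * A"
proof -
  assume l: "l < n"
  have "\<bar>x l * (2 * 3 ^ n) + 3 ^ l\<bar> \<le> \<bar>x l * (2 * 3 ^ n)\<bar> + 3 ^ l"
    using abs_triangle_ineq[of "x l * (2 * 3 ^ n)" "3 ^ l"] by simp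
  also have "\<dots> = \<bar>x l\<bar> * (2 * 3 ^ n) + 3 ^ l" by (simp add: abs_mult)
  also have "\<dots> \<le> (S - 1) * (2 * 3 ^ n) + 3 ^ n"
    using Sx[OF l] p34(2)[of l] l by (intro add_mono mult_right_mono) auto
  also have "\<dots> \<le> S * (2 * 3 ^ n)" by (simp add: algebra_simps)
  also have "\<dots> \<le> S * (2 * 4 ^ n)" using p34(1) S1 by (intro mult_left_mono) auto
  finally have "\<bar>x l * (2 * 3 ^ n) + 3 ^ l\<bar> * (int n + 1) \<le> S * (2 * 4 ^ n) * (int n + 1)"
    by (intro mult_right_mono) auto
  then show ?thesis by (simp add: gg_def A_def abs_mult mult_ac)
qed

definition ad :: "int \<Rightarrow> nat \<Rightarrow> nat \<Rightarrow> int" where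
  "ad \<tau> i j = ((int j * (int n + 1) + int i) * 8 + \<tau>) * str + kk"

definition TG :: "int \<Rightarrow> int set" where
  "TG \<tau> = {(8 * a + \<tau>) * str + kk | a. True}"

lemma str_pos: "0 < str" using kk by linarith

lemma ad_TG: "ad \<tau> i j \<in> TG \<tau>"
  unfolding ad_def TG_def by (auto intro!: exI[of _ "int j * (int n + 1) + int i"])

lemma slot_inj: "a * str + kk = b * str + kk \<longleftrightarrow> a = b"
  using str_pos by simp

lemma ad_inj: "i \<le> n \<Longrightarrow> i' \<le> n \<Longrightarrow> ad \<tau> i j = ad \<tau> i' j' \<longleftrightarrow> i = i' \<and> j = j'"
proof -
  assume i: "i \<le> n" "i' \<le> n"
  have "int j = int j' \<and> int i = int i'" if "int j * (int n + 1) + int i = int j' * (int n + 1) + int i'"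
  proof -
    have "int i < int n + 1" "int i' < int n + 1" using i by auto
    then have "(int j * (int n + 1) + int i) div (int n + 1) = int j"
      "(int j' * (int n + 1) + int i') div (int n + 1) = int j'" by simp_all
    with that have "int j = int j'" by metis
    with that show ?thesis by simp
  qed
  then show ?thesis unfolding ad_def slot_inj by auto
qed

lemma inp_slot: "l < n \<Longrightarrow> int l \<noteq> a * str + kk"
proof
  assume l: "l < n" "int l = a * str + kk"
  have "(a * str + kk) mod str = kk" using kk by simp
  moreover have "int l mod str = int l" using l(1) kk by (simp add: mod_pos_pos_trivial)
  ultimately show False using l kk by simp
qed

lemma TG_disj: "0 \<le> \<tau> \<Longrightarrow> \<tau> < 8 \<Longrightarrow> 0 \<le> \<tau>' \<Longrightarrow> \<tau>' < 8 \<Longrightarrow> \<tau> \<noteq> \<tau>' \<Longrightarrow> a \<in> TG \<tau> \<Longrightarrow> a \<notin> TG \<tau>'"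
  unfolding TG_def using slot_inj by (auto simp del: mult_cancel_right) presburger

lemma inp_TG: "l < n \<Longrightarrow> int l \<notin> TG \<tau>"
  unfolding TG_def using inp_slot by blast

lemma slot_\<Gamma> [simp]: "a * str + kk \<in> \<Gamma>" "l < n \<Longrightarrow> int l \<in> \<Gamma>"
  using kk by (auto simp: \<Gamma>)

definition AP :: "int \<Rightarrow> nat \<Rightarrow> int list \<Rightarrow> (nat \<Rightarrow> int) \<Rightarrow> (int \<Rightarrow> int) \<Rightarrow> bool" where
  "AP \<tau> i xs va me \<longleftrightarrow> va vnl = int (length xs) \<and> (\<forall>p<length xs. me (ad \<tau> (Suc i) p) = xs ! p)"

definition fr :: "int \<Rightarrow> nat \<Rightarrow> (nat \<Rightarrow> int) \<Rightarrow> (int \<Rightarrow> int) \<Rightarrow> (nat \<Rightarrow> int) \<Rightarrow> (int \<Rightarrow> int) \<Rightarrow> bool" where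
  "fr \<tau> i va me va' me' \<longleftrightarrow> (\<forall>v. v \<noteq> vnl \<longrightarrow> va' v = va v) \<and> (\<forall>a. a \<notin> range (ad \<tau> (Suc i)) \<longrightarrow> me' a = me a)"

lemma fr_trans: "fr \<tau> i va me va1 me1 \<Longrightarrow> fr \<tau> i va1 me1 va2 me2 \<Longrightarrow> fr \<tau> i va me va2 me2"
  unfolding fr_def by auto

lemma J_app:
  assumes "AP \<tau> i xs va me" "va vN1 = int n + 1" "va vi = int i" "i < n" "\<bar>\<tau>\<bar> \<le> 64"
    "okI e va me" "deg e \<le> 15" "evv e va me = y" "\<bar>y\<bar> \<le> Y" "int (length xs) < Y"
  shows "J (app \<tau> e) va me 0 (\<lambda>va' me'. AP \<tau> i (xs @ [y]) va' me' \<and> fr \<tau> i va me va' me')"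
proof -
  let ?a = "ad \<tau> (Suc i) (length xs)"
  have a: "((va vnl * va vN1 + (va vi + 1)) * 8 + \<tau>) * str + kk = ?a"
    using assms by (simp add: AP_def ad_def add.commute)
  have "AP \<tau> i (xs @ [y]) (va(vnl := va vnl + 1)) (me(?a := y))"
    using assms(1,4) by (auto simp: AP_def nth_append ad_inj less_Suc_eq)
  moreover have "fr \<tau> i va me (va(vnl := va vnl + 1)) (me(?a := y))"
    by (auto simp: fr_def)
  moreover have "\<bar>va vnl + 1\<bar> \<le> Y" using assms by (simp add: AP_def)
  ultimately show ?thesis using assms(5-9) a
    by (intro wp_J) (simp add: app_def adE_def)
qed

text \<open>The contract between the level-by-level enumeration and the code that extends one entry;
  both \<open>chV_code\<close> and \<open>chR_code\<close> meet it.\<close>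

definition chspec :: "int \<Rightarrow> st \<Rightarrow> (nat \<Rightarrow> int \<Rightarrow> int list) \<Rightarrow> int \<Rightarrow> int \<Rightarrow> int \<Rightarrow> bool" where
  "chspec \<tau> CH ch ty k z \<longleftrightarrow> (\<forall>va me i xs e. i < n \<longrightarrow> AP \<tau> i xs va me \<longrightarrow> va vN1 = int n + 1 \<longrightarrow> va vi = int i \<longrightarrow>
     va ve = e \<longrightarrow> va vg = gg x n i \<longrightarrow> va vc = tp ty i \<longrightarrow> va vk = k \<longrightarrow> va vz = z \<longrightarrow>
     (\<forall>y\<in>set (ch i e). \<bar>y\<bar> \<le> Y) \<longrightarrow> int (length xs + length (ch i e)) \<le> Y \<longrightarrow>
     J CH va me 0 (\<lambda>va' me'. AP \<tau> i (xs @ ch i e) va' me' \<and> fr \<tau> i va me va' me'))"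

lemma J_app_then:
  assumes "AP \<tau> i xs va me" "va vN1 = int n + 1" "va vi = int i" "i < n" "\<bar>\<tau>\<bar> \<le> 64"
    "okI e va me" "deg e \<le> 15" "evv e va me = y" "\<bar>y\<bar> \<le> Y" "int (length xs) < Y"
    "\<And>va' me'. AP \<tau> i (xs @ [y]) va' me' \<Longrightarrow> fr \<tau> i va me va' me' \<Longrightarrow> J c va' me' 0 P"
  shows "J (app \<tau> e ;; c) va me 0 P"
  by (rule J_Sq'[OF J_conseq[OF J_app[OF assms(1-10)]]]) (use assms(11) in auto)

lemma chspec_R: "\<bar>\<tau>\<bar> \<le> 64 \<Longrightarrow> chspec \<tau> (chR_code \<tau>) (chR x n ty) ty k z"
  unfolding chspec_def
proof (intro allI impI)
  fix va me i xs e
  assume t: "\<bar>\<tau>\<bar> \<le> 64" and h: "i < n" "AP \<tau> i xs va me" "va vN1 = int n + 1" "va vi = int i" "va ve = e"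
    "va vg = gg x n i" "va vc = tp ty i" "\<forall>y\<in>set (chR x n ty i e). \<bar>y\<bar> \<le> Y"
    "int (length xs + length (chR x n ty i e)) \<le> Y"
  let ?P = "\<lambda>va' me'. AP \<tau> i (xs @ chR x n ty i e) va' me' \<and> fr \<tau> i va me va' me'"
  show "J (chR_code \<tau>) va me 0 ?P"
    unfolding chR_code_def
  proof (rule J_Ite)
    assume "evv (V vc [<] N 2) va me \<noteq> 0"
    then have l: "chR x n ty i e = [e]" using h by (simp add: chR_def split: if_splits)
    show "J (app \<tau> (V ve)) va me 0 ?P"
      unfolding l by (rule J_app) (use h l t in auto)
  next
    assume "evv (V vc [<] N 2) va me = 0"
    then have l: "chR x n ty i e = [e, e + gg x n i]" using h by (simp add: chR_def split: if_splits)
    show "J (app \<tau> (V ve) ;; app \<tau> (V ve [+] V vg)) va me 0 ?P"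
    proof (rule J_app_then[OF h(2-4) h(1) t])
      fix va' me' assume a: "AP \<tau> i (xs @ [e]) va' me'" "fr \<tau> i va me va' me'"
      have v: "va' vN1 = int n + 1" "va' vi = int i" "va' ve = e" "va' vg = gg x n i"
        using a(2) h by (auto simp: fr_def)
      show "J (app \<tau> (V ve [+] V vg)) va' me' 0 ?P"
        by (rule J_conseq[OF J_app[OF a(1) v(1,2) h(1) t, of _ "e + gg x n i"]])
          (use h l v fr_trans[OF a(2)] in auto)
    qed (use h l in auto)
  qed auto
qed

lemma chspec_V: "\<bar>\<tau>\<bar> \<le> 64 \<Longrightarrow> \<bar>cls\<bar> \<le> 64 \<Longrightarrow> chspec \<tau> (chV_code \<tau> cls) (chV x n ty k z cls) ty k z"
  unfolding chspec_def
proof (intro allI impI)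
  fix va me i xs e
  assume t: "\<bar>\<tau>\<bar> \<le> 64" "\<bar>cls\<bar> \<le> 64" and h: "i < n" "AP \<tau> i xs va me" "va vN1 = int n + 1" "va vi = int i" "va ve = e"
    "va vg = gg x n i" "va vc = tp ty i" "va vk = k" "va vz = z"
    "\<forall>y\<in>set (chV x n ty k z cls i e). \<bar>y\<bar> \<le> Y"
    "int (length xs + length (chV x n ty k z cls i e)) \<le> Y"
  let ?P = "\<lambda>va' me'. AP \<tau> i (xs @ chV x n ty k z cls i e) va' me' \<and> fr \<tau> i va me va' me'"
  show "J (chV_code \<tau> cls) va me 0 ?P"
    unfolding chV_code_def
  proof (rule J_Ite)
    assume "evv (V vc [-] N cls) va me \<noteq> 0"
    then have l: "chV x n ty k z cls i e = [e]" using h by (simp add: chV_def split: if_splits)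
    show "J (app \<tau> (V ve)) va me 0 ?P"
      unfolding l by (rule J_app) (use h l t in auto)
  next
    assume c: "evv (V vc [-] N cls) va me = 0"
    define l1 where "l1 = (if k \<noteq> 0 then [e + gg x n i, e - gg x n i] else [])"
    define l2 where "l2 = (if e mod (int n + 1) < z then [e + 1] else [])"
    have l: "chV x n ty k z cls i e = l1 @ l2" using h c by (simp add: chV_def l1_def l2_def)
    let ?P1 = "\<lambda>va' me'. AP \<tau> i (xs @ l1) va' me' \<and> fr \<tau> i va me va' me'"
    have 1: "J (Ite (V vk) (app \<tau> (V ve [+] V vg) ;; app \<tau> (V ve [-] V vg)) Skip) va me 0 ?P1"
    proof (rule J_Ite)
      assume "evv (V vk) va me \<noteq> 0"
      then have l1: "l1 = [e + gg x n i, e - gg x n i]" using h by (simp add: l1_def)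
      show "J (app \<tau> (V ve [+] V vg) ;; app \<tau> (V ve [-] V vg)) va me 0 ?P1"
      proof (rule J_app_then[OF h(2-4) h(1) t(1)])
        fix va' me' assume a: "AP \<tau> i (xs @ [e + gg x n i]) va' me'" "fr \<tau> i va me va' me'"
        have v: "va' vN1 = int n + 1" "va' vi = int i" "va' ve = e" "va' vg = gg x n i"
          using a(2) h by (auto simp: fr_def)
        show "J (app \<tau> (V ve [-] V vg)) va' me' 0 ?P1"
          by (rule J_conseq[OF J_app[OF a(1) v(1,2) h(1) t(1), of _ "e - gg x n i"]])
            (use h l l1 v fr_trans[OF a(2)] in auto)
      qed (use h l l1 in auto)
    next
      assume "evv (V vk) va me = 0"
      then have l1: "l1 = []" using h by (simp add: l1_def)
      show "J Skip va me 0 ?P1" by (rule J_Skip) (use h l1 in \<open>auto simp: fr_def\<close>)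
    qed auto
    have 2: "J (Ite (V ve [mod] V vN1 [<] V vz) (app \<tau> (V ve [+] N 1)) Skip) va' me' 0 ?P"
      if p: "AP \<tau> i (xs @ l1) va' me'" "fr \<tau> i va me va' me'" for va' me'
    proof (rule J_Ite)
      have v: "va' vN1 = int n + 1" "va' vi = int i" "va' ve = e" "va' vz = z"
        using p(2) h by (auto simp: fr_def)
      {
        assume "evv (V ve [mod] V vN1 [<] V vz) va' me' \<noteq> 0"
        then have l2: "l2 = [e + 1]" using v by (simp add: l2_def split: if_splits)
        show "J (app \<tau> (V ve [+] N 1)) va' me' 0 ?P"
          by (rule J_conseq[OF J_app[OF p(1) v(1,2) h(1) t(1), of _ "e + 1"]])
            (use h l l2 v fr_trans[OF p(2)] in auto)
      next
        assume "evv (V ve [mod] V vN1 [<] V vz) va' me' = 0"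
        then have l2: "l2 = []" using v by (simp add: l2_def split: if_splits)
        show "J Skip va' me' 0 ?P" by (rule J_Skip) (use p l l2 in auto)
      }
    qed auto
    show "J (Ite (V vk) (app \<tau> (V ve [+] V vg) ;; app \<tau> (V ve [-] V vg)) Skip ;;
        Ite (V ve [mod] V vN1 [<] V vz) (app \<tau> (V ve [+] N 1)) Skip) va me 0 ?P"
      by (rule J_Sq'[OF J_conseq[OF 1]]) (use 2 in auto)
  qed (use t in auto)
qed

text \<open>Level 0 consists of the single entry 0, which a fresh memory already contains; hence the
  assumption \<open>me0\<close>. The budget has one unit per level and one for each entry of each
  level below \<open>n\<close>.\<close>

lemma build:
  assumes ch: "chspec \<tau> CH ch ty k z" and \<tau>: "\<bar>\<tau>\<bar> \<le> 64"
    and len: "\<And>i. i \<le> n \<Longrightarrow> int (length (lev ch i)) \<le> Y"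
    and bd: "\<And>i e. i \<le> n \<Longrightarrow> e \<in> set (lev ch i) \<Longrightarrow> \<bar>e\<bar> \<le> Y"
    and c: "ctx va me" and v: "va vty = ty" "\<bar>ty\<bar> \<le> Y" "va vk = k" "va vz = z"
    and me0: "me (ad \<tau> 0 0) = 0"
  shows "J (build \<tau> CH) va me (\<Sum>i<n. Suc (length (lev ch i))) (\<lambda>va' me'.
     va' vlen = int (length (lev ch n)) \<and> (\<forall>j<length (lev ch n). me' (ad \<tau> n j) = lev ch n ! j) \<and>
     (\<forall>v. v \<notin> {vlen, vi, vpw, vtt, vg, vc, vnl, vj, ve} \<longrightarrow> va' v = va v) \<and>
     (\<forall>a. a \<notin> TG \<tau> \<longrightarrow> me' a = me a))"
proof -
  let ?BV = "{vlen, vi, vpw, vtt, vg, vc, vnl, vj, ve}"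
  define F where "F va' me' \<longleftrightarrow> (\<forall>v. v \<notin> ?BV \<longrightarrow> va' v = va v) \<and> (\<forall>a. a \<notin> TG \<tau> \<longrightarrow> me' a = me a)" for va' me'
  define Inv where "Inv i va' me' \<longleftrightarrow> va' vi = int i \<and> va' vlen = int (length (lev ch i)) \<and> va' vpw = 3 ^ i \<and>
     va' vtt = ty div 4 ^ i \<and> (\<forall>j<length (lev ch i). me' (ad \<tau> i j) = lev ch i ! j) \<and> F va' me'" for i va' me'
  have YA: "2 * A \<le> Y" "3 ^ n \<le> Y" "int n + 1 \<le> Y" using A1 A64 p34(1) by linarith+
  have tyb: "\<bar>ty div b\<bar> \<le> Y" for b using abs_div_le[of ty b] v(2) by linarith
  have body: "J (build_body \<tau> CH) va1 me1 (length (lev ch i)) (Inv (Suc i))"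
    if i: "i < n" and inv: "Inv i va1 me1" for i va1 me1
  proof -
    let ?L = "lev ch i"
    have cs: "ctx va1 me1" "va1 vk = k" "va1 vz = z"
      using inv c v inp_TG by (auto simp: Inv_def F_def ctx_def)
    define Inv2 where "Inv2 j va' me' \<longleftrightarrow> va' vj = int j \<and> AP \<tau> i (concat (map (ch i) (take j ?L))) va' me' \<and>
      (\<forall>p<length ?L. me' (ad \<tau> i p) = ?L ! p) \<and> va' vc = tp ty i \<and> va' vg = gg x n i \<and>
      (\<forall>v\<in>{vi, vlen, vpw, vtt}. va' v = va1 v) \<and> F va' me'" for j va' me'
    have sub: "length (concat (map (ch i) (take j ?L))) + (if j < length ?L then length (ch i (?L ! j)) else 0)
        \<le> length (lev ch (Suc i))" for j
    proof -
      have "?L = take j ?L @ drop j ?L" by simp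
      then have "lev ch (Suc i) = concat (map (ch i) (take j ?L)) @ concat (map (ch i) (drop j ?L))"
        by (metis concat_append lev.simps(2) map_append)
      moreover have "length (ch i (?L ! j)) \<le> length (concat (map (ch i) (drop j ?L)))" if "j < length ?L"
        by (subst Cons_nth_drop_Suc[OF that, symmetric]) simp
      ultimately show ?thesis by auto
    qed
    have 1: "J (Asg vg ((Inp (V vi) [*] V vG [+] V vpw) [*] V vN1) ;; Asg vc (V vtt [mod] N 4) ;;
      Asg vnl (N 0) ;; Asg vj (N 0)) va1 me1 0 (Inv2 0)"
      using inv cs i wv_bound[OF i] YA abs_mod_less[of 4 "ty div 4 ^ i"] Y64
      by (intro wp_J) (auto simp: Inv_def Inv2_def ctx_def gg_def tp_def AP_def F_def)
    have 2: "J (Whl (V vlen [-] V vj) (build_inner \<tau> CH)) va2 me2 (\<Sum>j<length ?L. Suc 0) (Inv2 (length ?L))"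
      if "Inv2 0 va2 me2" for va2 me2
    proof (rule J_Whl[where Inv = Inv2 and f = "\<lambda>_. 0"])
      show "Inv2 0 va2 me2" by (rule that)
    next
      fix j va' me' assume j: "j < length ?L" and b: "bnd va' me'" and I: "Inv2 j va' me'"
      have vl: "va' vlen = int (length ?L)" "va' vi = int i" using I inv by (auto simp: Inv2_def Inv_def)
      have vs: "va' vN1 = int n + 1" "va' vk = k" "va' vz = z"
        using I c v by (auto simp: Inv2_def F_def ctx_def)
      have a: "((va' vj * va' vN1 + va' vi) * 8 + \<tau>) * str + kk = ad \<tau> i j"
        using I vl vs by (simp add: Inv2_def ad_def)
      let ?xs = "concat (map (ch i) (take j ?L))" and ?va = "va'(ve := ?L ! j)"
      have A: "AP \<tau> i ?xs ?va me'" using I by (auto simp: Inv2_def AP_def)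
      have Lb: "\<bar>?L ! j\<bar> \<le> Y" using bd[of i] j i by simp
      have chb: "\<forall>y\<in>set (ch i (?L ! j)). \<bar>y\<bar> \<le> Y"
        using bd[of "Suc i"] i j by (auto 4 4 intro: nth_mem)
      have lb: "int (length ?xs + length (ch i (?L ! j))) \<le> Y"
        using sub[of j] j len[of "Suc i"] i by simp
      have s1: "J CH ?va me' 0 (\<lambda>va' me''. AP \<tau> i (?xs @ ch i (?L ! j)) va' me'' \<and> fr \<tau> i ?va me' va' me'')"
        by (rule ch[unfolded chspec_def, rule_format]) (use i A vl vs I chb lb in \<open>auto simp: Inv2_def\<close>)
      have t: "take (Suc j) ?L = take j ?L @ [?L ! j]" using j by (simp add: take_Suc_conv_app_nth)
      have s2: "J (Asg vj (V vj [+] N 1)) va3 me3 0 (Inv2 (Suc j))"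
        if h: "AP \<tau> i (?xs @ ch i (?L ! j)) va3 me3" "fr \<tau> i ?va me' va3 me3" for va3 me3
      proof -
        have v3: "va3 v = ?va v" if "v \<noteq> vnl" for v using h(2) that by (simp add: fr_def)
        have m3: "me3 a = me' a" if "a \<notin> TG \<tau>" for a
        proof -
          have "a \<notin> range (ad \<tau> (Suc i))" using that ad_TG by blast
          then show ?thesis using h(2) by (simp add: fr_def)
        qed
        have m4: "me3 (ad \<tau> i p) = me' (ad \<tau> i p)" for p
        proof -
          have "ad \<tau> i p \<notin> range (ad \<tau> (Suc i))" using i ad_inj[of i "Suc i" \<tau> p] by auto
          then show ?thesis using h(2) by (simp add: fr_def)
        qed
        have jY: "int j + 1 \<le> Y" using j len[of i] i by simp
        have "Inv2 (Suc j) (va3(vj := int j + 1)) me3"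
          using I h(1) v3 m3 m4 unfolding Inv2_def t by (auto simp: F_def AP_def)
        moreover have "va3 vj = int j" using v3[of vj] I by (simp add: Inv2_def)
        ultimately show ?thesis using jY by (intro wp_J) (auto)
      qed
      have "J (build_inner \<tau> CH) va' me' 0 (Inv2 (Suc j))"
        unfolding build_inner_def
      proof (rule J_Sq'[of _ _ _ 0])
        show "J (Asg ve (Ld (adE \<tau> (V vi) (V vj)))) va' me' 0
            (\<lambda>va1 me1. J (CH ;; Asg vj (V vj [+] N 1)) va1 me1 0 (Inv2 (Suc j)))"
        proof (rule J_Asg)
          have m: "me' (ad \<tau> i j) = ?L ! j" using I j by (auto simp: Inv2_def)
          then show "\<bar>evv (Ld (adE \<tau> (V vi) (V vj))) va' me'\<bar> \<le> Y" using a Lb by (simp add: adE_def)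
          have e: "evv (Ld (adE \<tau> (V vi) (V vj))) va' me' = ?L ! j" using a m by (simp add: adE_def)
          show "J (CH ;; Asg vj (V vj [+] N 1)) (va'(ve := evv (Ld (adE \<tau> (V vi) (V vj))) va' me')) me' 0 (Inv2 (Suc j))"
            unfolding e by (rule J_Sq'[OF J_conseq[OF s1]]) (use s2 in auto)
        qed (use \<tau> in \<open>auto simp: adE_def\<close>)
      qed simp
      then show "evv (V vlen [-] V vj) va' me' \<noteq> 0 \<and> okI (V vlen [-] V vj) va' me' \<and>
          J (build_inner \<tau> CH) va' me' 0 (Inv2 (Suc j))"
        using vl I j by (simp add: Inv2_def)
    next
      fix va' me' assume "Inv2 (length ?L) va' me'"
      then show "evv (V vlen [-] V vj) va' me' = 0 \<and> okI (V vlen [-] V vj) va' me'"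
        using inv by (simp add: Inv2_def Inv_def)
    qed simp
    have 3: "J (Asg vlen (V vnl) ;; Asg vi (V vi [+] N 1) ;; Asg vpw (V vpw [*] N 3) ;; Asg vtt (V vtt [div] N 4)) va2 me2 0 (Inv (Suc i))"
      if I: "Inv2 (length ?L) va2 me2" for va2 me2
    proof -
      have e: "va2 vi = int i" "va2 vpw = 3 ^ i" "va2 vtt = ty div 4 ^ i" "va2 vnl = int (length (lev ch (Suc i)))"
        using I inv by (auto simp: Inv2_def Inv_def AP_def)
      have d: "ty div 4 ^ i div 4 = ty div 4 ^ Suc i"
        by (subst zdiv_zmult2_eq[symmetric]) (auto simp: mult.commute)
      have "(3::int) ^ Suc i \<le> Y" using p34(2)[of "Suc i"] i YA by simp
      moreover have "va1 vpw = 3 ^ i" using inv by (simp add: Inv_def)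
      ultimately have p: "\<bar>3 * va1 vpw\<bar> \<le> Y" by simp
      have "\<bar>int (length (lev ch (Suc i)))\<bar> \<le> Y" using len[of "Suc i"] i by simp
      moreover have "\<bar>int i + 1\<bar> \<le> Y" using i YA by simp
      ultimately show ?thesis
        using e d p tyb[of "4 ^ Suc i"] I
        by (intro wp_J) (auto simp: Inv_def Inv2_def F_def AP_def mult.commute simp del: lev.simps(2) power_Suc
             simp: power_Suc[symmetric] simp flip: power_Suc2; simp)
    qed
    show ?thesis
      unfolding build_body_def
      by (rule J_Sq'[OF J_conseq[OF 1], of 0]) (use 2 3 in \<open>auto intro!: J_Sq'[OF J_conseq[OF 2]]\<close>)
  qed
  have i0: "J (Asg vlen (N 1) ;; Asg vi (N 0) ;; Asg vpw (N 1) ;; Asg vtt (V vty)) va me 0 (Inv 0)"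
    using v Y64 me0 by (intro wp_J) (auto simp: Inv_def F_def)
  have w: "J (Whl (V vN [-] V vi) (build_body \<tau> CH)) va1 me1 (\<Sum>i<n. Suc (length (lev ch i))) (Inv n)"
    if "Inv 0 va1 me1" for va1 me1
    by (rule J_Whl[where Inv = Inv and f = "\<lambda>i. length (lev ch i)"]) (use that body c in \<open>auto simp: Inv_def F_def ctx_def\<close>)
  show ?thesis
    unfolding build_def
    by (rule J_conseq[OF J_Sq[OF J_conseq[OF i0 order_refl w]]]) (auto simp: Inv_def F_def)
qed

end

section \<open>Bucket table and join\<close>

definition wE :: "ex \<Rightarrow> ex" where "wE e = (e [+] V vp3) [div] V vG"
definition hE :: ex where "hE = (V val [*] V vw [mod] V vQ) [div] V vW"

text \<open>Array 3 holds the current size of each bucket, array 4 its contents, with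
  \<open>2 ^ n\<close> slots per bucket. Memory is addressed sparsely, so slots that stay empty cost
  no time.\<close>

definition fill_body :: st where
  "fill_body = (Asg vE (Ld (adE 2 (V vN) (V vj)) [div] V vN1) ;; Asg vw (wE (V vE)) ;; Asg vr hE ;;
     Asg vp (Ld (V vr [*] N 8 [+] N 3)) ;; Wr ((V vr [*] V vp2 [+] V vp) [*] N 8 [+] N 4) (V vE) ;;
     Wr (V vr [*] N 8 [+] N 3) (V vp [+] N 1) ;; Asg vj (V vj [+] N 1))"

definition fill :: st where
  "fill = (Asg vj (N 0) ;; Whl (V vlC [-] V vj) fill_body)"

text \<open>The loop index carries the entry in \<open>j div 2\<close> and a guess of the carry in
  \<open>j mod 2\<close>. Given both, the target \<open>t\<close> determines the bucket of the
  partner.\<close>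

definition join_head :: "int \<Rightarrow> st" where
  "join_head \<tau> = (Asg vE1 (Ld (adE \<tau> (V vN) (V vj [div] N 2)) [div] V vN1) ;; Asg vw (wE (V vE1)) ;;
     Asg vr ((V vt [-] (V vj [mod] N 2) [-] hE) [mod] V vM) ;; Asg vp (Ld (V vr [*] N 8 [+] N 3)))"

definition join_pair :: st where
  "join_pair = (Asg vp (V vp [-] N 1) ;; Asg vE (V vE1 [+] Ld ((V vr [*] V vp2 [+] V vp) [*] N 8 [+] N 4)) ;;
     Asg vw (wE (V vE)))"

definition join :: "int \<Rightarrow> nat \<Rightarrow> st \<Rightarrow> st" where
  "join \<tau> lv BODY = (Asg vj (N 0) ;; Whl (N 2 [*] V lv [-] V vj)
     (join_head \<tau> ;; Whl (V vp) (join_pair ;; BODY) ;; Asg vj (V vj [+] N 1)))"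

text \<open>Recovers the weight by rounding: the ternary part is less than \<open>3 ^ n / 2\<close>
  in absolute value, so after adding \<open>3 ^ n\<close> it lies strictly between 0 and
  \<open>2 * 3 ^ n\<close>.\<close>

definition wv :: "nat \<Rightarrow> int \<Rightarrow> int" where "wv n E = (E + 3 ^ n) div (2 * 3 ^ n)"
text \<open>The leading part of \<open>\<alpha> * w mod Q\<close>: the residues are cut into blocks
  of width \<open>W\<close>. It is additive up to a carry, see \<open>hh_add\<close>, and separates
  nearby values, see \<open>hh_collision_count\<close>.\<close>

definition hh :: "int \<Rightarrow> int \<Rightarrow> int \<Rightarrow> int \<Rightarrow> int" where "hh \<alpha> Q W w = (\<alpha> * w mod Q) div W"

context jlog begin

lemma wp_AsgI:
  "okI e va me \<Longrightarrow> deg e \<le> 15 \<Longrightarrow> evv e va me = y \<Longrightarrow> \<bar>y\<bar> \<le> Y \<Longrightarrow> P (va(v := y)) me \<Longrightarrow> wp (Asg v e) P va me"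
  by simp

lemma wp_WrI:
  "okI a va me \<Longrightarrow> deg a \<le> 15 \<Longrightarrow> evv a va me * str + kk = d \<Longrightarrow> okI e va me \<Longrightarrow> deg e \<le> 15 \<Longrightarrow>
    evv e va me = y \<Longrightarrow> \<bar>y\<bar> \<le> Y \<Longrightarrow> P va (me(d := y)) \<Longrightarrow> wp (Wr a e) P va me"
  by simp

end

context core begin

definition ad3 :: "int \<Rightarrow> int" where "ad3 r = (r * 8 + 3) * str + kk"
definition ad4 :: "int \<Rightarrow> nat \<Rightarrow> int" where "ad4 r p = ((r * 2 ^ n + int p) * 8 + 4) * str + kk"
definition ad5 :: "int \<Rightarrow> int" where "ad5 w = (w * 8 + 5) * str + kk"

lemma ad3_TG: "ad3 r \<in> TG 3" unfolding ad3_def TG_def by (rule CollectI, rule exI[of _ r]) (simp add: mult.commute)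
lemma ad4_TG: "ad4 r p \<in> TG 4" unfolding ad4_def TG_def by (rule CollectI, rule exI[of _ "r * 2 ^ n + int p"]) (simp add: mult.commute)
lemma ad5_TG: "ad5 w \<in> TG 5" unfolding ad5_def TG_def by (rule CollectI, rule exI[of _ w]) (simp add: mult.commute)

lemma ad3_inj: "ad3 r = ad3 r' \<longleftrightarrow> r = r'" unfolding ad3_def slot_inj by simp
lemma ad5_inj: "ad5 r = ad5 r' \<longleftrightarrow> r = r'" unfolding ad5_def slot_inj by simp

lemma ad4_inj: "p < 2 ^ n \<Longrightarrow> p' < 2 ^ n \<Longrightarrow> ad4 r p = ad4 r' p' \<longleftrightarrow> r = r' \<and> p = p'"
proof -
  assume p: "p < 2 ^ n" "p' < 2 ^ n"
  then have p: "int p < 2 ^ n" "int p' < 2 ^ n" by simp_all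
  have "r = r' \<and> int p = int p'" if "r * 2 ^ n + int p = r' * 2 ^ n + int p'"
  proof -
    have "(r * 2 ^ n + int p) div 2 ^ n = r" "(r' * 2 ^ n + int p') div 2 ^ n = r'"
      using p by (simp_all add: div_pos_pos_trivial)
    with that have "r = r'" by metis
    with that show ?thesis by simp
  qed
  then show ?thesis unfolding ad4_def slot_inj by auto
qed

lemma ad34: "ad3 r \<noteq> ad4 r' p" "ad4 r' p \<noteq> ad3 r"
  using TG_disj[of 3 4 "ad3 r"] ad3_TG[of r] ad4_TG[of r' p] by auto

definition hpar :: "int \<Rightarrow> int \<Rightarrow> int \<Rightarrow> (nat \<Rightarrow> int) \<Rightarrow> bool" where
  "hpar \<alpha> W M va \<longleftrightarrow> va val = \<alpha> \<and> va vW = W \<and> va vM = M \<and> 0 < W \<and> 0 < M \<and> M \<le> Y"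

abbreviation "Q \<equiv> S * 2 ^ n"
abbreviation "h \<alpha> W E \<equiv> hh \<alpha> Q W (wv n E)"
definition bk :: "int \<Rightarrow> int \<Rightarrow> int list \<Rightarrow> int \<Rightarrow> int list" where
  "bk \<alpha> W Cs r = filter (\<lambda>E. h \<alpha> W E = r) Cs"

lemma QY: "0 < Q" "Q \<le> Y"
proof -
  show "0 < Q" using S1 by simp
  have "S * 2 ^ n \<le> A * ((int n + 1) * 2 ^ n)"
  proof (rule mult_mono)
    have "1 * 2 ^ n \<le> (int n + 1) * 2 ^ n" by (rule mult_right_mono) auto
    then show "2 ^ n \<le> (int n + 1) * 2 ^ n" by simp
  qed (use A1 S1 in auto)
  also have "A * ((int n + 1) * 2 ^ n) \<le> A * ((int n + 1) * 2 ^ n) * (2 ^ n * 64)"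
  proof -
    have "1 * 1 \<le> (2::int) ^ n * 64" by (rule mult_mono) auto
    moreover have "0 \<le> A * ((int n + 1) * 2 ^ n)" using A1 by simp
    ultimately show ?thesis by (simp only: mult_le_cancel_left1 mult_1_right) simp
  qed
  also have "\<dots> = A * ((int n + 1) * 2 ^ n * 2 ^ n) * 64" by (simp only: mult_ac)
  also note A_le
  finally show "Q \<le> Y" .
qed

lemma h_range: "0 < W \<Longrightarrow> 0 \<le> h \<alpha> W E \<and> h \<alpha> W E \<le> Y"
proof -
  assume W: "0 < W"
  have 1: "0 \<le> \<alpha> * wv n E mod Q" "\<alpha> * wv n E mod Q < Q" using QY by auto
  have "\<bar>h \<alpha> W E\<bar> \<le> \<bar>\<alpha> * wv n E mod Q\<bar>" unfolding hh_def by (rule abs_div_le)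
  moreover have "0 \<le> h \<alpha> W E" unfolding hh_def using 1 W by (simp add: pos_imp_zdiv_nonneg_iff)
  ultimately show ?thesis using 1 QY by linarith
qed

lemma wv_Y: "\<bar>E\<bar> \<le> 6 * A \<Longrightarrow> \<bar>wv n E\<bar> \<le> Y"
  unfolding wv_def using abs_div_le[of "E + 3 ^ n" "2 * 3 ^ n"] abs_triangle_ineq[of E "3 ^ n"]
    p34(1) A1(1,3) A64 power_abs[of "3::int" n] by simp

definition bkinv :: "int \<Rightarrow> int \<Rightarrow> int list \<Rightarrow> (int \<Rightarrow> int) \<Rightarrow> bool" where
  "bkinv \<alpha> W Cs me \<longleftrightarrow> (\<forall>r\<ge>0. me (ad3 r) = int (length (bk \<alpha> W Cs r)) \<and>
     (\<forall>p<length (bk \<alpha> W Cs r). me (ad4 r p) = bk \<alpha> W Cs r ! p))"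

lemma fill:
  fixes L :: "int list"
  defines "Cs \<equiv> map (\<lambda>e. e div (int n + 1)) L"
  assumes len: "length L \<le> 2 ^ n" and bd: "\<And>e. e \<in> set L \<Longrightarrow> \<bar>e\<bar> \<le> 3 * A"
    and c: "ctx va me" and hp: "hpar \<alpha> W M va" and lC: "va vlC = int (length L)"
    and L: "\<forall>j<length L. me (ad 2 n j) = L ! j"
    and zero: "\<And>r. me (ad3 r) = 0"
  shows "J fill va me (length L) (\<lambda>va' me'. bkinv \<alpha> W Cs me' \<and>
     (\<forall>v. v \<notin> {vj, vE, vw, vr, vp} \<longrightarrow> va' v = va v) \<and> (\<forall>a. a \<notin> TG 3 \<union> TG 4 \<longrightarrow> me' a = me a))"
proof -
  define Inv where "Inv j va' me' \<longleftrightarrow> va' vj = int j \<and> bkinv \<alpha> W (take j Cs) me' \<and>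
     (\<forall>v. v \<notin> {vj, vE, vw, vr, vp} \<longrightarrow> va' v = va v) \<and> (\<forall>a. a \<notin> TG 3 \<union> TG 4 \<longrightarrow> me' a = me a)" for j va' me'
  have lY: "int (length L) \<le> 2 ^ n" "(2::int) ^ n \<le> Y - 1"
    using len p34(3) A1 A64 by (simp, linarith)
  have i0: "J (Asg vj (N 0)) va me 0 (Inv 0)"
    using Y64 zero by (intro wp_J) (auto simp: Inv_def bkinv_def bk_def)
  have step: "J fill_body va' me' 0 (Inv (Suc j))" if j: "j < length L" and I: "Inv j va' me'" for j va' me'
  proof -
    have v: "va' vN1 = int n + 1" "va' vN = int n" "va' vp3 = 3 ^ n" "va' vG = 2 * 3 ^ n" "va' vQ = Q" "va' val = \<alpha>" "va' vW = W"
        "va' vj = int j" "va' vp2 = 2 ^ n"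
      using I c hp by (auto simp: Inv_def ctx_def hpar_def)
    have W: "0 < W" using hp by (simp add: hpar_def)
    have nT: "ad 2 n j \<notin> TG 3 \<union> TG 4"
      using ad_TG[of 2 n j] TG_disj[of 2 3 "ad 2 n j"] TG_disj[of 2 4 "ad 2 n j"] by auto
    have m: "me' (((int j * (int n + 1) + int n) * 8 + 2) * str + kk) = L ! j"
      using L j I nT by (auto simp: Inv_def ad_def)
    define E where "E = L ! j div (int n + 1)"
    have Eb: "\<bar>E\<bar> \<le> 3 * A"
      using abs_div_le[of "L ! j" "int n + 1"] bd[of "L ! j"] j by (simp add: E_def)
    then have Ey: "\<bar>E\<bar> \<le> Y" "\<bar>wv n E\<bar> \<le> Y" using wv_Y[of E] A1 A64 by auto
    define r where "r = h \<alpha> W E"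
    have r: "0 \<le> r" "\<bar>r\<bar> \<le> Y" using h_range[OF W, of \<alpha> E] by (auto simp: r_def)
    define pp where "pp = length (bk \<alpha> W (take j Cs) r)"
    have pl: "pp \<le> j"
      using length_filter_le[of "\<lambda>E. h \<alpha> W E = r" "take j Cs"] j by (simp add: pp_def bk_def Cs_def)
    have pp: "me' ((r * 8 + 3) * str + kk) = int pp"
      using I r by (auto simp: Inv_def bkinv_def pp_def ad3_def)
    have ppY: "int pp + 1 \<le> Y" "int j + 1 \<le> Y" "pp < 2 ^ n" using pl j lY len by linarith+
    have t: "take (Suc j) Cs = take j Cs @ [E]"
      using j by (simp add: take_Suc_conv_app_nth Cs_def E_def)
    have bk': "bk \<alpha> W (take (Suc j) Cs) r' = bk \<alpha> W (take j Cs) r' @ (if r' = r then [E] else [])" for r'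
      unfolding t by (auto simp: bk_def r_def)
    have lb: "length (bk \<alpha> W (take j Cs) r') < 2 ^ n" for r'
      using length_filter_le[of "\<lambda>E. h \<alpha> W E = r'" "take j Cs"] j len by (simp add: bk_def Cs_def)
    let ?me = "me'(ad4 r pp := E, ad3 r := int pp + 1)"
    have "bkinv \<alpha> W (take (Suc j) Cs) ?me"
      unfolding bkinv_def bk'
    proof (intro allI impI conjI)
      fix r' :: int assume r': "0 \<le> r'"
      show "?me (ad3 r') = int (length (bk \<alpha> W (take j Cs) r' @ (if r' = r then [E] else [])))"
        using I r' ad34 by (auto simp: Inv_def bkinv_def ad3_inj pp_def)
      fix p assume p: "p < length (bk \<alpha> W (take j Cs) r' @ (if r' = r then [E] else []))"
      then have p2: "p < 2 ^ n" using lb[of r'] by (auto split: if_splits)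
      show "?me (ad4 r' p) = (bk \<alpha> W (take j Cs) r' @ (if r' = r then [E] else [])) ! p"
        using I r' p ad4_inj[OF p2 ppY(3)] ad34
        by (auto simp: Inv_def bkinv_def pp_def nth_append less_Suc_eq split: if_splits)
    qed
    moreover have "?me a = me' a" if "a \<notin> TG 3 \<union> TG 4" for a
      using that ad3_TG ad4_TG by auto
    ultimately have fin: "Inv (Suc j) (va'(vE := E, vw := wv n E, vr := r, vp := int pp, vj := int j + 1)) ?me"
      using I by (auto simp: Inv_def)
    have "wp fill_body (Inv (Suc j)) va' me'"
      unfolding fill_body_def wp.simps(4)
      apply (rule wp_AsgI[where y = E], simp add: adE_def v, simp add: adE_def, use m in \<open>simp add: adE_def v E_def\<close>, rule Ey)
      apply (rule wp_AsgI[where y = "wv n E"], simp add: wE_def, simp add: wE_def, simp add: wE_def v wv_def, rule Ey)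
      apply (rule wp_AsgI[where y = r], simp add: hE_def, simp add: hE_def, simp add: hE_def v hh_def r_def, rule r)
      apply (rule wp_AsgI[where y = "int pp"], simp, simp, use pp in simp, use ppY in simp)
      apply (rule wp_WrI[where d = "ad4 r pp" and y = E], simp, simp, simp add: v ad4_def, simp, simp, simp, rule Ey)
      apply (rule wp_WrI[where d = "ad3 r" and y = "int pp + 1"], simp, simp, simp add: ad3_def, simp, simp, simp, use ppY in simp)
      apply (rule wp_AsgI[where y = "int j + 1"], simp, simp, simp add: v, use ppY in simp)
      using fin by simp
    then show ?thesis by (rule wp_J)
  qed
  have w: "J (Whl (V vlC [-] V vj) fill_body) va1 me1 (\<Sum>j<length L. Suc 0) (Inv (length L))" if "Inv 0 va1 me1" for va1 me1
    by (rule J_Whl[where Inv = Inv and f = "\<lambda>_. 0"]) (use that step lC in \<open>auto simp: Inv_def\<close>)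
  show ?thesis
    unfolding fill_def
    by (rule J_conseq[OF J_Sq[OF J_conseq[OF i0 order_refl w]]]) (auto simp: Inv_def Cs_def)
qed

definition rr :: "int \<Rightarrow> int \<Rightarrow> int \<Rightarrow> int \<Rightarrow> int list \<Rightarrow> nat \<Rightarrow> int" where
  "rr \<alpha> W M t Ls i = (t - int (i mod 2) - h \<alpha> W (Ls ! (i div 2))) mod M"

text \<open>Both carries are tried, so some of these sums miss the target residue. This is harmless,
  because collisions are judged by exact weights.\<close>

definition Gen :: "int \<Rightarrow> int \<Rightarrow> int \<Rightarrow> int \<Rightarrow> int list \<Rightarrow> int list \<Rightarrow> nat \<Rightarrow> int set" where
  "Gen \<alpha> W M t Cs Ls j = (\<Union>i<j. (\<lambda>C. Ls ! (i div 2) + C) ` set (bk \<alpha> W Cs (rr \<alpha> W M t Ls i)))"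

text \<open>Applied to both lists, first to enter sums into the table of weights and then to look
  them up. Hence the body is abstract: \<open>I P\<close> is its invariant after the sums in
  \<open>P\<close> have been processed, and by \<open>dep\<close> it depends only on
  \<open>vcand\<close> and the cells of array 5.\<close>

lemma join:
  fixes L :: "int list" and I :: "int set \<Rightarrow> (nat \<Rightarrow> int) \<Rightarrow> (int \<Rightarrow> int) \<Rightarrow> bool"
  defines "Ls \<equiv> map (\<lambda>e. e div (int n + 1)) L"
  assumes len: "length Cs \<le> 2 ^ n" and bd: "\<And>e. e \<in> set L \<Longrightarrow> \<bar>e\<bar> \<le> 3 * A" "\<And>E. E \<in> set Cs \<Longrightarrow> \<bar>E\<bar> \<le> 3 * A"
    and lY: "2 * int (length L) < Y"
    and c: "ctx va me" and hp: "hpar \<alpha> W M va" and lv: "va lv = int (length L)" "lv \<notin> {vj, vE1, vE, vw, vr, vp, vcand, vd}"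
    and t: "va vt = t" "\<bar>t\<bar> \<le> Y"
    and \<tau>: "\<tau> \<in> {0, 1}"
    and L: "\<forall>j<length L. me (ad \<tau> n j) = L ! j"
    and bk: "bkinv \<alpha> W Cs me"
    and I0: "I {} va me"
    and body: "\<And>P va me E. I P va me \<Longrightarrow> E \<in> {e + C | e C. e \<in> set Ls \<and> C \<in> set Cs} \<Longrightarrow> \<bar>E\<bar> \<le> 6 * A \<Longrightarrow> va vE = E \<Longrightarrow> va vw = wv n E \<Longrightarrow>
       J BODY va me 0 (\<lambda>va' me'. I (insert E P) va' me' \<and> (\<forall>v. v \<notin> {vcand, vd} \<longrightarrow> va' v = va v) \<and> (\<forall>a. a \<notin> TG 5 \<longrightarrow> me' a = me a))"
    and dep: "\<And>P va me va' me'. I P va me \<Longrightarrow> va' vcand = va vcand \<Longrightarrow> (\<And>a. a \<in> TG 5 \<Longrightarrow> me' a = me a) \<Longrightarrow> I P va' me'"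
  shows "J (join \<tau> lv BODY) va me (\<Sum>i<2 * length L. Suc (length (bk \<alpha> W Cs (rr \<alpha> W M t Ls i)))) (\<lambda>va' me'.
     I (Gen \<alpha> W M t Cs Ls (2 * length L)) va' me' \<and>
     (\<forall>v. v \<notin> {vj, vE1, vE, vw, vr, vp, vcand, vd} \<longrightarrow> va' v = va v) \<and> (\<forall>a. a \<notin> TG 5 \<longrightarrow> me' a = me a))"
proof -
  define F where "F va' me' \<longleftrightarrow> (\<forall>v. v \<notin> {vj, vE1, vE, vw, vr, vp, vcand, vd} \<longrightarrow> va' v = va v) \<and> (\<forall>a. a \<notin> TG 5 \<longrightarrow> me' a = me a)" for va' me'
  define Inv where "Inv j va' me' \<longleftrightarrow> va' vj = int j \<and> I (Gen \<alpha> W M t Cs Ls j) va' me' \<and> F va' me'" for j va' me'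
  have W: "0 < W" and M: "0 < M" "M \<le> Y" using hp by (auto simp: hpar_def)
  have n5: "ad \<tau> n j \<notin> TG 5" "ad3 r \<notin> TG 5" "ad4 r p \<notin> TG 5" for j r p
    using ad_TG[of \<tau> n j] ad3_TG[of r] ad4_TG[of r p] TG_disj[of \<tau> 5 "ad \<tau> n j"] TG_disj[of 3 5] TG_disj[of 4 5] \<tau> by auto
  have i0: "J (Asg vj (N 0)) va me 0 (Inv 0)"
    using Y64 dep[OF I0] by (intro wp_J) (auto simp: Inv_def F_def Gen_def)
  let ?body = "join_head \<tau> ;; Whl (V vp) (join_pair ;; BODY) ;; Asg vj (V vj [+] N 1)"
  let ?B = "\<lambda>i. bk \<alpha> W Cs (rr \<alpha> W M t Ls i)"
  have step: "J ?body va1 me1 (length (?B j)) (Inv (Suc j))" if j: "j < 2 * length L" and Ij: "Inv j va1 me1" for j va1 me1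
  proof -
    have fv: "va' vN1 = int n + 1" "va' vN = int n" "va' vp3 = 3 ^ n" "va' vG = 2 * 3 ^ n" "va' vQ = Q" "va' val = \<alpha>" "va' vW = W"
        "va' vp2 = 2 ^ n" "va' vt = t" "va' vM = M" if "F va' me'" for va' me'
      using that c hp t by (auto simp: F_def ctx_def hpar_def)
    have Fj: "F va1 me1" using Ij by (simp add: Inv_def)
    define j2 where "j2 = j div 2"
    have j2: "j2 < length L" using j by (simp add: j2_def less_mult_imp_div_less)
    have jj: "int j div 2 = int j2" by (simp add: j2_def zdiv_int)
    have jm: "int j mod 2 = int (j mod 2)" by (simp add: zmod_int)
    define E1 where "E1 = L ! j2 div (int n + 1)"
    have E1: "Ls ! (j div 2) = E1" "E1 \<in> set Ls" using j2 by (auto simp: Ls_def E1_def j2_def)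
    have m: "me1 (((int j2 * (int n + 1) + int n) * 8 + \<tau>) * str + kk) = L ! j2"
      using L j2 Fj n5(1)[of j2] by (auto simp: F_def ad_def)
    have Eb: "\<bar>E1\<bar> \<le> 3 * A"
      using abs_div_le[of "L ! j2" "int n + 1"] bd(1)[of "L ! j2"] j2 by (simp add: E1_def)
    then have Ey: "\<bar>E1\<bar> \<le> Y" "\<bar>wv n E1\<bar> \<le> Y" using wv_Y[of E1] A1 A64 by auto
    define r where "r = rr \<alpha> W M t Ls j"
    have r: "r = (t - int j mod 2 - h \<alpha> W E1) mod M" by (simp add: r_def rr_def E1 jm)
    have r0: "0 \<le> r" "\<bar>r\<bar> \<le> Y" using M pos_mod_bound[of M "t - int j mod 2 - h \<alpha> W E1"]
      pos_mod_sign[of M "t - int j mod 2 - h \<alpha> W E1"] unfolding r by linarith+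
    let ?b = "bk \<alpha> W Cs r"
    have lb: "length ?b \<le> 2 ^ n" unfolding bk_def using length_filter_le le_trans len by blast
    then have "int (length ?b) \<le> 2 ^ n" by simp
    then have lbY: "int (length ?b) \<le> Y" using p34(3) A1 A64 by linarith
    have m3: "me' (ad3 r) = int (length ?b)" if "F va' me'" for va' me'
      using that n5 bk r0 by (auto simp: F_def bkinv_def)
    have m4: "me' (ad4 r p) = ?b ! p" if "F va' me'" "p < length ?b" for va' me' p
      using that n5 bk r0 by (auto simp: F_def bkinv_def)
    \<comment> \<open>\<open>vp\<close> counts down, so a bucket is traversed from its end: after
      \<open>q\<close> steps its last \<open>q\<close> entries are done.\<close>
    define Inv2 where "Inv2 q va' me' \<longleftrightarrow> va' vp = int (length ?b - q) \<and> va' vj = int j \<and> va' vr = r \<and> va' vE1 = E1 \<and>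
       I (Gen \<alpha> W M t Cs Ls j \<union> (\<lambda>C. E1 + C) ` set (drop (length ?b - q) ?b)) va' me' \<and> F va' me'" for q va' me'
    have head: "J (join_head \<tau>) va1 me1 0 (Inv2 0)"
    proof -
      have i: "I (Gen \<alpha> W M t Cs Ls j) va' me1" if "va' vcand = va1 vcand" for va'
        using dep[of "Gen \<alpha> W M t Cs Ls j" va1 me1 va' me1] that Ij by (simp add: Inv_def)
      have F': "F (va1(vE1 := a, vw := b, vr := c, vp := d)) me1" for a b c d using Fj by (auto simp: F_def)
      have vj: "va1 vj = int j" using Ij by (simp add: Inv_def)
      note v = fv[OF Fj] vj
      have \<tau>s: "\<bar>\<tau>\<bar> \<le> 64" using \<tau> by auto
      have fin: "Inv2 0 (va1(vE1 := E1, vw := wv n E1, vr := r, vp := int (length ?b))) me1"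
        using i F' vj by (simp add: Inv2_def)
      have "wp (join_head \<tau>) (Inv2 0) va1 me1"
        unfolding join_head_def wp.simps(4)
        apply (rule wp_AsgI[where y = E1], simp add: adE_def \<tau>s, simp add: adE_def, use m in \<open>simp add: adE_def v jj E1_def\<close>, rule Ey)
        apply (rule wp_AsgI[where y = "wv n E1"], simp add: wE_def, simp add: wE_def, simp add: wE_def v wv_def, rule Ey)
        apply (rule wp_AsgI[where y = r], simp add: hE_def, simp add: hE_def, simp add: hE_def v hh_def r, rule r0)
        apply (rule wp_AsgI[where y = "int (length ?b)"], simp, simp, use m3[OF Fj, unfolded ad3_def] in simp, use lbY in simp)
        using fin by simp
      then show ?thesis by (rule wp_J)
    qed
    have pair: "J (join_pair ;; BODY) va2 me2 0 (Inv2 (Suc q))" if q: "q < length ?b" and I2: "Inv2 q va2 me2" for q va2 me2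
    proof -
      have F2: "F va2 me2" using I2 by (simp add: Inv2_def)
      define p where "p = length ?b - Suc q"
      have p: "p < length ?b" "length ?b - q = Suc p" using q by (auto simp: p_def)
      have C: "?b ! p \<in> set Cs" using nth_mem[OF p(1)] by (auto simp: bk_def)
      define E where "E = E1 + ?b ! p"
      have Eb2: "\<bar>E\<bar> \<le> 6 * A" using bd(2)[OF C] Eb by (simp add: E_def)
      have Ey: "\<bar>E\<bar> \<le> Y" "\<bar>wv n E\<bar> \<le> Y" using wv_Y[OF Eb2] Eb2 A1 A64 by auto
      let ?P = "Gen \<alpha> W M t Cs Ls j \<union> (\<lambda>C. E1 + C) ` set (drop (Suc p) ?b)"
      have vp: "va2 vp = 1 + int p" and rv: "va2 vr = r" "va2 vE1 = E1" using I2 p by (simp_all add: Inv2_def)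
      let ?va = "va2(vp := int p, vE := E, vw := wv n E)"
      have i: "I ?P ?va me2" using dep[of ?P va2 me2 ?va me2] I2 p by (simp add: Inv2_def)
      have 1: "J join_pair va2 me2 0 (\<lambda>va' me'. va' = ?va \<and> me' = me2)"
        unfolding join_pair_def
        apply (rule wp_J, unfold wp.simps(4))
        apply (rule wp_AsgI[where y = "int p"], simp, simp, simp add: vp, use lbY p in simp)
        apply (rule wp_AsgI[where y = E], simp, simp, use m4[OF F2 p(1), unfolded ad4_def] in \<open>simp add: fv[OF F2] rv E_def\<close>, rule Ey)
        apply (rule wp_AsgI[where y = "wv n E"], simp add: wE_def, simp add: wE_def, simp add: wE_def fv[OF F2] wv_def, rule Ey)
        by simp
      have d: "set (drop p ?b) = insert (?b ! p) (set (drop (Suc p) ?b))"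
        by (subst Cons_nth_drop_Suc[OF p(1), symmetric]) simp
      have 2: "J BODY ?va me2 0 (Inv2 (Suc q))"
      proof (rule J_conseq[OF body[OF i _ Eb2]])
        show "E \<in> {e + C |e C. e \<in> set Ls \<and> C \<in> set Cs}" using E1 C by (auto simp: E_def)
        fix va' me' assume b: "I (insert E ?P) va' me' \<and> (\<forall>v. v \<notin> {vcand, vd} \<longrightarrow> va' v = ?va v) \<and> (\<forall>a. a \<notin> TG 5 \<longrightarrow> me' a = me2 a)"
        have "insert E ?P = Gen \<alpha> W M t Cs Ls j \<union> (\<lambda>C. E1 + C) ` set (drop p ?b)"
          unfolding d by (auto simp: E_def)
        then show "Inv2 (Suc q) va' me'"
          using b I2 by (auto simp: Inv2_def F_def p_def)
      qed auto
      show ?thesis by (rule J_Sq'[OF J_conseq[OF 1]]) (use 2 in auto)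
    qed
    have w2: "J (Whl (V vp) (join_pair ;; BODY)) va2 me2 (\<Sum>q<length ?b. Suc 0) (Inv2 (length ?b))" if "Inv2 0 va2 me2" for va2 me2
      by (rule J_Whl[where Inv = Inv2 and f = "\<lambda>_. 0"]) (use that pair in \<open>auto simp: Inv2_def\<close>)
    have fin: "J (Asg vj (V vj [+] N 1)) va3 me3 0 (Inv (Suc j))" if I2: "Inv2 (length ?b) va3 me3" for va3 me3
    proof -
      have G: "Gen \<alpha> W M t Cs Ls (Suc j) = Gen \<alpha> W M t Cs Ls j \<union> (\<lambda>C. E1 + C) ` set ?b"
        unfolding Gen_def lessThan_Suc r_def E1(1)[symmetric] by auto
      have "I (Gen \<alpha> W M t Cs Ls (Suc j)) (va3(vj := int j + 1)) me3"
        using dep[of "Gen \<alpha> W M t Cs Ls (Suc j)" va3 me3 "va3(vj := int j + 1)" me3] I2 by (simp add: Inv2_def G)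
      then show ?thesis
        using I2 j lY by (intro wp_J) (auto simp: Inv_def Inv2_def F_def add.commute)
    qed
    show ?thesis
      by (rule J_Sq'[OF J_conseq[OF head order_refl J_Sq'[OF J_conseq[OF w2 order_refl fin]]]]) (auto simp: r_def)
  qed
  have w: "J (Whl (N 2 [*] V lv [-] V vj) ?body) va1 me1 (\<Sum>i<2 * length L. Suc (length (?B i))) (Inv (2 * length L))"
    if "Inv 0 va1 me1" for va1 me1
    by (rule J_Whl[where Inv = Inv and f = "\<lambda>i. length (?B i)"]) (use that step lv in \<open>auto simp: Inv_def F_def\<close>)
  show ?thesis
    unfolding join_def
    by (rule J_conseq[OF J_Sq[OF J_conseq[OF i0 order_refl w]]]) (auto simp: Inv_def F_def)
qed

end

section \<open>The enumerated vectors\<close>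

definition dig :: "(nat \<Rightarrow> int) \<Rightarrow> bool" where "dig d \<longleftrightarrow> (\<forall>l. d l \<in> {-1, 0, 1})"

definition ws :: "(nat \<Rightarrow> int) \<Rightarrow> nat \<Rightarrow> (nat \<Rightarrow> int) \<Rightarrow> int" where "ws x n d = (\<Sum>l<n. d l * x l)"
definition cd :: "nat \<Rightarrow> (nat \<Rightarrow> int) \<Rightarrow> int" where "cd n d = (\<Sum>l<n. d l * 3 ^ l)"
definition cv :: "(nat \<Rightarrow> int) \<Rightarrow> nat \<Rightarrow> (nat \<Rightarrow> int) \<Rightarrow> int" where "cv x n d = ws x n d * (2 * 3 ^ n) + cd n d"
definition pv :: "(nat \<Rightarrow> int) \<Rightarrow> nat \<Rightarrow> nat \<Rightarrow> (nat \<Rightarrow> int) \<Rightarrow> int" where "pv x n i d = (\<Sum>l<i. d l * gg x n l)"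
definition zc :: "int \<Rightarrow> int \<Rightarrow> nat \<Rightarrow> (nat \<Rightarrow> int) \<Rightarrow> int" where
  "zc ty cls i d = (\<Sum>l<i. if tp ty l = cls \<and> d l = 0 then 1 else 0)"

definition VD :: "int \<Rightarrow> int \<Rightarrow> int \<Rightarrow> (nat \<Rightarrow> int) set" where
  "VD ty k cls = {d. dig d \<and> (\<forall>l. tp ty l \<noteq> cls \<longrightarrow> d l = 0) \<and> (k = 0 \<longrightarrow> (\<forall>l. d l = 0))}"
definition RD :: "int \<Rightarrow> (nat \<Rightarrow> int) set" where
  "RD ty = {d. (\<forall>l. d l \<in> {0, 1}) \<and> (\<forall>l. tp ty l < 2 \<longrightarrow> d l = 0)}"

lemma zc_bounds: "0 \<le> zc ty cls i d" "zc ty cls i d \<le> int i"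
proof -
  show "0 \<le> zc ty cls i d" unfolding zc_def by (rule sum_nonneg) auto
  have "zc ty cls i d \<le> (\<Sum>l<i. 1)" unfolding zc_def by (rule sum_mono) auto
  then show "zc ty cls i d \<le> int i" by simp
qed

lemma zc_mono: "i \<le> j \<Longrightarrow> zc ty cls i d \<le> zc ty cls j d"
  unfolding zc_def by (rule sum_mono2) auto

lemma pv_dvd: "(int n + 1) dvd pv x n i d"
  unfolding pv_def gg_def by (rule dvd_sum) (simp add: mult.assoc[symmetric])

text \<open>All of \<open>pv\<close> is divisible by \<open>n + 1\<close>, while the number of zeros
  is at most \<open>i \<le> n\<close> and so equals its own residue.\<close>

lemma pv_mod: "i \<le> n \<Longrightarrow> (pv x n i d + zc ty cls i d) mod (int n + 1) = zc ty cls i d"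
proof -
  assume "i \<le> n"
  then have "0 \<le> zc ty cls i d" "zc ty cls i d < int n + 1" using zc_bounds[of ty cls i d] by linarith+
  then have "zc ty cls i d mod (int n + 1) = zc ty cls i d" by simp
  moreover from pv_dvd[of n x i d] obtain q where "pv x n i d = (int n + 1) * q" by (elim dvdE)
  ultimately show ?thesis by simp
qed

lemma pv_div: "(pv x n n d + zc ty cls n d) div (int n + 1) = cv x n d"
proof -
  have "pv x n n d = (int n + 1) * cv x n d"
    unfolding pv_def gg_def cv_def ws_def cd_def sum_distrib_left sum_distrib_right
    by (simp add: sum.distrib[symmetric] algebra_simps sum_distrib_left)
  moreover have "zc ty cls n d div (int n + 1) = 0" using zc_bounds[of ty cls n d] by (intro div_pos_pos_trivial) auto
  ultimately show ?thesis by simp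
qed

lemma pv_div0: "pv x n n d div (int n + 1) = cv x n d"
  \<comment> \<open>No coordinate has class -1, so the count of zeros is 0.\<close>
  using pv_div[of x n d 0 "-1"] by (simp add: zc_def tp_def)

lemma levV_elem:
  "e \<in> set (lev (chV x n ty k z cls) i) \<Longrightarrow> i \<le> n \<Longrightarrow> \<exists>d\<in>VD ty k cls. e = pv x n i d + zc ty cls i d"
proof (induction i arbitrary: e)
  case 0
  then show ?case by (intro bexI[of _ "\<lambda>_. 0"]) (auto simp: VD_def dig_def pv_def zc_def)
next
  case (Suc i)
  then obtain e0 where e0: "e0 \<in> set (lev (chV x n ty k z cls) i)" "e \<in> set (chV x n ty k z cls i e0)" by auto
  from Suc.IH[OF e0(1)] Suc.prems obtain d where d: "d \<in> VD ty k cls" "e0 = pv x n i d + zc ty cls i d" by auto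
  have u: "pv x n (Suc i) (d(i := a)) + zc ty cls (Suc i) (d(i := a))
      = e0 + a * gg x n i + (if tp ty i = cls \<and> a = 0 then 1 else 0)" for a
    unfolding pv_def zc_def d(2) by (simp add: pv_def zc_def)
  consider "tp ty i \<noteq> cls" "e = e0" | "tp ty i = cls" "k \<noteq> 0" "e = e0 + gg x n i"
    | "tp ty i = cls" "k \<noteq> 0" "e = e0 - gg x n i" | "tp ty i = cls" "e = e0 + 1"
    using e0(2) by (auto simp: chV_def split: if_splits)
  then show ?case
  proof cases
    case 1
    have "d(i := 0) \<in> VD ty k cls" using d 1 by (auto simp: VD_def dig_def)
    moreover have "e = pv x n (Suc i) (d(i := 0)) + zc ty cls (Suc i) (d(i := 0))" using u[of "0"] 1 by simp
    ultimately show ?thesis by blast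
  next
    case 2
    have "d(i := 1) \<in> VD ty k cls" using d 2 by (auto simp: VD_def dig_def)
    moreover have "e = pv x n (Suc i) (d(i := 1)) + zc ty cls (Suc i) (d(i := 1))" using u[of "1"] 2 by simp
    ultimately show ?thesis by blast
  next
    case 3
    have "d(i := -1) \<in> VD ty k cls" using d 3 by (auto simp: VD_def dig_def)
    moreover have "e = pv x n (Suc i) (d(i := -1)) + zc ty cls (Suc i) (d(i := -1))" using u[of "-1"] 3 by simp
    ultimately show ?thesis by blast
  next
    case 4
    have "d(i := 0) \<in> VD ty k cls" using d 4 by (auto simp: VD_def dig_def)
    moreover have "e = pv x n (Suc i) (d(i := 0)) + zc ty cls (Suc i) (d(i := 0))" using u[of "0"] 4 by simp
    ultimately show ?thesis by blast
  qed
qed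

text \<open>The number of zeros only grows along the levels, so a vector that ends with at most
  \<open>z\<close> of them is never cut off on the way.\<close>

lemma levV_mem:
  assumes "d \<in> VD ty k cls" "zc ty cls n d \<le> z"
  shows "i \<le> n \<Longrightarrow> pv x n i d + zc ty cls i d \<in> set (lev (chV x n ty k z cls) i)"
proof (induction i)
  case 0
  then show ?case by (simp add: pv_def zc_def)
next
  case (Suc i)
  let ?e = "pv x n i d + zc ty cls i d"
  have m: "?e mod (int n + 1) = zc ty cls i d" using Suc.prems by (intro pv_mod) simp
  have s: "zc ty cls (Suc i) d \<le> z" using zc_mono[OF Suc.prems] assms(2) order_trans by blast
  have s': "zc ty cls (Suc i) d = zc ty cls i d + (if tp ty i = cls \<and> d i = 0 then 1 else 0)"
    by (simp add: zc_def)
  have p: "pv x n (Suc i) d = pv x n i d + d i * gg x n i" by (simp add: pv_def)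
  have di: "d i \<in> {-1, 0, 1}" "tp ty i \<noteq> cls \<Longrightarrow> d i = 0" "k = 0 \<Longrightarrow> d i = 0"
    using assms(1) unfolding VD_def dig_def by blast+
  have "pv x n (Suc i) d + zc ty cls (Suc i) d \<in> set (chV x n ty k z cls i ?e)"
    using m s s' p di by (auto simp: chV_def)
  then show ?case using Suc by auto
qed

lemma levR_elem: "e \<in> set (lev (chR x n ty) i) \<Longrightarrow> \<exists>d\<in>RD ty. e = pv x n i d"
proof (induction i arbitrary: e)
  case 0
  then show ?case by (intro bexI[of _ "\<lambda>_. 0"]) (auto simp: RD_def pv_def)
next
  case (Suc i)
  then obtain e0 where e0: "e0 \<in> set (lev (chR x n ty) i)" "e \<in> set (chR x n ty i e0)" by auto
  from Suc.IH[OF e0(1)] obtain d where d: "d \<in> RD ty" "e0 = pv x n i d" by auto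
  have u: "pv x n (Suc i) (d(i := a)) = e0 + a * gg x n i" for a
    unfolding pv_def d(2) by (simp add: pv_def)
  consider "e = e0" | "\<not> tp ty i < 2" "e = e0 + gg x n i"
    using e0(2) by (auto simp: chR_def split: if_splits)
  then show ?case
  proof cases
    case 1
    have "d(i := 0) \<in> RD ty" using d 1 by (auto simp: RD_def)
    moreover have "e = pv x n (Suc i) (d(i := 0))" using u[of "0"] 1 by simp
    ultimately show ?thesis by blast
  next
    case 2
    have "d(i := 1) \<in> RD ty" using d 2 by (auto simp: RD_def)
    moreover have "e = pv x n (Suc i) (d(i := 1))" using u[of "1"] 2 by simp
    ultimately show ?thesis by blast
  qed
qed

lemma levR_mem: "d \<in> RD ty \<Longrightarrow> pv x n i d \<in> set (lev (chR x n ty) i)"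
proof (induction i)
  case (Suc i)
  have p: "pv x n (Suc i) d = pv x n i d + d i * gg x n i" by (simp add: pv_def)
  have "d i \<in> {0, 1}" "tp ty i < 2 \<Longrightarrow> d i = 0" using Suc.prems unfolding RD_def by blast+
  then have "pv x n (Suc i) d \<in> set (chR x n ty i (pv x n i d))" using p by (auto simp: chR_def)
  then show ?case using Suc by auto
qed (simp add: pv_def)

lemma lev_length: "(\<And>i e. length (ch i e) \<le> c) \<Longrightarrow> length (lev ch i) \<le> c ^ i"
proof (induction i)
  case (Suc i)
  have "sum_list (map (\<lambda>e. length (ch i e)) (lev ch i)) \<le> sum_list (map (\<lambda>e. c) (lev ch i))"
    by (rule sum_list_mono) (use Suc in auto)
  also have "\<dots> = c * length (lev ch i)" by (simp add: sum_list_triv)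
  also have "\<dots> \<le> c * c ^ i" using Suc by (intro mult_left_mono) auto
  finally show ?case by (simp add: length_concat comp_def)
qed simp

lemma levV_length: "length (lev (chV x n ty k z cls) i) \<le> 3 ^ i"
  by (rule lev_length) (auto simp: chV_def)

lemma levR_length: "length (lev (chR x n ty) i) \<le> 2 ^ i"
  by (rule lev_length) (auto simp: chR_def)

lemma levR_length_eq: "length (lev (chR x n ty) i) = 2 ^ card {l. l < i \<and> 2 \<le> tp ty l}"
proof (induction i)
  case (Suc i)
  have "{l. l < Suc i \<and> 2 \<le> tp ty l} = (if 2 \<le> tp ty i then insert i else id) {l. l < i \<and> 2 \<le> tp ty l}"
    using less_Suc_eq by auto
  moreover have "length (lev (chR x n ty) (Suc i)) = (if 2 \<le> tp ty i then 2 else 1) * length (lev (chR x n ty) i)"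
    by (auto simp: length_concat comp_def chR_def sum_list_triv)
  ultimately show ?case using Suc by auto
qed simp

lemma cv_add: "cv x n (\<lambda>l. d l + e l) = cv x n d + cv x n e"
  by (simp add: cv_def ws_def cd_def sum.distrib algebra_simps)

lemma ws_add: "ws x n (\<lambda>l. d l + e l) = ws x n d + ws x n e"
  by (simp add: ws_def sum.distrib algebra_simps)

lemma cd_diff: "cd n (\<lambda>l. d l - e l) = cd n d - cd n e"
  by (simp add: cd_def sum_subtractf algebra_simps)

lemma ws_diff: "ws x n (\<lambda>l. d l - e l) = ws x n d - ws x n e"
  by (simp add: ws_def sum_subtractf algebra_simps)

text \<open>The extreme case is \<open>2 * (1 + 3 + ... + 3 ^ (n - 1)) = 3 ^ n - 1\<close>.\<close>

lemma cd_bound: "(\<And>l. l < n \<Longrightarrow> \<bar>d l\<bar> \<le> 1) \<Longrightarrow> 2 * \<bar>cd n d\<bar> < 3 ^ n"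
proof (induction n)
  case (Suc n)
  have "\<bar>d n * 3 ^ n\<bar> \<le> 3 ^ n" using Suc.prems[of n] by (simp add: abs_mult)
  moreover have "2 * \<bar>cd n d\<bar> < 3 ^ n" using Suc by simp
  moreover have "cd (Suc n) d = cd n d + d n * 3 ^ n" by (simp add: cd_def)
  moreover have "\<bar>b\<bar> \<le> t \<Longrightarrow> 2 * \<bar>a\<bar> < t \<Longrightarrow> 2 * \<bar>a + b\<bar> < 3 * t" for a b t :: int by (auto simp: abs_if split: if_splits)
  ultimately show ?case by simp
qed (simp add: cd_def)

lemma wv_cv: "(\<And>l. l < n \<Longrightarrow> \<bar>d l\<bar> \<le> 1) \<Longrightarrow> wv n (cv x n d) = ws x n d"
proof -
  assume a: "\<And>l. l < n \<Longrightarrow> \<bar>d l\<bar> \<le> 1"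
  have "2 * \<bar>cd n d\<bar> < 3 ^ n" by (rule cd_bound) (rule a)
  then have "0 \<le> cd n d + 3 ^ n" "cd n d + 3 ^ n < 2 * 3 ^ n" by auto
  then have "(cd n d + 3 ^ n) div (2 * 3 ^ n) = 0" by (rule div_pos_pos_trivial)
  moreover have "(cd n d + 3 ^ n + ws x n d * (2 * 3 ^ n)) div (2 * 3 ^ n) = ws x n d + (cd n d + 3 ^ n) div (2 * 3 ^ n)"
    by (rule div_mult_self1) simp
  ultimately show ?thesis unfolding wv_def cv_def by (simp add: add_ac)
qed

lemma VD_abs: "d \<in> VD ty k cls \<Longrightarrow> \<bar>d l\<bar> \<le> 1"
  unfolding VD_def dig_def by (auto dest!: spec[of _ l])

lemma RD_abs: "d \<in> RD ty \<Longrightarrow> \<bar>d l\<bar> \<le> 1"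
  unfolding RD_def by (auto dest!: spec[of _ l])

definition CD :: "int \<Rightarrow> int \<Rightarrow> int \<Rightarrow> (nat \<Rightarrow> int) set" where
  "CD ty k cls = {\<lambda>l. d l + e l | d e. d \<in> VD ty k cls \<and> e \<in> RD ty}"

lemma CD_abs: "cls < 2 \<Longrightarrow> c \<in> CD ty k cls \<Longrightarrow> \<bar>c l\<bar> \<le> 1"
proof -
  assume c: "cls < 2" "c \<in> CD ty k cls"
  then obtain d e where *: "c l = d l + e l" "d \<in> VD ty k cls" "e \<in> RD ty" unfolding CD_def by auto
  then have "d l = 0 \<or> e l = 0" using c(1) unfolding VD_def RD_def by force
  then show ?thesis using * VD_abs[of d] RD_abs[of e] by auto
qed

text \<open>Outside \<open>R\<close> at most one of the two vectors is nonzero at a given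
  coordinate, and on \<open>R\<close> both entries are 0 or 1.\<close>

lemma CD_diff:
  assumes "c1 \<in> CD ty k 0" "c2 \<in> CD ty k 1"
  shows "dig (\<lambda>l. c1 l - c2 l)"
  unfolding dig_def
proof
  fix l
  from assms obtain d e d' e' where *: "c1 l = d l + e l" "d \<in> VD ty k 0" "e \<in> RD ty"
      "c2 l = d' l + e' l" "d' \<in> VD ty k 1" "e' \<in> RD ty" unfolding CD_def by auto
  have b: "\<bar>d l\<bar> \<le> 1" "\<bar>d' l\<bar> \<le> 1" "e l \<in> {0,1}" "e' l \<in> {0,1}"
    using * VD_abs by (auto simp: RD_def)
  consider "tp ty l = 0" | "tp ty l = 1" | "tp ty l \<ge> 2" | "tp ty l < 0" by linarith
  then show "c1 l - c2 l \<in> {-1, 0, 1}"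
  proof cases
    case 1
    then have "e l = 0" "e' l = 0" "d' l = 0" using * by (auto simp: VD_def RD_def)
    then show ?thesis using * b by auto
  next
    case 2
    then have "e l = 0" "e' l = 0" "d l = 0" using * by (auto simp: VD_def RD_def)
    then show ?thesis using * b by auto
  next
    case 3
    then have "d l = 0" "d' l = 0" using * by (auto simp: VD_def RD_def)
    then show ?thesis using * b by auto
  next
    case 4
    then show ?thesis by (simp add: tp_def)
  qed
qed

section \<open>The core algorithm\<close>

definition decode :: st where
  "decode = (Asg vz (V vom [mod] V vN1) ;; Asg vom (V vom [div] V vN1) ;;
     Asg vk (V vom [mod] V vN1) ;; Asg vom (V vom [div] V vN1) ;;
     Asg vt (V vom [mod] V vp2) ;; Asg vom (V vom [div] V vp2) ;;
     Asg vty (V vom [mod] V vp4) ;; Asg val (V vom [div] V vp4) ;;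
     Asg vcand (N 0) ;; Asg vM (N 1) ;; Asg vi (V vk))"

definition powM :: st where
  "powM = Whl (V vi) (Asg vM (V vM [*] N 2) ;; Asg vi (V vi [-] N 1))"

text \<open>A table indexed by weight. Storing the odd number \<open>2 * E + 1\<close> distinguishes
  an entry from an untouched cell, which contains 0.\<close>

definition body1 :: st where "body1 = Wr (V vw [*] N 8 [+] N 5) (N 2 [*] V vE [+] N 1)"
text \<open>The stored and the current vector have equal weight, so the difference of their entries
  is the ternary code of a solution unless they coincide.\<close>

definition body2 :: st where
  "body2 = (Asg vd (Ld (V vw [*] N 8 [+] N 5)) ;; Ite (V vd)
     (Asg vd ((V vd [-] N 1) [div] N 2 [-] V vE) ;; Ite (V vd) (Asg vcand (V vd)) Skip) Skip)"

definition core_prog :: st where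
  "core_prog = (decode ;; powM ;; Asg vW (V vQ [div] V vM) ;;
     (build 0 (chV_code 0 0) ;; Asg vlA (V vlen)) ;; (build 1 (chV_code 1 1) ;; Asg vlB (V vlen)) ;;
     (build 2 (chR_code 2) ;; Asg vlC (V vlen)) ;; fill ;; join 0 vlA body1 ;; join 1 vlB body2)"

lemma mixed_radix: "0 \<le> a \<Longrightarrow> a < b \<Longrightarrow> (a + b * q) mod b = a \<and> (a + b * q) div b = q" for a b q :: int
  by simp

context core begin

definition cells :: "int \<Rightarrow> int list \<Rightarrow> (int \<Rightarrow> int) \<Rightarrow> bool" where
  "cells \<tau> L me \<longleftrightarrow> (\<forall>j<length L. me (ad \<tau> n j) = L ! j)"

definition Z :: "int set \<Rightarrow> (int \<Rightarrow> int) \<Rightarrow> bool" where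
  "Z T me \<longleftrightarrow> (\<forall>\<tau>\<in>T. \<forall>a\<in>TG \<tau>. me a = 0)"

lemma cells_frame:
  "cells \<tau> L me \<Longrightarrow> (\<And>a. a \<notin> TG \<sigma> \<Longrightarrow> me' a = me a) \<Longrightarrow> \<tau> \<in> {0..<8} \<Longrightarrow> \<sigma> \<in> {0..<8} \<Longrightarrow> \<tau> \<noteq> \<sigma> \<Longrightarrow> cells \<tau> L me'"
  unfolding cells_def using TG_disj[of \<tau> \<sigma>] ad_TG[of \<tau> n] by auto

lemma Z_frame:
  "Z T me \<Longrightarrow> (\<And>a. a \<notin> TG \<sigma> \<Longrightarrow> me' a = me a) \<Longrightarrow> T \<subseteq> {0..<8} \<Longrightarrow> \<sigma> \<in> {0..<8} \<Longrightarrow> \<sigma> \<notin> T \<Longrightarrow> Z T me'"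
  unfolding Z_def
proof (intro ballI)
  fix \<tau> a assume h: "\<forall>\<tau>\<in>T. \<forall>a\<in>TG \<tau>. me a = 0" "\<And>a. a \<notin> TG \<sigma> \<Longrightarrow> me' a = me a" "T \<subseteq> {0..<8}" "\<sigma> \<in> {0..<8}" "\<sigma> \<notin> T" "\<tau> \<in> T" "a \<in> TG \<tau>"
  then have "\<tau> \<noteq> \<sigma>" "\<tau> \<in> {0..<8}" by auto
  then have "a \<notin> TG \<sigma>" using TG_disj[of \<tau> \<sigma> a] h by auto
  with h show "me' a = 0" by simp
qed

lemma Z_sub: "Z T me \<Longrightarrow> T' \<subseteq> T \<Longrightarrow> Z T' me" unfolding Z_def by blast

lemma ctx_frame: "ctx va me \<Longrightarrow> (\<And>v. v < 20 \<Longrightarrow> v \<noteq> vcand \<Longrightarrow> v \<noteq> vom \<Longrightarrow> va' v = va v) \<Longrightarrow> (\<And>a. a \<notin> TG \<sigma> \<Longrightarrow> me' a = me a) \<Longrightarrow> ctx va' me'"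
  unfolding ctx_def using inp_TG by auto

lemma ws_bound: "(\<And>l. l < n \<Longrightarrow> \<bar>d l\<bar> \<le> 1) \<Longrightarrow> \<bar>ws x n d\<bar> \<le> S - 1"
proof -
  assume d: "\<And>l. l < n \<Longrightarrow> \<bar>d l\<bar> \<le> 1"
  have "\<bar>ws x n d\<bar> \<le> (\<Sum>l<n. \<bar>d l * x l\<bar>)" unfolding ws_def by (rule sum_abs)
  also have "\<dots> \<le> (\<Sum>l<n. \<bar>x l\<bar>)"
    by (rule sum_mono) (use d in \<open>auto simp: abs_mult intro: mult_left_le_one_le\<close>)
  finally show ?thesis using S by simp
qed

lemma cv_bound: "(\<And>l. l < n \<Longrightarrow> \<bar>d l\<bar> \<le> 1) \<Longrightarrow> \<bar>cv x n d\<bar> * (int n + 1) \<le> 2 * A"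
proof -
  assume d: "\<And>l. l < n \<Longrightarrow> \<bar>d l\<bar> \<le> 1"
  have "\<bar>cv x n d\<bar> \<le> \<bar>ws x n d * (2 * 3 ^ n)\<bar> + \<bar>cd n d\<bar>" unfolding cv_def by (rule abs_triangle_ineq)
  also have "\<dots> = \<bar>ws x n d\<bar> * (2 * 3 ^ n) + \<bar>cd n d\<bar>" by (simp add: abs_mult)
  also have "\<dots> \<le> (S - 1) * (2 * 3 ^ n) + 3 ^ n"
    by (intro add_mono mult_right_mono) (use ws_bound d cd_bound[of n d] in auto)
  also have "\<dots> \<le> S * (2 * 3 ^ n)" by (simp add: algebra_simps)
  also have "\<dots> \<le> S * (2 * 4 ^ n)" using p34(1) S1 by (intro mult_left_mono) auto
  finally have "\<bar>cv x n d\<bar> * (int n + 1) \<le> S * (2 * 4 ^ n) * (int n + 1)" by (intro mult_right_mono) auto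
  then show ?thesis by (simp add: A_def mult_ac)
qed

lemma pv_cv: "pv x n n d = cv x n d * (int n + 1)"
  using pv_div0[of x n d] pv_dvd[of n x n d] by (metis dvd_div_mult_self)

lemma levV_bound: "e \<in> set (lev (chV x n ty k z cls) i) \<Longrightarrow> i \<le> n \<Longrightarrow> \<bar>e\<bar> \<le> 3 * A"
proof -
  assume "e \<in> set (lev (chV x n ty k z cls) i)" and i: "i \<le> n"
  from levV_elem[OF this] obtain d where d: "d \<in> VD ty k cls" "e = pv x n i d + zc ty cls i d" by auto
  \<comment> \<open>Truncating to the first \<open>i\<close> coordinates turns a partial sum into a
    full one, to which \<open>cv_bound\<close> applies.\<close>
  define d' where "d' l = (if l < i then d l else 0)" for l
  have "pv x n i d = pv x n n d'" unfolding pv_def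
    by (rule sum.mono_neutral_cong_left) (use i in \<open>auto simp: d'_def\<close>)
  moreover have "\<bar>pv x n n d'\<bar> \<le> 2 * A"
    unfolding pv_cv abs_mult using cv_bound[of d'] VD_abs[OF d(1)] by (auto simp: d'_def)
  moreover have "0 \<le> zc ty cls i d" "zc ty cls i d \<le> A" using zc_bounds[of ty cls i d] i A1 by linarith+
  ultimately show ?thesis using d(2) by linarith
qed

lemma levR_bound: "e \<in> set (lev (chR x n ty) i) \<Longrightarrow> i \<le> n \<Longrightarrow> \<bar>e\<bar> \<le> 3 * A"
proof -
  assume "e \<in> set (lev (chR x n ty) i)" and i: "i \<le> n"
  from levR_elem[OF this(1)] obtain d where d: "d \<in> RD ty" "e = pv x n i d" by auto
  define d' where "d' l = (if l < i then d l else 0)" for l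
  have "pv x n i d = pv x n n d'" unfolding pv_def
    by (rule sum.mono_neutral_cong_left) (use i in \<open>auto simp: d'_def\<close>)
  moreover have "\<bar>pv x n n d'\<bar> \<le> 2 * A"
    unfolding pv_cv abs_mult using cv_bound[of d'] RD_abs[OF d(1)] by (auto simp: d'_def)
  ultimately show ?thesis using d(2) A1 by linarith
qed

lemma lens: "i \<le> n \<Longrightarrow> 2 * int (length (lev (chV x n ty k z cls) i)) < Y"
  "i \<le> n \<Longrightarrow> 2 * int (length (lev (chR x n ty) i)) < Y"
proof -
  assume i: "i \<le> n"
  have iA: "(3::int) ^ i \<le> A" using p34(1) p34(2)[OF i] A1(3) by linarith
  have "int (length (lev (chV x n ty k z cls) i)) \<le> int (3 ^ i)"
    using levV_length by (simp only: of_nat_le_iff)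
  also have "\<dots> \<le> A" using iA by simp
  finally show "2 * int (length (lev (chV x n ty k z cls) i)) < Y" using A1 A64 by linarith
  have "int (length (lev (chR x n ty) i)) \<le> int (2 ^ i)"
    using levR_length by (simp only: of_nat_le_iff)
  also have "\<dots> \<le> int (3 ^ i)" by (simp add: power_mono)
  also have "\<dots> \<le> A" using iA by simp
  finally show "2 * int (length (lev (chR x n ty) i)) < Y" using A1 A64 by linarith
qed

definition dv :: "int list \<Rightarrow> int list" where "dv L = map (\<lambda>e. e div (int n + 1)) L"

lemma dv_V: "E \<in> set (dv (lev (chV x n ty k z cls) n)) \<Longrightarrow> \<exists>d\<in>VD ty k cls. E = cv x n d"
  unfolding dv_def using levV_elem[of _ x n ty k z cls n] pv_div by force

lemma dv_R: "E \<in> set (dv (lev (chR x n ty) n)) \<Longrightarrow> \<exists>d\<in>RD ty. E = cv x n d"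
  unfolding dv_def using levR_elem[of _ x n ty n] pv_div0 by force

lemma dv_bound: "(\<And>e. e \<in> set L \<Longrightarrow> \<bar>e\<bar> \<le> 3 * A) \<Longrightarrow> E \<in> set (dv L) \<Longrightarrow> \<bar>E\<bar> \<le> 3 * A"
  unfolding dv_def using abs_div_le order_trans by fastforce

text \<open>\<open>Q\<close> carries the factor \<open>2 ^ n\<close>, so for
  \<open>k \<le> n\<close> this division is exact and the residues modulo \<open>Q\<close> split
  into \<open>2 ^ k\<close> blocks of equal width.\<close>

definition W where "W k = Q div 2 ^ k"

definition genA :: "int \<Rightarrow> nat \<Rightarrow> int \<Rightarrow> int \<Rightarrow> int \<Rightarrow> int \<Rightarrow> int set" where
  "genA ty k z t \<alpha> cls = Gen \<alpha> (W k) (2 ^ k) t (dv (lev (chR x n ty) n)) (dv (lev (chV x n ty (int k) z cls) n))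
     (2 * length (lev (chV x n ty (int k) z cls) n))"

text \<open>
  The table of the first list keeps only the last vector for each value \<open>w\<close>, hence the
  quantification over all \<open>E\<close> with that value.
\<close>

definition hit :: "int \<Rightarrow> nat \<Rightarrow> int \<Rightarrow> int \<Rightarrow> int \<Rightarrow> bool" where
  "hit ty k z t \<alpha> \<longleftrightarrow> (\<exists>w. (\<exists>E\<in>genA ty k z t \<alpha> 0. wv n E = w) \<and>
     (\<forall>E\<in>genA ty k z t \<alpha> 0. wv n E = w \<longrightarrow> (\<exists>E'\<in>genA ty k z t \<alpha> 1. wv n E' = w \<and> E' \<noteq> E)))"

definition pairs :: "int \<Rightarrow> nat \<Rightarrow> int \<Rightarrow> int \<Rightarrow> int \<Rightarrow> int \<Rightarrow> nat" where
  "pairs ty k z t \<alpha> cls = (\<Sum>i<2 * length (lev (chV x n ty (int k) z cls) n). Suc (length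
     (bk \<alpha> (W k) (dv (lev (chR x n ty) n)) (rr \<alpha> (W k) (2 ^ k) t (dv (lev (chV x n ty (int k) z cls) n)) i))))"

lemma genA_CD: "E \<in> genA ty k z t \<alpha> cls \<Longrightarrow> \<exists>c\<in>CD ty (int k) cls. E = cv x n c"
proof -
  assume "E \<in> genA ty k z t \<alpha> cls"
  then obtain i C where i: "i < 2 * length (lev (chV x n ty (int k) z cls) n)"
    "C \<in> set (dv (lev (chR x n ty) n))" "E = dv (lev (chV x n ty (int k) z cls) n) ! (i div 2) + C"
    unfolding genA_def Gen_def bk_def by auto
  have "dv (lev (chV x n ty (int k) z cls) n) ! (i div 2) \<in> set (dv (lev (chV x n ty (int k) z cls) n))"
    by (rule nth_mem) (use i(1) in \<open>auto simp: dv_def\<close>)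
  from dv_V[OF this] dv_R[OF i(2)] i(3) obtain d e where "d \<in> VD ty (int k) cls" "e \<in> RD ty" "E = cv x n (\<lambda>l. d l + e l)"
    by (auto simp: cv_add)
  then show ?thesis unfolding CD_def by blast
qed

text \<open>For any two generated sums of equal weight, whatever their hashes, the weight parts
  cancel. What remains is the code of a vector with zero sum, and it is nonzero because the entries
  differ.\<close>

lemma gen_diff:
  assumes "E1 \<in> genA ty k z t \<alpha> 0" "E2 \<in> genA ty k z t \<alpha> 1" "wv n E1 = wv n E2" "E1 \<noteq> E2"
  shows "\<exists>c. dig c \<and> ws x n c = 0 \<and> E1 - E2 = cd n c \<and> cd n c \<noteq> 0"
proof -
  obtain c1 where c1: "c1 \<in> CD ty (int k) 0" "E1 = cv x n c1" using genA_CD[OF assms(1)] by auto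
  obtain c2 where c2: "c2 \<in> CD ty (int k) 1" "E2 = cv x n c2" using genA_CD[OF assms(2)] by auto
  have w: "ws x n c1 = ws x n c2"
    using assms(3) wv_cv[of n c1 x] wv_cv[of n c2 x] CD_abs[OF _ c1(1)] CD_abs[OF _ c2(1)] c1 c2 by simp
  have "E1 - E2 = cd n (\<lambda>l. c1 l - c2 l)" using w c1 c2 by (simp add: cv_def cd_diff)
  then show ?thesis using CD_diff[OF c1(1) c2(1)] w assms(4)
    by (intro exI[of _ "\<lambda>l. c1 l - c2 l"]) (auto simp: ws_diff)
qed

definition fuelc :: "int \<Rightarrow> nat \<Rightarrow> int \<Rightarrow> int \<Rightarrow> int \<Rightarrow> nat" where
  "fuelc ty k z t \<alpha> = k + (\<Sum>i<n. Suc (length (lev (chV x n ty (int k) z 0) i))) +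
     (\<Sum>i<n. Suc (length (lev (chV x n ty (int k) z 1) i))) + (\<Sum>i<n. Suc (length (lev (chR x n ty) i))) +
     length (lev (chR x n ty) n) + pairs ty k z t \<alpha> 0 + pairs ty k z t \<alpha> 1"

lemma core_correct:
  assumes c: "ctx va me" and zero: "\<And>a. me (a * str + kk) = 0"
    and om: "va vom = z + (int n + 1) * (int k + (int n + 1) * (t + 2 ^ n * (ty + 4 ^ n * \<alpha>)))" "\<bar>va vom\<bar> \<le> Y"
    and rg: "0 \<le> z" "z \<le> int n" "k \<le> n" "0 \<le> t" "t < 2 ^ n" "0 \<le> ty" "ty < 4 ^ n" "0 \<le> \<alpha>"
    and hit: "hit ty k z t \<alpha>"
  shows "J core_prog va me (fuelc ty k z t \<alpha>) (\<lambda>va' me'.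
     \<exists>c. dig c \<and> ws x n c = 0 \<and> va' vcand = cd n c \<and> cd n c \<noteq> 0)"
proof -
  define K0 where "K0 va' me' \<longleftrightarrow> ctx va' me' \<and> va' vz = z \<and> va' vk = int k \<and> va' vt = t \<and> va' vty = ty \<and>
    va' val = \<alpha> \<and> va' vcand = 0" for va' me'
  define K1 where "K1 va' me' \<longleftrightarrow> K0 va' me' \<and> va' vM = 2 ^ k \<and> va' vW = W k" for va' me'
  let ?A = "lev (chV x n ty (int k) z 0)" and ?B = "lev (chV x n ty (int k) z 1)" and ?C = "lev (chR x n ty)"
  have YA: "int n + 1 \<le> Y" "4 ^ n \<le> Y" "2 ^ n \<le> Y" using A1 A64 p34(3) by linarith+
  have tY: "\<bar>t\<bar> \<le> Y" "\<bar>ty\<bar> \<le> Y" "\<bar>z\<bar> \<le> Y" "\<bar>int k\<bar> \<le> Y" using rg YA by linarith+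
  have "(2::int) ^ k \<le> 2 ^ n" using rg by (intro power_increasing) auto
  then have k2: "(2::int) ^ k \<le> Y" using YA by linarith
  have Wk: "0 < W k" "W k \<le> Y"
  proof -
    have "(2::int) ^ n = 2 ^ (n - k) * 2 ^ k" using rg(3) by (simp add: power_add[symmetric])
    then have "Q = S * 2 ^ (n - k) * 2 ^ k" by simp
    then have "W k = S * 2 ^ (n - k)" unfolding W_def by (metis nonzero_mult_div_cancel_right power_not_zero zero_neq_numeral)
    then show "0 < W k" using S1 by simp
    show "W k \<le> Y" unfolding W_def using abs_div_le[of Q "2 ^ k"] QY by linarith
  qed
  have hp: "hpar \<alpha> (W k) (2 ^ k) va'" if "K1 va' me'" for va' me'
    using that Wk k2 YA by (auto simp: K1_def K0_def hpar_def)
  have K1_frame: "K1 va' me'" if "K1 va1 me1" "\<And>v. v < 28 \<Longrightarrow> v \<noteq> 20 \<Longrightarrow> va' v = va1 v" "\<And>a. a \<notin> TG \<sigma> \<Longrightarrow> me' a = me1 a"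
    for va1 me1 va' me' \<sigma>
    using that ctx_frame[of va1 me1 va' \<sigma> me'] by (auto simp: K1_def K0_def)
  have 1: "J decode va me 0 (\<lambda>va' me'. K0 va' me' \<and> va' vi = int k \<and> va' vM = 1 \<and> me' = me)"
  proof -
    define o1 where "o1 = int k + (int n + 1) * (t + 2 ^ n * (ty + 4 ^ n * \<alpha>))"
    define o2 where "o2 = t + 2 ^ n * (ty + 4 ^ n * \<alpha>)"
    define o3 where "o3 = ty + 4 ^ n * \<alpha>"
    have d0: "va vom mod (int n + 1) = z" "va vom div (int n + 1) = o1"
      unfolding om(1) o1_def[symmetric] using mixed_radix[of z "int n + 1" o1] rg by auto
    have d1: "o1 mod (int n + 1) = int k" "o1 div (int n + 1) = o2"
      unfolding o1_def o2_def[symmetric] using mixed_radix[of "int k" "int n + 1" o2] rg by auto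
    have d2: "o2 mod 2 ^ n = t" "o2 div 2 ^ n = o3"
      unfolding o2_def o3_def[symmetric] using mixed_radix[of t "2 ^ n" o3] rg by auto
    have d3: "o3 mod 4 ^ n = ty" "o3 div 4 ^ n = \<alpha>"
      unfolding o3_def using mixed_radix[of ty "4 ^ n" \<alpha>] rg by auto
    have b: "\<bar>o1\<bar> \<le> Y" "\<bar>o2\<bar> \<le> Y" "\<bar>o3\<bar> \<le> Y" "\<bar>\<alpha>\<bar> \<le> Y"
      using d0 d1 d2 d3 om(2) abs_div_le[of "va vom" "int n + 1"] abs_div_le[of o1 "int n + 1"] abs_div_le[of o2 "2 ^ n"]
        abs_div_le[of o3 "4 ^ n"] by linarith+
    have vs: "va vN1 = int n + 1" "va vp2 = 2 ^ n" "va vp4 = 4 ^ n" using c by (auto simp: ctx_def)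
    show ?thesis
      unfolding decode_def
      apply (rule wp_J, unfold wp.simps(4))
      apply (rule wp_AsgI[where y = z], simp, simp, simp add: vs d0, rule tY)
      apply (rule wp_AsgI[where y = o1], simp, simp, simp add: vs d0, rule b)
      apply (rule wp_AsgI[where y = "int k"], simp, simp, simp add: vs d1, rule tY)
      apply (rule wp_AsgI[where y = o2], simp, simp, simp add: vs d1, rule b)
      apply (rule wp_AsgI[where y = t], simp, simp, simp add: vs d2, rule tY)
      apply (rule wp_AsgI[where y = o3], simp, simp, simp add: vs d2, rule b)
      apply (rule wp_AsgI[where y = ty], simp, simp, simp add: vs d3, rule tY)
      apply (rule wp_AsgI[where y = \<alpha>], simp, simp, simp add: vs d3, rule b)
      apply (rule wp_AsgI[where y = 0], simp, simp, simp, use Y64 in simp)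
      apply (rule wp_AsgI[where y = 1], simp, simp, simp, use Y64 in simp)
      apply (rule wp_AsgI[where y = "int k"], simp, simp, simp, rule tY)
      using c by (simp add: K0_def ctx_def)
  qed
  have 2: "J powM va1 me1 k (\<lambda>va' me'. K0 va' me' \<and> va' vM = 2 ^ k \<and> me' = me)"
    if h: "K0 va1 me1 \<and> va1 vi = int k \<and> va1 vM = 1 \<and> me1 = me" for va1 me1
  proof -
    define Inv where "Inv i va' me' \<longleftrightarrow> K0 va' me' \<and> va' vi = int (k - i) \<and> va' vM = 2 ^ i \<and> me' = me" for i va' me'
    have s: "J (Asg vM (V vM [*] N 2) ;; Asg vi (V vi [-] N 1)) va' me' 0 (Inv (Suc i))" if i: "i < k" "Inv i va' me'" for i va' me'
    proof -
      have "(2::int) ^ Suc i \<le> 2 ^ n" using i rg by (intro power_increasing) auto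
      then have "2 * 2 ^ i \<le> Y" using YA by simp
      moreover have "int (k - i) = int (k - Suc i) + 1" "int (k - Suc i) \<le> Y" using i tY by auto
      ultimately show ?thesis using i by (intro wp_J) (auto simp: Inv_def K0_def ctx_def)
    qed
    have "J powM va1 me1 (\<Sum>i<k. Suc 0) (Inv k)"
      unfolding powM_def by (rule J_Whl[where Inv = Inv and f = "\<lambda>_. 0"]) (use s h in \<open>auto simp: Inv_def\<close>)
    then show ?thesis by (rule J_conseq) (auto simp: Inv_def)
  qed
  have 3: "J (Asg vW (V vQ [div] V vM)) va1 me1 0 (\<lambda>va' me'. K1 va' me' \<and> me' = me)"
    if h: "K0 va1 me1 \<and> va1 vM = 2 ^ k \<and> me1 = me" for va1 me1
  proof -
    have "va1 vQ = Q" using h by (simp add: K0_def ctx_def)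
    then show ?thesis using h Wk by (intro wp_J) (auto simp: K1_def K0_def ctx_def W_def[symmetric])
  qed
  define P2 where "P2 va' me' \<longleftrightarrow> K1 va' me' \<and> Z {1, 2, 3, 4, 5} me' \<and> cells 0 (?A n) me' \<and> va' vlA = int (length (?A n))" for va' me'
  define P3 where "P3 va' me' \<longleftrightarrow> K1 va' me' \<and> Z {2, 3, 4, 5} me' \<and> cells 0 (?A n) me' \<and> va' vlA = int (length (?A n)) \<and>
    cells 1 (?B n) me' \<and> va' vlB = int (length (?B n))" for va' me'
  define P4 where "P4 va' me' \<longleftrightarrow> K1 va' me' \<and> Z {3, 4, 5} me' \<and> cells 0 (?A n) me' \<and> va' vlA = int (length (?A n)) \<and>
    cells 1 (?B n) me' \<and> va' vlB = int (length (?B n)) \<and> cells 2 (?C n) me' \<and> va' vlC = int (length (?C n))" for va' me'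
  let ?Cs = "dv (?C n)"
  define P5 where "P5 va' me' \<longleftrightarrow> K1 va' me' \<and> Z {5} me' \<and> cells 0 (?A n) me' \<and> va' vlA = int (length (?A n)) \<and>
    cells 1 (?B n) me' \<and> va' vlB = int (length (?B n)) \<and> bkinv \<alpha> (W k) ?Cs me'" for va' me'
  let ?GA = "genA ty k z t \<alpha> 0" and ?GB = "genA ty k z t \<alpha> 1"
  define D where "D G me' \<longleftrightarrow> (\<forall>w. (me' (ad5 w) = 0 \<and> \<not> (\<exists>E\<in>G. wv n E = w)) \<or> (\<exists>E\<in>G. wv n E = w \<and> me' (ad5 w) = 2 * E + 1))" for G me'
  define P6 where "P6 va' me' \<longleftrightarrow> K1 va' me' \<and> cells 1 (?B n) me' \<and> va' vlB = int (length (?B n)) \<and> bkinv \<alpha> (W k) ?Cs me' \<and> D ?GA me'" for va' me'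
  have bY: "\<And>i e. i \<le> n \<Longrightarrow> e \<in> set (lev (chV x n ty (int k) z cls) i) \<Longrightarrow> \<bar>e\<bar> \<le> Y" for cls
    using levV_bound A1 A64 by fastforce
  have bYR: "\<And>i e. i \<le> n \<Longrightarrow> e \<in> set (?C i) \<Longrightarrow> \<bar>e\<bar> \<le> Y" using levR_bound A1 A64 by fastforce
  have lY: "int (length (lev (chV x n ty (int k) z cls) i)) \<le> Y" if "i \<le> n" for cls i
    using lens(1)[OF that, of ty "int k" z cls] by linarith
  have lYR: "int (length (?C i)) \<le> Y" if "i \<le> n" for i
    using lens(2)[OF that, of ty] by linarith
  have 4: "J (build 0 (chV_code 0 0) ;; Asg vlA (V vlen)) va1 me1 (\<Sum>i<n. Suc (length (?A i))) P2"
    if h: "K1 va1 me1 \<and> me1 = me" for va1 me1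
  proof (rule J_Sq'[OF J_conseq[OF build[OF chspec_V _ lY bY]]])
    have zz: "Z {1, 2, 3, 4, 5} me1" using h zero by (auto simp: Z_def TG_def)
    show "me1 (ad 0 0 0) = 0" using h zero[of 0] by (simp add: ad_def)
    fix va' me' assume b: "va' vlen = int (length (?A n)) \<and> (\<forall>j<length (?A n). me' (ad 0 n j) = ?A n ! j) \<and>
       (\<forall>v. v \<notin> {vlen, vi, vpw, vtt, vg, vc, vnl, vj, ve} \<longrightarrow> va' v = va1 v) \<and> (\<forall>a. a \<notin> TG 0 \<longrightarrow> me' a = me1 a)"
    have "K1 (va'(vlA := va' vlen)) me'" by (rule K1_frame[of va1 me1 _ 0]) (use b h in auto)
    moreover have "Z {1, 2, 3, 4, 5} me'" by (rule Z_frame[OF zz, of 0]) (use b in auto)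
    ultimately show "J (Asg vlA (V vlen)) va' me' 0 P2"
      using b lY[of n 0] by (intro wp_J) (auto simp: P2_def cells_def)
  qed (use h tY in \<open>auto simp: K1_def K0_def\<close>)
  have 5: "J (build 1 (chV_code 1 1) ;; Asg vlB (V vlen)) va1 me1 (\<Sum>i<n. Suc (length (?B i))) P3"
    if h: "P2 va1 me1" for va1 me1
  proof (rule J_Sq'[OF J_conseq[OF build[OF chspec_V _ lY bY]]])
    show "me1 (ad 1 0 0) = 0" using h ad_TG[of 1 0 0] by (auto simp: P2_def Z_def)
    fix va' me' assume b: "va' vlen = int (length (?B n)) \<and> (\<forall>j<length (?B n). me' (ad 1 n j) = ?B n ! j) \<and>
       (\<forall>v. v \<notin> {vlen, vi, vpw, vtt, vg, vc, vnl, vj, ve} \<longrightarrow> va' v = va1 v) \<and> (\<forall>a. a \<notin> TG 1 \<longrightarrow> me' a = me1 a)"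
    have "K1 (va'(vlB := va' vlen)) me'" by (rule K1_frame[of va1 me1 _ 1]) (use b h in \<open>auto simp: P2_def\<close>)
    moreover have "Z {2, 3, 4, 5} me'" by (rule Z_frame[OF Z_sub[of "{1,2,3,4,5}" me1], of _ 1]) (use b h in \<open>auto simp: P2_def\<close>)
    moreover have "cells 0 (?A n) me'" by (rule cells_frame[of 0 _ me1 1]) (use b h in \<open>auto simp: P2_def\<close>)
    ultimately show "J (Asg vlB (V vlen)) va' me' 0 P3"
      using b h lY[of n 1] by (intro wp_J) (auto simp: P2_def P3_def cells_def)
  qed (use h tY in \<open>auto simp: P2_def K1_def K0_def\<close>)
  have 6: "J (build 2 (chR_code 2) ;; Asg vlC (V vlen)) va1 me1 (\<Sum>i<n. Suc (length (?C i))) P4"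
    if h: "P3 va1 me1" for va1 me1
  proof (rule J_Sq'[OF J_conseq[OF build[OF chspec_R[of 2 ty "int k" z] _ lYR bYR]]])
    show "me1 (ad 2 0 0) = 0" using h ad_TG[of 2 0 0] by (auto simp: P3_def Z_def)
    fix va' me' assume b: "va' vlen = int (length (?C n)) \<and> (\<forall>j<length (?C n). me' (ad 2 n j) = ?C n ! j) \<and>
       (\<forall>v. v \<notin> {vlen, vi, vpw, vtt, vg, vc, vnl, vj, ve} \<longrightarrow> va' v = va1 v) \<and> (\<forall>a. a \<notin> TG 2 \<longrightarrow> me' a = me1 a)"
    have "K1 (va'(vlC := va' vlen)) me'" by (rule K1_frame[of va1 me1 _ 2]) (use b h in \<open>auto simp: P3_def\<close>)
    moreover have "Z {3, 4, 5} me'" by (rule Z_frame[OF Z_sub[of "{2,3,4,5}" me1], of _ 2]) (use b h in \<open>auto simp: P3_def\<close>)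
    moreover have "cells 0 (?A n) me'" by (rule cells_frame[of 0 _ me1 2]) (use b h in \<open>auto simp: P3_def\<close>)
    moreover have "cells 1 (?B n) me'" by (rule cells_frame[of 1 _ me1 2]) (use b h in \<open>auto simp: P3_def\<close>)
    ultimately show "J (Asg vlC (V vlen)) va' me' 0 P4"
      using b h lYR[of n] by (intro wp_J) (auto simp: P3_def P4_def cells_def)
  qed (use h tY in \<open>auto simp: P3_def K1_def K0_def\<close>)
  have 7: "J fill va1 me1 (length (?C n)) P5" if h: "P4 va1 me1" for va1 me1
  proof (rule J_conseq[OF fill[of "?C n" va1 me1 \<alpha> "W k" "2 ^ k"]])
    show "me1 (ad3 r) = 0" for r using h ad3_TG[of r] by (auto simp: P4_def Z_def)
    fix va' me' assume b: "bkinv \<alpha> (W k) (map (\<lambda>e. e div (int n + 1)) (?C n)) me' \<and>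
       (\<forall>v. v \<notin> {vj, vE, vw, vr, vp} \<longrightarrow> va' v = va1 v) \<and> (\<forall>a. a \<notin> TG 3 \<union> TG 4 \<longrightarrow> me' a = me1 a)"
    have n34: "int l \<notin> TG 3 \<union> TG 4" if "l < n" for l using inp_TG that by auto
    have "K1 va' me'" using h b n34 by (auto simp: P4_def K1_def K0_def ctx_def)
    moreover have "ad \<tau> n j \<notin> TG 3 \<union> TG 4" if "\<tau> \<in> {0, 1}" for \<tau> j
      using ad_TG[of \<tau> n j] TG_disj[of \<tau> 3 "ad \<tau> n j"] TG_disj[of \<tau> 4 "ad \<tau> n j"] that by auto
    moreover have "a \<notin> TG 3 \<union> TG 4" if "a \<in> TG 5" for a
      using TG_disj[of 5 3 a] TG_disj[of 5 4 a] that by auto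
    ultimately show "P5 va' me'" using h b by (auto simp: P4_def P5_def cells_def Z_def dv_def)
  qed (use h levR_length[of x n ty n] levR_bound hp in \<open>auto simp: P4_def K1_def K0_def cells_def\<close>)
  have lCs: "length ?Cs \<le> 2 ^ n" using levR_length[of x n ty n] by (simp add: dv_def)
  have bC: "\<And>E. E \<in> set ?Cs \<Longrightarrow> \<bar>E\<bar> \<le> 3 * A" by (rule dv_bound[of "?C n"]) (use levR_bound in auto)
  have 8: "J (join 0 vlA body1) va1 me1 (pairs ty k z t \<alpha> 0) P6" if h: "P5 va1 me1" for va1 me1
  proof -
    define I where "I P va' me' \<longleftrightarrow> D P me' \<and> va' vcand = 0" for P and va' :: "nat \<Rightarrow> int" and me'
    note j = join[of ?Cs "?A n" va1 me1 \<alpha> "W k" "2 ^ k" vlA t 0 I body1]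
    have K: "K1 va1 me1" using h by (simp add: P5_def)
    have "J (join 0 vlA body1) va1 me1 (pairs ty k z t \<alpha> 0) (\<lambda>va' me'. I ?GA va' me' \<and>
      (\<forall>v. v \<notin> {vj, vE1, vE, vw, vr, vp, vcand, vd} \<longrightarrow> va' v = va1 v) \<and> (\<forall>a. a \<notin> TG 5 \<longrightarrow> me' a = me1 a))"
      unfolding pairs_def genA_def dv_def
    proof (rule j[unfolded dv_def])
      show "I {} va1 me1" using h ad5_TG by (auto simp: I_def D_def P5_def Z_def K1_def K0_def)
    next
      fix P va' me' va'' me'' assume "I P va' me'" "va'' vcand = va' vcand" "\<And>a. a \<in> TG 5 \<Longrightarrow> me'' a = me' a"
      then show "I P va'' me''" using ad5_TG by (simp add: I_def D_def)
    next
      fix P va' me' E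
      assume b: "I P va' me'" "\<bar>E\<bar> \<le> 6 * A" "va' vE = E" "va' vw = wv n E"
      have "\<bar>2 * E + 1\<bar> \<le> Y" using b A1 A64 by linarith
      moreover have "D (insert E P) (me'(ad5 (wv n E) := 2 * E + 1))"
        using b(1) by (auto simp: I_def D_def ad5_inj)
      ultimately show "J body1 va' me' 0 (\<lambda>va'' me''. I (insert E P) va'' me'' \<and> (\<forall>v. v \<notin> {vcand, vd} \<longrightarrow> va'' v = va' v) \<and>
         (\<forall>a. a \<notin> TG 5 \<longrightarrow> me'' a = me' a))"
        unfolding body1_def
        apply (intro wp_J)
        apply (rule wp_WrI[where d = "ad5 (wv n E)" and y = "2 * E + 1"])
        using b ad5_TG by (auto simp: ad5_def[symmetric] I_def)
    qed (use h K hp tY levV_bound lens(1) lCs bC in \<open>auto simp: P5_def K1_def K0_def cells_def dv_def[symmetric]\<close>)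
    then show ?thesis
    proof (rule J_conseq)
      fix va' me' assume b: "I ?GA va' me' \<and>
        (\<forall>v. v \<notin> {vj, vE1, vE, vw, vr, vp, vcand, vd} \<longrightarrow> va' v = va1 v) \<and> (\<forall>a. a \<notin> TG 5 \<longrightarrow> me' a = me1 a)"
      have "K1 va' me'"
      proof (rule K1_frame[of va1 me1 _ 5])
        fix v :: nat assume "v < 28" "v \<noteq> 20"
        then show "va' v = va1 v" using b h by (cases "v = 17") (auto simp: I_def P5_def K1_def K0_def)
      qed (use b h in \<open>auto simp: P5_def\<close>)
      moreover have "cells 1 (?B n) me'" by (rule cells_frame[of 1 _ me1 5]) (use b h in \<open>auto simp: P5_def\<close>)
      moreover have "ad3 r \<notin> TG 5" "ad4 r p \<notin> TG 5" for r p
        using ad3_TG[of r] ad4_TG[of r p] TG_disj[of 3 5] TG_disj[of 4 5] by auto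
      then have "bkinv \<alpha> (W k) ?Cs me'" using b h by (auto simp: P5_def bkinv_def)
      ultimately show "P6 va' me'" using b h by (auto simp: P6_def P5_def I_def)
    qed simp
  qed
  have 9: "J (join 1 vlB body2) va1 me1 (pairs ty k z t \<alpha> 1) (\<lambda>va' me'. \<exists>c. dig c \<and> ws x n c = 0 \<and> va' vcand = cd n c \<and> cd n c \<noteq> 0)"
    if h: "P6 va1 me1" for va1 me1
  proof -
    define ok where "ok v P \<longleftrightarrow> (\<exists>E1\<in>?GA. \<exists>E2\<in>P. wv n E1 = wv n E2 \<and> E1 \<noteq> E2 \<and> v = E1 - E2)" for v P
    \<comment> \<open>Either no collision has occurred, and then every processed sum found its cell
      empty or occupied by itself, or the candidate is the difference of two colliding sums.\<close>
    define I where "I P va' me' \<longleftrightarrow> (\<forall>a\<in>TG 5. me' a = me1 a) \<and> ((va' vcand = 0 \<and>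
       (\<forall>E\<in>P. me1 (ad5 (wv n E)) \<in> {0, 2 * E + 1})) \<or> ok (va' vcand) P)" for P and va' :: "nat \<Rightarrow> int" and me'
    have K: "K1 va1 me1" using h by (simp add: P6_def)
    have D1: "D ?GA me1" using h by (simp add: P6_def)
    have "J (join 1 vlB body2) va1 me1 (pairs ty k z t \<alpha> 1) (\<lambda>va' me'. I ?GB va' me' \<and>
      (\<forall>v. v \<notin> {vj, vE1, vE, vw, vr, vp, vcand, vd} \<longrightarrow> va' v = va1 v) \<and> (\<forall>a. a \<notin> TG 5 \<longrightarrow> me' a = me1 a))"
      unfolding pairs_def genA_def dv_def
    proof (rule join[of ?Cs "?B n" va1 me1 \<alpha> "W k" "2 ^ k" vlB t 1 I body2, unfolded dv_def])
      show "I {} va1 me1" using K by (auto simp: I_def K1_def K0_def)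
    next
      fix P va' me' va'' me'' assume "I P va' me'" "va'' vcand = va' vcand" "\<And>a. a \<in> TG 5 \<Longrightarrow> me'' a = me' a"
      then show "I P va'' me''" by (simp add: I_def)
    next
      fix P va' me' E
      assume b: "I P va' me'" "E \<in> {e + C |e C. e \<in> set (map (\<lambda>e. e div (int n + 1)) (?B n)) \<and> C \<in> set (map (\<lambda>e. e div (int n + 1)) (?C n))}"
        "\<bar>E\<bar> \<le> 6 * A" "va' vE = E" "va' vw = wv n E"
      let ?P = "\<lambda>va'' me''. I (insert E P) va'' me'' \<and> (\<forall>v. v \<notin> {vcand, vd} \<longrightarrow> va'' v = va' v) \<and>
         (\<forall>a. a \<notin> TG 5 \<longrightarrow> me'' a = me' a)"
      define m where "m = me1 (ad5 (wv n E))"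
      have me: "me' (ad5 (wv n E)) = m" using b(1) ad5_TG by (simp add: I_def m_def)
      have okm: "ok v P \<Longrightarrow> ok v (insert E P)" for v by (auto simp: ok_def)
      have mc: "m = 0 \<or> (\<exists>E1\<in>?GA. wv n E1 = wv n E \<and> m = 2 * E1 + 1)" using D1 by (auto simp: D_def m_def)
      have mb: "\<bar>m\<bar> \<le> 13 * A"
        using mc
      proof
        assume "\<exists>E1\<in>?GA. wv n E1 = wv n E \<and> m = 2 * E1 + 1"
        then obtain E1 where E1: "E1 \<in> ?GA" "m = 2 * E1 + 1" by auto
        from genA_CD[OF E1(1)] obtain c where c: "c \<in> CD ty (int k) 0" "E1 = cv x n c" by auto
        have "\<bar>E1\<bar> * 1 \<le> \<bar>E1\<bar> * (int n + 1)" by (rule mult_left_mono) auto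
        also have "\<dots> \<le> 2 * A" using cv_bound[of c] CD_abs[OF _ c(1)] c(2) by simp
        finally show ?thesis using E1 A1 by linarith
      qed (use A1 in auto)
      have mY: "\<bar>m\<bar> \<le> Y" "\<bar>(m - 1) div 2 - E\<bar> \<le> Y"
        using mb b(3) A1 A64 abs_div_le[of "m - 1" 2] by linarith+
      have inner: "wp (Ite (V vd) (Asg vd ((V vd [-] N 1) [div] N 2 [-] V vE) ;; Ite (V vd) (Asg vcand (V vd)) Skip) Skip) ?P
          (va'(vd := m)) me'"
      proof (cases "m = 0")
        case True
        then have "I (insert E P) (va'(vd := m)) me'" using b(1) okm by (auto simp: I_def m_def)
        then show ?thesis using True by simp
      next
        case False
        with mc obtain E1 where E1: "E1 \<in> ?GA" "wv n E1 = wv n E" "m = 2 * E1 + 1" by auto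
        have "I (insert E P) (va'(vd := 0)) me'" if "E1 = E"
          using b(1) okm that E1 by (auto simp: I_def m_def)
        moreover have "I (insert E P) (va'(vd := E1 - E, vcand := E1 - E)) me'" if "E1 \<noteq> E"
          using b(1) E1 that by (auto simp: I_def ok_def)
        ultimately show ?thesis using False mY b(4) E1 by simp
      qed
      have "wp body2 ?P va' me'"
        unfolding body2_def wp.simps(4)[of "Asg vd (Ld (V vw [*] N 8 [+] N 5))"]
        apply (rule wp_AsgI[where y = m])
        using me mY(1) b(5) inner by (auto simp: ad5_def simp del: wp.simps)
      then show "J body2 va' me' 0 ?P" by (rule wp_J)
    qed (use h K hp tY levV_bound lens(1) lCs bC in \<open>auto simp: P6_def K1_def K0_def cells_def dv_def[symmetric]\<close>)
    then show ?thesis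
    proof (rule J_conseq)
      fix va' me' assume "I ?GB va' me' \<and>
        (\<forall>v. v \<notin> {vj, vE1, vE, vw, vr, vp, vcand, vd} \<longrightarrow> va' v = va1 v) \<and> (\<forall>a. a \<notin> TG 5 \<longrightarrow> me' a = me1 a)"
      then have I: "I ?GB va' me'" by simp
      from hit obtain w E0 where w: "E0 \<in> ?GA" "wv n E0 = w"
        "\<And>E. E \<in> ?GA \<Longrightarrow> wv n E = w \<Longrightarrow> \<exists>E'\<in>?GB. wv n E' = w \<and> E' \<noteq> E" unfolding hit_def by blast
      from D1 w(1,2) obtain E where E: "E \<in> ?GA" "wv n E = w" "me1 (ad5 w) = 2 * E + 1" by (auto simp: D_def)
      from w(3)[OF E(1,2)] obtain E' where E': "E' \<in> ?GB" "wv n E' = w" "E' \<noteq> E" by blast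
      \<comment> \<open>The cell holds some vector of weight \<open>w\<close>, and by
        \<open>hit\<close> the second list contains a different vector of this weight. This rules
        out the first alternative of the invariant.\<close>
      have "me1 (ad5 (wv n E')) \<notin> {0, 2 * E' + 1}"
      proof -
        have "2 * E + 1 \<noteq> 0" by presburger
        then show ?thesis using E E' by simp
      qed
      with I E' have "ok (va' vcand) ?GB" by (auto simp: I_def)
      then obtain E1 E2 where "E1 \<in> ?GA" "E2 \<in> ?GB" "wv n E1 = wv n E2" "E1 \<noteq> E2" "va' vcand = E1 - E2"
        by (auto simp: ok_def)
      with gen_diff[of E1 ty k z t \<alpha> E2] show "\<exists>c. dig c \<and> ws x n c = 0 \<and> va' vcand = cd n c \<and> cd n c \<noteq> 0" by auto
    qed simp
  qed
  note s8 = J_Sq[OF J_conseq[OF 8 order_refl 9]]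
  note s7 = J_Sq[OF J_conseq[OF 7 order_refl s8]]
  note s6 = J_Sq[OF J_conseq[OF 6 order_refl s7]]
  note s5 = J_Sq[OF J_conseq[OF 5 order_refl s6]]
  note s4 = J_Sq[OF J_conseq[OF 4 order_refl s5]]
  note s3 = J_Sq[OF J_conseq[OF 3 order_refl s4]]
  note s2 = J_Sq[OF J_conseq[OF 2 order_refl s3]]
  note s1 = J_Sq[OF J_conseq[OF 1 order_refl s2]]
  show ?thesis
    unfolding core_prog_def by (rule J_conseq[OF s1]) (auto simp: fuelc_def)
qed

end

section \<open>Counting for the multiplicative hash\<close>

lemma count_mod:
  fixes M r q :: int
  assumes "0 < M" "0 \<le> r" "r < M" "0 \<le> q"
  shows "card {t \<in> {0..<M * q}. t mod M = r} = nat q"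
proof -
  have "{t \<in> {0..<M * q}. t mod M = r} = (\<lambda>j. r + M * j) ` {0..<q}"
  proof (intro set_eqI iffI)
    fix t assume t: "t \<in> {t \<in> {0..<M * q}. t mod M = r}"
    then have e: "t = r + M * (t div M)" by auto
    have "0 \<le> t div M" using t assms by (auto simp: pos_imp_zdiv_nonneg_iff)
    moreover have "t div M < q"
    proof (rule ccontr)
      assume "\<not> t div M < q"
      then have "M * q \<le> M * (t div M)" using assms by (intro mult_left_mono) auto
      with t e assms show False by auto
    qed
    ultimately show "t \<in> (\<lambda>j. r + M * j) ` {0..<q}" using e by auto
  next
    fix t assume "t \<in> (\<lambda>j. r + M * j) ` {0..<q}"
    then obtain j where j: "0 \<le> j" "j < q" "t = r + M * j" by auto
    have "M * (j + 1) \<le> M * q" using j assms by (intro mult_left_mono) auto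
    then show "t \<in> {t \<in> {0..<M * q}. t mod M = r}" using j assms by (auto simp: algebra_simps)
  qed
  moreover have "inj_on (\<lambda>j. r + M * j) {0..<q}" using assms by (auto simp: inj_on_def)
  ultimately show ?thesis by (simp add: card_image)
qed

lemma zdiv_less: "0 < W \<Longrightarrow> b < W * M \<Longrightarrow> b div W < M" for b W M :: int
proof (rule ccontr)
  assume a: "0 < W" "b < W * M" "\<not> b div W < M"
  then have "W * M \<le> W * (b div W)" by (intro mult_left_mono) auto
  with a show False using mult_div_mod_eq[of W b] pos_mod_sign[OF a(1), of b] by linarith
qed

text \<open>While \<open>\<alpha>\<close> runs up to \<open>Q\<close>, the multiple
  \<open>\<alpha> * D\<close> winds around \<open>Q\<close> at most \<open>D\<close> times. Within
  one winding the residues are \<open>D\<close> apart, so at most \<open>W div D + 1\<close> of them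
  fall below \<open>W\<close>; winding number and block of length \<open>D\<close> together identify
  \<open>\<alpha>\<close>.\<close>

lemma count_mult:
  fixes D W Q :: int
  assumes "0 < D" "0 \<le> W" "0 < Q"
  shows "int (card {\<alpha> \<in> {0..<Q}. \<alpha> * D mod Q < W}) \<le> W + D"
proof -
  let ?S = "{\<alpha> \<in> {0..<Q}. \<alpha> * D mod Q < W}"
  let ?f = "\<lambda>\<alpha>. (\<alpha> * D div Q, \<alpha> * D mod Q div D)"
  have "inj_on ?f ?S"
  proof (rule inj_onI)
    fix a b assume "?f a = ?f b"
    then have e: "a * D div Q = b * D div Q" "a * D mod Q div D = b * D mod Q div D" by auto
    have "a * D - b * D = a * D mod Q - b * D mod Q"
      using mult_div_mod_eq[of Q "a * D"] mult_div_mod_eq[of Q "b * D"] arg_cong[OF e(1), of "\<lambda>y. Q * y"] by linarith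
    also have "\<dots> = a * D mod Q mod D - b * D mod Q mod D"
      using mult_div_mod_eq[of D "a * D mod Q"] mult_div_mod_eq[of D "b * D mod Q"]
        arg_cong[OF e(2), of "\<lambda>y. D * y"] by linarith
    finally have "(a - b) * D = a * D mod Q mod D - b * D mod Q mod D" by (simp add: algebra_simps)
    moreover have "\<bar>a * D mod Q mod D - b * D mod Q mod D\<bar> < D"
      using pos_mod_bound[OF assms(1), of "a * D mod Q"] pos_mod_bound[OF assms(1), of "b * D mod Q"]
        pos_mod_sign[OF assms(1), of "a * D mod Q"] pos_mod_sign[OF assms(1), of "b * D mod Q"] by linarith
    ultimately have "\<bar>(a - b) * D\<bar> < D" by (simp only:)
    then have "\<bar>a - b\<bar> * D < 1 * D" using assms by (simp only: abs_mult abs_of_pos mult_1_left)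
    then have "\<bar>a - b\<bar> < 1" using assms by (simp only: mult_less_cancel_right)
    then show "a = b" by simp
  qed
  moreover have "?f ` ?S \<subseteq> {0..<D} \<times> {0..<W div D + 1}"
  proof
    fix y assume "y \<in> ?f ` ?S"
    then obtain \<alpha> where a: "0 \<le> \<alpha>" "\<alpha> < Q" "\<alpha> * D mod Q < W" "y = ?f \<alpha>" by auto
    have "0 \<le> \<alpha> * D div Q" using a assms by (simp add: pos_imp_zdiv_nonneg_iff)
    moreover have "\<alpha> * D div Q < D"
      using a assms by (intro zdiv_less) auto
    moreover have "0 \<le> \<alpha> * D mod Q div D" using assms by (simp add: pos_imp_zdiv_nonneg_iff)
    moreover have "\<alpha> * D mod Q div D \<le> W div D" using a assms by (intro zdiv_mono1) auto
    ultimately show "y \<in> {0..<D} \<times> {0..<W div D + 1}" using a by auto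
  qed
  ultimately have "card ?S \<le> card ({0..<D} \<times> {0..<W div D + 1})"
    by (intro card_inj_on_le) auto
  also have "\<dots> = nat D * nat (W div D + 1)" by (simp add: card_cartesian_product)
  finally have "int (card ?S) \<le> int (nat D * nat (W div D + 1))" by (simp only: of_nat_le_iff)
  also have "\<dots> = D * (W div D + 1)"
    using assms by (simp add: pos_imp_zdiv_nonneg_iff)
  also have "\<dots> = D * (W div D) + D" by (simp add: algebra_simps)
  also have "\<dots> \<le> W + D"
    using mult_div_mod_eq[of D W] pos_mod_sign[OF assms(1), of W] by linarith
  finally show ?thesis .
qed

text \<open>Equal hashes put \<open>\<alpha> * (v - v')\<close> within \<open>W\<close> of 0 modulo
  \<open>Q\<close>, on one side or the other. The map \<open>\<alpha> \<mapsto> - \<alpha>\<close>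
  reduces the negative side to the positive one, and with \<open>D = \<bar>v - v'\<bar>\<close> each
  side has at most \<open>W + D \<le> 2 * W\<close> solutions.\<close>

lemma hh_collision_count:
  fixes v v' W M :: int
  assumes "0 < W" "0 < M" "v \<noteq> v'" "\<bar>v - v'\<bar> \<le> W"
  shows "int (card {\<alpha> \<in> {0..<W * M}. hh \<alpha> (W * M) W v = hh \<alpha> (W * M) W v'}) \<le> 4 * W"
proof -
  define Q where "Q = W * M"
  have Q: "0 < Q" using assms by (simp add: Q_def)
  have main: "int (card {\<alpha> \<in> {0..<Q}. hh \<alpha> Q W v = hh \<alpha> Q W (v + D)}) \<le> 4 * W" if D: "0 < D" "D \<le> W" for D v
  proof -
    let ?A = "{\<alpha> \<in> {0..<Q}. \<alpha> * D mod Q < W}" and ?B = "{\<alpha> \<in> {0..<Q}. (- \<alpha>) mod Q * D mod Q < W}"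
    have "card ?B \<le> card ?A"
    proof (rule card_inj_on_le[of "\<lambda>\<alpha>. (- \<alpha>) mod Q"])
      show "inj_on (\<lambda>\<alpha>. (- \<alpha>) mod Q) ?B"
      proof (rule inj_onI)
        fix a b assume h: "a \<in> ?B" "b \<in> ?B" "- a mod Q = - b mod Q"
        have "(- (- a)) mod Q = (- (- b)) mod Q" by (rule mod_minus_cong) (rule h(3))
        with h show "a = b" by (simp add: mod_pos_pos_trivial)
      qed
      show "(\<lambda>\<alpha>. (- \<alpha>) mod Q) ` ?B \<subseteq> ?A" using Q by auto
      have "?A \<subseteq> {0..<Q}" by auto
      then show "finite ?A" by (rule finite_subset) simp
    qed
    moreover have "int (card ?A) \<le> W + D" by (rule count_mult) (use assms D Q in auto)
    moreover have "{\<alpha> \<in> {0..<Q}. hh \<alpha> Q W v = hh \<alpha> Q W (v + D)} \<subseteq> ?A \<union> ?B"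
    proof
      fix \<alpha> assume a: "\<alpha> \<in> {\<alpha> \<in> {0..<Q}. hh \<alpha> Q W v = hh \<alpha> Q W (v + D)}"
      define p where "p = \<alpha> * v mod Q"
      define q where "q = \<alpha> * (v + D) mod Q"
      have r: "0 \<le> p" "p < Q" "0 \<le> q" "q < Q" using Q by (auto simp: p_def q_def)
      have pq0: "p div W = q div W" using a by (simp add: hh_def p_def q_def)
      have pq: "\<bar>q - p\<bar> < W"
        using arg_cong[OF pq0, of "\<lambda>y. W * y"] mult_div_mod_eq[of W p] mult_div_mod_eq[of W q] pos_mod_bound[OF assms(1), of p] pos_mod_bound[OF assms(1), of q]
          pos_mod_sign[OF assms(1), of p] pos_mod_sign[OF assms(1), of q] by linarith
      have "\<alpha> * D mod Q = (\<alpha> * (v + D) - \<alpha> * v) mod Q" by (simp add: algebra_simps)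
      also have "\<dots> = (q - p) mod Q" unfolding p_def q_def by (simp add: mod_diff_eq)
      finally have e: "\<alpha> * D mod Q = (q - p) mod Q" .
      show "\<alpha> \<in> ?A \<union> ?B"
      proof (cases "p \<le> q")
        case True
        then have "\<alpha> * D mod Q = q - p" using e r by (simp add: mod_pos_pos_trivial)
        then show ?thesis using a pq True by auto
      next
        case False
        have "(- \<alpha>) mod Q * D mod Q = - (\<alpha> * D) mod Q" by (simp add: mod_mult_left_eq)
        also have "\<dots> = (p - q) mod Q" using mod_minus_cong[OF e] by simp
        also have "\<dots> = p - q" using r False by (simp add: mod_pos_pos_trivial)
        finally show ?thesis using a pq False by auto
      qed
    qed
    then have "card {\<alpha> \<in> {0..<Q}. hh \<alpha> Q W v = hh \<alpha> Q W (v + D)} \<le> card (?A \<union> ?B)"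
      by (rule card_mono[rotated]) (auto intro: finite_subset[of _ "{0..<Q}"])
    ultimately show ?thesis using D card_Un_le[of ?A ?B] by linarith
  qed
  show ?thesis
  proof (cases "v < v'")
    case True
    then show ?thesis using main[of "v' - v" v] assms by (simp add: Q_def)
  next
    case False
    then show ?thesis using main[of "v - v'" v'] assms by (simp add: Q_def eq_commute)
  qed
qed

text \<open>Cutting both residues into blocks of width \<open>W\<close> loses at most one carry, and
  the wrap-around modulo \<open>W * M\<close> shifts by a multiple of \<open>M\<close>
  blocks.\<close>

lemma hh_add:
  assumes "0 < W" "0 < M"
  shows "\<exists>q\<in>{0, 1}. hh \<alpha> (W * M) W v = (hh \<alpha> (W * M) W (u + v) - q - hh \<alpha> (W * M) W u) mod M"
proof -
  define Q where "Q = W * M"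
  have Q: "0 < Q" using assms by (simp add: Q_def)
  define a b s where "a = \<alpha> * u mod Q" and "b = \<alpha> * v mod Q" and "s = \<alpha> * (u + v) mod Q"
  have r: "0 \<le> a" "a < Q" "0 \<le> b" "b < Q" using Q by (auto simp: a_def b_def)
  have s: "s = (a + b) mod Q" unfolding a_def b_def s_def by (simp add: mod_add_eq algebra_simps)
  obtain e where e: "a + b = s + W * (M * e)"
    using mult_div_mod_eq[of Q "a + b"] s unfolding Q_def by (metis add.commute mult.assoc)
  have "(a + b) div W = s div W + M * e" unfolding e using assms by simp
  moreover have "\<exists>q\<in>{0, 1}. (a + b) div W = a div W + b div W + q"
  proof -
    define q where "q = (a mod W + b mod W) div W"
    have "a + b = (a mod W + b mod W) + W * (a div W + b div W)"
      using mult_div_mod_eq[of W a] mult_div_mod_eq[of W b] by (simp add: algebra_simps)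
    then have "(a + b) div W = ((a mod W + b mod W) + W * (a div W + b div W)) div W" by simp
    also have "\<dots> = q + (a div W + b div W)" unfolding q_def using assms by simp
    finally have "(a + b) div W = q + (a div W + b div W)" .
    moreover have "q \<in> {0, 1}"
    proof (cases "a mod W + b mod W < W")
      case True
      then show ?thesis unfolding q_def using assms by (simp add: div_pos_pos_trivial)
    next
      case False
      then have "(a mod W + b mod W - W) div W = 0"
        using pos_mod_bound[OF assms(1), of a] pos_mod_bound[OF assms(1), of b] by (intro div_pos_pos_trivial) auto
      moreover have "(a mod W + b mod W) div W = (a mod W + b mod W - W) div W + 1"
        using assms div_add_self2[of W "a mod W + b mod W - W"] by simp
      ultimately show ?thesis unfolding q_def by simp
    qed
    ultimately show ?thesis by (intro bexI[of _ q]) auto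
  qed
  ultimately obtain q where q: "q \<in> {0, 1}" "b div W = s div W - q - a div W + M * e" by fastforce
  have "b div W = b div W mod M"
  proof -
    have "0 \<le> b div W" using r assms by (simp add: pos_imp_zdiv_nonneg_iff)
    moreover have "b div W < M" using r assms by (intro zdiv_less) (auto simp: Q_def)
    ultimately show ?thesis by simp
  qed
  then have "b div W = (s div W - q - a div W) mod M" unfolding q(2) by simp
  then show ?thesis using q(1) unfolding hh_def Q_def[symmetric] a_def[symmetric] b_def[symmetric] s_def[symmetric] by auto
qed

lemma markov_count:
  fixes f :: "'a \<Rightarrow> nat"
  assumes "finite T"
  shows "card {t \<in> T. B < f t} * B \<le> (\<Sum>t\<in>T. f t)"
proof -
  have "card {t \<in> T. B < f t} * B = (\<Sum>t\<in>{t \<in> T. B < f t}. B)" by simp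
  also have "\<dots> \<le> (\<Sum>t\<in>{t \<in> T. B < f t}. f t)" by (rule sum_mono) auto
  also have "\<dots> \<le> (\<Sum>t\<in>T. f t)" using assms by (intro sum_mono2) auto
  finally show ?thesis .
qed

text \<open>Removing every element that takes part in a collision leaves a set on which
  \<open>f\<close> is injective.\<close>

lemma card_image_collisions:
  assumes "finite A"
  shows "card A \<le> card (f ` A) + card {(a, b). a \<in> A \<and> b \<in> A \<and> a \<noteq> b \<and> f a = f b}"
proof -
  let ?C = "{(a, b). a \<in> A \<and> b \<in> A \<and> a \<noteq> b \<and> f a = f b}"
  have fC: "finite ?C" by (rule finite_subset[of _ "A \<times> A"]) (use assms in auto)
  have "inj_on f (A - fst ` ?C)"
  proof (rule inj_onI, rule ccontr)
    fix a b assume h: "a \<in> A - fst ` ?C" "b \<in> A - fst ` ?C" "f a = f b" "a \<noteq> b"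
    then have "(a, b) \<in> ?C" by blast
    then have "a \<in> fst ` ?C" by (rule image_eqI[rotated]) simp
    with h show False by blast
  qed
  then have "card (A - fst ` ?C) = card (f ` (A - fst ` ?C))" by (simp add: card_image)
  also have "\<dots> \<le> card (f ` A)" using assms by (intro card_mono) auto
  finally have "card (A - fst ` ?C) \<le> card (f ` A)" .
  moreover have "card A \<le> card (A - fst ` ?C) + card (fst ` ?C)"
  proof -
    have "card A \<le> card ((A - fst ` ?C) \<union> fst ` ?C)" by (rule card_mono) (use assms fC in auto)
    also have "\<dots> \<le> card (A - fst ` ?C) + card (fst ` ?C)" by (rule card_Un_le)
    finally show ?thesis .
  qed
  moreover have "card (fst ` ?C) \<le> card ?C" using fC by (rule card_image_le)
  ultimately show ?thesis by linarith
qed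

text \<open>Uniqueness of balanced ternary expansions. The comparison starts at the leading digit:
  the lower digits contribute less than half a unit on each side.\<close>

lemma cd_inj:
  assumes "\<And>l. l < n \<Longrightarrow> \<bar>c l\<bar> \<le> 1" "\<And>l. l < n \<Longrightarrow> \<bar>d l\<bar> \<le> 1" "cd n c = cd n d"
  shows "l < n \<Longrightarrow> c l = d l"
  using assms
proof (induction n)
  case (Suc n)
  have b: "2 * \<bar>cd n c\<bar> < 3 ^ n" "2 * \<bar>cd n d\<bar> < 3 ^ n" using Suc.prems by (auto intro!: cd_bound)
  have e: "cd n c + c n * 3 ^ n = cd n d + d n * 3 ^ n" using Suc.prems(4) by (simp add: cd_def)
  then have "(c n - d n) * 3 ^ n = cd n d - cd n c" by (simp add: algebra_simps)
  then have "\<bar>c n - d n\<bar> * 3 ^ n = \<bar>cd n d - cd n c\<bar>" by (metis abs_mult abs_of_nonneg zero_le_numeral zero_le_power)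
  also have "\<dots> < 1 * 3 ^ n" using b by linarith
  finally have "\<bar>c n - d n\<bar> < 1" by (simp only: mult_less_cancel_right) simp
  then have top: "c n = d n" by simp
  with e have "cd n c = cd n d" by simp
  with Suc top show ?case by (cases "l = n") auto
qed simp

section \<open>Sums that the join is certain to find\<close>

context core begin

lemma W_Q: "k \<le> n \<Longrightarrow> W k * 2 ^ k = Q" and S_W: "k \<le> n \<Longrightarrow> S \<le> W k"
proof -
  assume k: "k \<le> n"
  have "(2::int) ^ n = 2 ^ (n - k) * 2 ^ k" using k by (simp add: power_add[symmetric])
  then have Q: "Q = S * 2 ^ (n - k) * 2 ^ k" by simp
  then have W: "W k = S * 2 ^ (n - k)" unfolding W_def by (metis nonzero_mult_div_cancel_right power_not_zero zero_neq_numeral)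
  have "S * 1 \<le> S * 2 ^ (n - k)" using S1 by (intro mult_left_mono) auto
  then show "S \<le> W k" using W by simp
  show "W k * 2 ^ k = Q" using W Q by (simp only:)
qed

lemma W_pos: "k \<le> n \<Longrightarrow> 0 < W k" using S_W[of k] S1 by linarith

lemma genA_mem:
  assumes d: "d \<in> VD ty (int k) cls" "zc ty cls n d \<le> z" "e \<in> RD ty" and k: "k \<le> n"
    and t: "hh \<alpha> Q (W k) (ws x n d + ws x n e) = t mod 2 ^ k"
  shows "cv x n (\<lambda>l. d l + e l) \<in> genA ty k z t \<alpha> cls"
proof -
  let ?L = "lev (chV x n ty (int k) z cls) n"
  have "pv x n n d + zc ty cls n d \<in> set ?L" using levV_mem[OF d(1,2), of n] by simp
  then have "(pv x n n d + zc ty cls n d) div (int n + 1) \<in> (\<lambda>e. e div (int n + 1)) ` set ?L" by (rule imageI)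
  then have "cv x n d \<in> set (dv ?L)" unfolding dv_def set_map pv_div .
  then obtain j where j: "j < length ?L" "dv ?L ! j = cv x n d"
    by (auto simp: in_set_conv_nth dv_def)
  have e: "cv x n e \<in> set (dv (lev (chR x n ty) n))"
    unfolding dv_def set_map 
    using imageI[OF levR_mem[OF d(3), of x n n], of "\<lambda>e. e div (int n + 1)"] pv_div0[of x n e] by simp
  have "wv n (cv x n d) = ws x n d" by (rule wv_cv) (rule VD_abs[OF d(1)])
  moreover have "wv n (cv x n e) = ws x n e" by (rule wv_cv) (rule RD_abs[OF d(3)])
  ultimately have hd: "h \<alpha> (W k) (cv x n d) = hh \<alpha> Q (W k) (ws x n d)"
    "h \<alpha> (W k) (cv x n e) = hh \<alpha> Q (W k) (ws x n e)" by simp_all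
  obtain q where q0: "q \<in> {0, 1}" "hh \<alpha> (W k * 2 ^ k) (W k) (ws x n e)
      = (hh \<alpha> (W k * 2 ^ k) (W k) (ws x n d + ws x n e) - q - hh \<alpha> (W k * 2 ^ k) (W k) (ws x n d)) mod 2 ^ k"
    using hh_add[OF W_pos[OF k], of "2 ^ k" \<alpha> "ws x n e" "ws x n d"] by (meson zero_less_numeral zero_less_power)
  have q: "q \<in> {0, 1}" "hh \<alpha> Q (W k) (ws x n e) = (t mod 2 ^ k - q - hh \<alpha> Q (W k) (ws x n d)) mod 2 ^ k"
    using q0 unfolding W_Q[OF k] t .
  \<comment> \<open>The carry given by \<open>hh_add\<close> tells at which of the two visits to
    entry \<open>j\<close> the partner is found.\<close>
  define i where "i = 2 * j + nat q"
  have i: "i < 2 * length ?L" "i div 2 = j" "int (i mod 2) = q" using j(1) q(1) by (auto simp: i_def)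
  have "(t mod 2 ^ k - q - hh \<alpha> Q (W k) (ws x n d)) mod 2 ^ k = (t - q - hh \<alpha> Q (W k) (ws x n d)) mod 2 ^ k"
    by (simp add: diff_diff_eq mod_diff_left_eq)
  then have "cv x n e \<in> set (bk \<alpha> (W k) (dv (lev (chR x n ty) n)) (rr \<alpha> (W k) (2 ^ k) t (dv ?L) i))"
    unfolding bk_def rr_def i(2) j(2) i(3) using e hd q(2) by simp
  then have "dv ?L ! (i div 2) + cv x n e \<in> genA ty k z t \<alpha> cls"
    unfolding genA_def Gen_def using i(1) by blast
  then show ?thesis by (simp add: i(2) j(2) cv_add)
qed

end

section \<open>Success probability of the hash constraint\<close>

text \<open>
  \<open>Zs\<close> is the set of zeros whose subsets generate the representations. The second alternative of \<open>mode\<close> makes the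
  two stored vectors of a representation different.
\<close>

locale attempt = core H str kk Y \<Gamma> n x S for H str kk Y :: int and \<Gamma> and n :: nat and x :: "nat \<Rightarrow> int" and S :: int +
  fixes ty :: int and k :: nat and z :: int and c :: "nat \<Rightarrow> int" and Zs :: "nat set"
  assumes k: "k \<le> n" and dig: "dig c" and c0: "\<And>l. n \<le> l \<Longrightarrow> c l = 0" and wsc: "ws x n c = 0"
    and nz: "\<exists>l. c l \<noteq> 0"
    and minimal: "\<And>d. dig d \<Longrightarrow> ws x n d = 0 \<Longrightarrow> card {l. l < n \<and> d l \<noteq> 0} < card {l. l < n \<and> c l \<noteq> 0}
      \<Longrightarrow> \<forall>l<n. d l = 0"
    and Zs: "Zs \<subseteq> {l. l < n \<and> 2 \<le> tp ty l \<and> c l = 0}" "card Zs = k - 4" "card Zs < card {l. l < n \<and> c l \<noteq> 0}"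
    and zc: "zc ty 0 n c \<le> z" "zc ty 1 n c \<le> z"
    and mode: "(k = 0 \<and> z = int n \<and> (\<forall>l. c l \<noteq> 0 \<longrightarrow> 2 \<le> tp ty l)) \<or> (0 < k \<and> (\<exists>l<n. tp ty l = 1 \<and> c l \<noteq> 0))"
begin

text \<open>Gives the splitting \<open>c = (dA + eA U) - (dB + eB U)\<close>:
  \<open>V\<^sub>2\<close> enters \<open>dB\<close> with opposite sign, on \<open>R\<close> the
  entries 1 go to \<open>eA\<close> and the entries -1 to \<open>eB\<close>, and \<open>U\<close> is
  added to both.\<close>

definition dA where "dA l = (if tp ty l = 0 then c l else 0)"
definition dB where "dB l = (if tp ty l = 1 then - c l else 0)"
definition eA where "eA U l = (if 2 \<le> tp ty l \<and> (c l = 1 \<or> l \<in> U) then 1 else 0 :: int)"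
definition eB where "eB U l = (if 2 \<le> tp ty l \<and> (c l = -1 \<or> l \<in> U) then 1 else 0 :: int)"
definition vv where "vv U = ws x n (\<lambda>l. dA l + eA U l)"

lemma c_dig: "c l = -1 \<or> c l = 0 \<or> c l = 1"
  using dig unfolding dig_def by blast

lemma tp_cases: "tp ty l = 0 \<or> tp ty l = 1 \<or> 2 \<le> tp ty l"
proof -
  have "0 \<le> tp ty l" by (simp add: tp_def)
  then show ?thesis by linarith
qed

lemma dA: "dA \<in> VD ty (int k) 0" "zc ty 0 n dA \<le> z"
proof -
  have "dA l \<in> {-1, 0, 1}" for l using c_dig[of l] by (auto simp: dA_def)
  then show "dA \<in> VD ty (int k) 0" using mode unfolding VD_def dig_def dA_def by fastforce
  have "zc ty 0 n dA = zc ty 0 n c" unfolding zc_def by (rule sum.cong) (auto simp: dA_def)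
  then show "zc ty 0 n dA \<le> z" using zc by simp
qed

lemma dB: "dB \<in> VD ty (int k) 1" "zc ty 1 n dB \<le> z"
proof -
  have "dB l \<in> {-1, 0, 1}" for l using c_dig[of l] by (auto simp: dB_def)
  then show "dB \<in> VD ty (int k) 1" using mode unfolding VD_def dig_def dB_def by fastforce
  have "zc ty 1 n dB = zc ty 1 n c" unfolding zc_def by (rule sum.cong) (auto simp: dB_def)
  then show "zc ty 1 n dB \<le> z" using zc by simp
qed

lemma eAB: "eA U \<in> RD ty" "eB U \<in> RD ty"
  unfolding RD_def eA_def eB_def by auto

lemma split_c: "U \<subseteq> Zs \<Longrightarrow> c l = (dA l + eA U l) - (dB l + eB U l)"
proof -
  assume U: "U \<subseteq> Zs"
  then have "l \<in> U \<Longrightarrow> c l = 0 \<and> 2 \<le> tp ty l" using Zs by auto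
  then show ?thesis using tp_cases[of l] c_dig[of l] by (auto simp: dA_def dB_def eA_def eB_def)
qed

lemma vv_B: "U \<subseteq> Zs \<Longrightarrow> ws x n (\<lambda>l. dB l + eB U l) = vv U"
  using wsc split_c[of U] ws_diff[of x n "\<lambda>l. dA l + eA U l" "\<lambda>l. dB l + eB U l"] unfolding vv_def
  by (metis (no_types, lifting) ext eq_iff_diff_eq_0)

lemma vv_diff: "vv U - vv U' = ws x n (\<lambda>l. eA U l - eA U' l)"
  by (simp add: vv_def ws_add ws_diff)

lemma dig_eA: "dig (\<lambda>l. eA U l - eA U' l)"
  unfolding dig_def eA_def by auto

text \<open>Equal values would make \<open>eA U - eA U'\<close> a zero-sum vector supported in
  \<open>Zs\<close>, which has fewer elements than the support of \<open>c\<close>; by minimality it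
  vanishes.\<close>

lemma vv_inj: "inj_on vv (Pow Zs)"
proof (rule inj_onI)
  fix U U' assume h: "U \<in> Pow Zs" "U' \<in> Pow Zs" "vv U = vv U'"
  have fin: "finite Zs" using Zs(1) by (rule finite_subset) simp
  have zZ: "l \<in> Zs \<Longrightarrow> c l = 0 \<and> 2 \<le> tp ty l \<and> l < n" for l using Zs by auto
  have sub: "{l. l < n \<and> eA U l - eA U' l \<noteq> 0} \<subseteq> Zs"
  proof
    fix l assume "l \<in> {l. l < n \<and> eA U l - eA U' l \<noteq> 0}"
    then have "l \<in> U \<or> l \<in> U'" unfolding eA_def by (cases "l \<in> U"; cases "l \<in> U'") auto
    then show "l \<in> Zs" using h by blast
  qed
  have w0: "ws x n (\<lambda>l. eA U l - eA U' l) = 0" using vv_diff[of U U'] h(3) by simp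
  have z: "\<forall>l<n. eA U l - eA U' l = 0"
    by (rule minimal[OF dig_eA w0]) (rule le_less_trans[OF card_mono[OF fin sub] Zs(3)])
  have eq: "l \<in> U \<longleftrightarrow> l \<in> U'" if "l \<in> Zs" for l
  proof -
    have "eA U l = eA U' l" using z zZ[OF that] by simp
    then show ?thesis using zZ[OF that] unfolding eA_def by (cases "l \<in> U"; cases "l \<in> U'") auto
  qed
  show "U = U'"
  proof (rule set_eqI)
    fix l show "l \<in> U \<longleftrightarrow> l \<in> U'" using eq[of l] h(1,2) by blast
  qed
qed

lemma vv_dist: "\<bar>vv U - vv U'\<bar> \<le> W k"
proof -
  have "\<bar>vv U - vv U'\<bar> \<le> S - 1"
    unfolding vv_diff by (rule ws_bound) (auto simp: eA_def)
  then show ?thesis using S_W[OF k] by linarith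
qed

text \<open>The table may hold any vector of this weight, so a partner different from it must exist
  in the second list. For \<open>k > 0\<close> the vector built from \<open>dB\<close> is nonzero at
  a coordinate of \<open>V\<^sub>2\<close> where all vectors of the first list vanish. For
  \<open>k = 0\<close> the second list contains both parts of \<open>c\<close>; they differ, so one
  of them will do.\<close>

lemma hit_vv:
  assumes U: "U \<subseteq> Zs" and t: "hh \<alpha> Q (W k) (vv U) = t mod 2 ^ k"
  shows "hit ty k z t \<alpha>"
proof -
  let ?c1 = "\<lambda>l. dA l + eA U l" and ?c2 = "\<lambda>l. dB l + eB U l"
  have C: "?c1 \<in> CD ty (int k) 0" "?c2 \<in> CD ty (int k) 1" unfolding CD_def using dA(1) dB(1) eAB by blast+
  have b1': "\<bar>?c1 l\<bar> \<le> 1" and b2: "\<bar>?c2 l\<bar> \<le> 1" for l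
    using CD_abs[OF _ C(1), of l] CD_abs[OF _ C(2), of l] by auto
  have w1: "wv n (cv x n ?c1) = vv U" using wv_cv[of n ?c1 x] b1' unfolding vv_def by blast
  have w2: "wv n (cv x n ?c2) = vv U" using wv_cv[of n ?c2 x] b2 vv_B[OF U] by metis
  have m1: "cv x n ?c1 \<in> genA ty k z t \<alpha> cls" if "dA \<in> VD ty (int k) cls" "zc ty cls n dA \<le> z" for cls
    by (rule genA_mem[OF that eAB(1) k]) (use t in \<open>simp add: vv_def ws_add\<close>)
  have m2: "cv x n ?c2 \<in> genA ty k z t \<alpha> cls" if "dB \<in> VD ty (int k) cls" "zc ty cls n dB \<le> z" for cls
    by (rule genA_mem[OF that eAB(2) k]) (use t vv_B[OF U] in \<open>simp add: ws_add\<close>)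
  have "\<exists>E'\<in>genA ty k z t \<alpha> 1. wv n E' = vv U \<and> E' \<noteq> E" if E: "E \<in> genA ty k z t \<alpha> 0" "wv n E = vv U" for E
    using mode
  proof
    assume md: "0 < k \<and> (\<exists>l<n. tp ty l = 1 \<and> c l \<noteq> 0)"
    then obtain l where l: "l < n" "tp ty l = 1" "c l \<noteq> 0" by auto
    have "cv x n ?c2 \<noteq> E"
    proof
      assume eq: "cv x n ?c2 = E"
      obtain c' where c': "c' \<in> CD ty (int k) 0" "E = cv x n c'" using genA_CD[OF E(1)] by auto
      have b1: "\<bar>c' l\<bar> \<le> 1" for l using CD_abs[OF _ c'(1)] by simp
      have "wv n (cv x n c') = ws x n c'" by (rule wv_cv) (rule b1)
      moreover have "wv n (cv x n ?c2) = ws x n ?c2" by (rule wv_cv) (rule b2)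
      ultimately have "ws x n c' = ws x n ?c2" using eq c' by simp
      then have "cd n c' = cd n ?c2" using eq c'(2) by (simp add: cv_def)
      then have "c' l = ?c2 l" by (rule cd_inj[OF b1 b2 _ l(1)])
      moreover have "c' l = 0" using c'(1) l(2) by (auto simp: CD_def VD_def RD_def)
      moreover have "?c2 l = - c l" using l(2) by (simp add: dB_def eB_def)
      ultimately show False using l by simp
    qed
    then show ?thesis using m2[OF dB] w2 by blast
  next
    assume md: "k = 0 \<and> z = int n \<and> (\<forall>l. c l \<noteq> 0 \<longrightarrow> 2 \<le> tp ty l)"
    have z0: "dA = (\<lambda>_. 0)" using dA(1) md by (auto simp: VD_def)
    have i1: "dA \<in> VD ty (int k) 1" unfolding z0 by (auto simp: VD_def dig_def)
    have "zc ty 1 n dA \<le> z" using zc_bounds[of ty 1 n dA] md by simp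
    from m1[OF i1 this] have g1: "cv x n ?c1 \<in> genA ty k z t \<alpha> 1" .
    have "cv x n ?c1 \<noteq> cv x n ?c2"
    proof
      assume eq: "cv x n ?c1 = cv x n ?c2"
      then have "cd n ?c1 = cd n ?c2" using vv_B[OF U] by (simp add: cv_def vv_def)
      then have "cd n c = 0" using split_c[OF U] cd_diff[of n ?c1 ?c2] by (metis (no_types, lifting) ext diff_self)
      moreover have "cd n (\<lambda>_. 0) = 0" by (simp add: cd_def)
      ultimately have cd0: "cd n c = cd n (\<lambda>_. 0)" by simp
      have "c l = 0" if "l < n" for l
      proof (rule cd_inj[of n c "\<lambda>_. 0" l])
        show "\<bar>c l\<bar> \<le> 1" for l using c_dig[of l] by auto
      qed (use that cd0 in auto)
      with nz c0 show False by (meson not_le)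
    qed
    then show ?thesis using g1 m2[OF dB] w1 w2 by (cases "E = cv x n ?c1") auto
  qed
  then show ?thesis unfolding hit_def using m1[OF dA] w1 by blast
qed

definition VV where "VV = vv ` Pow Zs"

lemma VV: "finite VV" "card VV = 2 ^ (k - 4)"
proof -
  have fin: "finite Zs" using Zs(1) by (rule finite_subset) simp
  then show "finite VV" by (simp add: VV_def)
  show "card VV = 2 ^ (k - 4)" unfolding VV_def using vv_inj fin Zs(2) by (simp add: card_image card_Pow)
qed

definition Im where "Im \<alpha> = hh \<alpha> Q (W k) ` VV"

lemma Im_range: "r \<in> Im \<alpha> \<Longrightarrow> 0 \<le> r \<and> r < 2 ^ k"
proof -
  assume "r \<in> Im \<alpha>"
  then obtain v where r: "r = \<alpha> * v mod Q div W k" by (auto simp: Im_def hh_def)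
  have "\<alpha> * v mod Q < W k * 2 ^ k" using W_Q[OF k] QY by simp
  then show ?thesis using zdiv_less[OF W_pos[OF k]] W_pos[OF k] QY r by (simp add: pos_imp_zdiv_nonneg_iff)
qed

text \<open>With \<open>K = 2 ^ (k - 4)\<close> values in \<open>16 * K\<close> buckets, each of at
  most \<open>K * K\<close> pairs collides for at most \<open>4 * W k\<close> of the
  \<open>16 * K * W k\<close> multipliers, so there are at most \<open>K / 4\<close> collisions on
  average. For at least half of the multipliers at most \<open>K / 2\<close> occur, which leaves
  \<open>K / 2\<close> distinct hashes. Below \<open>k = 4\<close> there is just one value.\<close>

lemma good_alpha: "Q \<le> 2 * int (card {\<alpha> \<in> {0..<Q}. 2 ^ k \<le> 32 * card (Im \<alpha>)})"
proof (cases "k < 4")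
  case True
  then have "card VV = 1" using VV by simp
  then obtain v where "VV = {v}" by (auto simp: card_1_singleton_iff)
  then have "card (Im \<alpha>) = 1" for \<alpha> by (simp add: Im_def)
  moreover have "(2::nat) ^ k \<le> 2 ^ 3" using True by (intro power_increasing) auto
  ultimately have "{\<alpha> \<in> {0..<Q}. 2 ^ k \<le> 32 * card (Im \<alpha>)} = {0..<Q}" by auto
  then show ?thesis using QY by simp
next
  case False
  define K :: nat where "K = 2 ^ (k - 4)"
  have K: "K * 16 = 2 ^ k"
  proof -
    have "(2::nat) ^ (k - 4) * 2 ^ 4 = 2 ^ k" using False by (simp only: power_add[symmetric]) simp
    then show ?thesis by (simp add: K_def)
  qed
  have cV: "card VV = K" using VV by (simp add: K_def)
  define P where "P = {(a, b). a \<in> VV \<and> b \<in> VV \<and> a \<noteq> b}"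
  have fP: "finite P" by (rule finite_subset[of _ "VV \<times> VV"]) (auto simp: P_def VV(1))
  have cP: "card P \<le> K * K"
    using card_mono[of "VV \<times> VV" P] VV(1) cV by (auto simp: P_def card_cartesian_product)
  let ?h = "\<lambda>\<alpha>. hh \<alpha> Q (W k)"
  define c2 where "c2 \<alpha> = card {(a, b). a \<in> VV \<and> b \<in> VV \<and> a \<noteq> b \<and> ?h \<alpha> a = ?h \<alpha> b}" for \<alpha>
  have c2: "c2 \<alpha> = (\<Sum>p\<in>P. if ?h \<alpha> (fst p) = ?h \<alpha> (snd p) then 1 else 0)" for \<alpha>
  proof -
    have "{(a, b). a \<in> VV \<and> b \<in> VV \<and> a \<noteq> b \<and> ?h \<alpha> a = ?h \<alpha> b} = {p \<in> P. ?h \<alpha> (fst p) = ?h \<alpha> (snd p)}"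
      by (auto simp: P_def)
    then show ?thesis unfolding c2_def using fP by (simp add: sum.If_cases Int_def)
  qed
  have pair: "int (card {\<alpha> \<in> {0..<Q}. ?h \<alpha> (fst p) = ?h \<alpha> (snd p)}) \<le> 4 * W k" if "p \<in> P" for p
  proof -
    have "fst p \<noteq> snd p" "\<bar>fst p - snd p\<bar> \<le> W k" using that vv_dist by (auto simp: P_def VV_def)
    from hh_collision_count[OF W_pos[OF k] _ this, of "2 ^ k"] show ?thesis using W_Q[OF k] by simp
  qed
  let ?bad = "{\<alpha> \<in> {0..<Q}. K < 2 * c2 \<alpha>}"
  have "(\<Sum>\<alpha>\<in>{0..<Q}. c2 \<alpha>) = (\<Sum>p\<in>P. card {\<alpha> \<in> {0..<Q}. ?h \<alpha> (fst p) = ?h \<alpha> (snd p)})"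
    unfolding c2 by (subst sum.swap) (simp add: sum.If_cases Int_def)
  then have "int (\<Sum>\<alpha>\<in>{0..<Q}. c2 \<alpha>) = (\<Sum>p\<in>P. int (card {\<alpha> \<in> {0..<Q}. ?h \<alpha> (fst p) = ?h \<alpha> (snd p)}))" by simp
  also have "\<dots> \<le> (\<Sum>p\<in>P. 4 * W k)" by (rule sum_mono) (rule pair)
  also have "\<dots> = int (card P) * (4 * W k)" by simp
  also have "\<dots> \<le> int (K * K) * (4 * W k)" 
  proof (rule mult_right_mono)
    show "int (card P) \<le> int (K * K)" using cP by (simp only: of_nat_le_iff)
    show "0 \<le> 4 * W k" using W_pos[OF k] by simp
  qed
  finally have s: "int (\<Sum>\<alpha>\<in>{0..<Q}. c2 \<alpha>) \<le> int K * int K * (4 * W k)" by simp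
  have "card ?bad * K \<le> (\<Sum>\<alpha>\<in>{0..<Q}. 2 * c2 \<alpha>)" by (rule markov_count) simp
  then have "int (card ?bad * K) \<le> int (\<Sum>\<alpha>\<in>{0..<Q}. 2 * c2 \<alpha>)" by (simp only: of_nat_le_iff)
  also have "\<dots> = 2 * int (\<Sum>\<alpha>\<in>{0..<Q}. c2 \<alpha>)" by (simp add: sum_distrib_left)
  also have "\<dots> \<le> 2 * (int K * int K * (4 * W k))" using s by simp
  finally have "int (card ?bad) * int K \<le> (8 * int K * W k) * int K" by (simp add: algebra_simps)
  moreover have "0 < int K" by (simp add: K_def)
  ultimately have "int (card ?bad) \<le> 8 * int K * W k" by (simp only: mult_le_cancel_right)
  moreover have "16 * int K * W k = Q"
  proof -
    have "int K * 16 = 2 ^ k" using K by (metis of_nat_mult of_nat_numeral of_nat_power)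
    then show ?thesis using W_Q[OF k] by (simp add: algebra_simps)
  qed
  ultimately have bad: "2 * int (card ?bad) \<le> Q" by linarith
  have "{0..<Q} - ?bad \<subseteq> {\<alpha> \<in> {0..<Q}. 2 ^ k \<le> 32 * card (Im \<alpha>)}"
  proof
    fix \<alpha> assume a: "\<alpha> \<in> {0..<Q} - ?bad"
    then have "2 * c2 \<alpha> \<le> K" by auto
    moreover have "K \<le> card (Im \<alpha>) + c2 \<alpha>"
      using card_image_collisions[OF VV(1), of "?h \<alpha>"] cV by (simp add: Im_def c2_def)
    ultimately have "K * 16 \<le> 32 * card (Im \<alpha>)" by linarith
    then show "\<alpha> \<in> {\<alpha> \<in> {0..<Q}. 2 ^ k \<le> 32 * card (Im \<alpha>)}" using a K by auto
  qed
  then have "card ({0..<Q} - ?bad) \<le> card {\<alpha> \<in> {0..<Q}. 2 ^ k \<le> 32 * card (Im \<alpha>)}"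
    by (rule card_mono[rotated]) (rule finite_subset[of _ "{0..<Q}"], auto)
  moreover have "card ({0..<Q} - ?bad) = card {0..<Q} - card ?bad"
    by (rule card_Diff_subset) (auto intro: finite_subset[of _ "{0..<Q}"])
  moreover have "card {0..<Q} = nat Q" by simp
  ultimately show ?thesis using bad QY by linarith
qed

text \<open>The target is sampled below \<open>2 ^ n\<close> for every \<open>k\<close>, and each
  residue modulo \<open>2 ^ k\<close> is attained by \<open>2 ^ (n - k)\<close> targets.\<close>

lemma hit_t_count: "card (Im \<alpha>) * 2 ^ (n - k) \<le> card {t \<in> {0..<2 ^ n}. hit ty k z t \<alpha>}"
proof -
  have M: "(2::int) ^ n = 2 ^ k * 2 ^ (n - k)" using k by (simp add: power_add[symmetric])
  have fin: "finite (Im \<alpha>)" by (simp add: Im_def VV(1))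
  have cnt: "card {t \<in> {0..<2 ^ n}. t mod 2 ^ k = r} = 2 ^ (n - k)" if "r \<in> Im \<alpha>" for r
    using count_mod[of "2 ^ k" r "2 ^ (n - k)"] Im_range[OF that] by (simp add: M nat_power_eq)
  have "(\<Union>r\<in>Im \<alpha>. {t \<in> {0..<2 ^ n}. t mod 2 ^ k = r}) \<subseteq> {t \<in> {0..<2 ^ n}. hit ty k z t \<alpha>}"
    using hit_vv by (auto simp: Im_def VV_def)
  then have "card (\<Union>r\<in>Im \<alpha>. {t \<in> {0..<(2::int) ^ n}. t mod 2 ^ k = r}) \<le> card {t \<in> {0..<2 ^ n}. hit ty k z t \<alpha>}"
    by (rule card_mono[rotated]) (rule finite_subset[of _ "{0..<2 ^ n}"], auto)
  moreover have "card (\<Union>r\<in>Im \<alpha>. {t \<in> {0..<(2::int) ^ n}. t mod 2 ^ k = r}) = (\<Sum>r\<in>Im \<alpha>. card {t \<in> {0..<(2::int) ^ n}. t mod 2 ^ k = r})"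
    by (rule card_UN_disjoint[OF fin]) (auto intro: finite_subset[of _ "{0..<2 ^ n}"])
  ultimately show ?thesis using cnt by simp
qed

definition lV where "lV cls = length (lev (chV x n ty (int k) z cls) n)"
definition lR where "lR = length (lev (chR x n ty) n)"

definition extra where "extra t \<alpha> cls = (\<Sum>i<2 * lV cls. length
     (bk \<alpha> (W k) (dv (lev (chR x n ty) n)) (rr \<alpha> (W k) (2 ^ k) t (dv (lev (chV x n ty (int k) z cls) n)) i)))"

lemma pairs_extra: "pairs ty k z t \<alpha> cls = 2 * lV cls + extra t \<alpha> cls"
  unfolding pairs_def extra_def lV_def by (simp add: sum_Suc)

text \<open>For a fixed entry and carry guess, each subset of \<open>R\<close> lies in the requested
  bucket for exactly one residue of \<open>t\<close> modulo \<open>2 ^ k\<close>. The average number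
  of joined pairs is therefore known exactly.\<close>

lemma extra_sum: "(\<Sum>t\<in>{0..<2 ^ n}. extra t \<alpha> cls) = 2 * lV cls * (lR * 2 ^ (n - k))"
proof -
  have M: "(2::int) ^ n = 2 ^ k * 2 ^ (n - k)" using k by (simp add: power_add[symmetric])
  have one: "(\<Sum>t\<in>{0..<(2::int) ^ n}. length (filter (\<lambda>E. f E = (t - s) mod 2 ^ k) Cs)) = length Cs * 2 ^ (n - k)"
    if "\<And>E. E \<in> set Cs \<Longrightarrow> 0 \<le> f E \<and> f E < 2 ^ k" for f :: "int \<Rightarrow> int" and s and Cs
    using that
  proof (induction Cs)
    case (Cons E Cs)
    have "{t \<in> {0..<(2::int) ^ n}. f E = (t - s) mod 2 ^ k} = {t \<in> {0..<2 ^ n}. t mod 2 ^ k = (f E + s) mod 2 ^ k}"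
    proof (intro Collect_cong conj_cong refl)
      fix t :: int
      have f: "f E mod 2 ^ k = f E" using Cons.prems[of E] by simp
      show "f E = (t - s) mod 2 ^ k \<longleftrightarrow> t mod 2 ^ k = (f E + s) mod 2 ^ k"
      proof
        assume "f E = (t - s) mod 2 ^ k"
        then have "(f E + s) mod 2 ^ k = ((t - s) + s) mod 2 ^ k" by (metis mod_add_left_eq)
        then show "t mod 2 ^ k = (f E + s) mod 2 ^ k" by simp
      next
        assume "t mod 2 ^ k = (f E + s) mod 2 ^ k"
        then have "(t - s) mod 2 ^ k = (f E + s - s) mod 2 ^ k" by (metis mod_diff_left_eq)
        then show "f E = (t - s) mod 2 ^ k" using f by simp
      qed
    qed simp
    then have "card {t \<in> {0..<(2::int) ^ n}. f E = (t - s) mod 2 ^ k} = 2 ^ (n - k)"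
      using count_mod[of "2 ^ k" "(f E + s) mod 2 ^ k" "2 ^ (n - k)"] by (simp add: M nat_power_eq)
    moreover have "(\<Sum>t\<in>{0..<(2::int) ^ n}. length (filter (\<lambda>E. f E = (t - s) mod 2 ^ k) (E # Cs)))
       = (\<Sum>t\<in>{0..<(2::int) ^ n}. (if f E = (t - s) mod 2 ^ k then 1 else 0) + length (filter (\<lambda>E. f E = (t - s) mod 2 ^ k) Cs))"
      by (rule sum.cong) auto
    ultimately show ?case using Cons by (simp add: sum.distrib sum.If_cases Int_def)
  qed simp
  have hr: "0 \<le> h \<alpha> (W k) E \<and> h \<alpha> (W k) E < 2 ^ k" for E
  proof -
    have "\<alpha> * wv n E mod Q < W k * 2 ^ k" using W_Q[OF k] QY by simp
    then show ?thesis using zdiv_less[OF W_pos[OF k]] W_pos[OF k] QY by (simp add: pos_imp_zdiv_nonneg_iff hh_def)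
  qed
  have "(\<Sum>t\<in>{0..<(2::int) ^ n}. length (bk \<alpha> (W k) (dv (lev (chR x n ty) n)) (rr \<alpha> (W k) (2 ^ k) t Ls i))) = lR * 2 ^ (n - k)" for Ls i
    using one[of "dv (lev (chR x n ty) n)" "h \<alpha> (W k)" "int (i mod 2) + h \<alpha> (W k) (Ls ! (i div 2))"] hr
    by (simp add: bk_def rr_def lR_def dv_def diff_diff_eq)
  then show ?thesis unfolding extra_def by (subst sum.swap) simp
qed

text \<open>At least half of the multipliers are good. For these, 1/32 of the targets hit, and by
  Markov's inequality at most 1/64 of the targets exceed 64 times the average join size, so 1/64 of
  them hit at acceptable cost.\<close>

lemma hit_count:
  "2 ^ n * Q \<le> 128 * int (card {(t, \<alpha>). t \<in> {0..<2 ^ n} \<and> \<alpha> \<in> {0..<Q} \<and> hit ty k z t \<alpha> \<and>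
     2 ^ k * (pairs ty k z t \<alpha> 0 + pairs ty k z t \<alpha> 1) \<le> 2 ^ k * (2 * (lV 0 + lV 1)) + 128 * (lV 0 + lV 1) * lR})"
  (is "_ \<le> 128 * int (card ?G)")
proof -
  \<comment> \<open>This is 64 times the average of \<open>?e \<alpha> t\<close> over the targets
    \<open>t\<close>, by \<open>extra_sum\<close>.\<close>
  define B where "B = 128 * (lV 0 + lV 1) * lR"
  let ?e = "\<lambda>\<alpha> t. 2 ^ k * (extra t \<alpha> 0 + extra t \<alpha> 1)"
  define G where "G \<alpha> = {t \<in> {0..<(2::int) ^ n}. hit ty k z t \<alpha> \<and> ?e \<alpha> t \<le> B}" for \<alpha>
  define GA where "GA = {\<alpha> \<in> {0..<Q}. 2 ^ k \<le> 32 * card (Im \<alpha>)}"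
  have N: "(2::nat) ^ n = 2 ^ k * 2 ^ (n - k)" using k by (simp add: power_add[symmetric])
  have fG: "finite (G \<alpha>)" for \<alpha> by (rule finite_subset[of _ "{0..<2 ^ n}"]) (auto simp: G_def)
  have mem0: "pv x n n dA + zc ty 0 n dA \<in> set (lev (chV x n ty (int k) z 0) n)" using levV_mem[OF dA, of n] by simp
  have l0: "0 < lV 0" unfolding lV_def using length_pos_if_in_set[OF mem0] .
  have mem1: "pv x n n (eA {}) \<in> set (lev (chR x n ty) n)" by (rule levR_mem[OF eAB(1)])
  have lR0: "0 < lR" unfolding lR_def using length_pos_if_in_set[OF mem1] .
  have each: "2 ^ n \<le> 64 * card (G \<alpha>)" if a: "\<alpha> \<in> GA" for \<alpha>
  proof -
    let ?bad = "{t \<in> {0..<(2::int) ^ n}. B < ?e \<alpha> t}" and ?hit = "{t \<in> {0..<(2::int) ^ n}. hit ty k z t \<alpha>}"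
    have "card ?bad * B \<le> (\<Sum>t\<in>{0..<(2::int) ^ n}. ?e \<alpha> t)" by (rule markov_count) simp
    also have "\<dots> = 2 ^ k * ((\<Sum>t\<in>{0..<(2::int) ^ n}. extra t \<alpha> 0) + (\<Sum>t\<in>{0..<(2::int) ^ n}. extra t \<alpha> 1))"
      by (simp only: sum.distrib[symmetric] sum_distrib_left)
    also have "\<dots> = 2 * ((lV 0 + lV 1) * lR) * 2 ^ n" unfolding extra_sum N by (simp add: algebra_simps)
    finally have "(64 * card ?bad) * (2 * ((lV 0 + lV 1) * lR)) \<le> 2 ^ n * (2 * ((lV 0 + lV 1) * lR))"
      by (simp add: B_def algebra_simps)
    then have bad: "64 * card ?bad \<le> 2 ^ n" using l0 lR0 by (simp only: mult_le_cancel2) simp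
    have "2 ^ k * 2 ^ (n - k) \<le> 32 * card (Im \<alpha>) * 2 ^ (n - k)" using a by (intro mult_right_mono) (auto simp: GA_def)
    then have "2 ^ n \<le> 32 * (card (Im \<alpha>) * 2 ^ (n - k))" unfolding N by simp
    then have hitc: "2 ^ n \<le> 32 * card ?hit" using hit_t_count[of \<alpha>] by linarith
    have "?hit \<subseteq> G \<alpha> \<union> ?bad" by (auto simp: G_def)
    then have "card ?hit \<le> card (G \<alpha> \<union> ?bad)"
      by (rule card_mono[rotated]) (auto simp: fG intro: finite_subset[of _ "{0..<2 ^ n}"])
    then have "card ?hit \<le> card (G \<alpha>) + card ?bad" using card_Un_le order_trans by blast
    then show ?thesis using bad hitc by linarith
  qed
  have fGA: "finite GA" by (rule finite_subset[of _ "{0..<Q}"]) (auto simp: GA_def)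
  let ?S = "Sigma GA G"
  have "prod.swap ` ?S \<subseteq> ?G"
  proof
    fix p assume "p \<in> prod.swap ` ?S"
    then obtain \<alpha> t where p: "p = (t, \<alpha>)" "\<alpha> \<in> GA" "t \<in> G \<alpha>" by auto
    have "2 ^ k * (pairs ty k z t \<alpha> 0 + pairs ty k z t \<alpha> 1) = 2 ^ k * (2 * (lV 0 + lV 1)) + ?e \<alpha> t"
      unfolding pairs_extra by (simp add: algebra_simps)
    then show "p \<in> ?G" using p by (simp add: G_def GA_def B_def)
  qed
  then have "card (prod.swap ` ?S) \<le> card ?G"
    by (rule card_mono[rotated]) (rule finite_subset[of _ "{0..<2 ^ n} \<times> {0..<Q}"], auto)
  moreover have "card (prod.swap ` ?S) = card ?S" by (rule card_image) (auto simp: inj_on_def)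
  moreover have "card ?S = (\<Sum>\<alpha>\<in>GA. card (G \<alpha>))" by (rule card_SigmaI[OF fGA]) (use fG in auto)
  moreover have "(\<Sum>\<alpha>\<in>GA. 2 ^ n) \<le> (\<Sum>\<alpha>\<in>GA. 64 * card (G \<alpha>))" by (rule sum_mono) (rule each)
  ultimately have "card GA * 2 ^ n \<le> 64 * card ?G" by (simp add: sum_distrib_left[symmetric])
  then have "int (card GA * 2 ^ n) \<le> int (64 * card ?G)" by (simp only: of_nat_le_iff)
  then have "int (card GA) * 2 ^ n * 2 \<le> 128 * int (card ?G)" by simp
  moreover have "Q * 2 ^ n \<le> (2 * int (card GA)) * 2 ^ n" using good_alpha unfolding GA_def by (intro mult_right_mono) auto
  moreover have "(2 * int (card GA)) * 2 ^ n = int (card GA) * 2 ^ n * 2" by simp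
  moreover have "2 ^ n * Q = Q * 2 ^ n" by (rule mult.commute)
  ultimately show ?thesis by (simp only:)
qed

end

section \<open>Precomputation and verification of candidates\<close>

abbreviation (input) "vRR \<equiv> 9 :: nat"
abbreviation (input) "vcap \<equiv> 19 :: nat"
abbreviation (input) "vx1 \<equiv> 21 :: nat"
abbreviation (input) "vx2 \<equiv> 22 :: nat"
abbreviation (input) "vx3 \<equiv> 23 :: nat"
abbreviation (input) "vx4 \<equiv> 24 :: nat"

text \<open>The sum of squares replaces the sum of absolute values: over the integers it is an upper
  bound, and it is computed without a sign test. The powers of 17 and 10 serve to compute
  \<open>B\<close>.\<close>

definition prelude_body :: st where
  "prelude_body = (Asg vx3 (Inp (V vi)) ;; Asg vx4 (V vx4 [+] V vx3 [*] V vx3) ;; Asg vp2 (V vp2 [*] N 2) ;;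
     Asg vp3 (V vp3 [*] N 3) ;; Asg vx1 (V vx1 [*] N 17) ;; Asg vx2 (V vx2 [*] N 10) ;; Asg vi (V vi [+] N 1))"

definition prelude_consts :: st where
  "prelude_consts = (Asg vB (V vx1 [div] V vx2) ;; Asg vp4 (V vp2 [*] V vp2) ;; Asg vN1 (V vN [+] N 1) ;;
     Asg vQ (V vx4 [*] V vp2) ;; Asg vG (N 2 [*] V vp3) ;;
     Asg vRR (V vN1 [*] V vN1 [*] V vp2 [*] V vp4 [*] V vQ) ;; Asg vcap (N 1) ;; Asg vL (N 0))"

text \<open>Finds the number of coin flips per sample, the least \<open>L\<close> with
  \<open>RR \<le> 2 ^ L\<close>. A uniform sample then falls below \<open>RR\<close> with
  probability at least 1/2.\<close>

definition prelude_cap :: st where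
  "prelude_cap = Whl (V vcap [<] V vRR) (Asg vcap (V vcap [*] N 2) ;; Asg vL (V vL [+] N 1))"

text \<open>Round \<open>j\<close> works in the residue class \<open>n + j\<close> modulo
  \<open>str = n + B + 2\<close>. For \<open>j\<close> up to \<open>B\<close> these classes are
  distinct and avoid the input cells.\<close>

definition prelude_last :: st where
  "prelude_last = (Asg vka (N 1) ;; Asg vstr (V vN [+] V vB [+] N 2) ;; Asg vkk (V vN [+] N 1) ;;
     Asg vfuel (V vB) ;; Asg vfound (N 0) ;; Asg vgo (N 1))"

definition prelude :: st where
  "prelude = ((Asg vi (N 0) ;; Asg vx4 (N 1) ;; Asg vp2 (N 1) ;; Asg vp3 (N 1) ;; Asg vx1 (N 1) ;; Asg vx2 (N 1)) ;;
     Whl (V vN [-] V vi) prelude_body ;; prelude_consts ;; prelude_cap ;; prelude_last)"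

definition digit_step :: st where
  "digit_step = (Asg vx4 ((V vx1 [+] N 1) [mod] N 3 [-] N 1) ;; Asg vx1 ((V vx1 [+] N 1) [div] N 3))"

definition next_try :: st where
  "next_try = (Asg vka (V vka [+] N 1) ;; Asg vkk (V vkk [+] N 1) ;; Asg vfuel (V vB [div] V vka) ;;
     Asg vgo (V vka [<] V vB [+] N 1))"

definition accept :: st where
  "accept = ((Asg vi (N 0) ;; Asg vx1 (V vcand)) ;;
     Whl (V vN [-] V vi) (digit_step ;; Wr (V vi) (V vx4) ;; Asg vi (V vi [+] N 1)) ;;
     (Asg vfound (N 1) ;; Asg vgo (N 0)))"

definition check :: st where
  "check = ((Asg vi (N 0) ;; Asg vx1 (V vcand) ;; Asg vx2 (N 0) ;; Asg vx3 (N 0)) ;;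
     Whl (V vN [-] V vi) (digit_step ;; Asg vx2 (V vx2 [+] V vx4 [*] Inp (V vi)) ;;
        Asg vx3 (V vx3 [+] V vx4 [*] V vx4) ;; Asg vi (V vi [+] N 1)) ;;
     Ite (V vx3) (Ite (V vx2) next_try accept) next_try)"

section \<open>Balanced ternary digits of a candidate\<close>

fun rv :: "int \<Rightarrow> nat \<Rightarrow> int" where
  "rv v 0 = v"
| "rv v (Suc i) = (rv v i + 1) div 3"

definition dgt :: "int \<Rightarrow> nat \<Rightarrow> int" where "dgt v i = (rv v i + 1) mod 3 - 1"

lemma dgt_range: "dgt v i \<in> {-1, 0, 1}"
proof -
  have "(rv v i + 1) mod 3 \<in> {0, 1, 2}" using pos_mod_bound[of 3 "rv v i + 1"] pos_mod_sign[of 3 "rv v i + 1"] by auto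
  then show ?thesis by (auto simp: dgt_def)
qed

lemma rv_bound: "0 \<le> v \<Longrightarrow> 0 \<le> rv v i \<and> rv v i \<le> v"
proof (induction i)
  case (Suc i)
  then have "0 \<le> (rv v i + 1) div 3" "(rv v i + 1) div 3 \<le> v" by linarith+
  then show ?case by simp
qed simp

text \<open>Reducing the code modulo \<open>2 * 3 ^ n\<close> makes it nonnegative and changes it by
  a multiple of \<open>3 ^ n\<close>, which does not affect the lowest \<open>n\<close>
  digits.\<close>

lemma dgt_cd:
  assumes c: "dig c" and v: "v = cd n c mod (2 * 3 ^ n)" and i: "i < n"
  shows "dgt v i = c i"
proof -
  have c3: "c l \<in> {-1, 0, 1}" for l using c by (simp add: dig_def)
  have "\<exists>m. rv v i = (\<Sum>l=i..<n. c l * 3 ^ (l - i)) + 3 ^ (n - i) * m" if "i \<le> n" for i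
    using that
  proof (induction i)
    case 0
    have "v = cd n c + 3 ^ n * (2 * (- (cd n c div (2 * 3 ^ n))))"
      unfolding v using mult_div_mod_eq[of "2 * 3 ^ n" "cd n c"] by (simp add: algebra_simps)
    then show ?case
      by (intro exI[of _ "2 * (- (cd n c div (2 * 3 ^ n)))"]) (simp add: cd_def atLeast0LessThan)
  next
    case (Suc i)
    then obtain m where m: "rv v i = (\<Sum>l=i..<n. c l * 3 ^ (l - i)) + 3 ^ (n - i) * m" by auto
    have s: "(\<Sum>l=i..<n. c l * 3 ^ (l - i)) = c i + 3 * (\<Sum>l=Suc i..<n. c l * 3 ^ (l - Suc i))"
    proof -
      have "(\<Sum>l=i..<n. c l * 3 ^ (l - i)) = c i + (\<Sum>l=Suc i..<n. c l * 3 ^ (l - i))"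
        using Suc.prems by (subst sum.atLeast_Suc_lessThan) auto
      also have "(\<Sum>l=Suc i..<n. c l * 3 ^ (l - i)) = 3 * (\<Sum>l=Suc i..<n. c l * 3 ^ (l - Suc i))"
        unfolding sum_distrib_left by (rule sum.cong) (auto simp: power_Suc[symmetric] Suc_diff_Suc simp del: power_Suc)
      finally show ?thesis .
    qed
    have p: "(3::int) ^ (n - i) = 3 * 3 ^ (n - Suc i)" using Suc.prems
      by (metis Suc_diff_Suc Suc_le_lessD power_Suc)
    let ?r = "(\<Sum>l=Suc i..<n. c l * 3 ^ (l - Suc i)) + 3 ^ (n - Suc i) * m"
    have e: "rv v i + 1 = (c i + 1) + 3 * ?r" unfolding m s p by (simp add: algebra_simps)
    have "(c i + 1) div 3 = 0" using c3[of i] by auto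
    then have "rv v (Suc i) = ?r" using e by simp
    then show ?case by blast
  qed
  from this[of i] i obtain m where m: "rv v i = (\<Sum>l=i..<n. c l * 3 ^ (l - i)) + 3 ^ (n - i) * m" by auto
  have s: "(\<Sum>l=i..<n. c l * 3 ^ (l - i)) = c i + 3 * (\<Sum>l=Suc i..<n. c l * 3 ^ (l - Suc i))"
  proof -
    have "(\<Sum>l=i..<n. c l * 3 ^ (l - i)) = c i + (\<Sum>l=Suc i..<n. c l * 3 ^ (l - i))"
      using i by (subst sum.atLeast_Suc_lessThan) auto
    also have "(\<Sum>l=Suc i..<n. c l * 3 ^ (l - i)) = 3 * (\<Sum>l=Suc i..<n. c l * 3 ^ (l - Suc i))"
      unfolding sum_distrib_left by (rule sum.cong) (auto simp: power_Suc[symmetric] Suc_diff_Suc simp del: power_Suc)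
    finally show ?thesis .
  qed
  have p: "(3::int) ^ (n - i) = 3 * 3 ^ (n - Suc i)" using i
    by (metis Suc_diff_Suc power_Suc)
  have e: "rv v i + 1 = (c i + 1) + 3 * ((\<Sum>l=Suc i..<n. c l * 3 ^ (l - Suc i)) + 3 ^ (n - Suc i) * m)"
    unfolding m s p by (simp add: algebra_simps)
  have "(rv v i + 1) mod 3 = (c i + 1) mod 3" unfolding e by (rule mod_mult_self2)
  moreover have "(c i + 1) mod 3 = c i + 1" using c3[of i] by auto
  ultimately show ?thesis by (simp add: dgt_def)
qed

lemma abs_le_square_int: "\<bar>a\<bar> \<le> a * a" for a :: int
proof (cases "a = 0")
  case False
  then have "\<bar>a\<bar> * 1 \<le> \<bar>a\<bar> * \<bar>a\<bar>" by (intro mult_left_mono) auto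
  then show ?thesis by simp
qed simp

text \<open>With stride 1 and offset 0 virtual and machine addresses coincide. In this instance the
  prelude reads the input and the check writes the answer.\<close>

locale io = jlog H 1 0 Y \<Gamma> for H Y :: int and \<Gamma> +
  fixes n :: nat and x :: "nat \<Rightarrow> int" and S :: int
  assumes S: "S = 1 + (\<Sum>l<n. x l * x l)"
    and YA: "64 ^ (n + 1) * S \<le> Y"
    and \<Gamma>: "\<Gamma> = {0..<int n}"
begin

definition B :: int where "B = 17 ^ n div 10 ^ n"
definition Lb :: nat where
  "Lb = (LEAST i. (int n + 1) * (int n + 1) * 2 ^ n * 4 ^ n * (S * 2 ^ n) \<le> 2 ^ i)"
definition RR :: int where "RR = (int n + 1) * (int n + 1) * 2 ^ n * 4 ^ n * (S * 2 ^ n)"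

lemma S_partial: "i \<le> n \<Longrightarrow> 1 + (\<Sum>l<i. x l * x l) \<le> S" "1 \<le> 1 + (\<Sum>l<i. x l * x l)"
proof -
  show "1 \<le> 1 + (\<Sum>l<i. x l * x l)" by (simp add: sum_nonneg)
  assume "i \<le> n"
  then have "(\<Sum>l<i. x l * x l) \<le> (\<Sum>l<n. x l * x l)" by (intro sum_mono2) auto
  then show "1 + (\<Sum>l<i. x l * x l) \<le> S" using S by simp
qed

lemma S1: "1 \<le> S" using S_partial(2)[of n] S by simp

lemma x_le: "l < n \<Longrightarrow> \<bar>x l\<bar> \<le> S" "l < n \<Longrightarrow> x l * x l \<le> S"
proof -
  assume l: "l < n"
  have "x l * x l \<le> (\<Sum>l<n. x l * x l)" using l by (intro member_le_sum) auto
  then show 1: "x l * x l \<le> S" using S by simp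
  show "\<bar>x l\<bar> \<le> S" using 1 abs_le_square_int[of "x l"] by linarith
qed

lemma Yb: "64 ^ (n + 1) \<le> Y" "S \<le> Y"
proof -
  have "64 ^ (n + 1) * 1 \<le> 64 ^ (n + 1) * S" using S1 by (intro mult_left_mono) auto
  then show "64 ^ (n + 1) \<le> Y" using YA by linarith
  have "1 \<le> (64::int) ^ (n + 1)" by (rule one_le_power) simp
  then have "1 * S \<le> 64 ^ (n + 1) * S" using S1 by (intro mult_right_mono) auto
  then show "S \<le> Y" using YA by linarith
qed

lemma powY: "b \<le> 64 \<Longrightarrow> 0 \<le> b \<Longrightarrow> i \<le> n \<Longrightarrow> b ^ i * 64 \<le> Y" for b :: int
proof -
  assume b: "b \<le> 64" "0 \<le> b" "i \<le> n"
  have "b ^ i \<le> 64 ^ i" using b by (intro power_mono) auto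
  also have "(64::int) ^ i \<le> 64 ^ n" using b by (intro power_increasing) auto
  finally have "b ^ i * 64 \<le> 64 ^ n * 64" by simp
  then show ?thesis using Yb by simp
qed

lemma n_le: "int n + 1 \<le> 2 ^ n"
  using less_exp[of n] by (metis Suc_eq_plus1 Suc_leI of_nat_1 of_nat_add of_nat_le_iff of_nat_numeral of_nat_power)

text \<open>\<open>(n + 1)\<^sup>2 \<le> 2 ^ n * 2 ^ n\<close> bounds \<open>RR\<close> by
  \<open>64 ^ n * S\<close>; this is the origin of the base 64 in \<open>YA\<close>.\<close>

lemma RR_Y: "64 * RR \<le> Y" "0 < RR"
proof -
  have "(int n + 1) * (int n + 1) \<le> 2 ^ n * 2 ^ n" using n_le by (intro mult_mono) auto
  then have "(int n + 1) * (int n + 1) * (2 ^ n * 4 ^ n * 2 ^ n * S) \<le> 2 ^ n * 2 ^ n * (2 ^ n * 4 ^ n * 2 ^ n * S)"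
    using S1 by (intro mult_right_mono) auto
  also have "2 ^ n * 2 ^ n * (2 ^ n * 4 ^ n * 2 ^ n * S) = (2 ^ n * 2 ^ n * 2 ^ n * 4 ^ n * 2 ^ n) * S" by (simp only: mult_ac)
  also have "(2::int) ^ n * 2 ^ n * 2 ^ n * 4 ^ n * 2 ^ n = 64 ^ n" by (simp add: power_mult_distrib[symmetric])
  finally have "RR \<le> 64 ^ n * S" unfolding RR_def by (simp only: mult_ac)
  then show "64 * RR \<le> Y" using YA by simp
  show "0 < RR" unfolding RR_def using S1 by simp
qed

lemma B1: "1 \<le> B" "B * 64 \<le> Y"
proof -
  have "(10::int) ^ n \<le> 17 ^ n" by (rule power_mono) auto
  then have "(10::int) ^ n div 10 ^ n \<le> B" unfolding B_def by (rule zdiv_mono1) simp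
  then show "1 \<le> B" by simp
  have "\<bar>B\<bar> \<le> \<bar>17 ^ n\<bar>" unfolding B_def by (rule abs_div_le)
  then have "B \<le> 17 ^ n" by simp
  then show "B * 64 \<le> Y" using powY[of 17 n] by simp
qed

definition glob :: "int \<Rightarrow> (nat \<Rightarrow> int) \<Rightarrow> bool" where
  "glob j va \<longleftrightarrow> va vN = int n \<and> va vp2 = 2 ^ n \<and> va vp3 = 3 ^ n \<and> va vp4 = 4 ^ n \<and> va vN1 = int n + 1 \<and>
     va vQ = S * 2 ^ n \<and> va vG = 2 * 3 ^ n \<and> va vB = B \<and> va vL = int Lb \<and> va vstr = int n + B + 2 \<and>
     va vka = j \<and> va vkk = int n + j \<and> va vfuel = B div j"

lemma Lb: "RR \<le> 2 ^ Lb" "i < Lb \<Longrightarrow> 2 ^ i < RR" "2 ^ Lb \<le> 2 * RR"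
proof -
  have Lb': "Lb = (LEAST i. RR \<le> 2 ^ i)" by (simp add: Lb_def RR_def)
  have "int (nat RR) \<le> int (2 ^ nat RR)" using less_exp[of "nat RR"] by (simp only: of_nat_le_iff less_imp_le)
  then have "RR \<le> 2 ^ nat RR" using RR_Y by simp
  then show "RR \<le> 2 ^ Lb" unfolding Lb' by (rule LeastI)
  have l: "2 ^ i < RR" if "i < Lb" for i using not_less_Least[of i "\<lambda>i. RR \<le> 2 ^ i"] that by (simp add: Lb')
  then show "i < Lb \<Longrightarrow> 2 ^ i < RR" .
  show "2 ^ Lb \<le> 2 * RR"
  proof (cases Lb)
    case 0
    then show ?thesis using RR_Y by simp
  next
    case (Suc i)
    then show ?thesis using l[of i] by simp
  qed
qed

lemma prelude_correct:
  assumes v0: "va vN = int n" and inp: "\<forall>l<n. me (int l) = x l"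
  shows "J prelude va me (n + Lb) (\<lambda>va' me'. me' = me \<and> va' vgo = 1 \<and> va' vfound = 0 \<and>
     glob 1 va' \<and> (\<forall>v. 45 \<le> v \<longrightarrow> va' v = va v))"
proof -
  define Fr where "Fr va' \<longleftrightarrow> (\<forall>v. 45 \<le> v \<longrightarrow> va' v = va v) \<and> va' vN = int n" for va'
  define Inv where "Inv i va' me' \<longleftrightarrow> me' = me \<and> Fr va' \<and> va' vi = int i \<and> va' vx4 = 1 + (\<Sum>l<i. x l * x l) \<and>
    va' vp2 = 2 ^ i \<and> va' vp3 = 3 ^ i \<and> va' vx1 = 17 ^ i \<and> va' vx2 = 10 ^ i" for i va' me'
  have 1: "J (Asg vi (N 0) ;; Asg vx4 (N 1) ;; Asg vp2 (N 1) ;; Asg vp3 (N 1) ;; Asg vx1 (N 1) ;; Asg vx2 (N 1)) va me 0 (Inv 0)"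
    using Y64 v0 by (intro wp_J) (auto simp: Inv_def Fr_def)
  have step: "J prelude_body va' me' 0 (Inv (Suc i))" if i: "i < n" and I: "Inv i va' me'" for i va' me'
  proof -
    have g: "int i \<in> \<Gamma>" using i \<Gamma> by simp
    have m: "me' (int i) = x i" using I inp i by (simp add: Inv_def)
    have s: "1 + (\<Sum>l<i. x l * x l) + x i * x i = 1 + (\<Sum>l<Suc i. x l * x l)" by simp
    have b: "\<bar>x i\<bar> \<le> Y" "\<bar>1 + (\<Sum>l<Suc i. x l * x l)\<bar> \<le> Y" "\<bar>2 ^ Suc i\<bar> \<le> Y" "\<bar>3 ^ Suc i\<bar> \<le> Y" "\<bar>17 ^ Suc i\<bar> \<le> Y"
      "\<bar>10 ^ Suc i\<bar> \<le> Y" "\<bar>int i + 1\<bar> \<le> Y"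
    proof -
      show "\<bar>x i\<bar> \<le> Y" using x_le(1)[OF i] Yb by linarith
      show "\<bar>1 + (\<Sum>l<Suc i. x l * x l)\<bar> \<le> Y" using S_partial[of "Suc i"] i Yb by linarith
      have p: "\<bar>b ^ Suc i\<bar> \<le> Y" if "0 \<le> b" "b \<le> 64" for b :: int
      proof -
        have "0 \<le> b ^ Suc i" using that by simp
        then show ?thesis using powY[of b "Suc i"] that i by linarith
      qed
      show "\<bar>2 ^ Suc i\<bar> \<le> Y" "\<bar>3 ^ Suc i\<bar> \<le> Y" "\<bar>17 ^ Suc i\<bar> \<le> Y" "\<bar>10 ^ Suc i\<bar> \<le> Y"
        by (rule p; simp)+
      show "\<bar>int i + 1\<bar> \<le> Y" using i n_le powY[of 2 n] by simp
    qed
    have vs: "va' vi = int i" "va' vx4 = 1 + (\<Sum>l<i. x l * x l)" "va' vp2 = 2 ^ i" "va' vp3 = 3 ^ i" "va' vx1 = 17 ^ i" "va' vx2 = 10 ^ i"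
      using I by (auto simp: Inv_def)
    show ?thesis
      unfolding prelude_body_def
      apply (rule wp_J, unfold wp.simps(4))
      apply (rule wp_AsgI[where y = "x i"], simp add: vs g, simp, simp add: vs m, rule b)
      apply (rule wp_AsgI[where y = "1 + (\<Sum>l<Suc i. x l * x l)"], simp, simp, simp add: vs add.assoc, rule b)
      apply (rule wp_AsgI[where y = "2 ^ Suc i"], simp, simp, simp add: vs, rule b)
      apply (rule wp_AsgI[where y = "3 ^ Suc i"], simp, simp, simp add: vs, rule b)
      apply (rule wp_AsgI[where y = "17 ^ Suc i"], simp, simp, simp add: vs, rule b)
      apply (rule wp_AsgI[where y = "10 ^ Suc i"], simp, simp, simp add: vs, rule b)
      apply (rule wp_AsgI[where y = "int i + 1"], simp, simp, simp add: vs, rule b)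
      using I by (simp add: Inv_def Fr_def)
  qed
  have 2: "J (Whl (V vN [-] V vi) prelude_body) va1 me1 n (Inv n)" if "Inv 0 va1 me1" for va1 me1
  proof -
    have "J (Whl (V vN [-] V vi) prelude_body) va1 me1 (\<Sum>i<n. Suc 0) (Inv n)"
      by (rule J_Whl[where Inv = Inv and f = "\<lambda>_. 0"]) (use that step in \<open>auto simp: Inv_def Fr_def\<close>)
    then show ?thesis by simp
  qed
  define P where "P va' me' \<longleftrightarrow> me' = me \<and> Fr va' \<and> va' vp2 = 2 ^ n \<and> va' vp3 = 3 ^ n \<and> va' vp4 = 4 ^ n \<and> va' vN1 = int n + 1 \<and>
     va' vQ = S * 2 ^ n \<and> va' vG = 2 * 3 ^ n \<and> va' vB = B \<and> va' vRR = RR" for va' me'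
  define Inv2 where "Inv2 i va' me' \<longleftrightarrow> P va' me' \<and> va' vcap = 2 ^ i \<and> va' vL = int i" for i va' me'
  have 3: "J prelude_consts va1 me1 0 (Inv2 0)" if I: "Inv n va1 me1" for va1 me1
  proof -
    have vs: "va1 vN = int n" "va1 vx4 = S" "va1 vp2 = 2 ^ n" "va1 vp3 = 3 ^ n" "va1 vx1 = 17 ^ n" "va1 vx2 = 10 ^ n"
      using I S by (auto simp: Inv_def Fr_def)
    have q: "2 ^ n * S \<le> RR"
    proof -
      have "1 * 1 * (1 * 1) \<le> (int n + 1) * (int n + 1) * (2 ^ n * 4 ^ n)" by (intro mult_mono) auto
      then have "1 * 1 * (1 * 1) * (2 ^ n * S) \<le> (int n + 1) * (int n + 1) * (2 ^ n * 4 ^ n) * (2 ^ n * S)"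
        using S1 by (intro mult_right_mono) auto
      then show ?thesis by (simp add: RR_def mult_ac)
    qed
    have b: "\<bar>B\<bar> \<le> Y" "\<bar>4 ^ n\<bar> \<le> Y" "\<bar>int n + 1\<bar> \<le> Y" "\<bar>S * 2 ^ n\<bar> \<le> Y" "\<bar>2 * 3 ^ n\<bar> \<le> Y" "\<bar>RR\<bar> \<le> Y"
      using B1 powY[of 4 n] powY[of 3 n] powY[of 2 n] n_le RR_Y q S1 by (auto simp: mult.commute[of S])
    have f: "(2::int) ^ n * 2 ^ n = 4 ^ n" by (simp add: power_mult_distrib[symmetric])
    show ?thesis
      unfolding prelude_consts_def
      apply (rule wp_J, unfold wp.simps(4))
      apply (rule wp_AsgI[where y = B], simp, simp, simp add: vs B_def, rule b)
      apply (rule wp_AsgI[where y = "4 ^ n"], simp, simp, simp add: vs f, rule b)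
      apply (rule wp_AsgI[where y = "int n + 1"], simp, simp, simp add: vs, rule b)
      apply (rule wp_AsgI[where y = "S * 2 ^ n"], simp, simp, simp add: vs, rule b)
      apply (rule wp_AsgI[where y = "2 * 3 ^ n"], simp, simp, simp add: vs, rule b)
      apply (rule wp_AsgI[where y = RR], simp, simp, simp add: vs RR_def, rule b)
      apply (rule wp_AsgI[where y = 1], simp, simp, simp, use Y64 in simp)
      apply (rule wp_AsgI[where y = 0], simp, simp, simp, use Y64 in simp)
      using I vs by (simp add: Inv_def Inv2_def P_def Fr_def)
  qed
  have 4: "J prelude_cap va1 me1 Lb (Inv2 Lb)" if "Inv2 0 va1 me1" for va1 me1
  proof -
    have "J prelude_cap va1 me1 (\<Sum>i<Lb. Suc 0) (Inv2 Lb)"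
      unfolding prelude_cap_def
    proof (rule J_Whl[where Inv = Inv2 and f = "\<lambda>_. 0"])
      fix i va' me' assume i: "i < Lb" "Inv2 i va' me'"
      have c: "2 ^ i < RR" using Lb(2) i by simp
      have "int i + 1 \<le> 2 ^ i" using less_exp[of i] by (metis Suc_eq_plus1 Suc_leI of_nat_1 of_nat_add of_nat_le_iff of_nat_numeral of_nat_power)
      then have "int i + 1 \<le> Y" "2 * 2 ^ i \<le> Y" using c RR_Y by linarith+
      then have "J (Asg vcap (V vcap [*] N 2) ;; Asg vL (V vL [+] N 1)) va' me' 0 (Inv2 (Suc i))"
        using i by (intro wp_J) (auto simp: Inv2_def P_def Fr_def)
      then show "evv (V vcap [<] V vRR) va' me' \<noteq> 0 \<and> okI (V vcap [<] V vRR) va' me' \<and>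
         J (Asg vcap (V vcap [*] N 2) ;; Asg vL (V vL [+] N 1)) va' me' 0 (Inv2 (Suc i))"
        using c i by (simp add: Inv2_def P_def)
    qed (use that Lb in \<open>auto simp: Inv2_def P_def\<close>)
    then show ?thesis by simp
  qed
  have 5: "J prelude_last va1 me1 0 (\<lambda>va' me'. me' = me \<and> va' vgo = 1 \<and> va' vfound = 0 \<and>
     glob 1 va' \<and> (\<forall>v. 45 \<le> v \<longrightarrow> va' v = va v))" if I: "Inv2 Lb va1 me1" for va1 me1
  proof -
    have vs: "va1 vN = int n" "va1 vB = B" using I by (auto simp: Inv2_def P_def Fr_def)
    have b: "\<bar>int n + B + 2\<bar> \<le> Y" "\<bar>int n + 1\<bar> \<le> Y" "\<bar>B\<bar> \<le> Y" using B1 n_le powY[of 2 n] by auto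
    show ?thesis
      unfolding prelude_last_def
      apply (rule wp_J, unfold wp.simps(4))
      apply (rule wp_AsgI[where y = 1], simp, simp, simp, use Y64 in simp)
      apply (rule wp_AsgI[where y = "int n + B + 2"], simp, simp, simp add: vs, rule b)
      apply (rule wp_AsgI[where y = "int n + 1"], simp, simp, simp add: vs, rule b)
      apply (rule wp_AsgI[where y = B], simp, simp, simp add: vs, rule b)
      apply (rule wp_AsgI[where y = 0], simp, simp, simp, use Y64 in simp)
      apply (rule wp_AsgI[where y = 1], simp, simp, simp, use Y64 in simp)
      using I by (auto simp: Inv2_def P_def Fr_def glob_def)
  qed
  note s4 = J_Sq[OF J_conseq[OF 4 order_refl 5]]
  note s3 = J_Sq[OF J_conseq[OF 3 order_refl s4]]
  note s2 = J_Sq[OF J_conseq[OF 2 order_refl s3]]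
  note s1 = J_Sq[OF J_conseq[OF 1 order_refl s2]]
  show ?thesis unfolding prelude_def by (rule J_conseq[OF s1]) auto
qed

definition acc :: "int \<Rightarrow> bool" where
  "acc v \<longleftrightarrow> (\<Sum>i<n. dgt v i * dgt v i) \<noteq> 0 \<and> (\<Sum>i<n. dgt v i * x i) = 0"

lemma J_digit:
  assumes "va vx1 = rv v i" "0 \<le> v" "v \<le> Y - 2"
  shows "J digit_step va me 0 (\<lambda>va' me'. me' = me \<and> va' = va(vx4 := dgt v i, vx1 := rv v (Suc i)))"
proof -
  have b: "\<bar>dgt v i\<bar> \<le> Y" "\<bar>rv v (Suc i)\<bar> \<le> Y" using dgt_range[of v i] Y64 rv_bound[of v "Suc i"] assms by auto
  show ?thesis
    unfolding digit_step_def
    apply (rule wp_J, unfold wp.simps(4))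
    apply (rule wp_AsgI[where y = "dgt v i"], simp, simp, simp add: assms dgt_def, rule b)
    apply (rule wp_AsgI[where y = "rv v (Suc i)"], simp, simp, simp add: assms, rule b)
    by simp
qed

text \<open>The digits of any candidate in range are tested against the input before they are
  accepted. The validity of the answer thus does not rest on the core having worked as
  intended.\<close>

lemma check_correct:
  assumes g: "glob j va" and j: "1 \<le> j" "j \<le> B" and inp: "\<forall>l<n. me (int l) = x l"
    and v: "va vcand = v" "0 \<le> v" "v < 2 * 3 ^ n"
  shows "J check va me (2 * n) (\<lambda>va' me'. if acc v
     then va' vgo = 0 \<and> va' vfound = 1 \<and> (\<forall>i<n. me' (int i) = dgt v i)
     else me' = me \<and> glob (j + 1) va' \<and> va' vfound = va vfound \<and> va' vgo = (if j < B then 1 else 0) \<and> (\<forall>v. 45 \<le> v \<longrightarrow> va' v = va v))"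
    (is "J check va me (2 * n) ?P")
proof -
  have "1 \<le> (3::int) ^ n" by simp
  then have vY: "v \<le> Y - 2" using v(3) powY[of 3 n] by linarith
  define Fr where "Fr va' \<longleftrightarrow> (\<forall>v. v \<notin> {vi, vx1, vx2, vx3, vx4} \<longrightarrow> va' v = va v)" for va'
  define Inv where "Inv i va' me' \<longleftrightarrow> me' = me \<and> Fr va' \<and> va' vi = int i \<and> va' vx1 = rv v i \<and>
    va' vx2 = (\<Sum>l<i. dgt v l * x l) \<and> va' vx3 = (\<Sum>l<i. dgt v l * dgt v l)" for i va' me'
  have iY: "\<bar>int i + 1\<bar> \<le> Y" if "i < n" for i using that n_le powY[of 2 n] by simp
  have gn: "va vN = int n" using g by (simp add: glob_def)
  have dd: "\<bar>dgt v l\<bar> \<le> 1" for l using dgt_range[of v l] by auto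
  have 1: "J (Asg vi (N 0) ;; Asg vx1 (V vcand) ;; Asg vx2 (N 0) ;; Asg vx3 (N 0)) va me 0 (Inv 0)"
    using Y64 v vY by (intro wp_J) (auto simp: Inv_def Fr_def)
  have step: "J (digit_step ;; Asg vx2 (V vx2 [+] V vx4 [*] Inp (V vi)) ;;
        Asg vx3 (V vx3 [+] V vx4 [*] V vx4) ;; Asg vi (V vi [+] N 1)) va' me' 0 (Inv (Suc i))"
    if i: "i < n" and I: "Inv i va' me'" for i va' me'
  proof -
    have a: "va' vx1 = rv v i" using I by (simp add: Inv_def)
    \<comment> \<open>Since \<open>\<bar>a\<bar> \<le> a * a\<close> for integers, the sum of
      squares in \<open>S\<close> bounds these signed partial sums.\<close>
    have s1: "\<bar>\<Sum>l<Suc i. dgt v l * x l\<bar> \<le> Y"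
    proof -
      have "\<bar>\<Sum>l<Suc i. dgt v l * x l\<bar> \<le> (\<Sum>l<Suc i. \<bar>dgt v l * x l\<bar>)" by (rule sum_abs)
      also have "\<dots> \<le> (\<Sum>l<Suc i. x l * x l)"
      proof (rule sum_mono)
        fix l
        have "\<bar>dgt v l * x l\<bar> \<le> 1 * \<bar>x l\<bar>" unfolding abs_mult by (rule mult_right_mono) (use dd in auto)
        also have "\<dots> \<le> x l * x l" using abs_le_square_int[of "x l"] by simp
        finally show "\<bar>dgt v l * x l\<bar> \<le> x l * x l" .
      qed
      also have "\<dots> \<le> S" using S_partial(1)[of "Suc i"] i by simp
      finally show ?thesis using Yb by simp
    qed
    have s2: "\<bar>\<Sum>l<Suc i. dgt v l * dgt v l\<bar> \<le> Y"
    proof -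
      have "\<bar>\<Sum>l<Suc i. dgt v l * dgt v l\<bar> \<le> (\<Sum>l<Suc i. \<bar>dgt v l * dgt v l\<bar>)" by (rule sum_abs)
      also have "\<dots> \<le> (\<Sum>l<Suc i. 1)"
      proof (rule sum_mono)
        show "\<bar>dgt v l * dgt v l\<bar> \<le> 1" for l using dgt_range[of v l] by auto
      qed
      finally show ?thesis using iY[OF i] by simp
    qed
    have m: "me' (int i) = x i" "int i \<in> \<Gamma>" using I inp i \<Gamma> by (auto simp: Inv_def)
    show ?thesis
    proof (rule J_Sq'[OF J_conseq[OF J_digit[of va' v i, OF a v(2) vY]]])
      fix va2' me2 assume h: "me2 = me' \<and> va2' = va'(vx4 := dgt v i, vx1 := rv v (Suc i))"
      show "J (Asg vx2 (V vx2 [+] V vx4 [*] Inp (V vi)) ;; Asg vx3 (V vx3 [+] V vx4 [*] V vx4) ;; Asg vi (V vi [+] N 1)) va2' me2 0 (Inv (Suc i))"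
        apply (rule wp_J, unfold wp.simps(4))
        apply (rule wp_AsgI[where y = "\<Sum>l<Suc i. dgt v l * x l"], use h I m in \<open>simp add: Inv_def\<close>, simp,
           use h I m in \<open>simp add: Inv_def\<close>, rule s1)
        apply (rule wp_AsgI[where y = "\<Sum>l<Suc i. dgt v l * dgt v l"], simp, simp,
           use h I in \<open>simp add: Inv_def\<close>, rule s2)
        apply (rule wp_AsgI[where y = "int i + 1"], simp, simp, use h I in \<open>simp add: Inv_def\<close>, rule iY[OF i])
        using h I by (auto simp: Inv_def Fr_def)
    qed simp_all
  qed
  have 2: "J (Whl (V vN [-] V vi) (digit_step ;; Asg vx2 (V vx2 [+] V vx4 [*] Inp (V vi)) ;;
        Asg vx3 (V vx3 [+] V vx4 [*] V vx4) ;; Asg vi (V vi [+] N 1))) va1 me1 (\<Sum>i<n. Suc 0) (Inv n)"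
    if "Inv 0 va1 me1" for va1 me1
    by (rule J_Whl[where Inv = Inv and f = "\<lambda>_. 0"]) (use that step gn in \<open>auto simp: Inv_def Fr_def\<close>)
  have nt: "J next_try va1 me1 n ?P" if I: "Inv n va1 me1" and na: "\<not> acc v" for va1 me1
  proof -
    have vs: "va1 vka = j" "va1 vkk = int n + j" "va1 vB = B" "va1 vfound = va vfound"
      using I g by (auto simp: Inv_def Fr_def glob_def)
    have b: "\<bar>j + 1\<bar> \<le> Y" "\<bar>int n + j + 1\<bar> \<le> Y" using j B1 n_le powY[of 2 n] by auto
    have b2: "\<bar>B div (j + 1)\<bar> \<le> Y" using abs_div_le[of B "j + 1"] B1 by linarith
    have "J next_try va1 me1 0 ?P"
      unfolding next_try_def
      apply (rule wp_J, unfold wp.simps(4))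
      apply (rule wp_AsgI[where y = "j + 1"], simp, simp, simp add: vs, rule b)
      apply (rule wp_AsgI[where y = "int n + j + 1"], simp, simp, simp add: vs, rule b)
      apply (rule wp_AsgI[where y = "B div (j + 1)"], simp, simp, simp add: vs, rule b2)
      apply (rule wp_AsgI[where y = "if j < B then 1 else 0"], simp, simp, simp add: vs, use Y64 in simp)
      using I g vs na by (auto simp: Inv_def Fr_def glob_def)
    then show ?thesis by (rule J_conseq) auto
  qed
  define InvA where "InvA i va' me' \<longleftrightarrow> va' vN = int n \<and> va' vi = int i \<and> va' vx1 = rv v i \<and> (\<forall>l<i. me' (int l) = dgt v l)" for i va' me'
  have stepA: "J (digit_step ;; Wr (V vi) (V vx4) ;; Asg vi (V vi [+] N 1)) va' me' 0 (InvA (Suc i))"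
    if i: "i < n" and I: "InvA i va' me'" for i va' me'
  proof -
    have a: "va' vx1 = rv v i" using I by (simp add: InvA_def)
    show ?thesis
    proof (rule J_Sq'[OF J_conseq[OF J_digit[of va' v i, OF a v(2) vY]]])
      fix va2' me2 assume h: "me2 = me' \<and> va2' = va'(vx4 := dgt v i, vx1 := rv v (Suc i))"
      have "InvA (Suc i) (va2'(vi := int i + 1)) (me2(int i := dgt v i))"
        using h I by (auto simp: InvA_def less_Suc_eq)
      then show "J (Wr (V vi) (V vx4) ;; Asg vi (V vi [+] N 1)) va2' me2 0 (InvA (Suc i))"
        using h I iY[OF i] dgt_range[of v i] Y64 by (intro wp_J) (auto simp: InvA_def)
    qed simp_all
  qed
  have ac: "J accept va1 me1 n ?P" if I: "Inv n va1 me1" and na: "acc v" for va1 me1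
  proof -
    have i: "J (Asg vi (N 0) ;; Asg vx1 (V vcand)) va1 me1 0 (InvA 0)"
      using I v vY Y64 gn by (intro wp_J) (auto simp: InvA_def Inv_def Fr_def)
    have w: "J (Whl (V vN [-] V vi) (digit_step ;; Wr (V vi) (V vx4) ;; Asg vi (V vi [+] N 1))) va' me' (\<Sum>i<n. Suc 0) (InvA n)"
      if "InvA 0 va' me'" for va' me'
      by (rule J_Whl[where Inv = InvA and f = "\<lambda>_. 0"]) (use that stepA in \<open>auto simp: InvA_def\<close>)
    have f: "J (Asg vfound (N 1) ;; Asg vgo (N 0)) va' me' 0 ?P" if "InvA n va' me'" for va' me'
      using that Y64 na by (intro wp_J) (auto simp: InvA_def)
    show ?thesis unfolding accept_def
      by (rule J_conseq[OF J_Sq[OF J_conseq[OF i order_refl J_Sq[OF J_conseq[OF w order_refl f]]]]]) auto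
  qed
  have 3: "J (Ite (V vx3) (Ite (V vx2) next_try accept) next_try) va1 me1 n ?P" if I: "Inv n va1 me1" for va1 me1
  proof -
    have a: "acc v \<longleftrightarrow> va1 vx3 \<noteq> 0 \<and> va1 vx2 = 0" using I by (auto simp: acc_def Inv_def)
    show ?thesis
      by (rule J_Ite, simp, simp, rule J_Ite, simp, simp) (use nt[OF I] ac[OF I] a in auto)
  qed
  show ?thesis unfolding check_def
    by (rule J_conseq[OF J_Sq[OF J_conseq[OF 1 order_refl J_Sq[OF J_conseq[OF 2 order_refl 3]]]]]) auto
qed

end

section \<open>The machine program\<close>

fun dst :: "com \<Rightarrow> state \<Rightarrow> state" where
  "dst (SetConst i k) s = set_reg i k s"
| "dst (Op f i j k) s = set_reg i (binop_val f (reg s j) (reg s k)) s"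
| "dst (Load i j) s = set_reg i (mem s (reg s j)) s"
| "dst _ s = s"

fun newval :: "com \<Rightarrow> state \<Rightarrow> int" where
  "newval (SetConst i k) s = k"
| "newval (Op f i j k) s = binop_val f (reg s j) (reg s k)"
| "newval _ s = 0"

fun straight :: "com \<Rightarrow> bool" where
  "straight (SetConst i k) \<longleftrightarrow> True"
| "straight (Op f i j k) \<longleftrightarrow> True"
| "straight (Load i j) \<longleftrightarrow> True"
| "straight _ \<longleftrightarrow> False"

fun slb :: "int \<Rightarrow> com list \<Rightarrow> state \<Rightarrow> bool" where
  "slb X [] s \<longleftrightarrow> True"
| "slb X (c # cs) s \<longleftrightarrow> straight c \<and> \<bar>newval c s\<bar> \<le> X \<and> slb X cs (dst c s)"

lemma exc_straight:
  "wb X s \<Longrightarrow> slb X cs s \<Longrightarrow> exc (wb X) (length cs) cs s (fold dst cs s)"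
proof (induction cs arbitrary: s)
  case Nil
  then show ?case by (simp add: exc_Nil)
next
  case (Cons c cs)
  have w: "wb X (dst c s)" using Cons.prems by (cases c) (auto intro: wb_set_reg wb_load)
  have "exc (wb X) (Suc 0) [c] s (dst c s)"
    using Cons.prems w by (cases c) (auto intro!: exc_1)
  from exc_Cons[OF this Cons.IH[OF w]] Cons.prems show ?case by simp
qed

lemma exc_While_end: "reg s i = 0 \<Longrightarrow> I s \<Longrightarrow> exc I (Suc 0) [WhileNZ i b] s s"
  by (rule exc_1) auto

lemma exc_While_step:
  "reg s i \<noteq> 0 \<Longrightarrow> I s \<Longrightarrow> exc I k b s s1 \<Longrightarrow> exc I l [WhileNZ i b] s1 s2 \<Longrightarrow> exc I (Suc (k + l)) [WhileNZ i b] s s2"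
proof -
  assume h: "reg s i \<noteq> 0" "I s" "exc I k b s s1" "exc I l [WhileNZ i b] s1 s2"
  have "reach I (k + l) (b @ [WhileNZ i b] @ rest, s) (rest, s2)" for rest
    using exc_append[OF h(3,4)] by (simp add: exc_def)
  then show ?thesis unfolding exc_def using h(1,2) by (auto intro!: reach.step)
qed

lemma guar_exc: "exc I k p s s' \<Longrightarrow> guar I A S B q (rest, s') \<Longrightarrow> guar I A S (B + k) q (p @ rest, s)"
  unfolding exc_def using guar_reach by blast

section \<open>Uniform samples from coin flips\<close>

definition sample_body :: "com list" where
  "sample_body = [Coin 9, Op Add (Rg vom) (Rg vom) (Rg vom), Op Add (Rg vom) (Rg vom) 9, Op Sub 8 8 2]"

text \<open>The flips append \<open>r\<close> binary digits to \<open>w\<close>, so all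
  \<open>2 ^ r\<close> continuations are equally likely and their guarantees are averaged. The bound
  \<open>(w + 1) * 2 ^ r \<le> X\<close> is stable under appending a digit, as
  \<open>2 * w + 1 + 1 = 2 * (w + 1)\<close>.\<close>

lemma guar_sample:
  assumes "wb X s" "reg s 8 = int r" "reg s 2 = 1" "reg s (Rg vom) = w" "0 \<le> w" "(w + 1) * 2 ^ r \<le> X" "int r \<le> X" "1 \<le> X"
    and "\<And>i s'. i < 2 ^ r \<Longrightarrow> wb X s' \<Longrightarrow> mem s' = mem s \<Longrightarrow> reg s' 8 = 0 \<Longrightarrow> reg s' (Rg vom) = w * 2 ^ r + int i \<Longrightarrow>
       (\<And>v. v \<notin> {8, 9, Rg vom} \<Longrightarrow> reg s' v = reg s v) \<Longrightarrow> guar (wb X) A S B (q i) (rest, s')"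
  shows "guar (wb X) A S (B + 5 * r + 1) ((\<Sum>i<2 ^ r. q i) / 2 ^ r) (WhileNZ 8 sample_body # rest, s)"
  using assms
proof (induction r arbitrary: s w q)
  case 0
  have "guar (wb X) A S B (q 0) (rest, s)" by (rule "0.prems"(9)) (use "0.prems" in auto)
  from guar_step[of "wb X" "(WhileNZ 8 sample_body # rest, s)" "(rest, s)", OF _ _ this] "0.prems"
  show ?case by simp
next
  case (Suc r)
  let ?W = "WhileNZ 8 sample_body"
  let ?c = "(sample_body @ ?W # rest, s)"
  define s1 where "s1 b = set_reg 8 (int r) (set_reg (Rg vom) (2 * w + b) (set_reg 9 b s))" for b :: int
  have pow: "(w + 1) * 2 ^ Suc r = (2 * w + 2) * 2 ^ r" by simp
  have le: "(2 * w + 2) * 1 \<le> (2 * w + 2) * (2::int) ^ r" using Suc.prems(5) by (intro mult_left_mono) auto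
  have ex: "guar (wb X) A S (B + 5 * r + 1 + 3) ((\<Sum>i<2 ^ r. q (nat b * 2 ^ r + i)) / 2 ^ r) (tl sample_body @ ?W # rest, set_reg 9 b s)"
    if b: "b \<in> {0, 1}" for b
  proof -
    have w9: "wb X (set_reg 9 b s)" using Suc.prems(1,8) b by (intro wb_set_reg) auto
    have "2 * w + 2 \<le> (2 * w + 2) * 2 ^ r" using le by simp
    also have "\<dots> \<le> X" using Suc.prems(6) unfolding pow .
    finally have wl: "2 * w + 2 \<le> X" .
    have f: "fold dst (tl sample_body) (set_reg 9 b s) = s1 b"
      using Suc.prems(2-4) by (simp add: sample_body_def s1_def fun_upd_twist)
    have "slb X (tl sample_body) (set_reg 9 b s)"
      using Suc.prems wl b by (auto simp: sample_body_def)
    from exc_straight[OF w9 this] have e: "exc (wb X) 3 (tl sample_body) (set_reg 9 b s) (s1 b)"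
      unfolding f by (simp add: sample_body_def numeral_3_eq_3)
    have "guar (wb X) A S (B + 5 * r + 1) ((\<Sum>i<2 ^ r. q (nat b * 2 ^ r + i)) / 2 ^ r) (?W # rest, s1 b)"
    proof (rule Suc.IH)
      show "wb X (s1 b)" using exc_I[OF e] .
      show "reg (s1 b) 8 = int r" "reg (s1 b) 2 = 1" "reg (s1 b) (Rg vom) = 2 * w + b" "0 \<le> 2 * w + b" "int r \<le> X" "1 \<le> X"
        using Suc.prems b by (auto simp: s1_def)
      have "(2 * w + b + 1) * 2 ^ r \<le> (2 * w + 2) * 2 ^ r" using b by (intro mult_right_mono) auto
      also have "\<dots> \<le> X" using Suc.prems(6) unfolding pow .
      finally show "(2 * w + b + 1) * 2 ^ r \<le> X" .
      fix i s' assume h: "i < 2 ^ r" "wb X s'" "mem s' = mem (s1 b)" "reg s' 8 = 0" "reg s' (Rg vom) = (2 * w + b) * 2 ^ r + int i"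
        "\<And>v. v \<notin> {8, 9, Rg vom} \<Longrightarrow> reg s' v = reg (s1 b) v"
      show "guar (wb X) A S B (q (nat b * 2 ^ r + i)) (rest, s')"
      proof (rule Suc.prems(9))
        show "nat b * 2 ^ r + i < 2 ^ Suc r" using h(1) b by auto
        show "reg s' (Rg vom) = w * 2 ^ Suc r + int (nat b * 2 ^ r + i)" using h(5) b by (auto simp: algebra_simps)
        show "reg s' v = reg s v" if "v \<notin> {8, 9, Rg vom}" for v using h(6)[OF that] that by (simp add: s1_def)
      qed (use h in \<open>simp_all add: s1_def\<close>)
    qed
    from guar_exc[OF e this] show ?thesis .
  qed
  have coin: "guar (wb X) A S (Suc (B + 5 * r + 1 + 3)) (((\<Sum>i<2 ^ r. q (nat 0 * 2 ^ r + i)) / 2 ^ r + (\<Sum>i<2 ^ r. q (nat 1 * 2 ^ r + i)) / 2 ^ r) / 2) ?c"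
    using guar_coin[OF Suc.prems(1) ex[of 0] ex[of 1]] by (simp add: sample_body_def)
  have "(\<Sum>i<2 ^ Suc r. q i) = (\<Sum>i<2 ^ r. q i) + (\<Sum>i<2 ^ r. q (2 ^ r + i))"
  proof -
    have "(\<Sum>i<2 ^ r + 2 ^ r. q i) = (\<Sum>i<2 ^ r. q i) + (\<Sum>i=2 ^ r..<2 ^ r + 2 ^ r. q i)"
      by (simp add: lessThan_atLeast0 sum.atLeastLessThan_concat)
    also have "(\<Sum>i=2 ^ r..<2 ^ r + 2 ^ r. q i) = (\<Sum>i<2 ^ r. q (2 ^ r + i))"
      using sum.shift_bounds_nat_ivl[of q 0 "2 ^ r" "2 ^ r"] by (simp add: lessThan_atLeast0 add.commute)
    finally show ?thesis by (simp add: mult_2)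
  qed
  then have eq: "((\<Sum>i<2 ^ r. q (nat 0 * 2 ^ r + i)) / 2 ^ r + (\<Sum>i<2 ^ r. q (nat 1 * 2 ^ r + i)) / 2 ^ r) / 2 = (\<Sum>i<2 ^ Suc r. q i) / 2 ^ Suc r"
    by (simp add: field_simps)
  show ?case
    using guar_step[of "wb X" "(?W # rest, s)" ?c, OF _ _ coin[unfolded eq]] Suc.prems by (simp add: ac_simps)
qed

definition zero_core :: "com list" where "zero_core = map (\<lambda>v. SetConst (Rg v) 0) [20..<45]"

lemma fold_zero: "fold dst (map (\<lambda>v. SetConst (Rg v) 0) vs) s = s\<lparr>reg := (\<lambda>r. if r \<in> Rg ` set vs then 0 else reg s r)\<rparr>"
proof (induction vs arbitrary: s)
  case (Cons v vs)
  show ?case by (auto simp: Cons fun_eq_iff)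
qed simp

lemma exc_zero_core:
  assumes "vm.cor H st k va me F s" "wb X s" "0 \<le> X"
  shows "\<exists>s'. exc (wb X) 25 zero_core s s' \<and> vm.cor H st k (\<lambda>v. if v \<in> {20..<45} then 0 else va v) me F s'"
proof -
  let ?s = "s\<lparr>reg := (\<lambda>r. if r \<in> Rg ` {20..<45} then 0 else reg s r)\<rparr>"
  have "slb X (map (\<lambda>v. SetConst (Rg v) 0) vs) s" for vs s
    using assms(3) by (induction vs arbitrary: s) auto
  moreover have l: "length (map (\<lambda>v. SetConst (Rg v) 0) [20..<45]) = 25" by simp
  ultimately have "exc (wb X) 25 zero_core s ?s"
    using exc_straight[OF assms(2), of "map (\<lambda>v. SetConst (Rg v) 0) [20..<45]"]
    unfolding fold_zero zero_core_def l set_upt by blast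
  moreover have "vm.cor H st k (\<lambda>v. if v \<in> {20..<45} then 0 else va v) me F ?s"
    using assms(1) unfolding vm.cor_def by (auto simp: image_iff)
  ultimately show ?thesis by blast
qed

section \<open>The assembled program and a size bound computed from the input\<close>

definition h_body :: "com list" where
  "h_body = [Op Sub 8 8 2, Load 10 8, Op Mul 10 10 10, Op Add 3 3 10, Op Mul 3 3 9]"

definition p_init :: "com list" where
  "p_init = [SetConst 2 1, Op Add (Rg vN) 0 1, Op Add 8 0 1, SetConst 3 64, SetConst 9 64] @ [WhileNZ 8 h_body] @
     [Op Mul 3 3 3, Op Mul 3 3 3, Op Mul 3 3 3, Op Mul 3 3 3, Op Mul 3 3 3, Op Add 4 3 3, SetConst 5 1, SetConst 6 0, Op Add 7 3 1]"

definition p_body :: "com list" where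
  "p_body = zero_core @ [SetConst (Rg vom) 0, Op Add 8 (Rg vL) 1] @ [WhileNZ 8 sample_body] @
     [Op Add 5 (Rg vstr) 1, Op Add 6 (Rg vkk) 1, Op Add 7 (Rg vfuel) 1] @ cst core_prog @ zero_core @
     [SetConst 5 1, SetConst 6 0, Op Add 7 3 1, SetConst (Rg vom) 0, Op Mod (Rg vcand) (Rg vcand) (Rg vG)] @ cst check"

definition prog :: "com list" where
  "prog = p_init @ cst prelude @ [WhileNZ (Rg vgo) p_body, Op Add 0 (Rg vfound) 1]"

text \<open>The machine scans the input from the right, hence the recursion that removes the first element.\<close>

fun hs :: "(nat \<Rightarrow> int) \<Rightarrow> nat \<Rightarrow> int" where
  "hs x 0 = 64"
| "hs x (Suc r) = (hs (\<lambda>l. x (Suc l)) r + x 0 * x 0) * 64"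

text \<open>One number dominates both \<open>64 ^ (n + 1)\<close> and \<open>S\<close>, so its
  square dominates the product that \<open>io\<close> asks for.\<close>

lemma hs_ge: "64 ^ (n + 1) \<le> hs x n" "64 + (\<Sum>l<n. x l * x l) \<le> hs x n"
proof -
  show "64 ^ (n + 1) \<le> hs x n"
  proof (induction n arbitrary: x)
    case (Suc n)
    from Suc[of "\<lambda>l. x (Suc l)"] have "64 ^ (n + 1) \<le> hs (\<lambda>l. x (Suc l)) n + x 0 * x 0" by (simp add: add_increasing2)
    then show ?case by simp
  qed simp
  show "64 + (\<Sum>l<n. x l * x l) \<le> hs x n"
  proof (induction n arbitrary: x)
    case (Suc n)
    have aux: "c \<le> h \<Longrightarrow> 0 \<le> c \<Longrightarrow> 0 \<le> q \<Longrightarrow> c + q \<le> (h + q) * 64" for c h q :: int by simp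
    have "64 + (\<Sum>l<n. x (Suc l) * x (Suc l)) + x 0 * x 0 \<le> (hs (\<lambda>l. x (Suc l)) n + x 0 * x 0) * 64"
      by (rule aux) (use Suc[of "\<lambda>l. x (Suc l)"] in \<open>simp_all add: sum_nonneg\<close>)
    then show ?case by (simp only: sum.lessThan_Suc_shift hs.simps add_ac comp_def)
  qed simp
qed

lemma hs_le:
  assumes "\<And>l. l < n \<Longrightarrow> x l * x l \<le> D" "0 \<le> D"
  shows "hs x n \<le> 64 ^ (n + 1) * (1 + int n * D)"
  using assms(1)
proof (induction n arbitrary: x)
  case (Suc n)
  have 1: "hs (\<lambda>l. x (Suc l)) n \<le> 64 ^ (n + 1) * (1 + int n * D)" by (rule Suc.IH) (use Suc.prems in auto)
  have "x 0 * x 0 \<le> D" using Suc.prems by simp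
  also have "D \<le> 64 ^ (n + 1) * D"
  proof -
    have "1 \<le> (64::int) ^ (n + 1)" by (rule one_le_power) simp
    then have "1 * D \<le> 64 ^ (n + 1) * D" using assms(2) by (rule mult_right_mono)
    then show ?thesis by simp
  qed
  finally have "(hs (\<lambda>l. x (Suc l)) n + x 0 * x 0) * 64 \<le> (64 ^ (n + 1) * (1 + int n * D) + 64 ^ (n + 1) * D) * 64"
    using 1 by (intro mult_right_mono add_mono) auto
  then show ?case by (simp add: algebra_simps)
qed simp

lemma hs_pos: "64 \<le> hs x n"
proof -
  have "0 \<le> (\<Sum>l<n. x l * x l)" by (simp add: sum_nonneg)
  then show ?thesis using hs_ge(2)[where x = x and n = n] by linarith
qed

lemma exc_h_loop:
  assumes "wb X s" "reg s 8 = int r" "r \<le> n" "reg s 2 = 1" "reg s 9 = 64" "reg s 3 = hs (\<lambda>l. x (r + l)) (n - r)"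
    "\<And>l. l < n \<Longrightarrow> mem s (int l) = x l" "hs x n \<le> X" "int n \<le> X"
  shows "\<exists>s'. exc (wb X) (Suc (6 * r)) [WhileNZ 8 h_body] s s' \<and> mem s' = mem s \<and> reg s' 3 = hs x n \<and>
     (\<forall>v. v \<notin> {3, 8, 10} \<longrightarrow> reg s' v = reg s v)"
  using assms
proof (induction r arbitrary: s)
  case 0
  then show ?case by (intro exI[of _ s] conjI) (auto intro!: exc_While_end)
next
  case (Suc r)
  have mono: "hs (\<lambda>l. x (i + l)) (n - i) \<le> hs x n" if "i \<le> n" for i
    using that
  proof (induction i)
    case (Suc i)
    have e: "n - i = Suc (n - Suc i)" using Suc.prems by simp
    have "hs (\<lambda>l. x (i + l)) (n - i) = (hs (\<lambda>l. x (Suc i + l)) (n - Suc i) + x i * x i) * 64"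
      unfolding e by simp
    moreover have "0 \<le> x i * x i" "0 \<le> hs (\<lambda>l. x (Suc i + l)) (n - Suc i)" using hs_pos[of "\<lambda>l. x (Suc i + l)" "n - Suc i"] by simp_all
    moreover have "a \<le> (a + b) * 64" if "0 \<le> a" "0 \<le> b" for a b :: int using that by simp
    ultimately have "hs (\<lambda>l. x (Suc i + l)) (n - Suc i) \<le> hs (\<lambda>l. x (i + l)) (n - i)" by simp
    then show ?case using Suc by simp
  qed simp
  have m: "mem s (int r) = x r" using Suc.prems by simp
  have e: "n - r = Suc (n - Suc r)" using Suc.prems by simp
  let ?h = "hs (\<lambda>l. x (Suc r + l)) (n - Suc r)"
  have h: "hs (\<lambda>l. x (r + l)) (n - r) = (?h + x r * x r) * 64" unfolding e by simp
  have hX: "(?h + x r * x r) * 64 \<le> X" using mono[of r] h Suc.prems by simp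
  have sq: "0 \<le> x r * x r" by simp
  have hp: "0 \<le> ?h" using hs_pos[of "\<lambda>l. x (Suc r + l)" "n - Suc r"] by simp
  have b: "\<bar>int r\<bar> \<le> X" "\<bar>x r * x r\<bar> \<le> X" "\<bar>?h + x r * x r\<bar> \<le> X" "\<bar>(?h + x r * x r) * 64\<bar> \<le> X"
  proof -
    have aux: "0 \<le> h \<Longrightarrow> 0 \<le> q \<Longrightarrow> (h + q) * 64 \<le> X \<Longrightarrow> \<bar>q\<bar> \<le> X \<and> \<bar>h + q\<bar> \<le> X \<and> \<bar>(h + q) * 64\<bar> \<le> X" for h q :: int
      by auto
    show "\<bar>x r * x r\<bar> \<le> X" "\<bar>?h + x r * x r\<bar> \<le> X" "\<bar>(?h + x r * x r) * 64\<bar> \<le> X"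
      using aux[OF hp sq hX] by blast+
    show "\<bar>int r\<bar> \<le> X" using Suc.prems(3,9) by simp
  qed
  have "slb X h_body s" using Suc.prems(2-7) m b by (simp add: h_body_def)
  moreover have "length h_body = 5" by (simp add: h_body_def)
  ultimately have ex: "exc (wb X) 5 h_body s (fold dst h_body s)"
    using exc_straight[OF Suc.prems(1)] by metis
  define s1 where "s1 = fold dst h_body s"
  have s1: "reg s1 8 = int r" "reg s1 3 = (?h + x r * x r) * 64" "mem s1 = mem s" "\<And>v. v \<notin> {3, 8, 10} \<Longrightarrow> reg s1 v = reg s v"
    using Suc.prems(2-7) m by (simp_all add: s1_def h_body_def)
  have "\<exists>s'. exc (wb X) (Suc (6 * r)) [WhileNZ 8 h_body] s1 s' \<and> mem s' = mem s1 \<and> reg s' 3 = hs x n \<and>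
     (\<forall>v. v \<notin> {3, 8, 10} \<longrightarrow> reg s' v = reg s1 v)"
    by (rule Suc.IH) (use Suc.prems s1 h exc_I[OF ex] in \<open>auto simp: s1_def\<close>)
  then obtain s' where s': "exc (wb X) (Suc (6 * r)) [WhileNZ 8 h_body] s1 s'" "mem s' = mem s1" "reg s' 3 = hs x n"
     "\<forall>v. v \<notin> {3, 8, 10} \<longrightarrow> reg s' v = reg s1 v" by blast
  have "exc (wb X) (Suc (5 + Suc (6 * r))) [WhileNZ 8 h_body] s s'"
    by (rule exc_While_step[OF _ Suc.prems(1) ex s'(1)[unfolded s1_def]]) (use Suc.prems in simp)
  then show ?case using s' s1 by (intro exI[of _ s']) (auto simp: numeral_eq_Suc)
qed

lemma sok_core: "64 \<le> H \<Longrightarrow> vm.sok H core_prog" for H :: int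
  by (simp add: vm.sok.simps vm.cok.simps core_prog_def decode_def powM_def build_def build_body_def build_inner_def
      chV_code_def chR_code_def app_def adE_def fill_def fill_body_def join_def join_head_def join_pair_def
      body1_def body2_def wE_def hE_def)

lemma sok_prelude: "64 \<le> H \<Longrightarrow> vm.sok H prelude" for H :: int
  by (simp add: vm.sok.simps vm.cok.simps prelude_def prelude_body_def prelude_consts_def prelude_cap_def prelude_last_def)

lemma sok_check: "64 \<le> H \<Longrightarrow> vm.sok H check" for H :: int
  by (simp add: vm.sok.simps vm.cok.simps check_def digit_step_def next_try_def accept_def)

lemma asg_core: "asg core_prog \<subseteq> {16, 17} \<union> {20..<45}"
  by (simp add: core_prog_def decode_def powM_def build_def build_body_def build_inner_def
      chV_code_def chR_code_def app_def adE_def fill_def fill_body_def join_def join_head_def join_pair_def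
      body1_def body2_def wE_def hE_def)

lemma cor_sample:
  assumes "vm.cor H st k va me F s" "mem s' = mem s" "reg s' (Rg vom) = w"
    "\<And>v. v \<notin> {8, 9, Rg vom} \<Longrightarrow> reg s' v = reg s v"
  shows "vm.cor H st k (va(vom := w)) me F s'"
proof -
  have "reg s' (Rg v) = (va(vom := w)) v" for v
    using assms(1,3) assms(4)[of "Rg v"] by (auto simp: vm.cor_def)
  then show ?thesis using assms(1,2) assms(4)[of 1] assms(4)[of 2] assms(4)[of 3] assms(4)[of 4] assms(4)[of 5]
    assms(4)[of 6] assms(4)[of 7] by (simp add: vm.cor_def)
qed

section \<open>Parameters belonging to a fixed input\<close>

locale mach =
  fixes xs :: "int list" and X :: int
begin

definition n where "n = length xs"
definition x where "x l = xs ! l"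
definition h where "h = hs x n"
text \<open>\<open>Y = h\<^sup>2\<close> bounds \<open>64 ^ (n + 1) * S\<close>. Degrees reach 15,
  so \<open>H = Y ^ 16\<close> leaves one spare factor, and it is obtained from \<open>h\<close> by
  five squarings.\<close>

definition Y where "Y = h * h"
definition H where "H = h ^ 32"
definition S where "S = 1 + (\<Sum>l<n. x l * x l)"

lemma h64: "64 \<le> h" unfolding h_def by (rule hs_pos)

lemma YH: "Y ^ 16 = H" by (simp add: Y_def H_def power2_eq_square[symmetric] power_mult[symmetric])

lemma io: "io H Y {0..<int n} n x S"
proof
  show "64 \<le> Y" using h64 mult_mono[of 1 h 64 h] by (simp add: Y_def)
  show "Y ^ 16 \<le> H" using YH by simp
  show "S = 1 + (\<Sum>l<n. x l * x l)" by (rule S_def)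
  have 0: "0 \<le> (\<Sum>l<n. x l * x l)" by (simp add: sum_nonneg)
  have "S \<le> h" using hs_ge(2)[where x = x and n = n] by (simp add: S_def h_def)
  moreover have "64 ^ (n + 1) \<le> h" using hs_ge(1)[where x = x and n = n] by (simp add: h_def)
  ultimately show "64 ^ (n + 1) * S \<le> Y" unfolding Y_def using 0 by (intro mult_mono) (auto simp: S_def)
qed simp

end

sublocale mach \<subseteq> io H Y "{0..<int n}" n x S by (rule io)

context mach begin

lemma YH': "Y \<le> H" "64 \<le> H"
proof -
  have "1 \<le> Y ^ 15" using Y64 by simp
  then have "Y * 1 \<le> Y * Y ^ 15" using Y64 by (intro mult_left_mono) auto
  also have "Y * Y ^ 15 = H" using YH by (simp add: power_Suc[symmetric])
  finally show "Y \<le> H" by simp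
  then show "64 \<le> H" using Y64 by simp
qed

definition str where "str = int n + B + 2"

lemma strY: "str \<le> Y" using B1 n_le powY[of 2 n] by (simp add: str_def)

lemma core:
  assumes "1 \<le> j" "j \<le> B"
  shows "core H str (int n + j) Y ({0..<int n} \<union> {a. a mod str = int n + j}) n x S"
proof
  have "(\<Sum>l<n. \<bar>x l\<bar>) \<le> (\<Sum>l<n. x l * x l)" by (rule sum_mono) (rule abs_le_square_int)
  then show "1 + (\<Sum>l<n. \<bar>x l\<bar>) \<le> S" by (simp add: S_def)
  show "64 * ((int n + 1)\<^sup>2 * 2 ^ n * 4 ^ n * (S * 2 ^ n)) \<le> Y"
    using RR_Y(1) by (simp only: RR_def power2_eq_square mult_ac)
qed (use assms in \<open>auto simp: str_def\<close>)

text \<open>The samples with which a round of fuel \<open>F\<close> succeeds. They are described by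
  \<open>hit\<close> and \<open>fuelc\<close>, without reference to the memory cells of the
  round.\<close>

definition G :: "nat \<Rightarrow> int set" where
  "G F = {w. \<exists>z k t ty \<alpha>. w = z + (int n + 1) * (int k + (int n + 1) * (t + 2 ^ n * (ty + 4 ^ n * \<alpha>))) \<and>
     0 \<le> z \<and> z \<le> int n \<and> k \<le> n \<and> 0 \<le> t \<and> t < 2 ^ n \<and> 0 \<le> ty \<and> ty < 4 ^ n \<and> 0 \<le> \<alpha> \<and> \<alpha> < S * 2 ^ n \<and>
     core.hit n x S ty k z t \<alpha> \<and> core.fuelc n x S ty k z t \<alpha> \<le> F}"

lemma mixed_lt: "0 \<le> a \<Longrightarrow> a < b \<Longrightarrow> 0 \<le> q \<Longrightarrow> q < c \<Longrightarrow> 0 \<le> a + b * q \<and> a + b * q < b * c" for a b q c :: int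
proof -
  assume h: "0 \<le> a" "a < b" "0 \<le> q" "q < c"
  have "b * (q + 1) \<le> b * c" using h by (intro mult_left_mono) auto
  then show ?thesis using h by (simp add: algebra_simps)
qed

lemma G_range: "w \<in> G F \<Longrightarrow> 0 \<le> w \<and> w < RR"
proof -
  assume "w \<in> G F"
  then obtain z k t ty \<alpha> where w: "w = z + (int n + 1) * (int k + (int n + 1) * (t + 2 ^ n * (ty + 4 ^ n * \<alpha>)))"
    and r: "0 \<le> z" "z \<le> int n" "k \<le> n" "0 \<le> t" "t < 2 ^ n" "0 \<le> ty" "ty < 4 ^ n" "0 \<le> \<alpha>" "\<alpha> < S * 2 ^ n"
    unfolding G_def by blast
  have 1: "0 \<le> ty + 4 ^ n * \<alpha> \<and> ty + 4 ^ n * \<alpha> < 4 ^ n * (S * 2 ^ n)" by (rule mixed_lt) (use r in auto)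
  have 2: "0 \<le> t + 2 ^ n * (ty + 4 ^ n * \<alpha>) \<and> t + 2 ^ n * (ty + 4 ^ n * \<alpha>) < 2 ^ n * (4 ^ n * (S * 2 ^ n))"
    by (rule mixed_lt) (use r 1 in auto)
  have 3: "0 \<le> int k + (int n + 1) * (t + 2 ^ n * (ty + 4 ^ n * \<alpha>)) \<and>
      int k + (int n + 1) * (t + 2 ^ n * (ty + 4 ^ n * \<alpha>)) < (int n + 1) * (2 ^ n * (4 ^ n * (S * 2 ^ n)))"
    by (rule mixed_lt) (use r 2 in auto)
  have "0 \<le> w \<and> w < (int n + 1) * ((int n + 1) * (2 ^ n * (4 ^ n * (S * 2 ^ n))))"
    unfolding w by (rule mixed_lt) (use r 3 in auto)
  then show ?thesis by (simp only: RR_def mult.assoc)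
qed

lemma core_success:
  assumes w: "w \<in> G F" and j: "1 \<le> j" "j \<le> B" and g: "glob j va" and om: "va vom = w"
    and b: "\<And>v. \<bar>va v\<bar> \<le> Y" and inp: "\<forall>l<n. me (int l) = x l" and zero: "\<And>a. me (a * str + (int n + j)) = 0"
  shows "\<exists>va' me' F' c. vm.bs H str (int n + j) core_prog va me F va' me' F' \<and> dig c \<and> ws x n c = 0 \<and>
    va' vcand = cd n c \<and> cd n c \<noteq> 0"
proof -
  interpret c: core H str "int n + j" Y "{0..<int n} \<union> {a. a mod str = int n + j}" n x S by (rule core[OF j])
  from w obtain z k t ty \<alpha> where w': "w = z + (int n + 1) * (int k + (int n + 1) * (t + 2 ^ n * (ty + 4 ^ n * \<alpha>)))"
    and r: "0 \<le> z" "z \<le> int n" "k \<le> n" "0 \<le> t" "t < 2 ^ n" "0 \<le> ty" "ty < 4 ^ n" "0 \<le> \<alpha>" "\<alpha> < S * 2 ^ n"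
    and hit: "c.hit ty k z t \<alpha>" and f: "c.fuelc ty k z t \<alpha> \<le> F"
    unfolding G_def by blast
  have ctx: "c.ctx va me" using g inp by (simp add: c.ctx_def glob_def)
  have bnd: "c.bnd va me"
    unfolding c.bnd_def
  proof (intro conjI allI ballI)
    fix a assume "a \<in> {0..<int n} \<union> {a. a mod str = int n + j}"
    then show "\<bar>me a\<bar> \<le> Y"
    proof
      assume a: "a \<in> {0..<int n}"
      then obtain l where l: "a = int l" "l < n" by (metis atLeastLessThan_iff nat_0_le nat_less_iff)
      then have "me (int (nat a)) = x (nat a)" using inp by simp
      then show ?thesis using x_le(1)[of "nat a"] Yb a l by simp
    next
      assume "a \<in> {a. a mod str = int n + j}"
      then have "a = (a div str) * str + (int n + j)" by (metis div_mult_mod_eq mem_Collect_eq)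
      then show ?thesis using zero[of "a div str"] Y64 by simp
    qed
  qed (rule b)
  have "c.J core_prog va me (c.fuelc ty k z t \<alpha>) (\<lambda>va' me'. \<exists>c. dig c \<and> ws x n c = 0 \<and> va' vcand = cd n c \<and> cd n c \<noteq> 0)"
    by (rule c.core_correct[OF ctx zero _ _ r(1-8) hit]) (use om w' b[of vom] in auto)
  with bnd obtain va' me' m' where m: "m' \<le> c.fuelc ty k z t \<alpha>" "\<exists>c. dig c \<and> ws x n c = 0 \<and> va' vcand = cd n c \<and> cd n c \<noteq> 0"
    "\<And>F. c.bs core_prog va me (m' + F) va' me' F" unfolding c.J_def by blast
  from m(3)[of "F - m'"] m(1) f have "c.bs core_prog va me F va' me' (F - m')" by simp
  with m(2) show ?thesis by blast
qed

definition outp :: "(int \<Rightarrow> int) \<Rightarrow> int list" where "outp me = map (\<lambda>i. me (int i)) [0..<n]"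

lemma acc_solution:
  assumes "acc v" "\<forall>i<n. me (int i) = dgt v i"
  shows "ess_solution xs (outp me)"
proof -
  have o: "outp me = map (dgt v) [0..<n]" using assms(2) by (auto simp: outp_def)
  have "\<exists>i<n. dgt v i \<noteq> 0" using assms(1) unfolding acc_def by (metis (no_types, lifting) lessThan_iff mult_zero_left sum.neutral)
  moreover have "(\<Sum>i<length xs. outp me ! i * xs ! i) = (\<Sum>i<n. dgt v i * x i)"
    unfolding o by (rule sum.cong) (auto simp: n_def x_def)
  ultimately show ?thesis using assms(1) dgt_range[of v]
    unfolding ess_solution_def o acc_def by (auto simp: n_def[symmetric] image_iff)
qed

lemma acc_cd: "dig c \<Longrightarrow> ws x n c = 0 \<Longrightarrow> cd n c \<noteq> 0 \<Longrightarrow> acc (cd n c mod (2 * 3 ^ n))"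
proof -
  assume c: "dig c" "ws x n c = 0" "cd n c \<noteq> 0"
  have d: "dgt (cd n c mod (2 * 3 ^ n)) i = c i" if "i < n" for i using dgt_cd[OF c(1) HOL.refl that] .
  have "(\<Sum>i<n. c i * c i) \<noteq> 0"
  proof
    assume "(\<Sum>i<n. c i * c i) = 0"
    then have "\<forall>i<n. c i = 0" by (subst (asm) sum_nonneg_eq_0_iff) auto
    then have "cd n c = 0" by (simp add: cd_def)
    with c show False by simp
  qed
  then show ?thesis using c(2) d by (simp add: acc_def ws_def)
qed

text \<open>The state before round \<open>j\<close>. The last clause says that the memories of this
  and all later rounds are untouched.\<close>

definition LH :: "int \<Rightarrow> (nat \<Rightarrow> int) \<Rightarrow> (int \<Rightarrow> int) \<Rightarrow> state \<Rightarrow> bool" where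
  "LH j va me s \<longleftrightarrow> (\<exists>F. vm.cor H 1 0 va me F s \<and> int F \<le> H) \<and> wb X s \<and> vm.sb H va me \<and> glob j va \<and> va vfound = 0 \<and>
     va vgo = (if j \<le> B then 1 else 0) \<and> (\<forall>v\<ge>45. va v = 0) \<and> (\<forall>v. \<bar>va v\<bar> \<le> Y) \<and> (\<forall>l<n. me (int l) = x l) \<and>
     (\<forall>a k. int n + j \<le> k \<longrightarrow> k < str \<longrightarrow> me (a * str + k) = 0)"

definition DN :: "state \<Rightarrow> bool" where
  "DN s \<longleftrightarrow> wb X s \<and> (\<exists>va me F. vm.cor H 1 0 va me F s \<and> va vgo = 0 \<and> va vfound = 1 \<and> ess_solution xs (outp me))"

text \<open>The constant 33 = 3 + 25 + 5 counts the instructions that switch to the memory of the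
  round, clear the scratch variables, and switch back and reduce the candidate.\<close>

definition tt :: "int \<Rightarrow> nat" where
  "tt j = 33 + ssz core_prog * (1 + nat (B div j)) + ssz check * (1 + 2 * n)"

definition tail :: "com list" where
  "tail = [Op Add 5 (Rg vstr) 1, Op Add 6 (Rg vkk) 1, Op Add 7 (Rg vfuel) 1] @ cst core_prog @ zero_core @
     [SetConst 5 1, SetConst 6 0, Op Add 7 3 1, SetConst (Rg vom) 0, Op Mod (Rg vcand) (Rg vcand) (Rg vG)] @ cst check"

end

section \<open>One round of the main loop\<close>

locale machX = mach xs X for xs :: "int list" and X :: int +
  assumes X: "4 * (H * H) \<le> X"
begin

lemma HX: "H \<le> X" "2 * H \<le> X" "0 \<le> X"
proof -
  have "1 * H \<le> H * H" using YH'(2) by (intro mult_right_mono) auto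
  then show "H \<le> X" "2 * H \<le> X" "0 \<le> X" using X YH'(2) by linarith+
qed

lemma exc_check:
  assumes "vm.cor H 1 0 va me (nat H) s" "wb X s" "vm.sb H va me" "glob j va" "1 \<le> j" "j \<le> B" "va vfound = 0"
    "\<forall>v\<ge>45. va v = 0" "\<And>v. \<bar>va v\<bar> \<le> Y" "\<forall>l<n. me (int l) = x l" "va vcand = v" "0 \<le> v" "v < 2 * 3 ^ n"
    "\<And>a k. int n + j < k \<Longrightarrow> k < str \<Longrightarrow> me (a * str + k) = 0"
  shows "\<exists>k s'. exc (wb X) k (cst check) s s' \<and> k \<le> ssz check * (1 + 2 * n) \<and>
    (if acc v then DN s' else (\<exists>va' me'. LH (j + 1) va' me' s'))"
proof -
  have bnd: "bnd va me" using assms(9,10) x_le(1) Yb unfolding bnd_def by (auto intro: order_trans)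
    (metis atLeastLessThan_iff nat_0_le nat_less_iff order_trans)
  let ?P = "\<lambda>va' me'. if acc v
     then va' vgo = 0 \<and> va' vfound = 1 \<and> (\<forall>i<n. me' (int i) = dgt v i)
     else me' = me \<and> glob (j + 1) va' \<and> va' vfound = va vfound \<and> va' vgo = (if j < B then 1 else 0) \<and> (\<forall>v. 45 \<le> v \<longrightarrow> va' v = va v)"
  from check_correct[OF assms(4,5,6,10,11,12,13)] bnd obtain va' me' m where
    m: "m \<le> 2 * n" "bnd va' me'" "?P va' me'" "\<And>F. bs check va me (m + F) va' me' F" unfolding J_def by blast
  have nH: "2 * n \<le> nat H"
  proof -
    have "2 * int n \<le> H" using n_le powY[of 2 n] YH' by simp
    then show ?thesis by simp
  qed
  define F' where "F' = nat H - m"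
  have bs: "bs check va me (nat H) va' me' F'" using m(4)[of F'] m(1) nH by (simp add: F'_def)
  have H1: "1 \<le> H" using YH' by simp
  from cst_correct[OF H1 X _ _ _ _ bs assms(1,2,3) sok_check[OF YH'(2)]] H1 obtain k s' where
    k: "exc (wb X) k (cst check) s s'" "k \<le> ssz check * (1 + (nat H - F'))" "cor va' me' F' s'" by auto
  have "nat H - F' = m" using m(1) nH by (simp add: F'_def)
  then have "k \<le> ssz check * (1 + m)" using k(2) by simp
  also have "\<dots> \<le> ssz check * (1 + 2 * n)" using m(1) by simp
  finally have kb: "k \<le> ssz check * (1 + 2 * n)" .
  have F'H: "int F' \<le> H" using H1 by (simp add: F'_def)
  have "if acc v then DN s' else (\<exists>va' me'. LH (j + 1) va' me' s')"
  proof (cases "acc v")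
    case True
    then have "ess_solution xs (outp me')" using m(3) by (intro acc_solution[of v]) auto
    then show ?thesis using True m(3) k(3) exc_I[OF k(1)] by (auto simp: DN_def)
  next
    case False
    have sb': "sb va' me'" by (rule bs_sb[OF bs H1 assms(3) sok_check[OF YH'(2)]])
    have "LH (j + 1) va' me' s'"
      unfolding LH_def using False m(2,3) k(3) F'H exc_I[OF k(1)] sb' assms(7,8,10,14)
      by (auto simp: bnd_def)
    then show ?thesis using False by auto
  qed
  then show ?thesis using k(1) kb by blast
qed

lemma exc_tail:
  assumes cor: "vm.cor H 1 0 va me F0 s" and wbs: "wb X s" and sb: "vm.sb H va me" and g: "glob j va" and j: "1 \<le> j" "j \<le> B"
    and f0: "va vfound = 0" and v45: "\<forall>v\<ge>45. va v = 0" and vY: "\<And>v. \<bar>va v\<bar> \<le> Y" and inp: "\<forall>l<n. me (int l) = x l"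
    and fresh: "\<And>a k. int n + j \<le> k \<Longrightarrow> k < str \<Longrightarrow> me (a * str + k) = 0"
  shows "\<exists>k s'. exc (wb X) k tail s s' \<and> k \<le> tt j \<and> (DN s' \<or> (\<exists>va' me'. LH (j + 1) va' me' s')) \<and>
    (va vom \<in> G (nat (B div j)) \<longrightarrow> DN s')"
proof -
  define F where "F = nat (B div j)"
  define kk where "kk = int n + j"
  interpret v: vm H str kk .
  have H1: "1 \<le> H" using YH' by simp
  have Bj: "0 \<le> B div j" "B div j \<le> B"
  proof -
    show "0 \<le> B div j" using j B1 by (simp add: pos_imp_zdiv_nonneg_iff)
    show "B div j \<le> B" using abs_div_le[of B j] B1 by linarith
  qed
  have FH: "int F \<le> H" using Bj B1 YH' by (simp add: F_def)
  have kkr: "0 \<le> kk" "kk < str" "kk \<le> H" "0 \<le> str" "str \<le> H"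
    using j B1 strY YH' by (auto simp: kk_def str_def)
  have gv: "va vstr = str" "va vkk = kk" "va vfuel = int F" using g Bj by (auto simp: glob_def kk_def str_def F_def)
  have rv: "reg s (Rg v) = va v" for v using cor by (auto simp: vm.cor_def)
  have r1: "reg s 1 = 0" using cor by (auto simp: vm.cor_def)
  let ?p1 = "[Op Add 5 (Rg vstr) 1, Op Add 6 (Rg vkk) 1, Op Add 7 (Rg vfuel) 1]"
  define s1 where "s1 = fold dst ?p1 s"
  have e1: "exc (wb X) 3 ?p1 s s1"
    using exc_straight[OF wbs, of ?p1] rv[of vstr] rv[of vkk] rv[of vfuel] r1[unfolded One_nat_def] gv kkr FH HX by (simp add: s1_def numeral_3_eq_3)
  have c1: "v.cor va me F s1"
    using cor rv[of vstr] rv[of vkk] rv[of vfuel] r1[unfolded One_nat_def] gv by (simp add: s1_def vm.cor_def)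
  \<comment> \<open>For samples outside \<open>G F\<close> the outcome of the core is unspecified;
    \<open>bs_total\<close> still provides one, and the check decides about it.\<close>
  have "\<exists>va2 me2 F2. v.bs core_prog va me F va2 me2 F2 \<and> (va vom \<in> G F \<longrightarrow>
     (\<exists>c. dig c \<and> ws x n c = 0 \<and> va2 vcand = cd n c \<and> cd n c \<noteq> 0))"
  proof (cases "va vom \<in> G F")
    case True
    have "me (a * str + (int n + j)) = 0" for a using fresh[of "int n + j"] kkr by (simp add: kk_def)
    from core_success[OF True j g HOL.refl vY inp this] show ?thesis unfolding kk_def by blast
  next
    case False
    then show ?thesis using v.bs_total[of core_prog va me F] by blast
  qed
  then obtain va2 me2 F2 where b2: "v.bs core_prog va me F va2 me2 F2"
    "va vom \<in> G F \<Longrightarrow> \<exists>c. dig c \<and> ws x n c = 0 \<and> va2 vcand = cd n c \<and> cd n c \<noteq> 0" by blast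
  from v.cst_correct[OF H1 X kkr(4,5,1,3) b2(1) c1 exc_I[OF e1] sb sok_core[OF YH'(2)] FH] obtain k2 s2 where
    k2: "exc (wb X) k2 (cst core_prog) s1 s2" "k2 \<le> ssz core_prog * (1 + (F - F2))" "v.cor va2 me2 F2 s2"
    unfolding vm.sb_def by blast
  have k2b: "k2 \<le> ssz core_prog * (1 + F)"
  proof -
    have "ssz core_prog * (1 + (F - F2)) \<le> ssz core_prog * (1 + F)" by (intro mult_left_mono) auto
    with k2(2) show ?thesis by linarith
  qed
  have sb2: "vm.sb H va2 me2"
    using v.bs_sb[OF b2(1) H1 _ sok_core[OF YH'(2)]] sb by (simp add: vm.sb_def)
  have fr: "va2 v = va v" if "v < 20" "v \<noteq> vom" "v \<noteq> vcand" for v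
    by (rule v.bs_asg[OF b2(1)]) (use asg_core that in auto)
  have fr45: "va2 v = va v" if "45 \<le> v" for v
    by (rule v.bs_asg[OF b2(1)]) (use asg_core that in auto)
  have frm: "me2 a = me a" if "a mod str \<noteq> kk" for a
    by (rule v.bs_mem[OF b2(1) kkr(1,2) that])
  from exc_zero_core[OF k2(3) exc_I[OF k2(1)] HX(3)] obtain s3 where
    e3: "exc (wb X) 25 zero_core s2 s3" and c3: "v.cor (\<lambda>v. if v \<in> {20..<45} then 0 else va2 v) me2 F2 s3" by blast
  let ?p4 = "[SetConst 5 1, SetConst 6 0, Op Add 7 3 1, SetConst (Rg vom) 0, Op Mod (Rg vcand) (Rg vcand) (Rg vG)]"
  define w where "w = va2 vcand mod (2 * 3 ^ n)"
  define va4 where "va4 = (\<lambda>v. if v \<in> {20..<45} then 0 else va2 v)(vom := 0, vcand := w)"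
  have vG: "va2 vG = 2 * 3 ^ n" using fr[of vG] g by (simp add: glob_def)
  have wr: "0 \<le> w" "w < 2 * 3 ^ n" by (auto simp: w_def)
  have wY: "w \<le> Y" using wr powY[of 3 n] by simp
  have r3: "reg s3 (Rg vcand) = va2 vcand" "reg s3 (Rg vG) = 2 * 3 ^ n" "reg s3 3 = H" "reg s3 1 = 0"
    using c3[unfolded vm.cor_def, THEN conjunct1, rule_format, of vcand]
      c3[unfolded vm.cor_def, THEN conjunct1, rule_format, of vG] c3 vG by (simp_all add: vm.cor_def)
  define s4 where "s4 = fold dst ?p4 s3"
  have l4: "length ?p4 = 5" by simp
  have "slb X ?p4 s3" using r3 wr wY YH' HX by (simp add: w_def[symmetric])
  then have e4: "exc (wb X) 5 ?p4 s3 s4"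
    using exc_straight[OF exc_I[OF e3]] l4 unfolding s4_def by metis
  have c4: "vm.cor H 1 0 va4 me2 (nat H) s4"
    unfolding vm.cor_def
  proof (intro conjI allI)
    fix v
    have "reg s3 (Rg v) = (if v \<in> {20..<45} then 0 else va2 v)" using c3 by (simp add: vm.cor_def)
    then show "reg s4 (Rg v) = va4 v" using r3 by (auto simp: s4_def va4_def w_def)
  qed (use c3 r3 H1 in \<open>auto simp: s4_def vm.cor_def\<close>)
  have v4: "va4 v = va v" if "v < 20" "v \<noteq> vom" "v \<noteq> vcand" for v using fr[OF that] that by (simp add: va4_def)
  have g4: "glob j va4" using g v4 by (simp add: glob_def)
  have Y4: "\<bar>va4 v\<bar> \<le> Y" for v
  proof -
    consider "v < 20" "v \<noteq> vom" "v \<noteq> vcand" | "v = vom" | "v = vcand" | "20 \<le> v" "v < 45" | "45 \<le> v" by linarith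
    then show ?thesis
    proof cases
      case 1 then show ?thesis using v4 vY by simp
    next
      case 5 then show ?thesis using fr45[of v] vY by (simp add: va4_def)
    qed (use wr wY Y64 in \<open>auto simp: va4_def\<close>)
  qed
  have sb4: "vm.sb H va4 me2" using sb2 Y4 YH'(1) unfolding vm.sb_def by (meson order_trans)
  have inp4: "\<forall>l<n. me2 (int l) = x l"
  proof (intro allI impI)
    fix l assume l: "l < n"
    have "int l mod str = int l" using l kkr B1 by (intro mod_pos_pos_trivial) (auto simp: str_def)
    then have "int l mod str \<noteq> kk" using l j by (simp add: kk_def)
    then show "me2 (int l) = x l" using frm inp l by simp
  qed
  have fresh4: "me2 (a * str + k) = 0" if "int n + j < k" "k < str" for a k
  proof -
    have "(a * str + k) mod str = k" using that j by (simp add: mod_pos_pos_trivial)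
    then have "me2 (a * str + k) = me (a * str + k)" using that by (intro frm) (simp add: kk_def)
    then show ?thesis using fresh[of k a] that by simp
  qed
  have "\<exists>k s'. exc (wb X) k (cst check) s4 s' \<and> k \<le> ssz check * (1 + 2 * n) \<and>
    (if acc w then DN s' else (\<exists>va' me'. LH (j + 1) va' me' s'))"
    by (rule exc_check[OF c4 exc_I[OF e4] sb4 g4 j _ _ Y4 inp4 _ wr fresh4])
      (use v4[of vfound] f0 fr45 v45 in \<open>auto simp: va4_def\<close>)
  then obtain k5 s5 where k5: "exc (wb X) k5 (cst check) s4 s5" "k5 \<le> ssz check * (1 + 2 * n)"
    "if acc w then DN s5 else (\<exists>va' me'. LH (j + 1) va' me' s5)" by blast
  have "exc (wb X) (3 + (k2 + (25 + (5 + k5)))) tail s s5"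
    unfolding tail_def using exc_append[OF e1 exc_append[OF k2(1) exc_append[OF e3 exc_append[OF e4 k5(1)]]]] .
  moreover have "3 + (k2 + (25 + (5 + k5))) \<le> tt j" using k2b k5(2) unfolding tt_def F_def by linarith
  moreover have "DN s5" if "va vom \<in> G F"
  proof -
    from b2(2)[OF that] obtain c where "dig c" "ws x n c = 0" "va2 vcand = cd n c" "cd n c \<noteq> 0" by blast
    then have "acc w" using acc_cd[of c] by (simp add: w_def)
    then show ?thesis using k5(3) by simp
  qed
  moreover have "DN s5 \<or> (\<exists>va' me'. LH (j + 1) va' me' s5)" using k5(3) by (auto split: if_splits)
  ultimately show ?thesis unfolding F_def by blast
qed

end

lemma cor_reg: "vm.cor H st k va me F s \<Longrightarrow> reg s (Rg v) = va v"
  by (simp add: vm.cor_def)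

section \<open>The loop over all rounds\<close>

context machX begin

definition okst :: "state \<Rightarrow> bool" where
  "okst s \<longleftrightarrow> (reg s 0 \<noteq> 0 \<longrightarrow> ess_solution xs (outp (mem s)))"

definition succst :: "state \<Rightarrow> bool" where
  "succst s \<longleftrightarrow> reg s 0 \<noteq> 0 \<and> ess_solution xs (outp (mem s))"

definition loop :: "com list" where "loop = [WhileNZ (Rg vgo) p_body, Op Add 0 (Rg vfound) 1]"

lemma guar_exit:
  assumes "wb X s" "reg s (Rg vgo) = 0" "reg s 1 = 0" "reg s (Rg vfound) = v" "v \<noteq> 0 \<longrightarrow> ess_solution xs (outp (mem s))"
    "p \<le> of_bool (v \<noteq> 0)"
  shows "guar (wb X) okst succst 2 p (loop, s)"
proof -
  let ?s = "set_reg 0 v s"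
  have w: "wb X ?s" using assms(1,4) by (auto simp: wb_def)
  have 0: "guar (wb X) okst succst 0 p ([], ?s)"
    by (rule guar_halted) (use w assms in \<open>auto simp: okst_def succst_def split: if_splits\<close>)
  have 1: "guar (wb X) okst succst (Suc 0) p ([Op Add 0 (Rg vfound) 1], s)"
    by (rule guar_step[OF _ _ 0]) (use assms in auto)
  have "guar (wb X) okst succst (Suc (Suc 0)) p (loop, s)"
    by (rule guar_step[OF _ _ 1]) (use assms in \<open>auto simp: loop_def\<close>)
  then show ?thesis by (simp add: numeral_2_eq_2)
qed

definition att :: "nat \<Rightarrow> nat" where "att j = tt (int j) + 5 * Lb + 29"

text \<open>Induction over the remaining rounds. A sample is drawn below
  \<open>2 ^ Lb \<le> 2 * RR\<close>, which explains \<open>2 * RR\<close> in the hypothesis on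
  \<open>q\<close>. Only the first \<open>M\<close> rounds are credited with success; later ones
  merely have to be safe.\<close>

lemma guar_loop:
  assumes q: "0 \<le> q" "\<And>j. 1 \<le> j \<Longrightarrow> j \<le> M \<Longrightarrow> q * (2 * real_of_int RR) \<le> real (card (G (nat (B div int j))))"
    and M: "M \<le> nat B"
  shows "1 \<le> j \<Longrightarrow> j + m = nat B + 1 \<Longrightarrow> LH (int j) va me s \<Longrightarrow>
    guar (wb X) okst succst (2 + (\<Sum>i=j..nat B. att i)) (1 - (1 - q) ^ (Suc M - j)) (loop, s)"
proof (induction m arbitrary: j va me s)
  case 0
  then have j: "j = nat B + 1" by simp
  obtain F where F: "vm.cor H 1 0 va me F s" using "0.prems"(3) by (auto simp: LH_def)
  have "guar (wb X) okst succst 2 0 (loop, s)"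
    by (rule guar_exit[where v = 0]) (use "0.prems"(3) cor_reg[OF F, of vgo] cor_reg[OF F, of vfound] F j B1 in \<open>auto simp: LH_def vm.cor_def\<close>)
  then show ?case using j M by (simp add: guar_mono)
next
  case (Suc m)
  let ?j = "int j"
  have jB: "1 \<le> ?j" "?j \<le> B" using Suc.prems(1,2) B1 by auto
  from Suc.prems(3) obtain F where F: "vm.cor H 1 0 va me F s" "int F \<le> H" and L: "wb X s" "vm.sb H va me" "glob ?j va"
    "va vfound = 0" "va vgo = 1" "\<forall>v\<ge>45. va v = 0" "\<forall>v. \<bar>va v\<bar> \<le> Y" "\<forall>l<n. me (int l) = x l"
    "\<forall>a k. int n + ?j \<le> k \<longrightarrow> k < str \<longrightarrow> me (a * str + k) = 0"
    using jB unfolding LH_def by auto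
  define T where "T = 2 + (\<Sum>i=Suc j..nat B. att i)"
  define p where "p = 1 - (1 - q) ^ (M - j)"
  define qq where "qq i = (if int i \<in> G (nat (B div ?j)) then 1 else p)" for i
  define vz where "vz v = (if v \<in> {20..<45} then 0 else va v)" for v
  from exc_zero_core[OF F(1) L(1) HX(3)] obtain s1 where e1: "exc (wb X) 25 zero_core s s1"
    and c1: "vm.cor H 1 0 vz me F s1" unfolding vz_def by blast
  let ?p2 = "[SetConst (Rg vom) 0, Op Add 8 (Rg vL) 1]"
  define s2 where "s2 = fold dst ?p2 s1"
  have Lbr: "reg s1 (Rg vL) = int Lb" "reg s1 (Suc 0) = 0"
    using c1[unfolded vm.cor_def, THEN conjunct1, rule_format, of vL] c1 L(3) by (auto simp: vm.cor_def vz_def glob_def)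
  have LbX: "int Lb \<le> X" "2 ^ Lb \<le> Y" "Y \<le> X"
  proof -
    show 1: "2 ^ Lb \<le> Y" using Lb(3) RR_Y by linarith
    show "Y \<le> X" using YH' HX by linarith
    have "int Lb \<le> 2 ^ Lb" by simp
    then show "int Lb \<le> X" using 1 \<open>Y \<le> X\<close> by linarith
  qed
  have e2: "exc (wb X) 2 ?p2 s1 s2"
    using exc_straight[OF exc_I[OF e1], of ?p2] Lbr LbX HX by (simp add: s2_def numeral_2_eq_2)
  have p01: "p \<le> 1" using q(1)
  proof -
    have "q \<le> 1 \<or> M < j"
    proof (cases "j \<le> M")
      case True
      have "G (nat (B div ?j)) \<subseteq> {0..<RR}" using G_range by auto
      then have "card (G (nat (B div ?j))) \<le> card {0..<RR}" by (intro card_mono) auto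
      then have "real (card (G (nat (B div ?j)))) \<le> real_of_int RR" using RR_Y(2) by simp
      with q(2)[OF Suc.prems(1) True] have "2 * q * real_of_int RR \<le> 1 * real_of_int RR" by (simp only: mult_ac mult_1)
      then show ?thesis using RR_Y(2) by (simp only: mult_le_cancel_right) auto
    qed simp
    then show ?thesis by (auto simp: p_def)
  qed
  have after: "guar (wb X) okst succst (T + tt ?j) (qq i) (tail @ loop, s')"
    if i: "i < 2 ^ Lb" "wb X s'" "mem s' = mem s2" "reg s' (Rg vom) = int i" "\<And>v. v \<notin> {8, 9, Rg vom} \<Longrightarrow> reg s' v = reg s2 v" for i s'
  proof -
    have fr: "reg s' v = reg s1 v" if "v \<notin> {8, 9, Rg vom}" for v using i(5)[OF that] that by (simp add: s2_def)
    have c: "vm.cor H 1 0 (vz(vom := int i)) me F s'"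
      by (rule cor_sample[OF c1 _ i(4) fr]) (use i(3) in \<open>simp add: s2_def\<close>)
    have iY: "int i \<le> Y" using i(1) LbX(2) by (metis less_le_not_le linorder_le_less_linear of_nat_less_iff of_nat_numeral of_nat_power order.trans)
    have vY: "\<bar>(vz(vom := int i)) v\<bar> \<le> Y" for v using L(7) iY Y64 by (simp add: vz_def)
    have iH: "int i \<le> H" using iY YH'(1) by linarith
    have "\<exists>k s''. exc (wb X) k tail s' s'' \<and> k \<le> tt ?j \<and> (DN s'' \<or> (\<exists>va' me'. LH (?j + 1) va' me' s'')) \<and>
      ((vz(vom := int i)) vom \<in> G (nat (B div ?j)) \<longrightarrow> DN s'')"
      by (rule exc_tail[OF c i(2) _ _ jB _ _ vY])
        (use L iH in \<open>auto simp: vm.sb_def glob_def vz_def intro: order_trans\<close>)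
    then obtain k s'' where k: "exc (wb X) k tail s' s''" "k \<le> tt ?j" "DN s'' \<or> (\<exists>va' me'. LH (?j + 1) va' me' s'')"
      "int i \<in> G (nat (B div ?j)) \<Longrightarrow> DN s''" by auto
    have dn: "guar (wb X) okst succst T 1 (loop, s'')" if D: "DN s''"
    proof -
      from D obtain va' me' F' where D': "wb X s''" "vm.cor H 1 0 va' me' F' s''" "va' vgo = 0" "va' vfound = 1" "ess_solution xs (outp me')"
        unfolding DN_def by blast
      have "guar (wb X) okst succst 2 1 (loop, s'')"
        by (rule guar_exit[where v = 1]) (use D' cor_reg[OF D'(2), of vgo] cor_reg[OF D'(2), of vfound] in \<open>auto simp: vm.cor_def\<close>)
      then show ?thesis by (rule guar_mono) (simp_all add: T_def)
    qed
    have "guar (wb X) okst succst T (qq i) (loop, s'')"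
    proof (cases "DN s''")
      case True
      show ?thesis by (rule guar_mono[OF dn[OF True]]) (use p01 in \<open>simp_all add: qq_def\<close>)
    next
      case False
      then obtain va' me' where l: "LH (?j + 1) va' me' s''" "int i \<notin> G (nat (B div ?j))" using k by blast
      have "guar (wb X) okst succst T p (loop, s'')"
        using Suc.IH[of "Suc j" va' me' s''] Suc.prems l(1) by (simp add: T_def p_def add.commute)
      then show ?thesis using l(2) by (simp add: qq_def)
    qed
    from guar_exc[OF k(1) this] show ?thesis by (rule guar_mono) (use k(2) in auto)
  qed
  have c2: "reg s2 8 = int Lb" "reg s2 2 = 1" "reg s2 (Rg vom) = 0"
    using c1 Lbr by (auto simp: s2_def vm.cor_def)
  have smp: "guar (wb X) okst succst (T + tt ?j + 5 * Lb + 1) ((\<Sum>i<2 ^ Lb. qq i) / 2 ^ Lb) (WhileNZ 8 sample_body # tail @ loop, s2)"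
    by (rule guar_sample[OF exc_I[OF e2] c2]) (use LbX Y64 after in auto)
  have e12: "exc (wb X) 27 (zero_core @ ?p2) s s2" using exc_append[OF e1 e2] by simp
  have body: "p_body @ loop = (zero_core @ ?p2) @ WhileNZ 8 sample_body # tail @ loop"
    by (simp add: p_body_def tail_def)
  have g: "guar (wb X) okst succst (Suc (T + tt ?j + 5 * Lb + 1 + 27)) ((\<Sum>i<2 ^ Lb. qq i) / 2 ^ Lb) (loop, s)"
  proof (rule guar_step)
    show "guar (wb X) okst succst (T + tt ?j + 5 * Lb + 1 + 27) ((\<Sum>i<2 ^ Lb. qq i) / 2 ^ Lb) (p_body @ loop, s)"
      unfolding body by (rule guar_exc[OF e12 smp])
    have "reg s (Rg vgo) = 1" using cor_reg[OF F(1), of vgo] L(5) by simp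
    then show "step (loop, s) = return_pmf (p_body @ loop, s)" by (simp add: loop_def)
  qed (use L(1) in simp)
  have pr: "1 - (1 - q) ^ (Suc M - j) \<le> (\<Sum>i<2 ^ Lb. qq i) / 2 ^ Lb"
  proof -
    define mm :: real where "mm = 2 ^ Lb"
    define g where "g = real (card {i. i < 2 ^ Lb \<and> int i \<in> G (nat (B div ?j))})"
    \<comment> \<open>A winning sample counts 1, every other one the guarantee \<open>p\<close> of
      the remaining rounds.\<close>
    have sum: "(\<Sum>i<2 ^ Lb. qq i) = g + (mm - g) * p"
    proof -
      have "(\<Sum>i<2 ^ Lb. qq i) = (\<Sum>i<2 ^ Lb. p + (1 - p) * of_bool (int i \<in> G (nat (B div ?j))))"
        by (rule sum.cong) (auto simp: qq_def)
      also have "\<dots> = mm * p + (1 - p) * g"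
        by (simp add: sum.distrib sum_distrib_left[symmetric] mm_def g_def of_bool_def sum.If_cases Int_def)
      finally show ?thesis by (simp add: algebra_simps)
    qed
    have "mm > 0" by (simp add: mm_def)
    have gM: "j \<le> M \<Longrightarrow> q * mm \<le> g"
    proof -
      assume jN: "j \<le> M"
      have "real_of_int (2 ^ Lb) \<le> real_of_int (2 * RR)" using Lb(3) by (simp only: of_int_le_iff)
      then have "mm \<le> 2 * real_of_int RR" by (simp add: mm_def)
      then have "q * mm \<le> q * (2 * real_of_int RR)" using q(1) by (rule mult_left_mono)
      also have "\<dots> \<le> real (card (G (nat (B div ?j))))" by (rule q(2)[OF Suc.prems(1) jN])
      also have "card (G (nat (B div ?j))) = card {i. i < 2 ^ Lb \<and> int i \<in> G (nat (B div ?j))}"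
      proof (rule bij_betw_same_card[symmetric, of int])
        have "y \<in> int ` {i. i < 2 ^ Lb \<and> int i \<in> G (nat (B div ?j))}" if y: "y \<in> G (nat (B div ?j))" for y
        proof -
          have "0 \<le> y" "y < 2 ^ Lb" using G_range[OF y] Lb(1) by auto
          then have "nat y < 2 ^ Lb" "y = int (nat y)" by (auto simp: nat_less_iff)
          then show ?thesis using y by (metis (mono_tags, lifting) image_eqI mem_Collect_eq)
        qed
        then show "bij_betw int {i. i < 2 ^ Lb \<and> int i \<in> G (nat (B div ?j))} (G (nat (B div ?j)))"
          by (auto simp: bij_betw_def)
      qed
      finally show "q * mm \<le> g" by (simp add: g_def)
    qed
    have g0: "0 \<le> g" by (simp add: g_def)
    show ?thesis
    proof (cases "j \<le> M")
      case True
      have "(1 - (1 - q) ^ (Suc M - j)) * mm = (1 - (1 - q) * (1 - p)) * mm"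
        using True by (simp add: p_def Suc_diff_le)
      also have "\<dots> = p * mm + (1 - p) * (q * mm)" by (simp add: algebra_simps)
      also have "\<dots> \<le> p * mm + (1 - p) * g" using gM[OF True] p01 by (intro add_left_mono mult_left_mono) auto
      also have "\<dots> = (\<Sum>i<2 ^ Lb. qq i)" unfolding sum by (simp add: algebra_simps)
      finally show ?thesis using \<open>mm > 0\<close> by (simp add: mm_def field_simps)
    next
      case False
      then have p0: "p = 0" by (simp add: p_def)
      show ?thesis using False g0 \<open>mm > 0\<close> unfolding sum p0 by (simp add: mm_def Suc_diff_le)
    qed
  qed
  have jB': "j \<le> nat B" using Suc.prems(2) by simp
  have "(\<Sum>i=j..nat B. att i) = att j + (\<Sum>i=Suc j..nat B. att i)" by (rule sum.atLeast_Suc_atMost[OF jB'])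
  then show ?case by (intro guar_mono[OF g _ pr]) (simp add: T_def att_def)
qed

definition total :: nat where
  "total = 17 + 6 * n + ssz prelude * (1 + n + Lb) + (\<Sum>i=1..nat B. att i)"

lemma exc_init:
  assumes "init prog xs = (prog, s)"
  shows "\<exists>s'. exc (wb X) (15 + 6 * n) p_init s s' \<and> vm.cor H 1 0 ((\<lambda>_. 0)(vN := int n)) (mem s) (nat H) s'"
proof -
  have s: "reg s = (\<lambda>_. 0)(0 := int n)" "mem s = (\<lambda>a. if 0 \<le> a \<and> a < int n then xs ! nat a else 0)"
    using assms by (auto simp: init_def n_def)
  have me: "mem s (int l) = x l" if "l < n" for l using that by (simp add: s x_def)
  have nX: "int n \<le> X" "64 \<le> X" using n_le powY[of 2 n] YH' HX by auto
  have XY: "Y \<le> X" using YH' HX by simp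
  have wb0: "wb X s"
    unfolding wb_def s
  proof (intro conjI allI)
    fix a show "\<bar>if 0 \<le> a \<and> a < int n then xs ! nat a else 0\<bar> \<le> X"
      using x_le(1)[of "nat a"] Yb(2) XY nX by (auto simp: x_def nat_less_iff)
  qed (use nX in auto)
  let ?p1 = "[SetConst 2 1, Op Add (Rg vN) 0 1, Op Add 8 0 1, SetConst 3 64, SetConst 9 64]"
  define s1 where "s1 = fold dst ?p1 s"
  have e1: "exc (wb X) 5 ?p1 s s1"
    using exc_straight[OF wb0, of ?p1] nX by (simp add: s1_def s numeral_eq_Suc)
  have r1: "reg s1 = (\<lambda>_. 0)(0 := int n, 2 := 1, Rg vN := int n, 8 := int n, 3 := 64, 9 := 64)" "mem s1 = mem s"
    by (auto simp: s1_def s fun_eq_iff)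
  have hY: "h \<le> Y" using h64 mult_mono[of 1 h h h] by (simp add: Y_def)
  have "\<exists>s'. exc (wb X) (Suc (6 * n)) [WhileNZ 8 h_body] s1 s' \<and> mem s' = mem s1 \<and> reg s' 3 = hs x n \<and>
     (\<forall>v. v \<notin> {3, 8, 10} \<longrightarrow> reg s' v = reg s1 v)"
    by (rule exc_h_loop[where n = n])
      (use exc_I[OF e1] r1 me hY XY nX in \<open>auto simp: h_def\<close>)
  then obtain s2 where e2: "exc (wb X) (Suc (6 * n)) [WhileNZ 8 h_body] s1 s2" and m2: "mem s2 = mem s"
    and r2: "reg s2 3 = h" "\<And>v. v \<notin> {3, 8, 10} \<Longrightarrow> reg s2 v = reg s1 v" unfolding h_def r1 by auto
  let ?p3 = "[Op Mul 3 3 3, Op Mul 3 3 3, Op Mul 3 3 3, Op Mul 3 3 3, Op Mul 3 3 3, Op Add 4 3 3, SetConst 5 1, SetConst 6 0, Op Add 7 3 1]"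
  define s3 where "s3 = fold dst ?p3 s2"
  have pw: "\<bar>h ^ i\<bar> \<le> X" if "i \<le> 32" for i
  proof -
    have "h ^ i \<le> h ^ 32" using that h64 by (intro power_increasing) auto
    then have "h ^ i \<le> X" using HX(1) unfolding H_def by linarith
    then show ?thesis using h64 by simp
  qed
  have hm: "h * h = h ^ 2" "h ^ 2 * h ^ 2 = h ^ 4" "h ^ 4 * h ^ 4 = h ^ 8" "h ^ 8 * h ^ 8 = h ^ 16" "h ^ 16 * h ^ 16 = H"
    unfolding H_def power_add[symmetric] by (simp_all add: power2_eq_square)
  have r20: "reg s2 (Suc 0) = 0" using r2(2)[of "Suc 0"] by (simp add: r1)
  have e3: "exc (wb X) 9 ?p3 s2 s3"
  proof -
    have "slb X ?p3 s2" using r2(1) r20 pw[of 2] pw[of 4] pw[of 8] pw[of 16] HX YH' nX by (simp add: hm H_def)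
    from exc_straight[OF exc_I[OF e2] this] show ?thesis by (simp add: s3_def numeral_eq_Suc)
  qed
  have "vm.cor H 1 0 ((\<lambda>_. 0)(vN := int n)) (mem s) (nat H) s3"
    unfolding vm.cor_def
  proof (intro conjI allI)
    fix v show "reg s3 (Rg v) = ((\<lambda>_. 0)(vN := int n)) v"
      using r2(2)[of "Rg v"] by (simp add: s3_def r1)
  qed (use r2(1) r2(2)[of "Suc 0"] r2(2)[of 2] m2 YH' H_def in \<open>simp_all add: s3_def hm r1\<close>)
  moreover have "exc (wb X) (5 + (Suc (6 * n) + 9)) p_init s s3"
    unfolding p_init_def by (rule exc_append[OF e1 exc_append[OF e2 e3]])
  moreover have "5 + (Suc (6 * n) + 9) = 15 + 6 * n" by simp
  ultimately show ?thesis by metis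
qed

lemma guar_prog:
  assumes q: "0 \<le> q" "\<And>j. 1 \<le> j \<Longrightarrow> j \<le> M \<Longrightarrow> q * (2 * real_of_int RR) \<le> real (card (G (nat (B div int j))))"
    and M: "M \<le> nat B"
  shows "guar (wb X) okst succst total (1 - (1 - q) ^ M) (init prog xs)"
proof -
  define s where "s = snd (init prog xs)"
  have i: "init prog xs = (prog, s)" by (simp add: s_def init_def)
  define me where "me = mem s"
  have me: "me = (\<lambda>a. if 0 \<le> a \<and> a < int n then xs ! nat a else 0)"
    unfolding me_def using i by (auto simp: init_def n_def)
  have inp: "\<forall>l<n. me (int l) = x l" by (simp add: me x_def)
  let ?va = "(\<lambda>_. 0)(vN := int n)"
  from exc_init[OF i] obtain s1 where e1: "exc (wb X) (15 + 6 * n) p_init s s1" and c1: "vm.cor H 1 0 ?va me (nat H) s1"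
    unfolding me_def by blast
  have nY: "int n \<le> Y" "0 \<le> Y" using n_le powY[of 2 n] Y64 by auto
  have mY: "\<bar>me a\<bar> \<le> Y" for a
    using x_le(1)[of "nat a"] nY Yb(2) by (auto simp: me x_def nat_less_iff)
  have b: "bnd ?va me"
    unfolding bnd_def using nY mY by auto
  have sb: "vm.sb H ?va me"
    unfolding vm.sb_def using nY mY YH'(1) by (auto intro: order_trans)
  have "J prelude ?va me (n + Lb) (\<lambda>va' me'. me' = me \<and> va' vgo = 1 \<and> va' vfound = 0 \<and>
     glob 1 va' \<and> (\<forall>v. 45 \<le> v \<longrightarrow> va' v = ?va v))"
    by (rule prelude_correct[OF _ inp]) simp
  with b obtain va' m where m: "m \<le> n + Lb" "bnd va' me" "va' vgo = 1" "va' vfound = 0" "glob 1 va'" "\<forall>v. 45 \<le> v \<longrightarrow> va' v = 0"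
    "\<And>F. bs prelude ?va me (m + F) va' me F" unfolding J_def by auto
  have nH: "m \<le> nat H"
  proof -
    have a: "int Lb \<le> 2 ^ Lb" by simp
    have "int Lb \<le> Y div 2" using a Lb(3) RR_Y by linarith
    moreover have "int n \<le> Y div 2" using n_le powY[of 2 n] by simp
    ultimately show ?thesis using m(1) YH' by linarith
  qed
  define F' where "F' = nat H - m"
  have bs: "bs prelude ?va me (nat H) va' me F'" using m(7)[of F'] nH by (simp add: F'_def)
  have H1: "1 \<le> H" using YH' by simp
  from cst_correct[OF H1 X _ _ _ _ bs c1 exc_I[OF e1] sb sok_prelude[OF YH'(2)]] H1 obtain k s2 where
    k: "exc (wb X) k (cst prelude) s1 s2" "k \<le> ssz prelude * (1 + (nat H - F'))" "cor va' me F' s2" by auto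
  have "nat H - F' = m" using nH by (simp add: F'_def)
  then have "k \<le> ssz prelude * (1 + m)" using k(2) by simp
  also have "\<dots> \<le> ssz prelude * (1 + n + Lb)" using m(1) by (intro mult_left_mono) auto
  finally have kb: "k \<le> ssz prelude * (1 + n + Lb)" .
  have "LH (int 1) va' me s2"
    unfolding LH_def
  proof (intro conjI allI impI)
    show "\<exists>F. cor va' me F s2 \<and> int F \<le> H" using k(3) H1 by (intro exI[of _ F']) (simp add: F'_def)
    show "wb X s2" by (rule exc_I[OF k(1)])
    show "sb va' me" by (rule bs_sb[OF bs H1 sb sok_prelude[OF YH'(2)]])
    show "va' vgo = (if int 1 \<le> B then 1 else 0)" using m B1 by simp
    show "\<bar>va' v\<bar> \<le> Y" for v using m(2) by (auto simp: bnd_def)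
    fix a k assume k: "int n + int 1 \<le> k" "k < str"
    \<comment> \<open>Input cells are their own residues and lie below \<open>n\<close>, whereas
      \<open>k\<close> is at least \<open>n + 1\<close>.\<close>
    have "(a * str + k) mod str = k" using k by (simp add: mod_pos_pos_trivial)
    moreover have "(a * str + k) mod str = a * str + k" if "0 \<le> a * str + k" "a * str + k < int n"
      using that k by (intro mod_pos_pos_trivial) auto
    ultimately show "me (a * str + k) = 0" using k unfolding me by auto
  qed (use m inp in auto)
  from guar_loop[OF q M, of 1 "nat B" va' me s2] this
  have "guar (wb X) okst succst (2 + (\<Sum>i=1..nat B. att i)) (1 - (1 - q) ^ M) (loop, s2)" by simp
  from guar_exc[OF e1 guar_exc[OF k(1) this]]
  have "guar (wb X) okst succst (2 + (\<Sum>i=1..nat B. att i) + k + (15 + 6 * n)) (1 - (1 - q) ^ M) (prog, s)"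
    by (simp add: prog_def loop_def)
  then show ?thesis unfolding i by (rule guar_mono) (use kb in \<open>simp_all add: total_def\<close>)
qed

end

section \<open>Cost of an attempt\<close>

text \<open>Weighting a partial sum with \<open>r\<close> zero digits by \<open>\<rho> ^ r\<close> bounds the number of those with at most \<open>z\<close> zeros.\<close>

lemma lev_weight:
  fixes \<rho> :: real
  assumes "0 < \<rho>" "z \<le> int n"
  shows "(\<Sum>e\<leftarrow>lev (chV x n ty k z cls) i. \<rho> ^ nat (e mod (int n + 1))) \<le> (2 + \<rho>) ^ card {l. l < i \<and> tp ty l = cls}"
proof (induction i)
  case (Suc i)
  let ?w = "\<lambda>e. \<rho> ^ nat (e mod (int n + 1))"
  let ?f = "if tp ty i = cls then 2 + \<rho> else 1"
  have g: "(e + gg x n i) mod (int n + 1) = e mod (int n + 1)" "(e - gg x n i) mod (int n + 1) = e mod (int n + 1)" for e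
    by (simp_all add: gg_def mod_diff_right_eq[symmetric, of e])
  have s: "(\<Sum>e'\<leftarrow>chV x n ty k z cls i e. ?w e') \<le> ?f * ?w e" for e
  proof (cases "e mod (int n + 1) < z")
    case True
    have "(e + 1) mod (int n + 1) = e mod (int n + 1) + 1"
    proof -
      have "(e + 1) mod (int n + 1) = (e mod (int n + 1) + 1) mod (int n + 1)" by (simp add: mod_add_left_eq)
      also have "\<dots> = e mod (int n + 1) + 1" using True assms(2) by (intro mod_pos_pos_trivial) auto
      finally show ?thesis .
    qed
    then have "?w (e + 1) = \<rho> * ?w e" by (simp add: nat_add_distrib)
    then show ?thesis using assms(1) True by (simp add: chV_def g distrib_right)
  next
    case False
    then show ?thesis using assms(1) by (simp add: chV_def g distrib_right)
  qed
  have "(\<Sum>e\<leftarrow>lev (chV x n ty k z cls) (Suc i). ?w e) = (\<Sum>e\<leftarrow>lev (chV x n ty k z cls) i. \<Sum>e'\<leftarrow>chV x n ty k z cls i e. ?w e')"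
  proof -
    have "(\<Sum>e\<leftarrow>concat (map f L). g e) = (\<Sum>e\<leftarrow>L. \<Sum>e'\<leftarrow>f e. g e')" for f :: "int \<Rightarrow> int list" and L and g :: "int \<Rightarrow> real"
      by (induction L) auto
    then show ?thesis by simp
  qed
  also have "\<dots> \<le> (\<Sum>e\<leftarrow>lev (chV x n ty k z cls) i. ?f * ?w e)"
    by (intro sum_list_mono s)
  also have "\<dots> = ?f * (\<Sum>e\<leftarrow>lev (chV x n ty k z cls) i. ?w e)" by (rule sum_list_const_mult)
  also have "\<dots> \<le> ?f * (2 + \<rho>) ^ card {l. l < i \<and> tp ty l = cls}"
    using Suc assms(1) by (intro mult_left_mono) auto
  also have "\<dots> = (2 + \<rho>) ^ card {l. l < Suc i \<and> tp ty l = cls}"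
  proof -
    have "{l. l < Suc i \<and> tp ty l = cls} = (if tp ty i = cls then insert i else id) {l. l < i \<and> tp ty l = cls}"
      using less_Suc_eq by auto
    then show ?thesis by simp
  qed
  finally show ?case .
qed simp

lemma lev_zeros:
  assumes "0 \<le> z" "z \<le> int n"
  shows "e \<in> set (lev (chV x n ty k z cls) i) \<Longrightarrow> e mod (int n + 1) \<le> z"
proof (induction i arbitrary: e)
  case (Suc i)
  then obtain e0 where e0: "e0 \<in> set (lev (chV x n ty k z cls) i)" "e \<in> set (chV x n ty k z cls i e0)" by auto
  have g: "(e + gg x n i) mod (int n + 1) = e mod (int n + 1)" "(e - gg x n i) mod (int n + 1) = e mod (int n + 1)" for e
    by (simp_all add: gg_def mod_diff_right_eq[symmetric, of e])
  have m: "e0 mod (int n + 1) < z \<Longrightarrow> (e0 + 1) mod (int n + 1) \<le> z"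
  proof -
    assume h: "e0 mod (int n + 1) < z"
    have "(e0 + 1) mod (int n + 1) = (e0 mod (int n + 1) + 1) mod (int n + 1)" by (simp add: mod_add_left_eq)
    also have "\<dots> = e0 mod (int n + 1) + 1" using h assms(2) by (intro mod_pos_pos_trivial) auto
    finally show ?thesis using h by simp
  qed
  show ?case using e0(2) Suc.IH[OF e0(1)] m by (auto simp: chV_def g split: if_splits)
qed (use assms in simp)

lemma lev_length_weight:
  fixes \<rho> :: real
  assumes "0 < \<rho>" "\<rho> \<le> 1" "0 \<le> z" "z \<le> int n" "i \<le> n"
  shows "real (length (lev (chV x n ty k z cls) i)) * \<rho> ^ nat z \<le> (2 + \<rho>) ^ card {l. l < n \<and> tp ty l = cls}"
proof -
  let ?L = "lev (chV x n ty k z cls) i"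
  have "real (length ?L) * \<rho> ^ nat z = (\<Sum>e\<leftarrow>?L. \<rho> ^ nat z)" by (simp add: sum_list_triv)
  also have "\<dots> \<le> (\<Sum>e\<leftarrow>?L. \<rho> ^ nat (e mod (int n + 1)))"
  proof (rule sum_list_mono)
    fix e assume "e \<in> set ?L"
    then have "nat (e mod (int n + 1)) \<le> nat z" using lev_zeros[OF assms(3,4)] by (simp add: nat_mono)
    then show "\<rho> ^ nat z \<le> \<rho> ^ nat (e mod (int n + 1))" using assms(1,2) by (intro power_decreasing) auto
  qed
  also have "\<dots> \<le> (2 + \<rho>) ^ card {l. l < i \<and> tp ty l = cls}" by (rule lev_weight[OF assms(1,4)])
  also have "\<dots> \<le> (2 + \<rho>) ^ card {l. l < n \<and> tp ty l = cls}"
    using assms by (intro power_increasing card_mono) auto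
  finally show ?thesis .
qed

lemma lev_length_0: "length (lev (chV x n ty 0 z cls) i) \<le> 1"
proof -
  have "length (lev (chV x n ty 0 z cls) i) \<le> 1 ^ i" by (rule lev_length) (auto simp: chV_def)
  then show ?thesis by simp
qed

lemma levR_mono: "i \<le> n \<Longrightarrow> length (lev (chR x n ty) i) \<le> length (lev (chR x n ty) n)"
  unfolding levR_length_eq by (intro power_increasing card_mono) auto

context core begin

text \<open>Listing and joining are charged to the same \<open>E\<close>: a join with
  \<open>2 ^ k\<close> buckets costs about the product of the lengths of its lists divided by
  \<open>2 ^ k\<close>.\<close>

lemma fuelc_bound:
  fixes E :: real and ty z :: int and k :: nat
  defines "lv \<equiv> \<lambda>cls i. length (lev (chV x n ty (int k) z cls) i)" and "lr \<equiv> length (lev (chR x n ty) n)"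
  assumes k: "k \<le> n" and E: "1 \<le> E" "\<And>cls i. cls \<in> {0, 1} \<Longrightarrow> i \<le> n \<Longrightarrow> real (lv cls i) \<le> E" "real lr \<le> E"
    "\<And>cls. cls \<in> {0, 1} \<Longrightarrow> real (lv cls n) * real lr \<le> E * 2 ^ k"
    and p: "2 ^ k * (pairs ty k z t \<alpha> 0 + pairs ty k z t \<alpha> 1) \<le> 2 ^ k * (2 * (lv 0 n + lv 1 n)) + 128 * (lv 0 n + lv 1 n) * lr"
  shows "real (fuelc ty k z t \<alpha>) \<le> 270 * (real n + 1) * E"
proof -
  define P where "P = real (pairs ty k z t \<alpha> 0 + pairs ty k z t \<alpha> 1)"
  have "real (2 ^ k * (pairs ty k z t \<alpha> 0 + pairs ty k z t \<alpha> 1)) \<le> real (2 ^ k * (2 * (lv 0 n + lv 1 n)) + 128 * (lv 0 n + lv 1 n) * lr)"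
    using p by (simp only: of_nat_le_iff)
  then have "2 ^ k * P \<le> 2 ^ k * (2 * (real (lv 0 n) + real (lv 1 n))) + 128 * (real (lv 0 n) * real lr + real (lv 1 n) * real lr)"
    by (simp add: P_def algebra_simps)
  also have "\<dots> \<le> 2 ^ k * (2 * (E + E)) + 128 * (E * 2 ^ k + E * 2 ^ k)"
    using E(2)[of 0 n] E(2)[of 1 n] E(4)[of 0] E(4)[of 1] by (intro add_mono mult_left_mono) auto
  also have "\<dots> = 2 ^ k * (260 * E)" by simp
  finally have P: "P \<le> 260 * E" by simp
  have s: "real (\<Sum>i<n. Suc (f i)) \<le> real n * (1 + E)" if "\<And>i. i \<le> n \<Longrightarrow> real (f i) \<le> E" for f :: "nat \<Rightarrow> nat"
  proof -
    have "real (\<Sum>i<n. Suc (f i)) = (\<Sum>i<n. 1 + real (f i))" by simp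
    also have "\<dots> \<le> (\<Sum>i<n. 1 + E)" by (intro sum_mono add_left_mono that) auto
    finally show ?thesis by simp
  qed
  have r: "real (length (lev (chR x n ty) i)) \<le> E" if "i \<le> n" for i
    using levR_mono[OF that, of x ty] E(3) unfolding lr_def by linarith
  have "real (fuelc ty k z t \<alpha>) \<le> real k + real n * (1 + E) + real n * (1 + E) + real n * (1 + E) + E + P"
    unfolding fuelc_def P_def of_nat_add
    using s[of "\<lambda>i. lv 0 i", OF E(2)[of 0]] s[of "\<lambda>i. lv 1 i", OF E(2)[of 1]] s[of "\<lambda>i. length (lev (chR x n ty) i)", OF r] r[OF order_refl]
    unfolding lv_def by simp
  also have "\<dots> \<le> real n * E + 3 * (real n * (E + E)) + E + 260 * E"
  proof -
    have "real k \<le> real n * 1" "real n * (1 + E) \<le> real n * (E + E)" using k E(1) by (auto intro!: mult_left_mono)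
    moreover have "real n * 1 \<le> real n * E" using E(1) by (intro mult_left_mono) auto
    ultimately show ?thesis using P by linarith
  qed
  also have "\<dots> \<le> 270 * (real n + 1) * E" using E(1) by (simp add: algebra_simps)
  finally show ?thesis .
qed

end

context mach begin

lemma mixed_eq:
  "0 \<le> a \<Longrightarrow> a < b \<Longrightarrow> 0 \<le> a' \<Longrightarrow> a' < b \<Longrightarrow> a + b * q = a' + b * q' \<Longrightarrow> a = a' \<and> q = q'" for a b q a' q' :: int
proof -
  assume h: "0 \<le> a" "a < b" "0 \<le> a'" "a' < b" "a + b * q = a' + b * q'"
  have "(a + b * q) mod b = a" "(a' + b * q') mod b = a'" using h(1-4) by simp_all
  then have "a = a'" using h(5) by metis
  then show ?thesis using h by auto
qed

text \<open>For fixed \<open>z\<close> and \<open>k\<close> each type vector in \<open>Ty\<close>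
  contributes its share of pairs \<open>(t, \<alpha>)\<close> by \<open>hit_count\<close>, and the
  mixed radix encoding keeps them apart. The memory layout of the first round stands in for all,
  since \<open>hit\<close> and \<open>fuelc\<close> do not involve it.\<close>

lemma card_G:
  fixes E :: real
  assumes z: "0 \<le> z" "z \<le> int n" and k: "k \<le> n" and Ty: "Ty \<subseteq> {0..<4 ^ n}"
    and att: "\<And>ty. ty \<in> Ty \<Longrightarrow> \<exists>Zs. attempt H str (int n + int 1) Y ({0..<int n} \<union> {a. a mod str = int n + int 1}) n x S ty k z c Zs"
    and E: "1 \<le> E" "\<And>ty cls i. ty \<in> Ty \<Longrightarrow> cls \<in> {0, 1} \<Longrightarrow> i \<le> n \<Longrightarrow> real (length (lev (chV x n ty (int k) z cls) i)) \<le> E"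
    "\<And>ty. ty \<in> Ty \<Longrightarrow> real (length (lev (chR x n ty) n)) \<le> E"
    "\<And>ty cls. ty \<in> Ty \<Longrightarrow> cls \<in> {0, 1} \<Longrightarrow> real (length (lev (chV x n ty (int k) z cls) n)) * real (length (lev (chR x n ty) n)) \<le> E * 2 ^ k"
    and F: "270 * (real n + 1) * E \<le> real F"
  shows "int (card Ty) * (2 ^ n * (S * 2 ^ n)) \<le> 128 * int (card (G F))"
proof -
  define D where "D ty = {(t, \<alpha>). t \<in> {0..<2 ^ n} \<and> \<alpha> \<in> {0..<S * 2 ^ n} \<and> core.hit n x S ty k z t \<alpha> \<and> core.fuelc n x S ty k z t \<alpha> \<le> F}" for ty
  have finD: "finite (D ty)" for ty
    by (rule finite_subset[of _ "{0..<2 ^ n} \<times> {0..<S * 2 ^ n}"]) (auto simp: D_def)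
  have finT: "finite Ty" using Ty by (rule finite_subset) simp
  have D: "2 ^ n * (S * 2 ^ n) \<le> 128 * int (card (D ty))" if ty: "ty \<in> Ty" for ty
  proof -
    from att[OF ty] obtain Zs where "attempt H str (int n + int 1) Y ({0..<int n} \<union> {a. a mod str = int n + int 1}) n x S ty k z c Zs" by blast
    then interpret a: attempt H str "int n + int 1" Y "{0..<int n} \<union> {a. a mod str = int n + int 1}" n x S ty k z c Zs .
    note a.hit_count
    also have "128 * int (card {(t, \<alpha>). t \<in> {0..<2 ^ n} \<and> \<alpha> \<in> {0..<S * 2 ^ n} \<and> a.hit ty k z t \<alpha> \<and>
     2 ^ k * (a.pairs ty k z t \<alpha> 0 + a.pairs ty k z t \<alpha> 1) \<le> 2 ^ k * (2 * (a.lV 0 + a.lV 1)) + 128 * (a.lV 0 + a.lV 1) * a.lR}) \<le> 128 * int (card (D ty))"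
    proof -
      have "a.fuelc ty k z t \<alpha> \<le> F" if "2 ^ k * (a.pairs ty k z t \<alpha> 0 + a.pairs ty k z t \<alpha> 1) \<le> 2 ^ k * (2 * (a.lV 0 + a.lV 1)) + 128 * (a.lV 0 + a.lV 1) * a.lR" for t \<alpha>
      proof -
        have "real (a.fuelc ty k z t \<alpha>) \<le> 270 * (real n + 1) * E"
          by (rule a.fuelc_bound[OF k E(1) E(2)[OF ty] E(3)[OF ty] E(4)[OF ty] that[unfolded a.lV_def a.lR_def]])
        with F show ?thesis by linarith
      qed
      then have "{(t, \<alpha>). t \<in> {0..<2 ^ n} \<and> \<alpha> \<in> {0..<S * 2 ^ n} \<and> a.hit ty k z t \<alpha> \<and>
       2 ^ k * (a.pairs ty k z t \<alpha> 0 + a.pairs ty k z t \<alpha> 1) \<le> 2 ^ k * (2 * (a.lV 0 + a.lV 1)) + 128 * (a.lV 0 + a.lV 1) * a.lR} \<subseteq> D ty"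
        unfolding D_def by auto
      from card_mono[OF finD this] show ?thesis by simp
    qed
    finally show ?thesis .
  qed
  define f where "f = (\<lambda>(ty, t, \<alpha>). z + (int n + 1) * (int k + (int n + 1) * (t + 2 ^ n * (ty + 4 ^ n * \<alpha>))))"
  have inj: "inj_on f (Sigma Ty D)"
  proof (rule inj_onI)
    fix u v assume uv: "u \<in> Sigma Ty D" "v \<in> Sigma Ty D" "f u = f v"
    obtain ty t \<alpha> ty' t' \<alpha>' where u: "u = (ty, t, \<alpha>)" and v: "v = (ty', t', \<alpha>')" by (metis surj_pair)
    have r: "0 \<le> t" "t < 2 ^ n" "0 \<le> t'" "t' < 2 ^ n" "0 \<le> ty" "ty < 4 ^ n" "0 \<le> ty'" "ty' < 4 ^ n"
      using uv(1,2) Ty unfolding u v D_def by auto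
    have "t + 2 ^ n * (ty + 4 ^ n * \<alpha>) = t' + 2 ^ n * (ty' + 4 ^ n * \<alpha>')"
      using uv(3) unfolding u v f_def by simp
    from mixed_eq[OF r(1-4) this] mixed_eq[OF r(5-8)] show "u = v" unfolding u v by blast
  qed
  have sub: "f ` Sigma Ty D \<subseteq> G F"
  proof
    fix w assume "w \<in> f ` Sigma Ty D"
    then obtain ty t \<alpha> where w: "w = f (ty, t, \<alpha>)" "ty \<in> Ty" "(t, \<alpha>) \<in> D ty" by auto
    have "0 \<le> ty \<and> ty < 4 ^ n" using w(2) Ty by auto
    then show "w \<in> G F" using w(1,3) z k unfolding G_def f_def D_def by (intro CollectI exI[of _ z] exI[of _ k] exI[of _ t] exI[of _ ty] exI[of _ \<alpha>]) simp
  qed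
  have finG: "finite (G F)" by (rule finite_subset[of _ "{0..<RR}"]) (use G_range in auto)
  have "int (card Ty) * (2 ^ n * (S * 2 ^ n)) = (\<Sum>ty\<in>Ty. 2 ^ n * (S * 2 ^ n))" by simp
  also have "\<dots> \<le> (\<Sum>ty\<in>Ty. 128 * int (card (D ty)))" by (rule sum_mono) (rule D)
  also have "\<dots> = 128 * int (card (Sigma Ty D))" by (simp add: card_SigmaI[OF finT] finD sum_distrib_left)
  also have "card (Sigma Ty D) = card (f ` Sigma Ty D)" using inj by (rule card_image[symmetric])
  also have "128 * int (card (f ` Sigma Ty D)) \<le> 128 * int (card (G F))" using card_mono[OF finG sub] by simp
  finally show ?thesis by simp
qed

end

section \<open>Counting types\<close>

text \<open>As a function of \<open>k\<close>, the quotient \<open>m ^ k / k!\<close> is largest at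
  \<open>k = m\<close>.\<close>

lemma fact_mult_power_le: "fact m * m ^ k \<le> fact k * (m ^ m :: nat)"
proof (cases "k \<le> m")
  case True
  have "fact m \<le> fact k * m ^ (m - k)"
    using fact_div_fact_le_pow[of "m - k" m] True fact_dvd[OF True, where ?'a = nat]
    by (metis diff_diff_cancel diff_le_self dvd_mult_div_cancel mult_le_mono2)
  then have "fact m * m ^ k \<le> fact k * m ^ (m - k) * m ^ k" by (rule mult_right_mono) simp
  then show ?thesis using True by (simp add: mult.assoc power_add[symmetric])
next
  case False
  have "fact m * m ^ (k - m) \<le> (fact k :: nat)"
  proof -
    have "fact m * m ^ j \<le> (fact (m + j) :: nat)" for j
    proof (induction j)
      case (Suc j)
      have "fact m * m ^ Suc j = m * (fact m * m ^ j)" by simp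
      also have "\<dots> \<le> (m + Suc j) * fact (m + j)" using Suc by (intro mult_mono) auto
      finally show ?case by simp
    qed simp
    from this[of "k - m"] False show ?thesis by simp
  qed
  then have "fact m * m ^ (k - m) * m ^ m \<le> fact k * m ^ m" by (rule mult_right_mono) simp
  then show ?thesis using False by (simp add: mult.assoc power_add[symmetric])
qed

text \<open>Two applications of \<open>fact_mult_power_le\<close>, to \<open>m\<close> and to
  \<open>n - m\<close>, show that the term of index \<open>m\<close> dominates the expansion of
  \<open>(m + (n - m)) ^ n\<close>.\<close>

lemma binomial_mode:
  assumes "k \<le> n" "m \<le> n"
  shows "(n choose k) * (m ^ k * (n - m) ^ (n - k)) \<le> (n choose m) * (m ^ m * (n - m) ^ (n - m))"
proof -
  have "(n choose k) * (m ^ k * (n - m) ^ (n - k)) * (fact m * fact (n - m))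
      = (n choose k) * ((fact m * m ^ k) * (fact (n - m) * (n - m) ^ (n - k)))" by (simp only: mult_ac)
  also have "\<dots> \<le> (n choose k) * ((fact k * m ^ m) * (fact (n - k) * (n - m) ^ (n - m)))"
    by (intro mult_left_mono mult_mono fact_mult_power_le) auto
  also have "\<dots> = (fact k * fact (n - k) * (n choose k)) * (m ^ m * (n - m) ^ (n - m))" by (simp only: mult_ac)
  also have "fact k * fact (n - k) * (n choose k) = fact m * fact (n - m) * (n choose m)"
    using assms by (simp only: binomial_fact_lemma)
  also have "fact m * fact (n - m) * (n choose m) * (m ^ m * (n - m) ^ (n - m))
      = (n choose m) * (m ^ m * (n - m) ^ (n - m)) * (fact m * fact (n - m))" by (simp only: mult_ac)
  finally show ?thesis by (simp only: mult_le_cancel2) simp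
qed

text \<open>The largest of the \<open>n + 1\<close> terms of the expansion of
  \<open>(m + (n - m)) ^ n\<close> is at least their average. This is the entropy bound for binomial
  coefficients up to a factor \<open>n + 1\<close>.\<close>

lemma binomial_ge_entropy:
  assumes "m \<le> n"
  shows "n ^ n \<le> (n + 1) * ((n choose m) * (m ^ m * (n - m) ^ (n - m)))"
proof -
  have "n ^ n = (m + (n - m)) ^ n" using assms by simp
  also have "\<dots> = (\<Sum>k\<le>n. (n choose k) * (m ^ k * (n - m) ^ (n - k)))"
    by (subst binomial) (simp add: mult.assoc)
  also have "\<dots> \<le> (\<Sum>k\<le>n. (n choose m) * (m ^ m * (n - m) ^ (n - m)))"
    by (rule sum_mono) (use assms in \<open>simp add: binomial_mode\<close>)
  also have "\<dots> = (n + 1) * ((n choose m) * (m ^ m * (n - m) ^ (n - m)))" by simp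
  finally show ?thesis .
qed

text \<open>The entropy bound at the fixed ratio \<open>c / A\<close>, where all powers of
  \<open>u\<close> cancel. The surplus \<open>r\<close> enters by monotonicity of binomial
  coefficients.\<close>

lemma binomial_proportional:
  assumes "c \<le> A"
  shows "(A ^ A) ^ u \<le> (A * u + r + 1) * ((A * u + r choose (c * u)) * (c ^ c * (A - c) ^ (A - c)) ^ u)"
proof (cases "u = 0")
  case False
  have cu: "c * u \<le> A * u" using assms by simp
  have d: "A * u - c * u = (A - c) * u" by (simp add: diff_mult_distrib)
  have "(A ^ A) ^ u * u ^ (A * u) = (A * u) ^ (A * u)" by (simp add: power_mult_distrib power_mult)
  also have "\<dots> \<le> (A * u + 1) * ((A * u choose (c * u)) * ((c * u) ^ (c * u) * ((A - c) * u) ^ ((A - c) * u)))"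
    using binomial_ge_entropy[OF cu] unfolding d .
  also have "(c * u) ^ (c * u) * ((A - c) * u) ^ ((A - c) * u) = (c ^ c * (A - c) ^ (A - c)) ^ u * u ^ (A * u)"
  proof -
    have "u ^ (c * u) * u ^ ((A - c) * u) = u ^ (A * u)" using cu by (simp add: power_add[symmetric] d[symmetric])
    then have m: "p * u ^ (c * u) * (q * u ^ ((A - c) * u)) = p * q * u ^ (A * u)" for p q
      by (metis mult.assoc mult.left_commute)
    have e: "(b * u) ^ (b * u) = (b ^ b) ^ u * u ^ (b * u)" for b by (simp only: power_mult_distrib power_mult)
    show ?thesis unfolding e[of c] e[of "A - c"] m by (simp only: power_mult_distrib)
  qed
  finally have "(A ^ A) ^ u * u ^ (A * u) \<le> ((A * u + 1) * ((A * u choose (c * u)) * (c ^ c * (A - c) ^ (A - c)) ^ u)) * u ^ (A * u)"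
    by (simp only: mult_ac)
  then have "(A ^ A) ^ u \<le> (A * u + 1) * ((A * u choose (c * u)) * (c ^ c * (A - c) ^ (A - c)) ^ u)"
    using False by (simp only: mult_le_cancel2) simp
  also have "\<dots> \<le> (A * u + r + 1) * ((A * u + r choose (c * u)) * (c ^ c * (A - c) ^ (A - c)) ^ u)"
    by (intro mult_mono binomial_right_mono) auto
  finally show ?thesis .
qed simp

text \<open>Encodes the type vectors on \<open>P\<close> with exactly \<open>a\<close> coordinates
  of type 0 and \<open>a\<close> of type 1, the sets \<open>A\<close> and \<open>B\<close>. The last
  component selects type 2 among the rest; what is left has type 3.\<close>

definition fam :: "nat set \<Rightarrow> nat \<Rightarrow> (nat set \<times> nat set \<times> nat set) set" where
  "fam P a = (SIGMA A:{A. A \<subseteq> P \<and> card A = a}. SIGMA B:{B. B \<subseteq> P - A \<and> card B = a}. Pow (P - A - B))"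

text \<open>With \<open>p = card P\<close> there are
  \<open>(p choose 2a) * (2a choose a) * 2 ^ (p - 2a)\<close> such triples, and the central binomial
  coefficient is at least \<open>4 ^ a / (2a + 1)\<close>.\<close>

lemma card_fam:
  assumes P: "finite P" "2 * a \<le> card P"
  shows "finite (fam P a)" "2 ^ card P * (card P choose (2 * a)) \<le> (card P + 1) * card (fam P a)"
proof -
  define p where "p = card P"
  have inner: "card (SIGMA B:{B. B \<subseteq> P - A \<and> card B = a}. Pow (P - A - B)) = (p - a choose a) * 2 ^ (p - 2 * a)"
    if A: "A \<subseteq> P" "card A = a" for A
  proof -
    have fA: "finite A" using A P by (auto intro: finite_subset)
    have cA: "card (P - A) = p - a" using A fA by (simp add: card_Diff_subset p_def)
    have "card (SIGMA B:{B. B \<subseteq> P - A \<and> card B = a}. Pow (P - A - B)) = (\<Sum>B\<in>{B. B \<subseteq> P - A \<and> card B = a}. card (Pow (P - A - B)))"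
      by (rule card_SigmaI) (use P in auto)
    also have "\<dots> = (\<Sum>B\<in>{B. B \<subseteq> P - A \<and> card B = a}. 2 ^ (p - 2 * a))"
    proof (rule sum.cong)
      fix B assume "B \<in> {B. B \<subseteq> P - A \<and> card B = a}"
      then have B: "B \<subseteq> P - A" "card B = a" by auto
      have "finite B" using B P by (auto intro: finite_subset)
      then have "card (P - A - B) = p - 2 * a" using B cA by (simp add: card_Diff_subset)
      then show "card (Pow (P - A - B)) = 2 ^ (p - 2 * a)" using P by (simp add: card_Pow)
    qed simp
    also have "\<dots> = (p - a choose a) * 2 ^ (p - 2 * a)" using n_subsets[of "P - A" a] P cA by simp
    finally show ?thesis .
  qed
  show "finite (fam P a)" unfolding fam_def using P by (intro finite_SigmaI) auto
  have "card (fam P a) = (\<Sum>A\<in>{A. A \<subseteq> P \<and> card A = a}. card (SIGMA B:{B. B \<subseteq> P - A \<and> card B = a}. Pow (P - A - B)))"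
    unfolding fam_def by (rule card_SigmaI) (use P in \<open>auto intro!: finite_SigmaI\<close>)
  also have "\<dots> = (\<Sum>A\<in>{A. A \<subseteq> P \<and> card A = a}. (p - a choose a) * 2 ^ (p - 2 * a))"
    by (rule sum.cong) (use inner in auto)
  also have "\<dots> = (p choose a) * ((p - a choose a) * 2 ^ (p - 2 * a))" using n_subsets[OF P(1), of a] by (simp add: p_def)
  also have "\<dots> = ((p choose (2 * a)) * (2 * a choose a)) * 2 ^ (p - 2 * a)"
    using choose_mult[of a "2 * a" p] P by (simp add: p_def)
  finally have c: "card (fam P a) = (p choose (2 * a)) * (2 * a choose a) * 2 ^ (p - 2 * a)" .
  have "4 ^ a \<le> (2 * a + 1) * (2 * a choose a)"
  proof -
    have "(2 * a) ^ (2 * a) \<le> (2 * a + 1) * ((2 * a choose a) * (a ^ a * a ^ a))"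
      using binomial_ge_entropy[of a "2 * a"] by simp
    also have "(2 * a) ^ (2 * a) = 4 ^ a * (a ^ a * a ^ a)"
      by (simp add: power_mult_distrib power_mult power2_eq_square)
    finally have "4 ^ a * (a ^ a * a ^ a) \<le> ((2 * a + 1) * (2 * a choose a)) * (a ^ a * a ^ a)" by (simp only: mult_ac)
    then show ?thesis by (simp only: mult_le_cancel2) (cases a, simp_all)
  qed
  moreover have "(2::nat) ^ p = 4 ^ a * 2 ^ (p - 2 * a)"
  proof -
    have "(2::nat) ^ (2 * a) * 2 ^ (p - 2 * a) = 2 ^ p" using P by (simp add: power_add[symmetric] p_def)
    then show ?thesis by (simp add: power_mult)
  qed
  ultimately have "2 ^ p * (p choose (2 * a)) \<le> ((2 * a + 1) * (2 * a choose a)) * 2 ^ (p - 2 * a) * (p choose (2 * a))"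
    by (intro mult_right_mono) auto
  also have "\<dots> = (2 * a + 1) * card (fam P a)" unfolding c by (simp only: mult_ac)
  also have "\<dots> \<le> (p + 1) * card (fam P a)" using P by (intro mult_right_mono) (auto simp: p_def)
  finally show "2 ^ card P * (card P choose (2 * a)) \<le> (card P + 1) * card (fam P a)" by (simp add: p_def)
qed

definition enc :: "nat \<Rightarrow> (nat \<Rightarrow> int) \<Rightarrow> int" where "enc n g = (\<Sum>l<n. g l * 4 ^ l)"

lemma enc_Suc: "enc (Suc n) g = g 0 + 4 * enc n (\<lambda>l. g (Suc l))"
  unfolding enc_def sum.lessThan_Suc_shift by (simp add: sum_distrib_left mult_ac)

lemma enc_range: "(\<And>l. 0 \<le> g l \<and> g l < 4) \<Longrightarrow> 0 \<le> enc n g \<and> enc n g < 4 ^ n"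
proof (induction n arbitrary: g)
  case (Suc n)
  have "0 \<le> enc n (\<lambda>l. g (Suc l)) \<and> enc n (\<lambda>l. g (Suc l)) < 4 ^ n" by (rule Suc.IH) (rule Suc.prems)
  then show ?case using Suc.prems[of 0] unfolding enc_Suc by simp
qed (simp add: enc_def)

lemma tp_enc: "(\<And>l. 0 \<le> g l \<and> g l < 4) \<Longrightarrow> i < n \<Longrightarrow> tp (enc n g) i = g i"
proof (induction n arbitrary: g i)
  case (Suc n)
  show ?case
  proof (cases i)
    case 0
    then show ?thesis using Suc.prems(1)[of 0] by (simp add: enc_Suc tp_def)
  next
    case (Suc j)
    have "tp (enc n (\<lambda>l. g (Suc l))) j = g (Suc j)" by (rule Suc.IH) (use Suc.prems Suc in auto)
    moreover have "enc (Suc n) g div 4 = enc n (\<lambda>l. g (Suc l))" using Suc.prems(1)[of 0] by (simp add: enc_Suc)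
    ultimately show ?thesis by (simp add: Suc tp_def zdiv_zmult2_eq[of "4 ^ j" _ 4, simplified mult.commute])
  qed
qed simp

lemma types_exist:
  assumes PZ: "P \<inter> Z = {}" "P \<union> Z = {..<n}" and a: "2 * a \<le> card P" "2 * b \<le> card Z"
  obtains Ty where "Ty \<subseteq> {0..<4 ^ n}" "card Ty = card (fam P a) * card (fam Z b)"
    "\<And>ty \<tau>. ty \<in> Ty \<Longrightarrow> \<tau> \<in> {0, 1} \<Longrightarrow> card {l \<in> P. tp ty l = \<tau>} = a \<and> card {l \<in> Z. tp ty l = \<tau>} = b"
proof -
  have fin: "finite P" "finite Z" using PZ(2) by (metis finite_Un finite_lessThan)+
  define g where "g u l = (case u of ((A, B, D), (A', B', D')) \<Rightarrow>
    if l \<in> A \<union> A' then 0 else if l \<in> B \<union> B' then 1 else if l \<in> D \<union> D' then 2 else (3::int))"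
    for u :: "(nat set \<times> nat set \<times> nat set) \<times> (nat set \<times> nat set \<times> nat set)" and l :: nat
  \<comment> \<open>Reads the triples back from the digits; as a left inverse of the encoding it
    gives injectivity.\<close>
  define inv where "inv ty = (({l \<in> P. tp ty l = 0}, {l \<in> P. tp ty l = 1}, {l \<in> P. tp ty l = 2}),
    ({l \<in> Z. tp ty l = 0}, {l \<in> Z. tp ty l = 1}, {l \<in> Z. tp ty l = 2}))" for ty
  have gr: "0 \<le> g u l \<and> g u l < 4" for u l by (auto simp: g_def split: prod.splits)
  have t: "tp (enc n (g u)) l = g u l" if "l \<in> P \<union> Z" for u l using that PZ(2) by (intro tp_enc gr) auto
  have li: "inv (enc n (g u)) = u" if u: "u \<in> fam P a \<times> fam Z b" for u
  proof -
    obtain A B D A' B' D' where u': "u = ((A, B, D), (A', B', D'))" by (metis surj_pair)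
    have s: "A \<subseteq> P" "B \<subseteq> P - A" "D \<subseteq> P - A - B" "A' \<subseteq> Z" "B' \<subseteq> Z - A'" "D' \<subseteq> Z - A' - B'"
      using u unfolding u' fam_def by auto
    have tP: "tp (enc n (g u)) l = (if l \<in> A then 0 else if l \<in> B then 1 else if l \<in> D then 2 else 3)" if "l \<in> P" for l
      using t[of l u] that s PZ(1) unfolding u' g_def by auto
    have tZ: "tp (enc n (g u)) l = (if l \<in> A' then 0 else if l \<in> B' then 1 else if l \<in> D' then 2 else 3)" if "l \<in> Z" for l
      using t[of l u] that s PZ(1) unfolding u' g_def by auto
    have "{l \<in> P. tp (enc n (g u)) l = 0} = A" "{l \<in> P. tp (enc n (g u)) l = 1} = B" "{l \<in> P. tp (enc n (g u)) l = 2} = D"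
      "{l \<in> Z. tp (enc n (g u)) l = 0} = A'" "{l \<in> Z. tp (enc n (g u)) l = 1} = B'" "{l \<in> Z. tp (enc n (g u)) l = 2} = D'"
      using s by (auto simp: tP tZ split: if_splits)
    then show ?thesis unfolding inv_def u' by simp
  qed
  define Ty where "Ty = (\<lambda>u. enc n (g u)) ` (fam P a \<times> fam Z b)"
  have "inj_on (\<lambda>u. enc n (g u)) (fam P a \<times> fam Z b)" by (rule inj_on_inverseI[where g = inv]) (rule li)
  then have c: "card Ty = card (fam P a) * card (fam Z b)" by (simp add: Ty_def card_image card_cartesian_product)
  have s: "Ty \<subseteq> {0..<4 ^ n}" using enc_range[of "g _", OF gr] by (auto simp: Ty_def)
  show thesis
  proof (rule that[OF s c])
    fix ty \<tau> assume "ty \<in> Ty" "\<tau> \<in> {0, 1::int}"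
    then obtain u where u: "u \<in> fam P a \<times> fam Z b" "ty = enc n (g u)" by (auto simp: Ty_def)
    have "inv ty \<in> fam P a \<times> fam Z b" using li[OF u(1)] u by simp
    then show "card {l \<in> P. tp ty l = \<tau>} = a \<and> card {l \<in> Z. tp ty l = \<tau>} = b"
      using \<open>\<tau> \<in> {0, 1}\<close> unfolding inv_def fam_def by auto
  qed
qed

section \<open>The three regimes\<close>

locale sol = mach xs X for xs :: "int list" and X :: int +
  fixes c :: "nat \<Rightarrow> int"
  assumes dig: "dig c" and c0: "\<And>l. n \<le> l \<Longrightarrow> c l = 0" and wsc: "ws x n c = 0" and nz: "\<exists>l. c l \<noteq> 0"
    and minimal: "\<And>d. dig d \<Longrightarrow> ws x n d = 0 \<Longrightarrow> card {l. l < n \<and> d l \<noteq> 0} < card {l. l < n \<and> c l \<noteq> 0}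
      \<Longrightarrow> \<forall>l<n. d l = 0"
begin

definition P where "P = {l. l < n \<and> c l \<noteq> 0}"
definition Z where "Z = {l. l < n \<and> c l = 0}"
definition p where "p = card P"
definition m where "m = card Z"

lemma PZ: "P \<inter> Z = {}" "P \<union> Z = {..<n}" "finite P" "finite Z"
  by (auto simp: P_def Z_def)

lemma pm: "p + m = n"
  using card_Un_disjoint[of P Z] PZ by (simp add: p_def m_def)

lemma p1: "0 < p"
proof -
  obtain l where "c l \<noteq> 0" using nz by blast
  then have "l \<in> P" using c0[of l] by (cases "l < n") (auto simp: P_def)
  then show ?thesis using PZ(3) by (auto simp: p_def card_gt_0_iff)
qed

text \<open>Reduces every regime to numerical conditions. The support has \<open>a\<close>
  coordinates of type 0 and \<open>a\<close> of type 1, the zeros have \<open>b\<close> of each. The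
  success probability is \<open>(p choose 2a) * (m choose 2b) / 2 ^ n\<close> up to
  \<open>256 * (n + 1) ^ 4\<close>: the constant is 128 from \<open>hit_count\<close> times 2 from
  rounding the sample space to a power of two, two factors \<open>n + 1\<close> come from
  \<open>card_fam\<close> and two from sampling \<open>z\<close> and \<open>k\<close>.\<close>

lemma master:
  fixes L E :: real
  assumes a: "2 * a \<le> p" "2 * b \<le> m" and k: "k \<le> n" "k - 4 \<le> m - 2 * b" "k - 4 < p" and z: "int b \<le> z" "z \<le> int n"
    and mode: "(k = 0 \<and> z = int n \<and> a = 0) \<or> (0 < k \<and> 0 < a)"
    and L: "1 \<le> L" "k = 0 \<or> (\<exists>\<rho>. 0 < \<rho> \<and> \<rho> \<le> 1 \<and> (2 + \<rho>) ^ (a + b) \<le> L * \<rho> ^ nat z)"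
    and E: "L \<le> E" "2 ^ (n - 2 * a - 2 * b) \<le> E" "L * 2 ^ (n - 2 * a - 2 * b) \<le> E * 2 ^ k"
    and F: "270 * (real n + 1) * E \<le> real F"
  shows "real (p choose (2 * a)) * real (m choose (2 * b)) / 2 ^ n / (256 * (real n + 1) ^ 4) * (2 * real_of_int RR) \<le> real (card (G F))"
proof -
  obtain Ty where Ty: "Ty \<subseteq> {0..<4 ^ n}" "card Ty = card (fam P a) * card (fam Z b)"
    and cnt: "\<And>ty \<tau>. ty \<in> Ty \<Longrightarrow> \<tau> \<in> {0, 1} \<Longrightarrow> card {l \<in> P. tp ty l = \<tau>} = a \<and> card {l \<in> Z. tp ty l = \<tau>} = b"
    using types_exist[OF PZ(1,2), of a b] a unfolding p_def m_def by blast
  have tpr: "tp ty l = 0 \<or> tp ty l = 1 \<or> 2 \<le> tp ty l" for ty l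
  proof -
    have "0 \<le> tp ty l" by (simp add: tp_def)
    then show ?thesis by linarith
  qed
  have cV: "card {l. l < n \<and> tp ty l = \<tau>} = a + b" if "ty \<in> Ty" "\<tau> \<in> {0, 1}" for ty \<tau>
  proof -
    have "{l. l < n \<and> tp ty l = \<tau>} = {l \<in> P. tp ty l = \<tau>} \<union> {l \<in> Z. tp ty l = \<tau>}" by (auto simp: P_def Z_def)
    moreover have "{l \<in> P. tp ty l = \<tau>} \<inter> {l \<in> Z. tp ty l = \<tau>} = {}" using PZ(1) by auto
    ultimately show ?thesis using card_Un_disjoint[of "{l \<in> P. tp ty l = \<tau>}" "{l \<in> Z. tp ty l = \<tau>}"] PZ(3,4) cnt[OF that] by simp
  qed
  have cW: "card {l \<in> W. 2 \<le> tp ty l} = card W - 2 * w"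
    if W: "finite W" "card {l \<in> W. tp ty l = 0} = w" "card {l \<in> W. tp ty l = 1} = w" for ty W w
  proof -
    have e: "W = {l \<in> W. 2 \<le> tp ty l} \<union> ({l \<in> W. tp ty l = 0} \<union> {l \<in> W. tp ty l = 1})" using tpr[of ty] by auto
    have "card W = card {l \<in> W. 2 \<le> tp ty l} + card ({l \<in> W. tp ty l = 0} \<union> {l \<in> W. tp ty l = 1})"
      by (subst e, rule card_Un_disjoint) (use W in auto)
    also have "card ({l \<in> W. tp ty l = 0} \<union> {l \<in> W. tp ty l = 1}) = w + w"
    proof -
      have "{l \<in> W. tp ty l = 0} \<inter> {l \<in> W. tp ty l = 1} = {}" by auto
      then show ?thesis using card_Un_disjoint[of "{l \<in> W. tp ty l = 0}" "{l \<in> W. tp ty l = 1}"] W by simp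
    qed
    finally show ?thesis by simp
  qed
  have cR: "card {l. l < n \<and> 2 \<le> tp ty l} = n - 2 * a - 2 * b" if "ty \<in> Ty" for ty
    using cW[of "{..<n}" ty "a + b"] cV[OF that] by simp
  have ab: "2 * a + 2 * b \<le> n" using a pm by simp
  have att: "\<exists>Zs. attempt H str (int n + int 1) Y ({0..<int n} \<union> {a. a mod str = int n + int 1}) n x S ty k z c Zs" if ty: "ty \<in> Ty" for ty
  proof -
    have "card {l \<in> Z. 2 \<le> tp ty l} = m - 2 * b" using cW[of Z ty b] PZ(4) cnt[OF ty] by (simp add: m_def)
    then obtain Zs where Zs: "Zs \<subseteq> {l \<in> Z. 2 \<le> tp ty l}" "card Zs = k - 4"
      using k(2) obtain_subset_with_card_n[of "k - 4" "{l \<in> Z. 2 \<le> tp ty l}"] by metis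
    have "attempt H str (int n + int 1) Y ({0..<int n} \<union> {a. a mod str = int n + int 1}) n x S ty k z c Zs"
    proof (intro attempt.intro attempt_axioms.intro)
      show "core H str (int n + int 1) Y ({0..<int n} \<union> {a. a mod str = int n + int 1}) n x S"
        using core[of "int 1"] B1 by simp
      show "Zs \<subseteq> {l. l < n \<and> 2 \<le> tp ty l \<and> c l = 0}" using Zs(1) by (auto simp: Z_def)
      show "card Zs < card {l. l < n \<and> c l \<noteq> 0}" using Zs(2) k(3) by (simp add: p_def P_def)
      have zc: "zc ty \<tau> n c = int (card {l \<in> Z. tp ty l = \<tau>})" for \<tau>
      proof -
        have "zc ty \<tau> n c = int (card {l \<in> {..<n}. tp ty l = \<tau> \<and> c l = 0})"
          by (simp add: zc_def sum.If_cases Int_def)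
        also have "{l \<in> {..<n}. tp ty l = \<tau> \<and> c l = 0} = {l \<in> Z. tp ty l = \<tau>}" by (auto simp: Z_def)
        finally show ?thesis .
      qed
      show "zc ty 0 n c \<le> z" "zc ty 1 n c \<le> z" using zc cnt[OF ty] z(1) by simp_all
      show "(k = 0 \<and> z = int n \<and> (\<forall>l. c l \<noteq> 0 \<longrightarrow> 2 \<le> tp ty l)) \<or> (0 < k \<and> (\<exists>l<n. tp ty l = 1 \<and> c l \<noteq> 0))"
      proof (cases "0 < k")
        case True
        then have "card {l \<in> P. tp ty l = 1} \<noteq> 0" using mode cnt[OF ty] by simp
        then obtain l where "l \<in> P" "tp ty l = 1" by (metis (mono_tags, lifting) card.empty empty_Collect_eq)
        then show ?thesis using True by (auto simp: P_def)
      next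
        case False
        then have k0: "k = 0" "z = int n" "a = 0" using mode by auto
        have e: "{l \<in> P. tp ty l = 0} = {}" "{l \<in> P. tp ty l = 1} = {}" using cnt[OF ty, of 0] cnt[OF ty, of 1] k0 PZ(3) by auto
        have "2 \<le> tp ty l" if "c l \<noteq> 0" for l
        proof -
          have "l \<in> P" using that c0[of l] by (cases "l < n") (auto simp: P_def)
          then show ?thesis using e tpr[of ty l] by auto
        qed
        then show ?thesis using k0 by auto
      qed
    qed (fact k(1) dig wsc nz Zs(2) c0 minimal)+
    then show ?thesis by blast
  qed
  have LV: "real (length (lev (chV x n ty (int k) z cls) i)) \<le> L" if "ty \<in> Ty" "cls \<in> {0, 1}" "i \<le> n" for ty cls i
  proof (cases "k = 0")
    case True
    then show ?thesis using lev_length_0[of x n ty z cls i] L(1) by simp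
  next
    case False
    then obtain \<rho> where \<rho>: "0 < \<rho>" "\<rho> \<le> 1" "(2 + \<rho>) ^ (a + b) \<le> L * \<rho> ^ nat z" using L(2) by auto
    have "real (length (lev (chV x n ty (int k) z cls) i)) * \<rho> ^ nat z \<le> (2 + \<rho>) ^ (a + b)"
      using lev_length_weight[OF \<rho>(1,2) _ z(2) that(3), of x ty "int k" cls] z(1) cV[OF that(1,2)] by simp
    then show ?thesis using \<rho> by (meson mult_right_le_imp_le order_trans zero_less_power)
  qed
  have LR: "real (length (lev (chR x n ty) n)) = 2 ^ (n - 2 * a - 2 * b)" if "ty \<in> Ty" for ty
    unfolding levR_length_eq cR[OF that] by simp
  have "int (card Ty) * (2 ^ n * (S * 2 ^ n)) \<le> 128 * int (card (G F))"
  proof (rule card_G[OF _ z(2) k(1) Ty(1) att])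
    show "1 \<le> E" using L E by simp
    show "real (length (lev (chV x n ty (int k) z cls) i)) \<le> E" if "ty \<in> Ty" "cls \<in> {0, 1}" "i \<le> n" for ty cls i
      using LV[OF that] E(1) by simp
    show "real (length (lev (chV x n ty (int k) z cls) n)) * real (length (lev (chR x n ty) n)) \<le> E * 2 ^ k"
      if "ty \<in> Ty" "cls \<in> {0, 1}" for ty cls
    proof -
      have "real (length (lev (chV x n ty (int k) z cls) n)) * 2 ^ (n - 2 * a - 2 * b) \<le> L * 2 ^ (n - 2 * a - 2 * b)"
        using LV[OF that order_refl] by (rule mult_right_mono) simp
      then show ?thesis unfolding LR[OF that(1)] using E(3) by (rule order_trans)
    qed
  qed (use z F E LR in auto)
  then have G: "real (card Ty) * (2 ^ n * (real_of_int S * 2 ^ n)) \<le> 128 * real (card (G F))"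
  proof -
    assume h: "int (card Ty) * (2 ^ n * (S * 2 ^ n)) \<le> 128 * int (card (G F))"
    then have "real_of_int (int (card Ty) * (2 ^ n * (S * 2 ^ n))) \<le> real_of_int (128 * int (card (G F)))" by (simp only: of_int_le_iff)
    then show ?thesis by simp
  qed
  have T: "2 ^ n * ((p choose (2 * a)) * (m choose (2 * b))) \<le> (n + 1) * (n + 1) * card Ty"
  proof -
    have "(2 ^ p * (p choose (2 * a))) * (2 ^ m * (m choose (2 * b))) \<le> ((p + 1) * card (fam P a)) * ((m + 1) * card (fam Z b))"
      unfolding p_def m_def
      by (rule mult_mono[OF card_fam(2)[OF PZ(3)] card_fam(2)[OF PZ(4)]]) (use a in \<open>simp_all add: p_def m_def\<close>)
    also have "\<dots> = (p + 1) * (m + 1) * card Ty" unfolding Ty(2) by (simp only: mult_ac)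
    also have "\<dots> \<le> (n + 1) * (n + 1) * card Ty" using pm by (intro mult_right_mono mult_mono) auto
    also have "(2 ^ p * (p choose (2 * a))) * (2 ^ m * (m choose (2 * b))) = 2 ^ n * ((p choose (2 * a)) * (m choose (2 * b)))"
    proof -
      have "(2::nat) ^ p * 2 ^ m = 2 ^ n" unfolding pm[symmetric] by (rule power_add[symmetric])
      moreover have "(q * A) * (q' * B) = q * q' * (A * B)" for q q' A B :: nat by (simp only: mult_ac)
      ultimately show ?thesis by metis
    qed
    finally show ?thesis .
  qed
  define Pi where "Pi = real (p choose (2 * a)) * real (m choose (2 * b))"
  define N where "N = real n + 1"
  have T': "2 ^ n * Pi \<le> N * N * real (card Ty)"
  proof -
    have "real (2 ^ n * ((p choose (2 * a)) * (m choose (2 * b)))) \<le> real ((n + 1) * (n + 1) * card Ty)" using T by (simp only: of_nat_le_iff)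
    then show ?thesis by (simp add: Pi_def N_def algebra_simps)
  qed
  have N0: "0 < N" by (simp add: N_def)
  have S0: "0 \<le> real_of_int S" using S1 by simp
  have RRr: "real_of_int RR = N * N * 2 ^ n * 4 ^ n * (real_of_int S * 2 ^ n)" unfolding RR_def N_def by simp
  have f: "(4::real) ^ n = 2 ^ n * 2 ^ n" by (simp add: power_mult_distrib[symmetric])
  have "Pi / 2 ^ n / (256 * N ^ 4) * (2 * real_of_int RR) = (2 ^ n * Pi) * (2 ^ n * (real_of_int S * 2 ^ n)) / (N * N) / 128"
  proof -
    have h: "P / q / (256 * N ^ 4) * (2 * (N * N * q * (q * q) * (s * q))) = (q * P) * (q * (s * q)) / (N * N) / 128"
      if "0 < q" for P q s :: real using that N0 by (simp add: field_simps power4_eq_xxxx)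
    show ?thesis unfolding RRr f by (rule h) simp
  qed
  also have "\<dots> \<le> (N * N * real (card Ty)) * (2 ^ n * (real_of_int S * 2 ^ n)) / (N * N) / 128"
    using T' S0 N0 by (intro divide_right_mono mult_right_mono) auto
  also have "\<dots> = real (card Ty) * (2 ^ n * (real_of_int S * 2 ^ n)) / 128" using N0 by simp
  also have "\<dots> \<le> real (card (G F))" using G by simp
  finally show ?thesis unfolding Pi_def N_def .
qed

lemma binomial_proportional_real:
  assumes "0 < c'" "c' < A"
  shows "(real A ^ A / (real c' ^ c' * real (A - c') ^ (A - c'))) ^ u \<le> real (A * u + r + 1) * real (A * u + r choose (c' * u))"
proof -
  have "real ((A ^ A) ^ u) \<le> real ((A * u + r + 1) * ((A * u + r choose (c' * u)) * (c' ^ c' * (A - c') ^ (A - c')) ^ u))"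
    using binomial_proportional[of c' A u r] assms by (simp only: of_nat_le_iff less_imp_le)
  then have h: "(real A ^ A) ^ u \<le> real (A * u + r + 1) * real (A * u + r choose (c' * u)) * (real c' ^ c' * real (A - c') ^ (A - c')) ^ u"
    by (simp only: of_nat_mult of_nat_power mult.assoc)
  have "0 < (real c' ^ c' * real (A - c') ^ (A - c')) ^ u" using assms by simp
  then show ?thesis unfolding power_divide using h by (simp only: pos_divide_le_eq)
qed

text \<open>\<open>E\<close> measures the fuel of a round and \<open>\<pi>\<close> its success
  probability, up to polynomial factors. Only their quotient is bounded by a fixed exponential,
  because the schedule of rounds covers every trade-off.\<close>

definition feasible :: "real \<Rightarrow> real \<Rightarrow> bool" where
  "feasible E \<pi> \<longleftrightarrow> 1 \<le> E \<and> 0 \<le> \<pi> \<and> E \<le> 2 ^ 200 * (real n + 1) ^ 2 * (169 / 100) ^ n * \<pi> \<and>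
     (\<forall>F. 270 * (real n + 1) * E \<le> real F \<longrightarrow> \<pi> / (256 * (real n + 1) ^ 4) * (2 * real_of_int RR) \<le> real (card (G F)))"

lemma choose_quarter: "16 ^ u \<le> (real (4 * u + r) + 1) * real (4 * u + r choose (2 * u))"
proof -
  have "(4 ^ 4) ^ u \<le> (4 * u + r + 1) * ((4 * u + r choose (2 * u)) * (2 ^ 2 * (4 - 2) ^ (4 - 2)) ^ u)"
    by (rule binomial_proportional) simp
  also have "(2 ^ 2 * (4 - 2) ^ (4 - 2)) ^ u = (16::nat) ^ u" by simp
  also have "((4::nat) ^ 4) ^ u = 16 ^ u * 16 ^ u" by (simp add: power_mult_distrib[symmetric])
  finally have "16 ^ u * 16 ^ u \<le> ((4 * u + r + 1) * (4 * u + r choose (2 * u))) * 16 ^ u" by (simp only: mult_ac)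
  then have "16 ^ u \<le> (4 * u + r + 1) * (4 * u + r choose (2 * u))" by (simp only: mult_le_cancel2) simp
  then have "real (16 ^ u) \<le> real ((4 * u + r + 1) * (4 * u + r choose (2 * u)))" by (simp only: of_nat_le_iff)
  then show ?thesis by (simp add: algebra_simps)
qed

lemma poly2: "real (i + 1) * real (j + 1) \<le> (real n + 1) ^ 2" if "i \<le> n" "j \<le> n"
  unfolding power2_eq_square using that by (intro mult_mono) auto

text \<open>With the whole support in \<open>R\<close>, both parts of \<open>c\<close> are subsets
  of \<open>R\<close>. About \<open>m / 4\<close> zeros, \<open>u\<close> of them, are placed in
  each of \<open>V\<^sub>1\<close> and \<open>V\<^sub>2\<close>, so the cost is
  \<open>2 ^ (n - 2u)\<close> and the probability about \<open>16 ^ u / 2 ^ n\<close>. Since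
  \<open>m \<ge> 6n/7\<close>, the quotient \<open>2 ^ (2n - 6u)\<close> is at most about
  \<open>2 ^ (5n/7)\<close>, below \<open>1.65 ^ n\<close>.\<close>

lemma regime_small:
  assumes "7 * p \<le> n"
  shows "\<exists>E \<pi>. feasible E \<pi>"
proof -
  define u where "u = m div 4"
  define r where "r = m mod 4"
  have m: "m = 4 * u + r" "r < 4" by (simp_all add: u_def r_def)
  define E :: real where "E = 2 ^ (n - 2 * u)"
  define \<pi> where "\<pi> = real (p choose (2 * 0)) * real (m choose (2 * u)) / 2 ^ n"
  have u: "2 * u \<le> n" using m pm by simp
  have e: "E * 2 ^ n \<le> 2 ^ 6 * ((169 / 100) ^ n * 16 ^ u)"
  proof -
    \<comment> \<open>The power 14 clears all denominators; the numerical fact left over is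
      \<open>2 ^ 10 \<le> 1.69 ^ 14\<close>.\<close>
    have "(2::real) ^ (14 * (2 * n - 2 * u)) \<le> 2 ^ (84 + 10 * n + 56 * u)"
    proof (rule power_increasing)
      have "14 * (2 * n) = 14 * 2 * p + 14 * 2 * m" using pm by simp
      then show "14 * (2 * n - 2 * u) \<le> 84 + 10 * n + 56 * u" using assms m pm by linarith
    qed simp
    also have "\<dots> = 2 ^ 84 * (1024 ^ n * (16 ^ u) ^ 14)" by (simp add: power_add power_mult power_mult[symmetric, of 16 u 14] mult.commute[of u 14])
    also have "\<dots> \<le> 2 ^ 84 * (((169 / 100) ^ 14) ^ n * (16 ^ u) ^ 14)"
      by (intro mult_left_mono mult_right_mono power_mono) (simp_all add: power_divide field_simps)
    also have "\<dots> = (2 ^ 6 * ((169 / 100) ^ n * 16 ^ u)) ^ 14"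
      by (simp add: power_mult_distrib power_mult[symmetric] mult.commute)
    finally have "((2::real) ^ (2 * n - 2 * u)) ^ 14 \<le> (2 ^ 6 * ((169 / 100) ^ n * 16 ^ u)) ^ (14::nat)"
      by (simp add: power_mult[symmetric] mult.commute)
    then have "(2::real) ^ (2 * n - 2 * u) \<le> 2 ^ 6 * ((169 / 100) ^ n * 16 ^ u)"
      by (rule power_le_imp_le_base[where n = 13, simplified]) simp
    moreover have "E * 2 ^ n = 2 ^ (2 * n - 2 * u)" using u by (simp add: E_def power_add[symmetric])
    ultimately show ?thesis by simp
  qed
  have "16 ^ u \<le> (real m + 1) * real (m choose (2 * u))" using choose_quarter[of u r] by (simp only: m)
  also have "\<dots> \<le> (real n + 1) ^ 2 * real (m choose (2 * u))"
    using poly2[of m 0] pm by (intro mult_right_mono) auto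
  also have "\<dots> = (real n + 1) ^ 2 * (\<pi> * 2 ^ n)" by (simp add: \<pi>_def)
  finally have c: "16 ^ u \<le> (real n + 1) ^ 2 * (\<pi> * 2 ^ n)" .
  have "E * 2 ^ n \<le> 2 ^ 6 * ((169 / 100) ^ n * 16 ^ u)" by (rule e)
  also have "\<dots> \<le> 2 ^ 200 * ((169 / 100) ^ n * ((real n + 1) ^ 2 * (\<pi> * 2 ^ n)))"
    using c by (intro mult_mono mult_left_mono) auto
  also have "\<dots> = (2 ^ 200 * (real n + 1) ^ 2 * (169 / 100) ^ n * \<pi>) * 2 ^ n" by (simp only: mult_ac)
  finally have E: "E \<le> 2 ^ 200 * (real n + 1) ^ 2 * (169 / 100) ^ n * \<pi>" by simp
  have "\<pi> / (256 * (real n + 1) ^ 4) * (2 * real_of_int RR) \<le> real (card (G F))" if "270 * (real n + 1) * E \<le> real F" for F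
    unfolding \<pi>_def
    by (rule master[where k = 0 and z = "int n" and L = 1 and E = E])
      (use that m pm p1 in \<open>auto simp: E_def\<close>)
  moreover have "1 \<le> E" by (simp add: E_def)
  moreover have "0 \<le> \<pi>" by (simp add: \<pi>_def)
  ultimately show ?thesis using E unfolding feasible_def by blast
qed

text \<open>Balanced types have inverse polynomial probability, so only the cost counts: lists of
  sizes \<open>3 ^ (n/4)\<close> and \<open>2 ^ (n/2)\<close> joined under \<open>n/7\<close> hash
  bits give \<open>12 ^ (n/4) / 2 ^ (n/7)\<close>. The bounds on \<open>p\<close> ensure that
  \<open>R\<close> contains enough zeros and that the chosen ones are fewer than the support;
  \<open>28 \<le> n\<close> keeps \<open>k\<close> and \<open>u\<close> positive.\<close>

lemma regime_medium:
  assumes "n < 7 * p" "p < 2 * m" "28 \<le> n"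
  shows "\<exists>E \<pi>. feasible E \<pi>"
proof -
  define u where "u = p div 4"
  define r where "r = p mod 4"
  define u' where "u' = m div 4"
  define r' where "r' = m mod 4"
  have p: "p = 4 * u + r" "r < 4" and m: "m = 4 * u' + r'" "r' < 4" by (simp_all add: u_def r_def u'_def r'_def)
  define k where "k = n div 7"
  have k: "7 * k \<le> n" "n \<le> 7 * k + 6" unfolding k_def by presburger+
  define v where "v = u + u'"
  have v: "4 * v \<le> n" "n \<le> 4 * v + 6" using p m pm by (simp_all add: v_def)
  define t :: real where "t = 169 / 100"
  \<comment> \<open>The last inequality is \<open>12 ^ (1/4) \<le> 1.69 * 2 ^ (1/7)\<close> raised
    to the power 28.\<close>
  have t: "1 \<le> t" "4 \<le> t ^ 4" "12 ^ 7 \<le> (t ^ 4) ^ 7 * 2 ^ 4"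
    unfolding t_def by (simp_all add: power_divide field_simps)
  define E where "E = 128 * t ^ n"
  define \<pi> where "\<pi> = real (p choose (2 * u)) * real (m choose (2 * u')) / 2 ^ n"
  have tn: "(t ^ 4) ^ v \<le> t ^ n" unfolding power_mult[symmetric] using v t by (intro power_increasing) auto
  have q: "16 ^ v * 1 \<le> (real n + 1) ^ 2 * (\<pi> * 2 ^ n)"
  proof -
    have "16 ^ v = (16::real) ^ u * 16 ^ u'" by (simp add: v_def power_add)
    also have "\<dots> \<le> ((real p + 1) * real (p choose (2 * u))) * ((real m + 1) * real (m choose (2 * u')))"
      using choose_quarter[of u r] choose_quarter[of u' r'] unfolding p(1)[symmetric] m(1)[symmetric] by (intro mult_mono) auto
    also have "\<dots> = (real (p + 1) * real (m + 1)) * (\<pi> * 2 ^ n)" by (simp add: \<pi>_def add.commute)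
    also have "\<dots> \<le> (real n + 1) ^ 2 * (\<pi> * 2 ^ n)"
      using poly2[of p m] pm by (intro mult_right_mono) (auto simp: \<pi>_def)
    finally show ?thesis by simp
  qed
  have n2: "(2::real) ^ n \<le> 64 * 16 ^ v"
  proof -
    have "(2::real) ^ n \<le> 2 ^ (4 * v + 6)" using v by (intro power_increasing) auto
    then show ?thesis by (simp add: power_add power_mult)
  qed
  have E: "E \<le> 2 ^ 200 * (real n + 1) ^ 2 * (169 / 100) ^ n * \<pi>"
  proof -
    have "2 ^ n \<le> 64 * ((real n + 1) ^ 2 * (\<pi> * 2 ^ n))" using n2 q by linarith
    then have "E * 2 ^ n \<le> E * (64 * ((real n + 1) ^ 2 * (\<pi> * 2 ^ n)))"
      using t by (intro mult_left_mono) (auto simp: E_def)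
    then have "E * 2 ^ n \<le> 8192 * ((real n + 1) ^ 2 * (t ^ n * \<pi>)) * 2 ^ n" by (simp add: E_def mult_ac)
    then have "E \<le> 8192 * ((real n + 1) ^ 2 * (t ^ n * \<pi>))" by (rule mult_right_le_imp_le) simp
    also have "\<dots> \<le> 2 ^ 200 * ((real n + 1) ^ 2 * (t ^ n * \<pi>))"
      using t by (intro mult_right_mono) (auto simp: \<pi>_def)
    finally show ?thesis by (simp add: t_def mult_ac)
  qed
  have tw: "12 ^ v \<le> t ^ n * 2 ^ (k + 1)"
  proof -
    have "((12::real) ^ v) ^ 7 = (12 ^ 7) ^ v" by (simp only: power_mult[symmetric] mult.commute)
    also have "\<dots> \<le> ((t ^ 4) ^ 7 * 2 ^ 4) ^ v" using t(3) by (intro power_mono) auto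
    also have "\<dots> = ((t ^ 4) ^ v) ^ 7 * 2 ^ (4 * v)" by (simp only: power_mult_distrib power_mult[symmetric] mult_ac)
    also have "\<dots> \<le> (t ^ n) ^ 7 * 2 ^ (7 * (k + 1))"
    proof (rule mult_mono)
      show "((t ^ 4) ^ v) ^ 7 \<le> (t ^ n) ^ 7" using tn t by (intro power_mono) auto
      show "(2::real) ^ (4 * v) \<le> 2 ^ (7 * (k + 1))" by (rule power_increasing) (use v k in auto)
    qed (use t in auto)
    also have "\<dots> = (t ^ n * 2 ^ (k + 1)) ^ 7" by (simp only: power_mult_distrib power_mult[symmetric] mult.commute)
    finally have "((12::real) ^ v) ^ 7 \<le> (t ^ n * 2 ^ (k + 1)) ^ (7::nat)" .
    then show ?thesis by (rule power_le_imp_le_base[where n = 6, simplified]) (use t in auto)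
  qed
  have v4: "(4::real) ^ v \<le> t ^ n"
    using power_mono[of 4 "t ^ 4" v] t tn by linarith
  have sz: "(2::real) ^ (n - 2 * u - 2 * u') \<le> 64 * 4 ^ v"
  proof -
    have "(2::real) ^ (n - 2 * u - 2 * u') \<le> 2 ^ (2 * v + 6)" using v by (intro power_increasing) (auto simp: v_def)
    then show ?thesis by (simp add: power_add power_mult)
  qed
  have "\<pi> / (256 * (real n + 1) ^ 4) * (2 * real_of_int RR) \<le> real (card (G F))" if F: "270 * (real n + 1) * E \<le> real F" for F
    unfolding \<pi>_def
  proof (rule master[where k = k and z = "int n" and L = "3 ^ v" and E = E])
    show "k - 4 \<le> m - 2 * u'" using k m assms pm by linarith
    show "k - 4 < p" using k assms by linarith
    show "(k = 0 \<and> int n = int n \<and> u = 0) \<or> (0 < k \<and> 0 < u)" using k p assms by linarith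
    show "k = 0 \<or> (\<exists>\<rho>::real. 0 < \<rho> \<and> \<rho> \<le> 1 \<and> (2 + \<rho>) ^ (u + u') \<le> 3 ^ v * \<rho> ^ nat (int n))"
      by (intro disjI2 exI[of _ 1]) (simp add: v_def)
    have t0: "0 \<le> t ^ n" using t by simp
    have "(3::real) ^ v \<le> 4 ^ v" by (rule power_mono) auto
    then show "3 ^ v \<le> E" using v4 t0 unfolding E_def by linarith
    show "2 ^ (n - 2 * u - 2 * u') \<le> E" using sz v4 t0 unfolding E_def by linarith
    have "3 ^ v * 2 ^ (n - 2 * u - 2 * u') \<le> (3::real) ^ v * (64 * 4 ^ v)" using sz by (intro mult_left_mono) auto
    also have "\<dots> = 64 * 12 ^ v" by (simp add: power_mult_distrib[symmetric])
    also have "\<dots> \<le> 64 * (t ^ n * 2 ^ (k + 1))" using tw by simp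
    also have "\<dots> = E * 2 ^ k" by (simp add: E_def)
    finally show "3 ^ v * 2 ^ (n - 2 * u - 2 * u') \<le> E * 2 ^ k" .
  qed (use F p m pm k in auto)
  moreover have "1 \<le> E" using one_le_power[OF t(1), of n] unfolding E_def by linarith
  moreover have "0 \<le> \<pi>" by (simp add: \<pi>_def)
  ultimately show ?thesis using E unfolding feasible_def by blast
qed

text \<open>The cost has two terms, the join \<open>L * 2 ^ (16 * u)\<close> and the subsets of
  \<open>R\<close>, \<open>2 ^ (16 * u + 32 * u')\<close>, up to constants. They are compared with
  the probability in \<open>b1\<close> and \<open>b2\<close>. From \<open>57 \<le> n\<close> follows
  \<open>p \<ge> 38\<close> and thus \<open>u > 0\<close>.\<close>

lemma regime_large:
  assumes "2 * m \<le> p" "57 \<le> n"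
  shows "\<exists>E \<pi>. feasible E \<pi>"
proof -
  define u where "u = p div 38"
  define r where "r = p mod 38"
  define u' where "u' = m div 38"
  define r' where "r' = m mod 38"
  have p: "p = 38 * u + r" "r < 38" and m: "m = 38 * u' + r'" "r' < 38" by (simp_all add: u_def r_def u'_def r'_def)
  have u: "0 < u" "2 * u' \<le> u" using p m assms pm by linarith+
  \<comment> \<open>Per block of 38 coordinates, \<open>\<alpha>\<close> and \<open>\<beta>\<close>
    are the entropy estimates for choosing the coordinates of types 0 and 1 on the support and on
    the zeros, \<open>l1\<close> and \<open>l2\<close> estimate the list of sign vectors, and
    \<open>\<theta> = (64 / 38) ^ 38\<close> is the quotient of cost and probability to be
    reached.\<close>
  define \<alpha> \<beta> l1 l2 \<theta> :: real where ab: "\<alpha> = real 38 ^ 38 / (real 22 ^ 22 * real (38 - 22) ^ (38 - 22))"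
    "\<beta> = real 38 ^ 38 / (real 6 ^ 6 * real (38 - 6) ^ (38 - 6))" "l1 = (256 / 121) ^ 11" "l2 = (256 / 9) ^ 3" "\<theta> = (32 / 19) ^ 38"
  \<comment> \<open>The first two are equalities, with the common values
    \<open>2 ^ 142 / 11 ^ 22\<close> and \<open>2 ^ 62 / 3 ^ 6\<close>. Here
    \<open>2 ^ 54 = 2 ^ 16 * 2 ^ 38\<close> combines the 16 coordinates in \<open>R\<close> with a
    factor \<open>2 ^ 38\<close> from the denominator \<open>2 ^ n\<close> of \<open>\<pi>\<close>;
    likewise \<open>2 ^ 70 = 2 ^ 32 * 2 ^ 38\<close> on the zeros.\<close>
  have num: "l1 * 2 ^ 54 \<le> \<theta> * \<alpha>" "l2 * 2 ^ 38 \<le> \<theta> * \<beta>" "2 ^ 54 \<le> \<theta> * \<alpha>" "(2 ^ 54) ^ 2 * 2 ^ 70 \<le> \<theta> ^ 3 * (\<alpha> ^ 2 * \<beta>)"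
    "1 \<le> l1" "1 \<le> l2" "0 < \<alpha>" "0 < \<beta>" "1 \<le> \<theta>"
    unfolding ab by (simp_all add: power_divide field_simps)
  define L where "L = l1 ^ u * l2 ^ u'"
  define V where "V = (2 ^ 16) ^ u * (2 ^ 32 :: real) ^ u'"
  define E where "E = 2 ^ 37 * (L * (2 ^ 16) ^ u) + 2 ^ 74 * V"
  define \<pi> where "\<pi> = real (p choose (2 * (11 * u))) * real (m choose (2 * (3 * u'))) / 2 ^ n"
  have L1: "1 \<le> L" using mult_mono[of 1 "l1 ^ u" 1 "l2 ^ u'"] num by (simp add: L_def one_le_power)
  have V1: "1 \<le> V" using mult_mono[of 1 "(2 ^ 16 :: real) ^ u" 1 "(2 ^ 32) ^ u'"] by (simp add: V_def)
  have q: "\<alpha> ^ u * \<beta> ^ u' \<le> (real n + 1) ^ 2 * (\<pi> * 2 ^ n)"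
  proof -
    have "\<alpha> ^ u \<le> real (38 * u + r + 1) * real (38 * u + r choose (22 * u))"
      unfolding ab by (rule binomial_proportional_real) auto
    moreover have "\<beta> ^ u' \<le> real (38 * u' + r' + 1) * real (38 * u' + r' choose (6 * u'))"
      unfolding ab by (rule binomial_proportional_real) auto
    ultimately have "\<alpha> ^ u * \<beta> ^ u' \<le> (real (p + 1) * real (p choose (22 * u))) * (real (m + 1) * real (m choose (6 * u')))"
      unfolding p(1)[symmetric] m(1)[symmetric] using num by (intro mult_mono) auto
    also have "\<dots> = (real (p + 1) * real (m + 1)) * (\<pi> * 2 ^ n)" by (simp add: \<pi>_def mult_ac)
    also have "\<dots> \<le> (real n + 1) ^ 2 * (\<pi> * 2 ^ n)"
      using poly2[of p m] pm by (intro mult_right_mono) (auto simp: \<pi>_def)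
    finally show ?thesis .
  qed
  have th: "\<theta> ^ (u + u') \<le> (169 / 100) ^ n"
  proof -
    have "\<theta> ^ (u + u') = (32 / 19) ^ (38 * (u + u'))" unfolding ab power_mult ..
    also have "\<dots> \<le> (169 / 100) ^ (38 * (u + u'))" by (rule power_mono) auto
    also have "\<dots> \<le> (169 / 100) ^ n" using p m pm by (intro power_increasing) auto
    finally show ?thesis .
  qed
  have b1: "(l1 * 2 ^ 54) ^ u * (l2 * 2 ^ 38) ^ u' \<le> \<theta> ^ (u + u') * (\<alpha> ^ u * \<beta> ^ u')"
  proof -
    have "(l1 * 2 ^ 54) ^ u * (l2 * 2 ^ 38) ^ u' \<le> (\<theta> * \<alpha>) ^ u * (\<theta> * \<beta>) ^ u'"
      by (rule mult_mono[OF power_mono[OF num(1)] power_mono[OF num(2)]]) (use num(5-9) in auto)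
    also have "\<dots> = \<theta> ^ (u + u') * (\<alpha> ^ u * \<beta> ^ u')" by (simp only: power_mult_distrib power_add mult_ac)
    finally show ?thesis .
  qed
  \<comment> \<open>Writing \<open>u = d + 2 * u'\<close> splits the claim into a part without zeros
    and a part with as many zeros as allowed. Each is settled by one of the last numerical
    inequalities.\<close>
  have b2: "(2 ^ 54) ^ u * (2 ^ 70) ^ u' \<le> \<theta> ^ (u + u') * (\<alpha> ^ u * \<beta> ^ u')"
  proof -
    define d where "d = u - 2 * u'"
    have d: "u = d + 2 * u'" using u by (simp add: d_def)
    have "(2 ^ 54) ^ u * (2 ^ 70) ^ u' = (2 ^ 54 :: real) ^ d * ((2 ^ 54) ^ 2 * 2 ^ 70) ^ u'"
      unfolding d by (simp only: power_add power_mult power_mult_distrib)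
    also have "\<dots> \<le> (\<theta> * \<alpha>) ^ d * (\<theta> ^ 3 * (\<alpha> ^ 2 * \<beta>)) ^ u'"
      by (rule mult_mono[OF power_mono[OF num(3)] power_mono[OF num(4)]]) (use num(5-9) in auto)
    also have "\<dots> = \<theta> ^ (u + u') * (\<alpha> ^ u * \<beta> ^ u')"
    proof -
      have "u + u' = d + 3 * u'" using d by simp
      then have "\<theta> ^ (u + u') = \<theta> ^ d * (\<theta> ^ 3) ^ u'" by (simp only: power_add power_mult)
      moreover have "\<alpha> ^ u = \<alpha> ^ d * (\<alpha> ^ 2) ^ u'" unfolding d by (simp only: power_add power_mult)
      ultimately show ?thesis by (simp only: power_mult_distrib mult_ac)
    qed
    finally show ?thesis .
  qed
  have E: "E \<le> 2 ^ 200 * (real n + 1) ^ 2 * (169 / 100) ^ n * \<pi>"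
  proof -
    have "(2::real) ^ n \<le> 2 ^ (74 + 38 * (u + u'))" using p m pm by (intro power_increasing) auto
    also have "\<dots> = 2 ^ 74 * ((2 ^ 38) ^ u * (2 ^ 38) ^ u')" by (simp only: power_add power_mult distrib_left)
    finally have n2: "(2::real) ^ n \<le> 2 ^ 74 * ((2 ^ 38) ^ u * (2 ^ 38) ^ u')" .
    have s: "(2 ^ 16) ^ u * (2 ^ 38) ^ u = (2 ^ 54 :: real) ^ u" "(2 ^ 32) ^ u' * (2 ^ 38) ^ u' = (2 ^ 70 :: real) ^ u'"
      unfolding power_mult_distrib[symmetric] power_add[symmetric] by simp_all
    have "E \<le> 2 ^ 74 * (L * (2 ^ 16) ^ u + V)" using L1 by (simp add: E_def distrib_left)
    then have "E * 2 ^ n \<le> (2 ^ 74 * (L * (2 ^ 16) ^ u + V)) * (2 ^ 74 * ((2 ^ 38) ^ u * (2 ^ 38) ^ u'))"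
      using n2 L1 V1 by (intro mult_mono) auto
    also have "\<dots> = 2 ^ 148 * (l1 ^ u * ((2 ^ 16) ^ u * (2 ^ 38) ^ u) * (l2 ^ u' * (2 ^ 38) ^ u')
        + ((2 ^ 16) ^ u * (2 ^ 38) ^ u) * ((2 ^ 32) ^ u' * (2 ^ 38) ^ u'))"
    proof -
      have "(c * (a1 * a2 * a3 + a3 * a4)) * (c * (a5 * a6)) = (c * c) * (a1 * (a3 * a5) * (a2 * a6) + (a3 * a5) * (a4 * a6))"
        for c a1 a2 a3 a4 a5 a6 :: real by (simp only: distrib_left distrib_right mult_ac)
      moreover have "(2::real) ^ 74 * 2 ^ 74 = 2 ^ 148" by (simp only: power_add[symmetric]) simp
      ultimately show ?thesis unfolding L_def V_def by metis
    qed
    also have "\<dots> = 2 ^ 148 * ((l1 * 2 ^ 54) ^ u * (l2 * 2 ^ 38) ^ u' + (2 ^ 54) ^ u * (2 ^ 70) ^ u')"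
      unfolding s by (simp only: power_mult_distrib)
    also have "\<dots> \<le> 2 ^ 148 * (\<theta> ^ (u + u') * (\<alpha> ^ u * \<beta> ^ u') + \<theta> ^ (u + u') * (\<alpha> ^ u * \<beta> ^ u'))"
      using b1 b2 by (intro mult_left_mono add_mono) auto
    also have "\<dots> = 2 ^ 149 * (\<theta> ^ (u + u') * (\<alpha> ^ u * \<beta> ^ u'))" by simp
    also have "\<dots> \<le> 2 ^ 200 * ((169 / 100) ^ n * ((real n + 1) ^ 2 * (\<pi> * 2 ^ n)))"
      by (rule mult_mono[OF _ mult_mono[OF th q]]) (use num(5-9) in auto)
    also have "\<dots> = (2 ^ 200 * (real n + 1) ^ 2 * (169 / 100) ^ n * \<pi>) * 2 ^ n" by (simp only: mult_ac)
    finally show ?thesis by (rule mult_right_le_imp_le) simp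
  qed
  \<comment> \<open>\<open>32 * u' + r'\<close> is the number of zeros in \<open>R\<close>. The
    extra 1 keeps \<open>k\<close> positive when this number is 0 and is absorbed by the slack in
    \<open>k - 4\<close>.\<close>
  define k where "k = 32 * u' + r' + 1"
  have sz: "n - 2 * (11 * u) - 2 * (3 * u') = (16 * u + 32 * u') + (r + r')" using p m pm by simp
  have pw: "(2::real) ^ ((16 * u + 32 * u') + (r + r')) = (2 ^ 16) ^ u * (2 ^ 32) ^ u' * (2 ^ r * 2 ^ r')"
    by (simp only: power_add power_mult)
  have szE: "(2::real) ^ (n - 2 * (11 * u) - 2 * (3 * u')) \<le> 2 ^ 74 * V"
  proof -
    have "(2::real) ^ (r + r') \<le> 2 ^ 74" using p m by (intro power_increasing) auto
    then have "V * (2::real) ^ (r + r') \<le> V * 2 ^ 74" using V1 by (intro mult_left_mono) auto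
    then show ?thesis unfolding sz pw V_def by (simp only: power_add mult_ac)
  qed
  have "\<pi> / (256 * (real n + 1) ^ 4) * (2 * real_of_int RR) \<le> real (card (G F))" if F: "270 * (real n + 1) * E \<le> real F" for F
    unfolding \<pi>_def
  proof (rule master[where k = k and z = "int (3 * u')" and L = L and E = E])
    show "k = 0 \<or> (\<exists>\<rho>::real. 0 < \<rho> \<and> \<rho> \<le> 1 \<and> (2 + \<rho>) ^ (11 * u + 3 * u') \<le> L * \<rho> ^ nat (int (3 * u')))"
    \<comment> \<open>\<open>2 + 9/121\<close> is at most \<open>256/121\<close>, and
      \<open>256/121 = (256/9) * (9/121)\<close> produces exactly the constants \<open>l1\<close>
      and \<open>l2\<close>.\<close>
    proof (intro disjI2 exI[of _ "9 / 121"] conjI)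
      have "(2 + 9 / 121 :: real) ^ (11 * u + 3 * u') \<le> (256 / 121) ^ (11 * u + 3 * u')" by (rule power_mono) auto
      also have "\<dots> = ((256 / 121) ^ 11) ^ u * ((256 / 121) ^ 3) ^ u'" by (simp only: power_add power_mult)
      also have "((256 / 121 :: real) ^ 3) = (256 / 9) ^ 3 * (9 / 121) ^ 3" unfolding power_mult_distrib[symmetric] by simp
      also have "((256 / 121) ^ 11) ^ u * ((256 / 9) ^ 3 * (9 / 121) ^ 3) ^ u' = L * (9 / 121 :: real) ^ nat (int (3 * u'))"
        unfolding L_def ab nat_int power_mult by (simp only: power_mult_distrib mult_ac)
      finally show "(2 + 9 / 121 :: real) ^ (11 * u + 3 * u') \<le> L * (9 / 121) ^ nat (int (3 * u'))" .
    qed auto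
    have "L * 1 \<le> L * (2 ^ 16) ^ u" using L1 by (intro mult_left_mono) auto
    then show "L \<le> E" unfolding E_def using V1 L1 by (smt (verit) one_le_power mult_le_cancel_right1 mult_nonneg_nonneg zero_le_power)
    show "2 ^ (n - 2 * (11 * u) - 2 * (3 * u')) \<le> E"
      using szE L1 unfolding E_def by (smt (verit) mult_nonneg_nonneg zero_le_power)
    have "(2::real) ^ r \<le> 2 ^ 38" using p by (intro power_increasing) auto
    then have "(L * (2 ^ 16) ^ u * (2 ^ 32) ^ u' * 2 ^ r') * 2 ^ r \<le> (L * (2 ^ 16) ^ u * (2 ^ 32) ^ u' * 2 ^ r') * (2::real) ^ 38"
      using L1 by (intro mult_left_mono) auto
    also have "\<dots> = (2 ^ 37 * (L * (2 ^ 16) ^ u)) * 2 ^ k"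
    proof -
      have "(2::real) ^ k = (2 ^ 32) ^ u' * 2 ^ r' * 2" unfolding k_def by (simp only: power_add power_mult power_one_right)
      moreover have "(2::real) ^ 38 = 2 ^ 37 * 2" by simp
      ultimately show ?thesis by (simp only: mult_ac)
    qed
    also have "\<dots> \<le> E * 2 ^ k" using V1 by (intro mult_right_mono) (auto simp: E_def)
    also have "(L * (2 ^ 16) ^ u * (2 ^ 32) ^ u' * 2 ^ r') * 2 ^ r = L * 2 ^ (n - 2 * (11 * u) - 2 * (3 * u'))"
      unfolding sz pw by (simp only: mult_ac)
    finally show "L * 2 ^ (n - 2 * (11 * u) - 2 * (3 * u')) \<le> E * 2 ^ k" .
    show "(k = 0 \<and> int (3 * u') = int n \<and> 11 * u = 0) \<or> (0 < k \<and> 0 < 11 * u)" using u by (simp add: k_def)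
    show "k - 4 < p" "k \<le> n" "k - 4 \<le> m - 2 * (3 * u')" using p m u assms pm unfolding k_def by linarith+
  qed (use F p m pm L1 in auto)
  moreover have "1 \<le> E" using L1 V1 unfolding E_def by (smt (verit) mult_nonneg_nonneg zero_le_power one_le_power mult_le_cancel_right1)
  moreover have "0 \<le> \<pi>" by (simp add: \<pi>_def)
  ultimately show ?thesis using E unfolding feasible_def by blast
qed

lemma feasible_exists: "57 \<le> n \<Longrightarrow> \<exists>E \<pi>. feasible E \<pi>"
  using regime_small regime_medium regime_large by (cases "7 * p \<le> n"; cases "2 * m \<le> p") auto

end

section \<open>Conclusion\<close>

lemma exists_sol:
  assumes "ess_solution xs cs"
  shows "\<exists>c. sol xs c"
proof -
  define n where "n = length xs"
  define x where "x l = xs ! l" for l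
  define D where "D = {d. dig d \<and> (\<forall>l\<ge>n. d l = 0) \<and> ws x n d = 0 \<and> (\<exists>l. d l \<noteq> 0)}"
  define d0 where "d0 l = (if l < n then cs ! l else 0)" for l
  have "length cs = n" using assms by (simp add: ess_solution_def n_def)
  moreover have "dig d0"
    unfolding dig_def
  proof
    fix l
    have "set cs \<subseteq> {-1, 0, 1}" "length cs = n" using assms by (auto simp: ess_solution_def n_def)
    then have "cs ! l \<in> {-1, 0, 1}" if "l < n" using nth_mem[of l cs] that by blast
    then show "d0 l \<in> {-1, 0, 1}" by (simp add: d0_def)
  qed
  moreover have "ws x n d0 = 0" using assms by (simp add: ws_def d0_def x_def n_def ess_solution_def)
  moreover obtain l where "l < length cs" "cs ! l \<noteq> 0" using assms unfolding ess_solution_def by (metis in_set_conv_nth)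
  ultimately have d0: "d0 \<in> D" by (auto simp: D_def d0_def intro!: exI[of _ l])
  obtain c where c: "c \<in> D" "\<And>d. d \<in> D \<Longrightarrow> card {l. l < n \<and> c l \<noteq> 0} \<le> card {l. l < n \<and> d l \<noteq> 0}"
    using ex_has_least_nat[of "\<lambda>d. d \<in> D" d0 "\<lambda>d. card {l. l < n \<and> d l \<noteq> 0}"] d0 by blast
  have nx: "mach.n xs = n" "mach.x xs = x" by (simp_all add: mach.n_def n_def mach.x_def x_def fun_eq_iff)
  have "sol xs c"
  proof (unfold_locales, unfold nx)
    fix d assume d: "dig d" "ws x n d = 0" "card {l. l < n \<and> d l \<noteq> 0} < card {l. l < n \<and> c l \<noteq> 0}"
    define d' where "d' l = (if l < n then d l else 0)" for l
    have "dig d'" "ws x n d' = 0" "{l. l < n \<and> d' l \<noteq> 0} = {l. l < n \<and> d l \<noteq> 0}"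
      using d(1,2) by (auto simp: dig_def ws_def d'_def)
    then have "\<not> (\<exists>l. d' l \<noteq> 0)" using c(2)[of d'] d(3) by (auto simp: D_def d'_def)
    then show "\<forall>l<n. d l = 0" by (metis d'_def)
  qed (use c(1) in \<open>auto simp: D_def\<close>)
  then show ?thesis by blast
qed

text \<open>The gap between 1.7 and 1.69 absorbs the overhead. The denominator collects
  \<open>271 * (n + 1)\<close> from the fuel, \<open>2 ^ 200 * (n + 1)\<^sup>2\<close> from
  \<open>feasible\<close> and \<open>256 * (n + 1) ^ 4\<close> from the success probability.\<close>

lemma exp_gap: "\<forall>\<^sub>F n in at_top. real n + 1 \<le> ((17 / 10) ^ n - 1) / (271 * 256 * 2 ^ 200 * (real n + 1) ^ 7 * (169 / 100) ^ n)"
  by real_asymp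

context machX begin

text \<open>With \<open>q = 0\<close> and \<open>M = 0\<close> nothing is promised about success.
  What remains, word size, termination and validity of the answer, holds for every input.\<close>

lemma guar_safe: "guar (wb X) okst succst total 0 (init prog xs)"
  using guar_prog[of 0 0] by simp

text \<open>Fuel \<open>mm\<close> suffices for a round, and the rounds
  \<open>j \<le> B / mm\<close> have it. Their number \<open>M\<close> satisfies
  \<open>q * M \<ge> n\<close> by the exponential gap, so
  \<open>(1 - q) ^ M \<le> exp (- n)\<close>.\<close>

lemma guar_success:
  assumes "sol xs c" "57 \<le> n"
    and gap: "real n + 1 \<le> ((17 / 10) ^ n - 1) / (271 * 256 * 2 ^ 200 * (real n + 1) ^ 7 * (169 / 100) ^ n)"
  shows "guar (wb X) okst succst total (1 - 1 / 2 ^ n) (init prog xs)"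
proof -
  interpret s: sol xs X c by fact
  from s.feasible_exists[OF assms(2)] obtain E \<pi> where "s.feasible E \<pi>" by blast
  then have E: "1 \<le> E" "0 \<le> \<pi>" "E \<le> 2 ^ 200 * (real n + 1) ^ 2 * (169 / 100) ^ n * \<pi>"
    and G: "\<And>F. 270 * (real n + 1) * E \<le> real F \<Longrightarrow> \<pi> / (256 * (real n + 1) ^ 4) * (2 * real_of_int RR) \<le> real (card (G F))"
    by (simp_all add: s.feasible_def)
  define r where "r = real n + 1"
  have r: "1 \<le> r" by (simp add: r_def)
  define q where "q = \<pi> / (256 * r ^ 4)"
  have q0: "0 \<le> q" using E(2) r by (simp add: q_def)
  define mm where "mm = nat \<lceil>270 * r * E\<rceil>"
  have rE: "1 \<le> r * E" using mult_mono[of 1 r 1 E] r E(1) by simp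
  have mm: "270 * r * E \<le> real mm" "real mm \<le> 271 * r * E" "0 < mm"
  proof -
    show 1: "270 * r * E \<le> real mm" unfolding mm_def by (rule real_nat_ceiling_ge)
    have "real mm \<le> 270 * r * E + 1" unfolding mm_def using rE by (simp add: of_nat_nat)
    then show "real mm \<le> 271 * r * E" using rE by linarith
    have "0 < real mm" using 1 rE by linarith
    then show "0 < mm" by simp
  qed
  have q1: "q \<le> 1"
  proof -
    have "G mm \<subseteq> {0..<RR}" using G_range by auto
    then have "card (G mm) \<le> nat RR" using card_mono[of "{0..<RR}" "G mm"] by simp
    then have "q * (2 * real_of_int RR) \<le> 1 * real_of_int RR"
      using G[of mm] mm(1) RR_Y(2) by (simp add: q_def r_def)
    then have "(2 * q) * real_of_int RR \<le> 1 * real_of_int RR" by (simp only: mult_ac)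
    then have "2 * q \<le> 1" using RR_Y(2) by (simp add: mult_le_cancel_right)
    then show ?thesis using q0 by linarith
  qed
  define M where "M = nat B div mm"
  have g: "guar (wb X) okst succst total (1 - (1 - q) ^ M) (init prog xs)"
  proof (rule guar_prog[OF q0])
    show "M \<le> nat B" by (simp add: M_def)
    fix j assume j: "1 \<le> j" "j \<le> M"
    have "mm * j \<le> mm * M" using j by simp
    also have "\<dots> \<le> nat B" by (simp add: M_def)
    finally have "mm \<le> nat B div j" using j by (simp add: less_eq_div_iff_mult_less_eq)
    also have "nat B div j = nat (B div int j)" using B1 by (simp add: nat_div_distrib)
    finally have "270 * r * E \<le> real (nat (B div int j))" using mm(1) by linarith
    then show "q * (2 * real_of_int RR) \<le> real (card (G (nat (B div int j))))"
      using G by (simp add: q_def r_def)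
  qed
  have Bb: "(17 / 10) ^ n - 1 \<le> real (nat B)"
  proof -
    have "(17::int) ^ n = 10 ^ n * B + 17 ^ n mod 10 ^ n" unfolding B_def by (simp add: mult_div_mod_eq)
    moreover have "(17::int) ^ n mod 10 ^ n < 10 ^ n" by simp
    ultimately have "(17::int) ^ n \<le> 10 ^ n * B + 10 ^ n" by linarith
    then have "(17::int) ^ n \<le> 10 ^ n * (B + 1)" by (simp only: distrib_left mult_1_right)
    then have "real_of_int (17 ^ n) \<le> real_of_int (10 ^ n * (B + 1))" by (simp only: of_int_le_iff)
    then have "(17::real) ^ n \<le> (real_of_int B + 1) * 10 ^ n" by (simp add: mult.commute)
    then have "(17 / 10 :: real) ^ n \<le> real_of_int B + 1" unfolding power_divide by (simp only: pos_divide_le_eq zero_less_power zero_less_numeral)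
    then show ?thesis using B1 by simp
  qed
  have qM: "real n \<le> q * real M"
  proof -
    define t :: real where "t = (169 / 100) ^ n"
    have t: "0 < t" by (simp add: t_def)
    have "real (nat B) \<le> real mm * (real M + 1)"
    proof -
      have "nat B = mm * M + nat B mod mm" by (simp add: M_def)
      moreover have "nat B mod mm < mm" using mm(3) by simp
      ultimately have "nat B \<le> mm * (M + 1)" by simp
      then have "real (nat B) \<le> real (mm * (M + 1))" by (simp only: of_nat_le_iff)
      then show ?thesis by (simp add: distrib_left)
    qed
    also have "\<dots> \<le> 271 * r * E * (real M + 1)" using mm(2) by (rule mult_right_mono) simp
    also have "\<dots> \<le> 271 * r * (2 ^ 200 * r ^ 2 * t * \<pi>) * (real M + 1)"
      using E(3) r unfolding r_def t_def by (intro mult_right_mono mult_left_mono) auto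
    also have "\<dots> = (271 * 256 * 2 ^ 200 * r ^ 7 * t) * (q * (real M + 1))"
      using r by (simp add: q_def field_simps power_add[symmetric] eval_nat_numeral)
    finally have "(17 / 10) ^ n - 1 \<le> (q * (real M + 1)) * (271 * 256 * 2 ^ 200 * r ^ 7 * t)" using Bb by (simp only: mult_ac)
    then have "((17 / 10) ^ n - 1) / (271 * 256 * 2 ^ 200 * r ^ 7 * t) \<le> q * (real M + 1)"
      using r t by (subst pos_divide_le_eq) auto
    then have "real n + 1 \<le> q * (real M + 1)" using gap unfolding r_def t_def by linarith
    then show ?thesis using q1 by (simp add: distrib_left)
  qed
  have "(1 - q) ^ M \<le> exp (- q) ^ M" using q1 exp_ge_add_one_self[of "- q"] by (intro power_mono) auto
  also have "\<dots> = exp (- (q * real M))" by (simp add: exp_of_nat_mult[symmetric] mult.commute)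
  also have "\<dots> \<le> exp (- real n)" using qM by simp
  also have "\<dots> = exp (- 1) ^ n" by (simp add: exp_of_nat_mult[symmetric])
  also have "\<dots> \<le> (1 / 2) ^ n"
  proof (rule power_mono)
    have "2 \<le> exp (1::real)" using exp_ge_add_one_self[of 1] by simp
    then show "exp (- 1) \<le> (1 / 2 :: real)" by (simp add: exp_minus field_simps)
  qed simp
  finally show ?thesis by (intro guar_mono[OF g order_refl]) (simp add: power_one_over)
qed

end

text \<open>Each block from \<open>2 ^ k + 1\<close> to \<open>2 ^ (k + 1)\<close> contributes at
  most 1.\<close>

lemma harmonic_dyadic: "(\<Sum>j=1..2 ^ k. 1 / real j) \<le> real k + 1"
proof (induction k)
  case (Suc k)
  have "(\<Sum>j=1..2 ^ k + 2 ^ k. 1 / real j) = (\<Sum>j=1..2 ^ k. 1 / real j) + (\<Sum>j=2 ^ k + 1..2 ^ k + 2 ^ k. 1 / real j)"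
    by (rule sum.ub_add_nat) simp
  also have "(\<Sum>j=2 ^ k + 1..2 ^ k + 2 ^ k. 1 / real j) \<le> (\<Sum>j=(2::nat) ^ k + 1..2 ^ k + 2 ^ k. 1 / 2 ^ k)"
  proof (rule sum_mono)
    fix j assume "j \<in> {(2::nat) ^ k + 1..2 ^ k + 2 ^ k}"
    then have j: "2 ^ k \<le> j" "0 < j" by auto
    then have "real (2 ^ k) \<le> real j" by (simp only: of_nat_le_iff)
    then show "1 / real j \<le> 1 / 2 ^ k" using j(2) by (intro divide_left_mono) auto
  qed
  also have "\<dots> = 1" by simp
  finally show ?case using Suc by (simp add: mult_2)
qed simp

lemma sum_div_le:
  assumes "b \<le> 2 ^ k"
  shows "real (\<Sum>j=1..b. b div j) \<le> real b * (real k + 1)"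
proof -
  have "real (\<Sum>j=1..b. b div j) \<le> (\<Sum>j=1..b. real b * (1 / real j))"
    unfolding of_nat_sum by (intro sum_mono) (simp add: of_nat_div_le_of_nat)
  also have "\<dots> = real b * (\<Sum>j=1..b. 1 / real j)" by (rule sum_distrib_left[symmetric])
  also have "\<dots> \<le> real b * (\<Sum>j=1..2 ^ k. 1 / real j)"
    using assms by (intro mult_left_mono sum_mono2) auto
  also have "\<dots> \<le> real b * (real k + 1)" by (intro mult_left_mono harmonic_dyadic) simp
  finally show ?thesis .
qed

section \<open>Running time and word size as functions of the input length\<close>

definition bud :: "nat \<Rightarrow> nat" where "bud n = 17 ^ n div 10 ^ n"
text \<open>The exponent comes from \<open>h \<le> 64 ^ (n + 1) * 2 ^ n * 4 ^ b n\<close>, and that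
  of \<open>wbits\<close> from \<open>4 * (H * H) = 4 * h ^ 64\<close>.\<close>

definition hbits :: "(nat \<Rightarrow> nat) \<Rightarrow> nat \<Rightarrow> nat" where "hbits b n = 7 * n + 6 + 2 * b n"
definition wbits :: "(nat \<Rightarrow> nat) \<Rightarrow> nat \<Rightarrow> nat" where "wbits b n = 64 * hbits b n + 2"

text \<open>\<open>total\<close> freed from its dependence on the input numbers: \<open>Lb\<close>
  is replaced by \<open>2 * hbits b n\<close>, and 62 = 33 + 29 adds the constants of
  \<open>tt\<close> and \<open>att\<close>.\<close>

definition runtime :: "(nat \<Rightarrow> nat) \<Rightarrow> nat \<Rightarrow> nat" where
  "runtime b n = 17 + 6 * n + ssz prelude * (1 + n + 2 * hbits b n) +
     (\<Sum>j=1..bud n. 62 + 10 * hbits b n + ssz core_prog * (1 + bud n div j) + ssz check * (1 + 2 * n))"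

context mach begin

lemma h_le:
  assumes "\<forall>y\<in>set xs. \<bar>y\<bar> \<le> 2 ^ b n"
  shows "h \<le> 2 ^ hbits b n"
proof -
  have x: "x l * x l \<le> 4 ^ b n" if "l < n" for l
  proof -
    have "\<bar>x l\<bar> \<le> 2 ^ b n" using assms that by (simp add: x_def n_def)
    then have "\<bar>x l\<bar> * \<bar>x l\<bar> \<le> 2 ^ b n * 2 ^ b n" by (intro mult_mono) auto
    also have "(2::int) ^ b n * 2 ^ b n = 4 ^ b n" by (simp add: power_mult_distrib[symmetric])
    finally show ?thesis by (simp add: abs_mult[symmetric])
  qed
  have "h \<le> 64 ^ (n + 1) * (1 + int n * 4 ^ b n)" unfolding h_def by (rule hs_le) (use x in auto)
  also have "\<dots> \<le> 64 ^ (n + 1) * (2 ^ n * 4 ^ b n)"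
  proof (rule mult_left_mono)
    have "(1::int) \<le> 4 ^ b n" by simp
    then have "1 + int n * 4 ^ b n \<le> (int n + 1) * 4 ^ b n" by (simp add: distrib_right)
    also have "\<dots> \<le> 2 ^ n * 4 ^ b n" using n_le by (rule mult_right_mono) simp
    finally show "1 + int n * 4 ^ b n \<le> 2 ^ n * 4 ^ b n" .
  qed simp
  also have "(64::int) ^ (n + 1) * (2 ^ n * 4 ^ b n) = 2 ^ hbits b n"
  proof -
    have "(64::int) ^ (n + 1) = 2 ^ (6 * (n + 1))" "(4::int) ^ b n = 2 ^ (2 * b n)" unfolding power_mult by simp_all
    then show ?thesis unfolding hbits_def by (simp add: power_add[symmetric])
  qed
  finally show ?thesis .
qed

lemma H_word:
  assumes "\<forall>y\<in>set xs. \<bar>y\<bar> \<le> 2 ^ b n"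
  shows "4 * (H * H) \<le> 2 ^ wbits b n"
proof -
  have "H \<le> (2 ^ hbits b n) ^ 32" unfolding H_def using h_le[where b = b, OF assms] h64 by (intro power_mono) auto
  then have "H * H \<le> (2 ^ hbits b n) ^ 32 * (2 ^ hbits b n) ^ 32" using YH' by (intro mult_mono) auto
  also have "(2 ^ hbits b n) ^ 32 * (2 ^ hbits b n) ^ 32 = (2::int) ^ (64 * hbits b n)" by (simp add: power_mult[symmetric] power_add[symmetric])
  finally show ?thesis unfolding wbits_def by (simp add: power_add)
qed

lemma Lb_le:
  assumes "\<forall>y\<in>set xs. \<bar>y\<bar> \<le> 2 ^ b n"
  shows "Lb \<le> 2 * hbits b n"
proof -
  have "2 ^ Lb \<le> Y" using Lb(3) RR_Y by linarith
  also have "Y \<le> 2 ^ hbits b n * 2 ^ hbits b n" unfolding Y_def using h_le[where b = b, OF assms] h64 by (intro mult_mono) auto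
  also have "\<dots> = 2 ^ (2 * hbits b n)" by (simp add: mult_2 power_add)
  finally show ?thesis by simp
qed

lemma B_bud: "nat B = bud n"
proof -
  have "B = int (bud n)" unfolding B_def bud_def by (simp add: zdiv_int)
  then show ?thesis by simp
qed

end

context machX begin

lemma total_le:
  assumes "\<forall>y\<in>set xs. \<bar>y\<bar> \<le> 2 ^ b n"
  shows "total \<le> runtime b n"
proof -
  have L: "Lb \<le> 2 * hbits b n" by (rule Lb_le[where b = b, OF assms])
  have "att j \<le> 62 + 10 * hbits b n + ssz core_prog * (1 + bud n div j) + ssz check * (1 + 2 * n)" for j
  proof -
    have "nat (B div int j) = bud n div j" using B1 B_bud by (simp add: nat_div_distrib)
    then show ?thesis using L by (simp add: att_def tt_def)
  qed
  then have "(\<Sum>j=1..bud n. att j) \<le> (\<Sum>j=1..bud n. 62 + 10 * hbits b n + ssz core_prog * (1 + bud n div j) + ssz check * (1 + 2 * n))"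
    by (rule sum_mono)
  moreover have "ssz prelude * (1 + n + Lb) \<le> ssz prelude * (1 + n + 2 * hbits b n)" using L by (intro mult_left_mono) auto
  ultimately show ?thesis unfolding total_def runtime_def B_bud by linarith
qed

end

lemma bigo_const_power: "(\<lambda>n. c) \<in> O(\<lambda>n. real n ^ d)" for c :: real
proof (rule bigoI[where c = "\<bar>c\<bar>"])
  show "\<forall>\<^sub>F n in at_top. norm c \<le> \<bar>c\<bar> * norm (real n ^ d)"
    using eventually_ge_at_top[of "1::nat"]
  proof eventually_elim
    case (elim n)
    then have "1 \<le> real n ^ d" by (intro one_le_power) simp
    then have "\<bar>c\<bar> * 1 \<le> \<bar>c\<bar> * real n ^ d" by (intro mult_left_mono) auto
    then show ?case by simp
  qed
qed

lemma bigo_power_mono: "d \<le> d' \<Longrightarrow> (\<lambda>n. real n ^ d) \<in> O(\<lambda>n. real n ^ d')"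
proof (rule bigoI[where c = 1])
  assume d: "d \<le> d'"
  show "\<forall>\<^sub>F n in at_top. norm (real n ^ d) \<le> 1 * norm (real n ^ d')"
    using eventually_ge_at_top[of "1::nat"] by eventually_elim (use d in \<open>simp add: power_increasing\<close>)
qed

lemma bigo_affine:
  assumes "(\<lambda>n. real (b n)) \<in> O(\<lambda>n. real n ^ d)"
  shows "(\<lambda>n. c0 + c1 * real n + c2 * real (b n)) \<in> O(\<lambda>n. real n ^ (d + 1))"
proof -
  have 1: "(\<lambda>n. real n) \<in> O(\<lambda>n. real n ^ (d + 1))" using bigo_power_mono[of 1 "d + 1"] by simp
  have 2: "(\<lambda>n. real (b n)) \<in> O(\<lambda>n. real n ^ (d + 1))"
    by (rule landau_o.big_trans[OF assms bigo_power_mono]) simp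
  show ?thesis
    by (intro sum_in_bigo bigo_const_power landau_o.big.cmult_in_iff[THEN iffD2, THEN disjI2, rule_format])
      (use 1 2 in \<open>auto intro: landau_o.big.mult_in_1 simp: landau_o.big.cmult_in_iff\<close>)
qed

text \<open>By the harmonic sum and \<open>bud n \<le> 2 ^ n\<close>, the fuel of all rounds
  together is at most \<open>bud n * (n + 1)\<close>. This gives \<open>1.7 ^ n\<close> up to
  polynomial factors, below the required base.\<close>

lemma runtime_Ostar:
  assumes "poly_bounded b"
  shows "(\<lambda>n. real (runtime b n)) \<in> Ostar (\<lambda>n. 1.7067 ^ n)"
proof -
  from assms obtain d where d: "(\<lambda>n. real (b n)) \<in> O(\<lambda>n. real n ^ d)" unfolding poly_bounded_def by blast
  define A where "A = real (ssz prelude) + real (ssz core_prog) + real (ssz check) + 10"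
  define f where "f n = 100 * A + 100 * A * real n + 100 * A * real (b n)" for n
  have A: "10 \<le> A" by (simp add: A_def)
  have le: "real (runtime b n) \<le> f n * 1.7067 ^ n" for n
  proof -
    define hb where "hb = real (hbits b n)"
    define sp sc sk where s: "sp = real (ssz prelude)" "sc = real (ssz core_prog)" "sk = real (ssz check)"
    define bb where "bb = real (bud n)"
    have b1: "bb \<le> 1.7 ^ n"
    proof -
      have "bb \<le> real (17 ^ n) / real (10 ^ n)" unfolding bb_def bud_def by (rule of_nat_div_le_of_nat)
      then show ?thesis by (simp add: power_divide[symmetric])
    qed
    have b2: "bud n \<le> 2 ^ n"
    proof -
      have "(1.7::real) ^ n \<le> 2 ^ n" by (rule power_mono) auto
      then have "real (bud n) \<le> 2 ^ n" using b1 unfolding bb_def by linarith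
      then have "real (bud n) \<le> real (2 ^ n)" by (simp only: of_nat_power of_nat_numeral)
      then show ?thesis by (simp only: of_nat_le_iff)
    qed
    have "real (runtime b n) = 17 + 6 * real n + sp * (1 + real n + 2 * hb) +
       bb * (62 + 10 * hb + sc + sk * (1 + 2 * real n)) + sc * real (\<Sum>j=1..bud n. bud n div j)"
      unfolding runtime_def s hb_def bb_def
      by (simp add: sum.distrib distrib_left sum_distrib_left[symmetric] algebra_simps)
    also have "\<dots> \<le> (17 + 6 * real n + sp * (1 + real n + 2 * hb)) * 1.7 ^ n +
       1.7 ^ n * (62 + 10 * hb + sc + sk * (1 + 2 * real n)) + sc * (1.7 ^ n * (real n + 1))"
    proof (intro add_mono)
      have "1 \<le> (1.7::real) ^ n" by (rule one_le_power) simp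
      then have "(17 + 6 * real n + sp * (1 + real n + 2 * hb)) * 1 \<le> (17 + 6 * real n + sp * (1 + real n + 2 * hb)) * 1.7 ^ n"
        by (intro mult_left_mono) (auto simp: s hb_def)
      then show "17 + 6 * real n + sp * (1 + real n + 2 * hb) \<le> (17 + 6 * real n + sp * (1 + real n + 2 * hb)) * 1.7 ^ n" by simp
      show "bb * (62 + 10 * hb + sc + sk * (1 + 2 * real n)) \<le> 1.7 ^ n * (62 + 10 * hb + sc + sk * (1 + 2 * real n))"
        using b1 by (intro mult_right_mono) (auto simp: s hb_def)
      have "real (\<Sum>j=1..bud n. bud n div j) \<le> bb * (real n + 1)" using sum_div_le[OF b2] by (simp add: bb_def)
      also have "\<dots> \<le> 1.7 ^ n * (real n + 1)" using b1 by (intro mult_right_mono) auto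
      finally show "sc * real (\<Sum>j=1..bud n. bud n div j) \<le> sc * (1.7 ^ n * (real n + 1))"
        by (intro mult_left_mono) (auto simp: s)
    qed
    also have "\<dots> = (17 + 6 * real n + sp * (1 + real n + 2 * hb) + (62 + 10 * hb + sc + sk * (1 + 2 * real n)) + sc * (real n + 1)) * 1.7 ^ n"
      by (simp only: distrib_left distrib_right mult_ac add_ac)
    also have "\<dots> \<le> f n * 1.7 ^ n"
    proof (rule mult_right_mono)
      have hb: "hb = 7 * real n + 6 + 2 * real (b n)" by (simp add: hb_def hbits_def)
      have nn: "0 \<le> sp * real n" "0 \<le> sc * real n" "0 \<le> sk * real n" "0 \<le> sp * real (b n)" "0 \<le> sc * real (b n)" "0 \<le> sk * real (b n)"
        "0 \<le> sp" "0 \<le> sc" "0 \<le> sk" by (simp_all add: s)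
      have "f n = 100 * (sp + sc + sk + 10) + 100 * (sp + sc + sk + 10) * real n + 100 * (sp + sc + sk + 10) * real (b n)"
        by (simp add: f_def A_def s)
      then show "17 + 6 * real n + sp * (1 + real n + 2 * hb) + (62 + 10 * hb + sc + sk * (1 + 2 * real n)) + sc * (real n + 1) \<le> f n"
        using nn unfolding hb by (simp add: algebra_simps)
    qed simp
    also have "\<dots> \<le> f n * 1.7067 ^ n"
      using A by (intro mult_left_mono power_mono) (auto simp: f_def)
    finally show ?thesis .
  qed
  have "(\<lambda>n. real (runtime b n)) \<in> O(\<lambda>n. f n * 1.7067 ^ n)"
  proof (rule bigoI[where c = 1], rule always_eventually, rule allI)
    show "norm (real (runtime b n)) \<le> 1 * norm (f n * 1.7067 ^ n)" for n using le[of n] by simp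
  qed
  also have "(\<lambda>n. f n * 1.7067 ^ n) \<in> O(\<lambda>n. real n ^ (d + 1) * 1.7067 ^ n)"
    unfolding f_def by (intro landau_o.big.mult bigo_affine[OF d] landau_o.big_refl)
  finally show ?thesis unfolding Ostar_def by blast
qed

theorem theorem7p8:
  "\<exists>P. \<forall>b. poly_bounded b \<longrightarrow>
     (\<exists>w T e. poly_bounded w \<and>
        (\<lambda>n. real (T n)) \<in> Ostar (\<lambda>n. 1.7067 ^ n) \<and>
        (\<lambda>n. real (e n)) \<in> \<Omega>(\<lambda>n. real n) \<and>
        solves_ess P b w T e)"
proof (rule exI[of _ prog], intro allI impI)
  fix b assume b: "poly_bounded b"
  from b obtain d where d: "(\<lambda>n. real (b n)) \<in> O(\<lambda>n. real n ^ d)" unfolding poly_bounded_def by blast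
  from exp_gap obtain n1 where n1: "\<And>n. n1 \<le> n \<Longrightarrow> real n + 1 \<le> ((17 / 10) ^ n - 1) / (271 * 256 * 2 ^ 200 * (real n + 1) ^ 7 * (169 / 100) ^ n)"
    unfolding eventually_at_top_linorder by blast
  define n0 where "n0 = max n1 57"
  \<comment> \<open>For small \<open>n\<close> the exponent 0 makes the claim on the success
    probability trivial; Omega only concerns large \<open>n\<close>.\<close>
  define e where "e n = (if n0 \<le> n then n else 0)" for n
  have "poly_bounded (wbits b)"
  proof -
    have "(\<lambda>n. real (wbits b n)) = (\<lambda>n. 386 + 448 * real n + 128 * real (b n))"
      by (simp add: wbits_def hbits_def fun_eq_iff)
    then show ?thesis unfolding poly_bounded_def using bigo_affine[OF d] by (intro exI[of _ "d + 1"]) simp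
  qed
  moreover have "(\<lambda>n. real (e n)) \<in> \<Omega>(\<lambda>n. real n)"
  proof (rule landau_omega.bigI[where c = 1])
    show "\<forall>\<^sub>F n in at_top. 1 * norm (real n) \<le> norm (real (e n))"
      using eventually_ge_at_top[of n0] by eventually_elim (simp add: e_def)
  qed simp
  moreover have "solves_ess prog b (wbits b) (runtime b) e"
    unfolding solves_ess_def
  proof (intro allI impI)
    fix n and xs :: "int list" assume "length xs = n \<and> (\<forall>x\<in>set xs. \<bar>x\<bar> \<le> 2 ^ b n)"
    then have xs: "mach.n xs = n" "\<forall>x\<in>set xs. \<bar>x\<bar> \<le> 2 ^ b n" by (auto simp: mach.n_def)
    interpret machX xs "2 ^ wbits b n"
      using mach.H_word[of xs b] xs by unfold_locales simp
    have T: "total \<le> runtime b n" using total_le[of b] xs by simp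
    have res: "result n c = (if reg (snd c) 0 = 0 then None else Some (outp (mem (snd c))))" for c
      unfolding result_def outp_def xs(1) by simp
    have succ: "{c. \<exists>cs. result n c = Some cs \<and> ess_solution xs cs} = {c. succst (snd c)}"
      unfolding res succst_def by auto
    have safe: "guar (wb (2 ^ wbits b n)) okst succst (runtime b n) 0 (init prog xs)"
      by (rule guar_mono[OF guar_safe T]) simp
    have wbd: "wb (2 ^ wbits b n) (snd c) \<longleftrightarrow> words_bounded (wbits b n) c" for c by (simp add: wb_def words_bounded_def)
    have "\<forall>t. \<forall>c\<in>set_pmf (run t (init prog xs)). words_bounded (wbits b n) c"
      using safe unfolding guar_def wbd by blast
    moreover have "\<forall>c\<in>set_pmf (run (runtime b n) (init prog xs)).
           halted c \<and> (\<forall>cs. result n c = Some cs \<longrightarrow> ess_solution xs cs)"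
      using safe unfolding guar_def res okst_def by auto
    moreover have "(\<exists>cs. ess_solution xs cs) \<longrightarrow>
           1 - 1 / 2 ^ e n \<le> measure_pmf.prob (run (runtime b n) (init prog xs)) {c. \<exists>cs. result n c = Some cs \<and> ess_solution xs cs}"
    proof
      assume "\<exists>cs. ess_solution xs cs"
      then obtain c where c: "sol xs c" using exists_sol by blast
      show "1 - 1 / 2 ^ e n \<le> measure_pmf.prob (run (runtime b n) (init prog xs)) {c. \<exists>cs. result n c = Some cs \<and> ess_solution xs cs}"
      proof (cases "n0 \<le> n")
        case True
        have "guar (wb (2 ^ wbits b n)) okst succst total (1 - 1 / 2 ^ n) (init prog xs)"
          using guar_success[OF c] True n1[of n] xs(1) by (simp add: n0_def)
        then show ?thesis using T True unfolding guar_def succ e_def by auto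
      qed (simp add: e_def)
    qed
    ultimately show "(\<forall>t. \<forall>c\<in>set_pmf (run t (init prog xs)). words_bounded (wbits b n) c) \<and>
        (\<forall>c\<in>set_pmf (run (runtime b n) (init prog xs)).
           halted c \<and> (\<forall>cs. result n c = Some cs \<longrightarrow> ess_solution xs cs)) \<and>
        ((\<exists>cs. ess_solution xs cs) \<longrightarrow>
           measure_pmf.prob (run (runtime b n) (init prog xs))
             {c. \<exists>cs. result n c = Some cs \<and> ess_solution xs cs} \<ge> 1 - 1 / 2 ^ e n)" by blast
  qed
  ultimately show "\<exists>w T e. poly_bounded w \<and>
        (\<lambda>n. real (T n)) \<in> Ostar (\<lambda>n. 1.7067 ^ n) \<and>
        (\<lambda>n. real (e n)) \<in> \<Omega>(\<lambda>n. real n) \<and>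
        solves_ess prog b w T e" using runtime_Ostar[OF b] by blast
qed

end
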